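(* Let $\mathbf{S}$ be a symmetric monoidal category. Let $G$ be a group. There is an equivalence of categories $$\mathbf{Alg}\left(\mathbb{D}\otimes(\mathbb{P}\otimes\mathbb{G})\otimes\mathbb{D}^{op},\mathbf{S}\right)\simeq\mathbf{GBimon}(\mathbf{S}).$$
   Context: For $n\geq 1$, $\underline{n}=\{1,\dots,n\}$, and $\underline{0}=\emptyset$. A PROP is a symmetric strict monoidal category whose objects are the sets $\underline{n}$, $n\ge 0$, with tensor product of objects given by addition. For a PROP $T$ and a symmetric monoidal category $\mathbf{S}$, $\mathbf{Alg}(T,\mathbf{S})$ is the category of symmetric strict monoidal functors $T\to\mathbf{S}$ and natural transformations. $\mathbf{Bimon}(\mathbf{S})$ is the category of bimonoids in $\mathbf{S}$. Regarding $G$ as a one-object category, $\mathbf{GBimon}(\mathbf{S})=\mathrm{Fun}(G,\mathbf{Bimon}(\mathbf{S}))$. $\mathbb{D}$ is the strict monoidal category of the sets $\underline{n}$ and order-preserving maps (tensor product: ordinal sum, written $\amalg$ on morphisms); $m:\underline{2}\to\underline{1}$ and $u:\underline{0}\to\underline{1}$ are its unique such maps. An element of $G^n\rtimes\Sigma_n$ is a permutation $\sigma$ with labels $x_1,\dots,x_n\in G$; multiplication is $(y;\tau)(x;\sigma)=\big((y_{\sigma(i)}x_i)_i;\,\tau\sigma\big)$. The PROP $Q=\mathbb{D}\otimes\mathbb{P}\otimes\mathbb{G}$ has as morphisms $\underline{n}\to\underline{m}$ the pairs $(\phi,g)$ with $\phi\in\mathrm{Hom}_{\mathbb{D}}(\underline{n},\underline{m})$,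 $g\in G^n\rtimes\Sigma_n$ (think "$\phi\circ g$"), with composition $(\phi_2,g_2)\circ(\phi_1,g_1)=\big(\phi_2\circ(g_2)_\star(\phi_1),\ \phi_1^\star(g_2)\,g_1\big)$. Here for $\phi\in\mathrm{Hom}_{\mathbb{D}}(\underline{n},\underline{m})$ and $g=(x;\sigma)\in G^m\rtimes\Sigma_m$: $g_\star(\phi)$ is the order-preserving map $\underline{n}\to\underline{m}$ whose fibre over $\sigma(i)$ has $|\phi^{-1}(i)|$ elements, and $\phi^\star(g)=\big((x_{\phi(1)},\dots,x_{\phi(n)});\phi^\star(\sigma)\big)$ where $\phi^\star(\sigma)\in\Sigma_n$ is the unique permutation which is order-preserving on each fibre of $\phi$ and satisfies $\sigma\circ\phi=g_\star(\phi)\circ\phi^\star(\sigma)$. Tensor product is juxtaposition and the symmetries are the block permutations with trivial labels. The isomorphisms of $Q$ are the labelled permutations. $Q^{op}\otimes_{\mathbb{P}\otimes\mathbb{G}}Q$ and $Q\otimes_{\mathbb{P}\otimes\mathbb{G}}Q^{op}$ denote the categories of equivalence classes of cospans, respectively spans, in $Q$, where two (co)spans are equivalent if they differ by an isomorphism of the middle object. The PROP $\mathbb{D}\otimes(\mathbb{P}\otimes\mathbb{G})\otimes\mathbb{D}^{op}$ is (isomorphic to) the composite PROP $Q\otimes_{\mathbb{P}\otimes\mathbb{G}}Q^{op}$: its morphisms $\underline{n}\to\underline{m}$ are the classes of spans $\underline{n}\leftarrow\underline{p}\to\underline{m}$ in $Q$, and two spans are composed by replacing the inner cospan by a span by means of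 the distributive law $Q^{op}\otimes_{\mathbb{P}\otimes\mathbb{G}}Q\to Q\otimes_{\mathbb{P}\otimes\mathbb{G}}Q^{op}$ determined as follows. (i) For $g,h\in G^n\rtimes\Sigma_n$: $\underline{n}\xrightarrow{g}\underline{n}\xleftarrow{h}\underline{n}\ \mapsto\ \underline{n}\xleftarrow{g^{-1}}\underline{n}\xrightarrow{h^{-1}}\underline{n}$. (ii) For $\phi\in\mathrm{Hom}_{\mathbb{D}}(\underline{n},\underline{m})$ and $g\in G^m\rtimes\Sigma_m$: $\underline{n}\xrightarrow{\phi}\underline{m}\xleftarrow{g}\underline{m}\ \mapsto\ \underline{n}\xleftarrow{\phi^\star(g)}\underline{n}\xrightarrow{g_\star(\phi)}\underline{m}$ and $\underline{m}\xrightarrow{g}\underline{m}\xleftarrow{\phi}\underline{n}\ \mapsto\ \underline{m}\xleftarrow{g_\star(\phi)}\underline{n}\xrightarrow{\phi^\star(g)}\underline{n}$. (iii) $\underline{2}\xrightarrow{m}\underline{1}\xleftarrow{m}\underline{2}\ \mapsto\ \underline{2}\xleftarrow{m^{\amalg 2}\circ\sigma_{2,3}}\underline{4}\xrightarrow{m^{\amalg 2}}\underline{2}$; $\ \underline{0}\xrightarrow{u}\underline{1}\xleftarrow{u}\underline{0}\ \mapsto\ \underline{0}\xleftarrow{\mathrm{id}_0}\underline{0}\xrightarrow{\mathrm{id}_0}\underline{0}$; $\ \underline{2}\xrightarrow{m}\underline{1}\xleftarrow{u}\underline{0}\ \mapsto\ \underline{2}\xleftarrow{u^{\amalg 2}}\underline{0}\xrightarrow{\mathrm{id}_0}\underline{0}$;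 $\ \underline{0}\xrightarrow{u}\underline{1}\xleftarrow{m}\underline{2}\ \mapsto\ \underline{0}\xleftarrow{\mathrm{id}_0}\underline{0}\xrightarrow{u^{\amalg 2}}\underline{2}$, where $\sigma_{2,3}=\mathrm{id}_1\amalg\sigma\amalg\mathrm{id}_1$ and $\sigma$ is the generator of $\Sigma_2$ (with trivial labels).
   Formalization: Rule (ii) is corrected by replacing g and φ^⋆(g) with their inverses in the iso legs; morphisms of Alg are monoidal natural transformations; for non-strict S, strict monoidal functors are taken up to the canonical associativity and unit isomorphisms. *)

theory Defs
  imports "HOL-Algebra.Group" "HOL-Combinatorics.Permutations"
begin

section \<open>Categories, functors, equivalences\<close>

record ('o, 'a) cat =
  Obj :: "'o set"
  Arr :: "'a set"
  Dom :: "'a \<Rightarrow> 'o"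
  Cod :: "'a \<Rightarrow> 'o"
  Ide :: "'o \<Rightarrow> 'a"
  Comp :: "'a \<Rightarrow> 'a \<Rightarrow> 'a" (infixl "\<cdot>\<index>" 70)

definition Hom :: "('o, 'a, 'z) cat_scheme \<Rightarrow> 'o \<Rightarrow> 'o \<Rightarrow> 'a set" where
  "Hom C X Y = {f \<in> Arr C. Dom C f = X \<and> Cod C f = Y}"

locale category =
  fixes C :: "('o, 'a, 'z) cat_scheme" (structure)
  assumes dom_obj: "f \<in> Arr C \<Longrightarrow> Dom C f \<in> Obj C"
    and cod_obj: "f \<in> Arr C \<Longrightarrow> Cod C f \<in> Obj C"
    and ide_hom: "X \<in> Obj C \<Longrightarrow> Ide C X \<in> Hom C X X"
    and comp_hom: "\<lbrakk>f \<in> Hom C X Y; g \<in> Hom C Y Z\<rbrakk> \<Longrightarrow> g \<cdot> f \<in> Hom C X Z"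
    and comp_assoc:
      "\<lbrakk>f \<in> Hom C W X; g \<in> Hom C X Y; h \<in> Hom C Y Z\<rbrakk> \<Longrightarrow> (h \<cdot> g) \<cdot> f = h \<cdot> (g \<cdot> f)"
    and comp_ide: "f \<in> Hom C X Y \<Longrightarrow> f \<cdot> Ide C X = f"
    and ide_comp: "f \<in> Hom C X Y \<Longrightarrow> Ide C Y \<cdot> f = f"

definition inverse_arrows :: "('o, 'a, 'z) cat_scheme \<Rightarrow> 'a \<Rightarrow> 'a \<Rightarrow> bool" where
  "inverse_arrows C f g \<longleftrightarrow> f \<in> Arr C \<and> g \<in> Hom C (Cod C f) (Dom C f) \<and>
     g \<cdot>\<^bsub>C\<^esub> f = Ide C (Dom C f) \<and> f \<cdot>\<^bsub>C\<^esub> g = Ide C (Cod C f)"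

definition is_iso :: "('o, 'a, 'z) cat_scheme \<Rightarrow> 'a \<Rightarrow> bool" where
  "is_iso C f \<longleftrightarrow> (\<exists>g. inverse_arrows C f g)"

definition inv_arr :: "('o, 'a, 'z) cat_scheme \<Rightarrow> 'a \<Rightarrow> 'a" where
  "inv_arr C f = (THE g. inverse_arrows C f g)"

record ('o, 'a, 'p, 'b) cfun =
  FO :: "'o \<Rightarrow> 'p"
  FA :: "'a \<Rightarrow> 'b"

locale cat_functor = source: category C + target: category D
  for C :: "('o, 'a, 'y) cat_scheme" and D :: "('p, 'b, 'z) cat_scheme" +
  fixes F :: "('o, 'a, 'p, 'b) cfun"
  assumes map_obj: "X \<in> Obj C \<Longrightarrow> FO F X \<in> Obj D"
    and map_hom: "f \<in> Hom C X Y \<Longrightarrow> FA F f \<in> Hom D (FO F X) (FO F Y)"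
    and map_ide: "X \<in> Obj C \<Longrightarrow> FA F (Ide C X) = Ide D (FO F X)"
    and map_comp: "\<lbrakk>f \<in> Hom C X Y; g \<in> Hom C Y Z\<rbrakk> \<Longrightarrow> FA F (g \<cdot>\<^bsub>C\<^esub> f) = FA F g \<cdot>\<^bsub>D\<^esub> FA F f"

locale nat_trans = dom_functor: cat_functor C D F + cod_functor: cat_functor C D H
  for C :: "('o, 'a, 'y) cat_scheme" and D :: "('p, 'b, 'z) cat_scheme"
    and F :: "('o, 'a, 'p, 'b) cfun" and H :: "('o, 'a, 'p, 'b) cfun" +
  fixes \<eta> :: "'o \<Rightarrow> 'b"
  assumes component_hom: "X \<in> Obj C \<Longrightarrow> \<eta> X \<in> Hom D (FO F X) (FO H X)"
    and naturality: "f \<in> Hom C X Y \<Longrightarrow> \<eta> Y \<cdot>\<^bsub>D\<^esub> FA F f = FA H f \<cdot>\<^bsub>D\<^esub> \<eta> X"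

definition naturally_isomorphic ::
  "('o, 'a, 'y) cat_scheme \<Rightarrow> ('p, 'b, 'z) cat_scheme \<Rightarrow>
   ('o, 'a, 'p, 'b) cfun \<Rightarrow> ('o, 'a, 'p, 'b) cfun \<Rightarrow> bool" where
  "naturally_isomorphic C D F H \<longleftrightarrow>
     (\<exists>\<eta>. nat_trans C D F H \<eta> \<and> (\<forall>X\<in>Obj C. is_iso D (\<eta> X)))"

definition id_fun :: "('o, 'a, 'o, 'a) cfun" where
  "id_fun = \<lparr>FO = (\<lambda>X. X), FA = (\<lambda>f. f)\<rparr>"

definition comp_fun ::
  "('p, 'b, 'q, 'c) cfun \<Rightarrow> ('o, 'a, 'p, 'b) cfun \<Rightarrow> ('o, 'a, 'q, 'c) cfun" where
  "comp_fun H F = \<lparr>FO = FO H \<circ> FO F, FA = FA H \<circ> FA F\<rparr>"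

definition equivalent_categories ::
  "('o, 'a, 'y) cat_scheme \<Rightarrow> ('p, 'b, 'z) cat_scheme \<Rightarrow> bool" where
  "equivalent_categories C D \<longleftrightarrow>
     (\<exists>F H. cat_functor C D F \<and> cat_functor D C H \<and>
        naturally_isomorphic C C id_fun (comp_fun H F) \<and>
        naturally_isomorphic D D (comp_fun F H) id_fun)"

text \<open>Functors and transformations that are elements of a functor category are required to be
  extensional, so that equality in HOL is equality of functors and of transformations.\<close>

record ('o, 'a, 'p, 'b) ntr =
  NDom :: "('o, 'a, 'p, 'b) cfun"
  NCod :: "('o, 'a, 'p, 'b) cfun"
  NMap :: "'o \<Rightarrow> 'b"

definition functors ::
  "('o, 'a, 'y) cat_scheme \<Rightarrow> ('p, 'b, 'z) cat_scheme \<Rightarrow> ('o, 'a, 'p, 'b) cfun set" where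
  "functors C D =
     {F. cat_functor C D F \<and> FO F \<in> extensional (Obj C) \<and> FA F \<in> extensional (Arr C)}"

definition functor_cat ::
  "('o, 'a, 'y) cat_scheme \<Rightarrow> ('p, 'b, 'z) cat_scheme \<Rightarrow>
   (('o, 'a, 'p, 'b) cfun, ('o, 'a, 'p, 'b) ntr) cat" where
  "functor_cat C D = \<lparr>
     Obj = functors C D,
     Arr = {t. NDom t \<in> functors C D \<and> NCod t \<in> functors C D \<and>
               nat_trans C D (NDom t) (NCod t) (NMap t) \<and> NMap t \<in> extensional (Obj C)},
     Dom = NDom,
     Cod = NCod,
     Ide = (\<lambda>F. \<lparr>NDom = F, NCod = F, NMap = restrict (\<lambda>X. Ide D (FO F X)) (Obj C)\<rparr>),
     Comp = (\<lambda>t s. \<lparr>NDom = NDom s, NCod = NCod t,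
                     NMap = restrict (\<lambda>X. NMap t X \<cdot>\<^bsub>D\<^esub> NMap s X) (Obj C)\<rparr>)\<rparr>"

definition group_cat :: "('g, 'z) monoid_scheme \<Rightarrow> (unit, 'g) cat" where
  "group_cat G = \<lparr>Obj = {()}, Arr = carrier G, Dom = (\<lambda>_. ()), Cod = (\<lambda>_. ()),
     Ide = (\<lambda>_. \<one>\<^bsub>G\<^esub>), Comp = (\<lambda>y x. y \<otimes>\<^bsub>G\<^esub> x)\<rparr>"


section \<open>Symmetric monoidal categories\<close>

text \<open>\<open>X \<boxtimes> Y\<close> is the tensor product of objects, \<open>f \<odot> g\<close> that of morphisms. The structure maps are
  \<open>Assoc X Y Z : (X \<boxtimes> Y) \<boxtimes> Z \<rightarrow> X \<boxtimes> (Y \<boxtimes> Z)\<close>, \<open>LUnit X : I \<boxtimes> X \<rightarrow> X\<close>, \<open>RUnit X : X \<boxtimes> I \<rightarrow> X\<close> and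
  \<open>Sym X Y : X \<boxtimes> Y \<rightarrow> Y \<boxtimes> X\<close>.\<close>

record ('o, 'a) smc = "('o, 'a) cat" +
  TensO :: "'o \<Rightarrow> 'o \<Rightarrow> 'o" (infixl "\<boxtimes>\<index>" 75)
  TensA :: "'a \<Rightarrow> 'a \<Rightarrow> 'a" (infixl "\<odot>\<index>" 75)
  Unit :: 'o
  Assoc :: "'o \<Rightarrow> 'o \<Rightarrow> 'o \<Rightarrow> 'a"
  LUnit :: "'o \<Rightarrow> 'a"
  RUnit :: "'o \<Rightarrow> 'a"
  Sym :: "'o \<Rightarrow> 'o \<Rightarrow> 'a"

locale symmetric_monoidal_category = category S
  for S :: "('o, 'a, 'z) smc_scheme" (structure) +
  assumes unit_obj: "Unit S \<in> Obj S"
    and tens_obj: "\<lbrakk>X \<in> Obj S; Y \<in> Obj S\<rbrakk> \<Longrightarrow> X \<boxtimes> Y \<in> Obj S"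
    and tens_hom: "\<lbrakk>f \<in> Hom S X X'; g \<in> Hom S Y Y'\<rbrakk> \<Longrightarrow> f \<odot> g \<in> Hom S (X \<boxtimes> Y) (X' \<boxtimes> Y')"
    and tens_ide: "\<lbrakk>X \<in> Obj S; Y \<in> Obj S\<rbrakk> \<Longrightarrow> Ide S X \<odot> Ide S Y = Ide S (X \<boxtimes> Y)"
    and tens_comp:
      "\<lbrakk>f \<in> Hom S X X'; f' \<in> Hom S X' X''; g \<in> Hom S Y Y'; g' \<in> Hom S Y' Y''\<rbrakk>
        \<Longrightarrow> (f' \<cdot> f) \<odot> (g' \<cdot> g) = (f' \<odot> g') \<cdot> (f \<odot> g)"
    and assoc_hom: "\<lbrakk>X \<in> Obj S; Y \<in> Obj S; Z \<in> Obj S\<rbrakk>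
        \<Longrightarrow> Assoc S X Y Z \<in> Hom S ((X \<boxtimes> Y) \<boxtimes> Z) (X \<boxtimes> (Y \<boxtimes> Z))"
    and assoc_iso: "\<lbrakk>X \<in> Obj S; Y \<in> Obj S; Z \<in> Obj S\<rbrakk> \<Longrightarrow> is_iso S (Assoc S X Y Z)"
    and assoc_nat:
      "\<lbrakk>f \<in> Hom S X X'; g \<in> Hom S Y Y'; h \<in> Hom S Z Z'\<rbrakk>
        \<Longrightarrow> Assoc S X' Y' Z' \<cdot> ((f \<odot> g) \<odot> h) = (f \<odot> (g \<odot> h)) \<cdot> Assoc S X Y Z"
    and lunit_hom: "X \<in> Obj S \<Longrightarrow> LUnit S X \<in> Hom S (Unit S \<boxtimes> X) X"
    and lunit_iso: "X \<in> Obj S \<Longrightarrow> is_iso S (LUnit S X)"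
    and lunit_nat: "f \<in> Hom S X Y \<Longrightarrow> LUnit S Y \<cdot> (Ide S (Unit S) \<odot> f) = f \<cdot> LUnit S X"
    and runit_hom: "X \<in> Obj S \<Longrightarrow> RUnit S X \<in> Hom S (X \<boxtimes> Unit S) X"
    and runit_iso: "X \<in> Obj S \<Longrightarrow> is_iso S (RUnit S X)"
    and runit_nat: "f \<in> Hom S X Y \<Longrightarrow> RUnit S Y \<cdot> (f \<odot> Ide S (Unit S)) = f \<cdot> RUnit S X"
    and pentagon:
      "\<lbrakk>W \<in> Obj S; X \<in> Obj S; Y \<in> Obj S; Z \<in> Obj S\<rbrakk>
        \<Longrightarrow> Assoc S W X (Y \<boxtimes> Z) \<cdot> Assoc S (W \<boxtimes> X) Y Z
          = (Ide S W \<odot> Assoc S X Y Z) \<cdot> Assoc S W (X \<boxtimes> Y) Z \<cdot> (Assoc S W X Y \<odot> Ide S Z)"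
    and triangle:
      "\<lbrakk>X \<in> Obj S; Y \<in> Obj S\<rbrakk>
        \<Longrightarrow> (Ide S X \<odot> LUnit S Y) \<cdot> Assoc S X (Unit S) Y = RUnit S X \<odot> Ide S Y"
    and sym_hom: "\<lbrakk>X \<in> Obj S; Y \<in> Obj S\<rbrakk> \<Longrightarrow> Sym S X Y \<in> Hom S (X \<boxtimes> Y) (Y \<boxtimes> X)"
    and sym_nat:
      "\<lbrakk>f \<in> Hom S X X'; g \<in> Hom S Y Y'\<rbrakk> \<Longrightarrow> Sym S X' Y' \<cdot> (f \<odot> g) = (g \<odot> f) \<cdot> Sym S X Y"
    and sym_sym: "\<lbrakk>X \<in> Obj S; Y \<in> Obj S\<rbrakk> \<Longrightarrow> Sym S Y X \<cdot> Sym S X Y = Ide S (X \<boxtimes> Y)"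
    and hexagon:
      "\<lbrakk>X \<in> Obj S; Y \<in> Obj S; Z \<in> Obj S\<rbrakk>
        \<Longrightarrow> Assoc S Y Z X \<cdot> Sym S X (Y \<boxtimes> Z) \<cdot> Assoc S X Y Z
          = (Ide S Y \<odot> Sym S X Z) \<cdot> Assoc S Y X Z \<cdot> (Sym S X Y \<odot> Ide S Z)"

locale symmetric_strict_monoidal_category = symmetric_monoidal_category S
  for S :: "('o, 'a, 'z) smc_scheme" (structure) +
  assumes strict_assoc_obj:
      "\<lbrakk>X \<in> Obj S; Y \<in> Obj S; Z \<in> Obj S\<rbrakk> \<Longrightarrow> (X \<boxtimes> Y) \<boxtimes> Z = X \<boxtimes> (Y \<boxtimes> Z)"
    and strict_lunit_obj: "X \<in> Obj S \<Longrightarrow> Unit S \<boxtimes> X = X"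
    and strict_runit_obj: "X \<in> Obj S \<Longrightarrow> X \<boxtimes> Unit S = X"
    and strict_assoc:
      "\<lbrakk>X \<in> Obj S; Y \<in> Obj S; Z \<in> Obj S\<rbrakk> \<Longrightarrow> Assoc S X Y Z = Ide S ((X \<boxtimes> Y) \<boxtimes> Z)"
    and strict_lunit: "X \<in> Obj S \<Longrightarrow> LUnit S X = Ide S X"
    and strict_runit: "X \<in> Obj S \<Longrightarrow> RUnit S X = Ide S X"


section \<open>PROPs and their algebras\<close>

text \<open>The natural number \<open>n\<close> stands for the object \<open>{1..n}\<close>.\<close>

locale is_PROP = symmetric_strict_monoidal_category T
  for T :: "(nat, 'a, 'z) smc_scheme" (structure) +
  assumes obj_UNIV: "Obj T = UNIV"
    and tens_add: "n \<boxtimes> m = n + m"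
    and unit_zero: "Unit T = 0"

text \<open>If \<open>S\<close> is not strict, a symmetric strict monoidal functor from a PROP to \<open>S\<close> is understood up
  to the canonical associativity and unit isomorphisms of \<open>S\<close>: the object \<open>n\<close> is sent to the
  tensor power of the image of \<open>1\<close> bracketed to the left, and \<open>can_tens S X p q\<close> is the canonical
  isomorphism from \<open>tpow S X p \<boxtimes> tpow S X q\<close> to \<open>tpow S X (p + q)\<close>. If \<open>S\<close> is strict, this
  is the literal notion, see \<open>prop_algebra_strict_iff\<close> below.\<close>

fun tpow :: "('o, 'a, 'z) smc_scheme \<Rightarrow> 'o \<Rightarrow> nat \<Rightarrow> 'o" where
  "tpow S X 0 = Unit S"
| "tpow S X (Suc 0) = X"
| "tpow S X (Suc (Suc n)) = tpow S X (Suc n) \<boxtimes>\<^bsub>S\<^esub> X"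

fun can_tens :: "('o, 'a, 'z) smc_scheme \<Rightarrow> 'o \<Rightarrow> nat \<Rightarrow> nat \<Rightarrow> 'a" where
  "can_tens S X p 0 = RUnit S (tpow S X p)"
| "can_tens S X 0 (Suc q) = LUnit S (tpow S X (Suc q))"
| "can_tens S X (Suc p) (Suc 0) = Ide S (tpow S X (Suc p) \<boxtimes>\<^bsub>S\<^esub> X)"
| "can_tens S X (Suc p) (Suc (Suc q)) =
     (can_tens S X (Suc p) (Suc q) \<odot>\<^bsub>S\<^esub> Ide S X) \<cdot>\<^bsub>S\<^esub>
     inv_arr S (Assoc S (tpow S X (Suc p)) (tpow S X (Suc q)) X)"

locale prop_algebra =
  T: is_PROP T + S: symmetric_monoidal_category S + cat_functor T S F
  for T :: "(nat, 'b, 'y) smc_scheme" and S :: "('o, 'a, 'z) smc_scheme"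
    and F :: "(nat, 'b, 'o, 'a) cfun" +
  assumes map_power: "FO F n = tpow S (FO F 1) n"
    and map_tens:
      "\<lbrakk>f \<in> Hom T p p'; g \<in> Hom T q q'\<rbrakk>
        \<Longrightarrow> FA F (f \<odot>\<^bsub>T\<^esub> g) \<cdot>\<^bsub>S\<^esub> can_tens S (FO F 1) p q
          = can_tens S (FO F 1) p' q' \<cdot>\<^bsub>S\<^esub> (FA F f \<odot>\<^bsub>S\<^esub> FA F g)"
    and map_sym:
      "FA F (Sym T p q) \<cdot>\<^bsub>S\<^esub> can_tens S (FO F 1) p q
        = can_tens S (FO F 1) q p \<cdot>\<^bsub>S\<^esub> Sym S (FO F p) (FO F q)"

definition monoidal_transformation ::
  "('o, 'a, 'z) smc_scheme \<Rightarrow> (nat, 'b, 'o, 'a) cfun \<Rightarrow> (nat, 'b, 'o, 'a) cfun \<Rightarrow>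
   (nat \<Rightarrow> 'a) \<Rightarrow> bool" where
  "monoidal_transformation S F H \<eta> \<longleftrightarrow>
     \<eta> 0 = Ide S (Unit S) \<and>
     (\<forall>p q. \<eta> (p + q) \<cdot>\<^bsub>S\<^esub> can_tens S (FO F 1) p q = can_tens S (FO H 1) p q \<cdot>\<^bsub>S\<^esub> (\<eta> p \<odot>\<^bsub>S\<^esub> \<eta> q))"

text \<open>The morphisms of algebras are the monoidal natural transformations.\<close>

definition Alg ::
  "(nat, 'b, 'y) smc_scheme \<Rightarrow> ('o, 'a, 'z) smc_scheme \<Rightarrow>
   ((nat, 'b, 'o, 'a) cfun, (nat, 'b, 'o, 'a) ntr) cat" where
  "Alg T S = (functor_cat T S)\<lparr>
     Obj := {F \<in> Obj (functor_cat T S). prop_algebra T S F},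
     Arr := {t \<in> Arr (functor_cat T S). prop_algebra T S (NDom t) \<and> prop_algebra T S (NCod t) \<and>
               monoidal_transformation S (NDom t) (NCod t) (NMap t)}\<rparr>"

definition symmetric_strict_monoidal_functor ::
  "('o, 'a, 'y) smc_scheme \<Rightarrow> ('p, 'b, 'z) smc_scheme \<Rightarrow> ('o, 'a, 'p, 'b) cfun \<Rightarrow> bool" where
  "symmetric_strict_monoidal_functor T S F \<longleftrightarrow>
     cat_functor T S F \<and> FO F (Unit T) = Unit S \<and>
     (\<forall>X\<in>Obj T. \<forall>Y\<in>Obj T. FO F (X \<boxtimes>\<^bsub>T\<^esub> Y) = FO F X \<boxtimes>\<^bsub>S\<^esub> FO F Y) \<and>
     (\<forall>f\<in>Arr T. \<forall>g\<in>Arr T. FA F (f \<odot>\<^bsub>T\<^esub> g) = FA F f \<odot>\<^bsub>S\<^esub> FA F g) \<and>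
     (\<forall>X\<in>Obj T. \<forall>Y\<in>Obj T. FA F (Sym T X Y) = Sym S (FO F X) (FO F Y))"

lemma (in symmetric_monoidal_category) tpow_obj: "X \<in> Obj S \<Longrightarrow> tpow S X n \<in> Obj S"
proof (induction n)
  case (Suc n)
  then show ?case by (cases n) (auto intro: tens_obj)
qed (simp add: unit_obj)

context symmetric_strict_monoidal_category
begin

lemma tpow_Suc: "X \<in> Obj S \<Longrightarrow> tpow S X (Suc n) = tpow S X n \<boxtimes> X"
  by (cases n) (simp_all add: strict_lunit_obj)

lemma tpow_add: "X \<in> Obj S \<Longrightarrow> tpow S X p \<boxtimes> tpow S X q = tpow S X (p + q)"
proof (induction q)
  case 0
  then show ?case by (simp add: strict_runit_obj tpow_obj)
next
  case (Suc q)
  have "tpow S X p \<boxtimes> tpow S X (Suc q) = (tpow S X p \<boxtimes> tpow S X q) \<boxtimes> X"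
    using Suc.prems by (simp only: tpow_Suc strict_assoc_obj tpow_obj)
  also have "\<dots> = tpow S X (p + Suc q)"
    using Suc.prems by (simp only: Suc.IH tpow_Suc add_Suc_right)
  finally show ?case .
qed

lemma inv_arr_ide:
  assumes X: "X \<in> Obj S"
  shows "inv_arr S (Ide S X) = Ide S X"
  unfolding inv_arr_def
proof (rule the_equality)
  note i = ide_hom [OF X]
  then have ends: "Ide S X \<in> Arr S" "Dom S (Ide S X) = X" "Cod S (Ide S X) = X"
    by (simp_all add: Hom_def)
  show "inverse_arrows S (Ide S X) (Ide S X)"
    unfolding inverse_arrows_def ends(2,3) by (intro conjI ends i comp_ide [OF i])
  fix g
  assume "inverse_arrows S (Ide S X) g"
  then have "g \<in> Hom S X X" and "g \<cdot> Ide S X = Ide S X"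
    unfolding inverse_arrows_def ends(2,3) by blast+
  then show "g = Ide S X" by (metis comp_ide)
qed

lemma can_strict: "X \<in> Obj S \<Longrightarrow> can_tens S X p q = Ide S (tpow S X (p + q))"
proof (induction q)
  case 0
  then show ?case by (simp add: strict_runit tpow_obj)
next
  case (Suc q)
  note X = Suc.prems
  show ?case
  proof (cases p)
    case 0
    then show ?thesis using tpow_obj [OF X, of "Suc q"] by (simp add: strict_lunit)
  next
    case p: (Suc p')
    show ?thesis
    proof (cases q)
      case 0
      then show ?thesis by (simp add: p)
    next
      case q: (Suc q')
      let ?P = "tpow S X p" and ?Q = "tpow S X q"
      have P: "?P \<in> Obj S" and Q: "?Q \<in> Obj S"
        using X by (simp_all add: tpow_obj)
      have sum: "tpow S X (p + q) \<boxtimes> X = tpow S X (p + Suc q)"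
        using X by (simp only: tpow_Suc add_Suc_right)
      have "inv_arr S (Assoc S ?P ?Q X) = Ide S (tpow S X (p + Suc q))"
        using P Q X by (simp only: strict_assoc inv_arr_ide tens_obj tpow_obj tpow_add sum)
      moreover have "can_tens S X p q \<odot> Ide S X = Ide S (tpow S X (p + Suc q))"
        using X by (simp only: Suc.IH tens_ide tpow_obj sum)
      moreover have "can_tens S X p (Suc q) = (can_tens S X p q \<odot> Ide S X) \<cdot> inv_arr S (Assoc S ?P ?Q X)"
        by (simp add: p q)
      ultimately show ?thesis
        using comp_ide [OF ide_hom [OF tpow_obj [OF X, of "p + Suc q"]]] by simp
    qed
  qed
qed

end

lemma prop_algebra_strict_iff:
  assumes T: "is_PROP T" and S: "symmetric_strict_monoidal_category S"
  shows "prop_algebra T S F \<longleftrightarrow> symmetric_strict_monoidal_functor T S F"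
proof -
  interpret T: is_PROP T by (rule T)
  interpret S: symmetric_strict_monoidal_category S by (rule S)
  have eqs: "FO F p \<in> Obj S" "tpow S (FO F 1) p \<in> Obj S"
      "can_tens S (FO F 1) p q = Ide S (tpow S (FO F 1) (p + q))"
      "tpow S (FO F 1) p \<boxtimes>\<^bsub>S\<^esub> tpow S (FO F 1) q = tpow S (FO F 1) (p + q)"
    if "cat_functor T S F" for p q
  proof -
    interpret F: cat_functor T S F by (rule that)
    show F: "FO F p \<in> Obj S" for p by (simp add: F.map_obj T.obj_UNIV)
    show "tpow S (FO F 1) p \<in> Obj S" by (simp add: F S.tpow_obj)
    show "can_tens S (FO F 1) p q = Ide S (tpow S (FO F 1) (p + q))" by (simp only: F S.can_strict)
    show "tpow S (FO F 1) p \<boxtimes>\<^bsub>S\<^esub> tpow S (FO F 1) q = tpow S (FO F 1) (p + q)"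
      by (simp only: F S.tpow_add)
  qed
  have arr_simps: "FA F (f \<odot>\<^bsub>T\<^esub> g) \<cdot>\<^bsub>S\<^esub> can_tens S (FO F 1) p q = FA F (f \<odot>\<^bsub>T\<^esub> g)"
      "can_tens S (FO F 1) p' q' \<cdot>\<^bsub>S\<^esub> (FA F f \<odot>\<^bsub>S\<^esub> FA F g) = FA F f \<odot>\<^bsub>S\<^esub> FA F g"
    if F: "cat_functor T S F" and pow: "\<And>n. FO F n = tpow S (FO F 1) n"
      and f: "f \<in> Hom T p p'" and g: "g \<in> Hom T q q'" for f g p p' q q'
  proof -
    interpret F: cat_functor T S F by (rule F)
    have "f \<odot>\<^bsub>T\<^esub> g \<in> Hom T (p + q) (p' + q')"
      using T.tens_hom [OF f g] by (simp add: T.tens_add)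
    from S.comp_ide [OF F.map_hom [OF this]]
    show "FA F (f \<odot>\<^bsub>T\<^esub> g) \<cdot>\<^bsub>S\<^esub> can_tens S (FO F 1) p q = FA F (f \<odot>\<^bsub>T\<^esub> g)"
      unfolding eqs(3) [OF F] pow [of "p + q"] .
    have "FO F p' \<boxtimes>\<^bsub>S\<^esub> FO F q' = tpow S (FO F 1) (p' + q')"
      by (simp only: pow [of p'] pow [of q'] eqs(4) [OF F])
    with S.ide_comp [OF S.tens_hom [OF F.map_hom [OF f] F.map_hom [OF g]]]
    show "can_tens S (FO F 1) p' q' \<cdot>\<^bsub>S\<^esub> (FA F f \<odot>\<^bsub>S\<^esub> FA F g) = FA F f \<odot>\<^bsub>S\<^esub> FA F g"
      by (simp only: eqs(3) [OF F])
  qed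
  have sym_simps: "FA F (Sym T p q) \<cdot>\<^bsub>S\<^esub> can_tens S (FO F 1) p q = FA F (Sym T p q)"
      "can_tens S (FO F 1) q p \<cdot>\<^bsub>S\<^esub> Sym S (FO F p) (FO F q) = Sym S (FO F p) (FO F q)"
    if F: "cat_functor T S F" and pow: "\<And>n. FO F n = tpow S (FO F 1) n" for p q
  proof -
    interpret F: cat_functor T S F by (rule F)
    have "Sym T p q \<in> Hom T (p + q) (q + p)"
      using T.sym_hom [of p q] by (simp add: T.tens_add T.obj_UNIV)
    from S.comp_ide [OF F.map_hom [OF this]]
    show "FA F (Sym T p q) \<cdot>\<^bsub>S\<^esub> can_tens S (FO F 1) p q = FA F (Sym T p q)"
      unfolding eqs(3) [OF F] pow [of "p + q"] .
    have "FO F q \<boxtimes>\<^bsub>S\<^esub> FO F p = tpow S (FO F 1) (q + p)"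
      by (simp only: pow [of p] pow [of q] eqs(4) [OF F])
    with S.ide_comp [OF S.sym_hom [OF eqs(1) [OF F, of p] eqs(1) [OF F, of q]]]
    show "can_tens S (FO F 1) q p \<cdot>\<^bsub>S\<^esub> Sym S (FO F p) (FO F q) = Sym S (FO F p) (FO F q)"
      by (simp only: eqs(3) [OF F])
  qed
  show ?thesis
  proof
    assume "prop_algebra T S F"
    then interpret A: prop_algebra T S F .
    note F = A.cat_functor_axioms
    have pow: "FO F n = tpow S (FO F 1) n" for n by (rule A.map_power)
    have add: "FO F (p + q) = FO F p \<boxtimes>\<^bsub>S\<^esub> FO F q" for p q
      by (simp only: pow [of p] pow [of q] pow [of "p + q"] eqs(4) [OF F])
    have "FA F (f \<odot>\<^bsub>T\<^esub> g) = FA F f \<odot>\<^bsub>S\<^esub> FA F g" if "f \<in> Arr T" "g \<in> Arr T" for f g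
    proof -
      from that have f: "f \<in> Hom T (Dom T f) (Cod T f)" and g: "g \<in> Hom T (Dom T g) (Cod T g)"
        by (simp_all add: Hom_def)
      from A.map_tens [OF f g] show ?thesis by (simp only: arr_simps [OF F pow f g])
    qed
    moreover have "FA F (Sym T p q) = Sym S (FO F p) (FO F q)" for p q
      using A.map_sym [of p q] by (simp only: sym_simps [OF F pow])
    ultimately show "symmetric_strict_monoidal_functor T S F"
      unfolding symmetric_strict_monoidal_functor_def T.tens_add T.unit_zero
      by (intro conjI ballI F add) (simp_all only: pow [of 0] tpow.simps)
  next
    assume *: "symmetric_strict_monoidal_functor T S F"
    then have F: "cat_functor T S F" and zero: "FO F 0 = Unit S"
      and add: "FO F (p + q) = FO F p \<boxtimes>\<^bsub>S\<^esub> FO F q"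
      and sym: "FA F (Sym T p q) = Sym S (FO F p) (FO F q)"
      and tens: "\<lbrakk>f \<in> Arr T; g \<in> Arr T\<rbrakk> \<Longrightarrow> FA F (f \<odot>\<^bsub>T\<^esub> g) = FA F f \<odot>\<^bsub>S\<^esub> FA F g" for p q f g
      by (auto simp: symmetric_strict_monoidal_functor_def T.tens_add T.unit_zero T.obj_UNIV)
    have pow: "FO F n = tpow S (FO F 1) n" for n
    proof (induction n)
      case 0
      show ?case by (simp add: zero)
    next
      case (Suc n)
      have "FO F (Suc n) = FO F n \<boxtimes>\<^bsub>S\<^esub> FO F 1" using add [of n 1] by simp
      then show ?case by (simp only: Suc.IH [symmetric] S.tpow_Suc eqs(1) [OF F])
    qed
    show "prop_algebra T S F"
    proof (intro prop_algebra.intro prop_algebra_axioms.intro)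
      show "is_PROP T" "symmetric_monoidal_category S" "cat_functor T S F"
        by (fact T.is_PROP_axioms S.symmetric_monoidal_category_axioms F)+
      show "FO F n = tpow S (FO F 1) n" for n by (rule pow)
      show "FA F (f \<odot>\<^bsub>T\<^esub> g) \<cdot>\<^bsub>S\<^esub> can_tens S (FO F 1) p q
          = can_tens S (FO F 1) p' q' \<cdot>\<^bsub>S\<^esub> (FA F f \<odot>\<^bsub>S\<^esub> FA F g)"
        if "f \<in> Hom T p p'" "g \<in> Hom T q q'" for f g p p' q q'
        using that tens [of f g] by (simp only: arr_simps [OF F pow that]) (simp add: Hom_def)
      show "FA F (Sym T p q) \<cdot>\<^bsub>S\<^esub> can_tens S (FO F 1) p q
          = can_tens S (FO F 1) q p \<cdot>\<^bsub>S\<^esub> Sym S (FO F p) (FO F q)" for p q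
        by (simp only: sym_simps [OF F pow]) (simp only: sym)
    qed
  qed
qed

lemma monoidal_transformation_strict_iff:
  assumes S: "symmetric_strict_monoidal_category S"
    and F: "prop_algebra T S F" and H: "prop_algebra T S H" and \<eta>: "nat_trans T S F H \<eta>"
  shows "monoidal_transformation S F H \<eta> \<longleftrightarrow>
    \<eta> 0 = Ide S (Unit S) \<and> (\<forall>p q. \<eta> (p + q) = \<eta> p \<odot>\<^bsub>S\<^esub> \<eta> q)"
proof -
  interpret S: symmetric_strict_monoidal_category S by (rule S)
  interpret F: prop_algebra T S F by (rule F)
  interpret H: prop_algebra T S H by (rule H)
  interpret nat_trans T S F H \<eta> by (rule \<eta>)
  have obj: "FO F n \<in> Obj S" "FO H n \<in> Obj S" for n
    by (simp_all add: F.map_obj H.map_obj F.T.obj_UNIV)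
  have hom: "\<eta> n \<in> Hom S (tpow S (FO F 1) n) (tpow S (FO H 1) n)" for n
    using component_hom [of n] unfolding F.map_power [of n] H.map_power [of n]
    by (simp add: F.T.obj_UNIV)
  have "\<eta> (p + q) \<cdot>\<^bsub>S\<^esub> can_tens S (FO F 1) p q = \<eta> (p + q)" for p q
    using S.comp_ide [OF hom [of "p + q"]] by (simp only: S.can_strict obj)
  moreover have "can_tens S (FO H 1) p q \<cdot>\<^bsub>S\<^esub> (\<eta> p \<odot>\<^bsub>S\<^esub> \<eta> q) = \<eta> p \<odot>\<^bsub>S\<^esub> \<eta> q" for p q
    using S.ide_comp [OF S.tens_hom [OF hom [of p] hom [of q]]]
    by (simp only: S.can_strict S.tpow_add obj)
  ultimately show ?thesis by (simp add: monoidal_transformation_def)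
qed


section \<open>Bimonoids\<close>

record ('o, 'a) bimonoid =
  Carr :: 'o
  Mult :: 'a
  Eta :: 'a
  Comult :: 'a
  Counit :: 'a

text \<open>The exchange of the two middle factors of \<open>(A \<boxtimes> A) \<boxtimes> (A \<boxtimes> A)\<close>.\<close>

definition middle_swap :: "('o, 'a, 'z) smc_scheme \<Rightarrow> 'o \<Rightarrow> 'a" where
  "middle_swap S A =
     inv_arr S (Assoc S A A (A \<boxtimes>\<^bsub>S\<^esub> A)) \<cdot>\<^bsub>S\<^esub>
     (Ide S A \<odot>\<^bsub>S\<^esub>
       (Assoc S A A A \<cdot>\<^bsub>S\<^esub> (Sym S A A \<odot>\<^bsub>S\<^esub> Ide S A) \<cdot>\<^bsub>S\<^esub> inv_arr S (Assoc S A A A))) \<cdot>\<^bsub>S\<^esub>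
     Assoc S A A (A \<boxtimes>\<^bsub>S\<^esub> A)"

locale is_bimonoid = symmetric_monoidal_category S
  for S :: "('o, 'a, 'z) smc_scheme" (structure)
    and A :: 'o and \<mu> :: 'a and e :: 'a and \<Delta> :: 'a and \<epsilon> :: 'a +
  assumes carr_obj: "A \<in> Obj S"
    and mult_hom: "\<mu> \<in> Hom S (A \<boxtimes> A) A"
    and eta_hom: "e \<in> Hom S (Unit S) A"
    and comult_hom: "\<Delta> \<in> Hom S A (A \<boxtimes> A)"
    and counit_hom: "\<epsilon> \<in> Hom S A (Unit S)"
    and mult_assoc: "\<mu> \<cdot> (\<mu> \<odot> Ide S A) = \<mu> \<cdot> (Ide S A \<odot> \<mu>) \<cdot> Assoc S A A A"
    and mult_lunit: "\<mu> \<cdot> (e \<odot> Ide S A) = LUnit S A"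
    and mult_runit: "\<mu> \<cdot> (Ide S A \<odot> e) = RUnit S A"
    and comult_coassoc: "Assoc S A A A \<cdot> (\<Delta> \<odot> Ide S A) \<cdot> \<Delta> = (Ide S A \<odot> \<Delta>) \<cdot> \<Delta>"
    and comult_lcounit: "LUnit S A \<cdot> (\<epsilon> \<odot> Ide S A) \<cdot> \<Delta> = Ide S A"
    and comult_rcounit: "RUnit S A \<cdot> (Ide S A \<odot> \<epsilon>) \<cdot> \<Delta> = Ide S A"
    and comult_mult: "\<Delta> \<cdot> \<mu> = (\<mu> \<odot> \<mu>) \<cdot> middle_swap S A \<cdot> (\<Delta> \<odot> \<Delta>)"
    and counit_mult: "\<epsilon> \<cdot> \<mu> = LUnit S (Unit S) \<cdot> (\<epsilon> \<odot> \<epsilon>)"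
    and comult_eta: "\<Delta> \<cdot> e \<cdot> LUnit S (Unit S) = e \<odot> e"
    and counit_eta: "\<epsilon> \<cdot> e = Ide S (Unit S)"

abbreviation bimonoid_in :: "('o, 'a, 'z) smc_scheme \<Rightarrow> ('o, 'a) bimonoid \<Rightarrow> bool" where
  "bimonoid_in S B \<equiv> is_bimonoid S (Carr B) (Mult B) (Eta B) (Comult B) (Counit B)"

record ('o, 'a) bimonoid_map =
  BDom :: "('o, 'a) bimonoid"
  BCod :: "('o, 'a) bimonoid"
  BMap :: 'a

definition is_bimonoid_map ::
  "('o, 'a, 'z) smc_scheme \<Rightarrow> ('o, 'a) bimonoid \<Rightarrow> ('o, 'a) bimonoid \<Rightarrow> 'a \<Rightarrow> bool" where
  "is_bimonoid_map S B B' f \<longleftrightarrow>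
     f \<in> Hom S (Carr B) (Carr B') \<and>
     f \<cdot>\<^bsub>S\<^esub> Mult B = Mult B' \<cdot>\<^bsub>S\<^esub> (f \<odot>\<^bsub>S\<^esub> f) \<and>
     f \<cdot>\<^bsub>S\<^esub> Eta B = Eta B' \<and>
     (f \<odot>\<^bsub>S\<^esub> f) \<cdot>\<^bsub>S\<^esub> Comult B = Comult B' \<cdot>\<^bsub>S\<^esub> f \<and>
     Counit B = Counit B' \<cdot>\<^bsub>S\<^esub> f"

definition Bimon ::
  "('o, 'a, 'z) smc_scheme \<Rightarrow> (('o, 'a) bimonoid, ('o, 'a) bimonoid_map) cat" where
  "Bimon S = \<lparr>
     Obj = {B. bimonoid_in S B},
     Arr = {t. bimonoid_in S (BDom t) \<and> bimonoid_in S (BCod t) \<and>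
               is_bimonoid_map S (BDom t) (BCod t) (BMap t)},
     Dom = BDom,
     Cod = BCod,
     Ide = (\<lambda>B. \<lparr>BDom = B, BCod = B, BMap = Ide S (Carr B)\<rparr>),
     Comp = (\<lambda>t s. \<lparr>BDom = BDom s, BCod = BCod t, BMap = BMap t \<cdot>\<^bsub>S\<^esub> BMap s\<rparr>)\<rparr>"

definition GBimon where
  "GBimon G S = functor_cat (group_cat G) (Bimon S)"


section \<open>The PROP \<open>Q\<close> of order-preserving maps and labelled permutations\<close>

type_synonym 'g lperm = "(nat \<Rightarrow> 'g) \<times> (nat \<Rightarrow> nat)"

text \<open>The group of permutations of \<open>{1..n}\<close> with labels in \<open>G\<close>.\<close>

definition lperm_group :: "('g, 'z) monoid_scheme \<Rightarrow> nat \<Rightarrow> 'g lperm monoid" where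
  "lperm_group G n = \<lparr>
     carrier = {(x, \<sigma>). x \<in> {1..n} \<rightarrow>\<^sub>E carrier G \<and> \<sigma> permutes {1..n}},
     monoid.mult = (\<lambda>(y, \<tau>) (x, \<sigma>). (restrict (\<lambda>i. y (\<sigma> i) \<otimes>\<^bsub>G\<^esub> x i) {1..n}, \<tau> \<circ> \<sigma>)),
     one = (restrict (\<lambda>_. \<one>\<^bsub>G\<^esub>) {1..n}, id)\<rparr>"

definition HomD :: "nat \<Rightarrow> nat \<Rightarrow> (nat \<Rightarrow> nat) set" where
  "HomD n m = {\<phi> \<in> {1..n} \<rightarrow>\<^sub>E {1..m}. mono_on {1..n} \<phi>}"

text \<open>\<open>push n m g \<phi>\<close> and \<open>pull n m g \<phi>\<close> are \<open>g\<^sub>\<star>(\<phi>)\<close> and \<open>\<phi>\<^sup>\<star>(g)\<close>, where \<open>\<phi> \<in> HomD n m\<close> and \<open>g\<close> is a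
  labelled permutation of \<open>{1..m}\<close>.\<close>

definition push :: "nat \<Rightarrow> nat \<Rightarrow> 'g lperm \<Rightarrow> (nat \<Rightarrow> nat) \<Rightarrow> nat \<Rightarrow> nat" where
  "push n m g \<phi> = (THE \<psi>. \<psi> \<in> HomD n m \<and>
     (\<forall>i\<in>{1..m}. card {j \<in> {1..n}. \<psi> j = snd g i} = card {j \<in> {1..n}. \<phi> j = i}))"

definition pull_perm :: "nat \<Rightarrow> nat \<Rightarrow> 'g lperm \<Rightarrow> (nat \<Rightarrow> nat) \<Rightarrow> nat \<Rightarrow> nat" where
  "pull_perm n m g \<phi> = (THE \<tau>. \<tau> permutes {1..n} \<and>
     (\<forall>i\<in>{1..m}. mono_on {j \<in> {1..n}. \<phi> j = i} \<tau>) \<and>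
     (\<forall>j\<in>{1..n}. snd g (\<phi> j) = push n m g \<phi> (\<tau> j)))"

definition pull :: "nat \<Rightarrow> nat \<Rightarrow> 'g lperm \<Rightarrow> (nat \<Rightarrow> nat) \<Rightarrow> 'g lperm" where
  "pull n m g \<phi> = (restrict (\<lambda>j. fst g (\<phi> j)) {1..n}, pull_perm n m g \<phi>)"

record 'g qarr =
  qdom :: nat
  qcod :: nat
  qmap :: "nat \<Rightarrow> nat"
  qlab :: "'g lperm"

text \<open>Juxtaposition of functions on \<open>{1..n}\<close> and \<open>{1..n'}\<close>; the values of the second are moved by
  the shift \<open>s\<close>. For permutations the result is again the identity outside \<open>{1..n + n'}\<close>.\<close>

definition juxt :: "nat \<Rightarrow> (nat \<Rightarrow> 'b) \<Rightarrow> ('b \<Rightarrow> 'b) \<Rightarrow> (nat \<Rightarrow> 'b) \<Rightarrow> nat \<Rightarrow> 'b" where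
  "juxt n f s f' = (\<lambda>j. if j \<le> n then f j else s (f' (j - n)))"

definition block_perm :: "nat \<Rightarrow> nat \<Rightarrow> nat \<Rightarrow> nat" where
  "block_perm n m j =
     (if j \<in> {1..n} then m + j else if j \<in> {n + 1..n + m} then j - n else j)"

definition qmor :: "('g, 'z) monoid_scheme \<Rightarrow> nat \<Rightarrow> nat \<Rightarrow> (nat \<Rightarrow> nat) \<Rightarrow> 'g qarr" where
  "qmor G n m \<phi> = \<lparr>qdom = n, qcod = m, qmap = \<phi>, qlab = \<one>\<^bsub>lperm_group G n\<^esub>\<rparr>"

definition qiso :: "nat \<Rightarrow> 'g lperm \<Rightarrow> 'g qarr" where
  "qiso n g = \<lparr>qdom = n, qcod = n, qmap = restrict id {1..n}, qlab = g\<rparr>"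

definition qide :: "('g, 'z) monoid_scheme \<Rightarrow> nat \<Rightarrow> 'g qarr" where
  "qide G n = qiso n \<one>\<^bsub>lperm_group G n\<^esub>"

definition qcomp :: "('g, 'z) monoid_scheme \<Rightarrow> 'g qarr \<Rightarrow> 'g qarr \<Rightarrow> 'g qarr" where
  "qcomp G q2 q1 = (let n = qdom q1; m = qcod q1; \<phi>1 = qmap q1; g2 = qlab q2 in
     \<lparr>qdom = n, qcod = qcod q2,
      qmap = compose {1..n} (qmap q2) (push n m g2 \<phi>1),
      qlab = pull n m g2 \<phi>1 \<otimes>\<^bsub>lperm_group G n\<^esub> qlab q1\<rparr>)"

definition qtens :: "'g qarr \<Rightarrow> 'g qarr \<Rightarrow> 'g qarr" where
  "qtens q q' = (let n = qdom q; m = qcod q; n' = qdom q' in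
     \<lparr>qdom = n + n', qcod = m + qcod q',
      qmap = restrict (juxt n (qmap q) ((+) m) (qmap q')) {1..n + n'},
      qlab = (restrict (juxt n (fst (qlab q)) id (fst (qlab q'))) {1..n + n'},
              juxt n (snd (qlab q)) ((+) n) (snd (qlab q')))\<rparr>)"

definition QPROP :: "('g, 'z) monoid_scheme \<Rightarrow> (nat, 'g qarr) smc" where
  "QPROP G = \<lparr>
     Obj = UNIV,
     Arr = {q. qmap q \<in> HomD (qdom q) (qcod q) \<and> qlab q \<in> carrier (lperm_group G (qdom q))},
     Dom = qdom,
     Cod = qcod,
     Ide = qide G,
     Comp = qcomp G,
     TensO = (+),
     TensA = qtens,
     Unit = 0,
     Assoc = (\<lambda>n m k. qide G (n + m + k)),
     LUnit = qide G,
     RUnit = qide G,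
     Sym = (\<lambda>n m. qiso (n + m) (fst \<one>\<^bsub>lperm_group G (n + m)\<^esub>, block_perm n m))\<rparr>"


section \<open>Spans, cospans and distributive laws\<close>

definition spans :: "('o, 'a, 'z) cat_scheme \<Rightarrow> ('a \<times> 'a) set" where
  "spans C = {(a, b). a \<in> Arr C \<and> b \<in> Arr C \<and> Dom C a = Dom C b}"

definition cospans :: "('o, 'a, 'z) cat_scheme \<Rightarrow> ('a \<times> 'a) set" where
  "cospans C = {(a, b). a \<in> Arr C \<and> b \<in> Arr C \<and> Cod C a = Cod C b}"

definition span_rel :: "('o, 'a, 'z) cat_scheme \<Rightarrow> (('a \<times> 'a) \<times> ('a \<times> 'a)) set" where
  "span_rel C = {((a, b), (a', b')). (a, b) \<in> spans C \<and> (a', b') \<in> spans C \<and>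
     (\<exists>h. is_iso C h \<and> Dom C h = Dom C a \<and> Cod C h = Dom C a' \<and>
          a = a' \<cdot>\<^bsub>C\<^esub> h \<and> b = b' \<cdot>\<^bsub>C\<^esub> h)}"

definition cospan_rel :: "('o, 'a, 'z) cat_scheme \<Rightarrow> (('a \<times> 'a) \<times> ('a \<times> 'a)) set" where
  "cospan_rel C = {((a, b), (a', b')). (a, b) \<in> cospans C \<and> (a', b') \<in> cospans C \<and>
     (\<exists>h. is_iso C h \<and> Dom C h = Cod C a \<and> Cod C h = Cod C a' \<and>
          a' = h \<cdot>\<^bsub>C\<^esub> a \<and> b' = h \<cdot>\<^bsub>C\<^esub> b)}"

abbreviation span_class :: "('o, 'a, 'z) cat_scheme \<Rightarrow> 'a \<Rightarrow> 'a \<Rightarrow> ('a \<times> 'a) set" where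
  "span_class C a b \<equiv> span_rel C `` {(a, b)}"

abbreviation cospan_class :: "('o, 'a, 'z) cat_scheme \<Rightarrow> 'a \<Rightarrow> 'a \<Rightarrow> ('a \<times> 'a) set" where
  "cospan_class C a b \<equiv> cospan_rel C `` {(a, b)}"

text \<open>A distributive law sends the class of a cospan \<open>p \<rightarrow> m \<leftarrow> q\<close>, given as \<open>(b, c)\<close>, to the class of
  a span \<open>p \<leftarrow> r \<rightarrow> q\<close>. It is compatible with isomorphisms at the outer objects (it is a morphism of
  bimodules over the isomorphisms), with identities and composition in both legs, and with the
  tensor product.\<close>

locale distributive_law = symmetric_monoidal_category C
  for C :: "('o, 'a, 'z) smc_scheme" (structure) +
  fixes \<Lambda> :: "('a \<times> 'a) set \<Rightarrow> ('a \<times> 'a) set"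
  assumes law_fun: "\<Lambda> \<in> cospans C // cospan_rel C \<rightarrow>\<^sub>E spans C // span_rel C"
    and law_ends: "\<lbrakk>(b, c) \<in> cospans C; (x, y) \<in> \<Lambda> (cospan_class C b c)\<rbrakk>
        \<Longrightarrow> Cod C x = Dom C b \<and> Cod C y = Dom C c"
    and law_iso:
      "\<lbrakk>(b, c) \<in> cospans C; (x, y) \<in> \<Lambda> (cospan_class C b c);
        inverse_arrows C g g'; inverse_arrows C h h'; Cod C g = Dom C b; Cod C h = Dom C c\<rbrakk>
        \<Longrightarrow> (g' \<cdot> x, h' \<cdot> y) \<in> \<Lambda> (cospan_class C (b \<cdot> g) (c \<cdot> h))"
    and law_ide_right: "f \<in> Hom C p m
        \<Longrightarrow> \<Lambda> (cospan_class C f (Ide C m)) = span_class C (Ide C p) f"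
    and law_ide_left: "f \<in> Hom C q m
        \<Longrightarrow> \<Lambda> (cospan_class C (Ide C m) f) = span_class C f (Ide C q)"
    and law_comp_left:
      "\<lbrakk>(b, c) \<in> cospans C; f \<in> Arr C; Cod C f = Dom C b;
        (x, y) \<in> \<Lambda> (cospan_class C b c); (z, w) \<in> \<Lambda> (cospan_class C f x)\<rbrakk>
        \<Longrightarrow> (z, y \<cdot> w) \<in> \<Lambda> (cospan_class C (b \<cdot> f) c)"
    and law_comp_right:
      "\<lbrakk>(b, c) \<in> cospans C; h \<in> Arr C; Cod C h = Dom C c;
        (x, y) \<in> \<Lambda> (cospan_class C b c); (z, w) \<in> \<Lambda> (cospan_class C y h)\<rbrakk>
        \<Longrightarrow> (x \<cdot> z, w) \<in> \<Lambda> (cospan_class C b (c \<cdot> h))"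
    and law_tens:
      "\<lbrakk>(b, c) \<in> cospans C; (b', c') \<in> cospans C;
        (x, y) \<in> \<Lambda> (cospan_class C b c); (x', y') \<in> \<Lambda> (cospan_class C b' c')\<rbrakk>
        \<Longrightarrow> (x \<odot> x', y \<odot> y') \<in> \<Lambda> (cospan_class C (b \<odot> b') (c \<odot> c'))"

text \<open>In the composite, the class of the span \<open>n \<leftarrow> p \<rightarrow> m\<close> is a morphism from \<open>n\<close> to \<open>m\<close>.\<close>

definition span_embed :: "('o, 'a, 'z) cat_scheme \<Rightarrow> 'a \<Rightarrow> ('a \<times> 'a) set" where
  "span_embed C f = span_class C (Ide C (Dom C f)) f"

definition composite ::
  "('o, 'a, 'z) smc_scheme \<Rightarrow> (('a \<times> 'a) set \<Rightarrow> ('a \<times> 'a) set) \<Rightarrow> ('o, ('a \<times> 'a) set) smc" where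
  "composite C \<Lambda> = \<lparr>
     Obj = Obj C,
     Arr = spans C // span_rel C,
     Dom = (\<lambda>X. Cod C (fst (SOME s. s \<in> X))),
     Cod = (\<lambda>X. Cod C (snd (SOME s. s \<in> X))),
     Ide = (\<lambda>n. span_class C (Ide C n) (Ide C n)),
     Comp = (\<lambda>Y X. \<Union>(a, b)\<in>X. \<Union>(c, d)\<in>Y. \<Union>(x, y)\<in>\<Lambda> (cospan_class C b c).
               span_class C (a \<cdot>\<^bsub>C\<^esub> x) (d \<cdot>\<^bsub>C\<^esub> y)),
     TensO = TensO C,
     TensA = (\<lambda>X Y. \<Union>(a, b)\<in>X. \<Union>(c, d)\<in>Y. span_class C (a \<odot>\<^bsub>C\<^esub> c) (b \<odot>\<^bsub>C\<^esub> d)),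
     Unit = Unit C,
     Assoc = (\<lambda>n m k. span_embed C (Assoc C n m k)),
     LUnit = (\<lambda>n. span_embed C (LUnit C n)),
     RUnit = (\<lambda>n. span_embed C (RUnit C n)),
     Sym = (\<lambda>n m. span_embed C (Sym C n m))\<rparr>"


section \<open>The PROP for \<open>G\<close>-bimonoids\<close>

definition m_arr :: "('g, 'z) monoid_scheme \<Rightarrow> 'g qarr" where
  "m_arr G = qmor G 2 1 (restrict (\<lambda>_. 1) {1..2})"

definition u_arr :: "('g, 'z) monoid_scheme \<Rightarrow> 'g qarr" where
  "u_arr G = qmor G 0 1 (restrict (\<lambda>_. 1) {1..0})"

definition sigma23 :: "('g, 'z) monoid_scheme \<Rightarrow> 'g qarr" where
  "sigma23 G = qtens (qtens (qide G 1) (Sym (QPROP G) 1 1)) (qide G 1)"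

text \<open>In \<open>law_push_pull\<close> and \<open>law_pull_push\<close> the inverses of \<open>g\<close> and \<open>\<phi>\<^sup>\<star>(g)\<close> are needed, as in
  \<open>law_lperm\<close>: in \<open>Q\<close> one has \<open>g \<circ> \<phi> = g\<^sub>\<star>(\<phi>) \<circ> \<phi>\<^sup>\<star>(g)\<close>, that is,
  \<open>\<phi> \<circ> \<phi>\<^sup>\<star>(g)\<inverse> = g\<inverse> \<circ> g\<^sub>\<star>(\<phi>)\<close>. Without them the value would depend on the choice of a
  representative of the class of the cospan.\<close>

locale bimonoid_law = distributive_law "QPROP G" \<Lambda>
  for G :: "('g, 'z) monoid_scheme"
    and \<Lambda> :: "('g qarr \<times> 'g qarr) set \<Rightarrow> ('g qarr \<times> 'g qarr) set" +
  assumes law_lperm: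
      "\<lbrakk>g \<in> carrier (lperm_group G n); h \<in> carrier (lperm_group G n)\<rbrakk>
        \<Longrightarrow> \<Lambda> (cospan_class (QPROP G) (qiso n g) (qiso n h)) =
          span_class (QPROP G) (qiso n (inv\<^bsub>lperm_group G n\<^esub> g)) (qiso n (inv\<^bsub>lperm_group G n\<^esub> h))"
    and law_push_pull:
      "\<lbrakk>\<phi> \<in> HomD n m; g \<in> carrier (lperm_group G m)\<rbrakk>
        \<Longrightarrow> \<Lambda> (cospan_class (QPROP G) (qmor G n m \<phi>) (qiso m (inv\<^bsub>lperm_group G m\<^esub> g))) =
          span_class (QPROP G) (qiso n (inv\<^bsub>lperm_group G n\<^esub> (pull n m g \<phi>))) (qmor G n m (push n m g \<phi>))"
    and law_pull_push:
      "\<lbrakk>\<phi> \<in> HomD n m; g \<in> carrier (lperm_group G m)\<rbrakk>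
        \<Longrightarrow> \<Lambda> (cospan_class (QPROP G) (qiso m (inv\<^bsub>lperm_group G m\<^esub> g)) (qmor G n m \<phi>)) =
          span_class (QPROP G) (qmor G n m (push n m g \<phi>)) (qiso n (inv\<^bsub>lperm_group G n\<^esub> (pull n m g \<phi>)))"
    and law_m_m:
      "\<Lambda> (cospan_class (QPROP G) (m_arr G) (m_arr G)) =
        span_class (QPROP G) (qcomp G (qtens (m_arr G) (m_arr G)) (sigma23 G)) (qtens (m_arr G) (m_arr G))"
    and law_u_u:
      "\<Lambda> (cospan_class (QPROP G) (u_arr G) (u_arr G)) = span_class (QPROP G) (qide G 0) (qide G 0)"
    and law_m_u:
      "\<Lambda> (cospan_class (QPROP G) (m_arr G) (u_arr G)) =
        span_class (QPROP G) (qtens (u_arr G) (u_arr G)) (qide G 0)"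
    and law_u_m:
      "\<Lambda> (cospan_class (QPROP G) (u_arr G) (m_arr G)) =
        span_class (QPROP G) (qide G 0) (qtens (u_arr G) (u_arr G))"

definition the_law ::
  "('g, 'z) monoid_scheme \<Rightarrow> ('g qarr \<times> 'g qarr) set \<Rightarrow> ('g qarr \<times> 'g qarr) set" where
  "the_law G = (THE \<Lambda>. bimonoid_law G \<Lambda>)"

definition GBimon_PROP ::
  "('g, 'z) monoid_scheme \<Rightarrow> (nat, ('g qarr \<times> 'g qarr) set) smc" where
  "GBimon_PROP G = composite (QPROP G) (the_law G)"

end

theory Submission
  imports Defs "HOL-Library.Multiset"
begin

text \<open>An arrow of \<open>Q\<close> is a map of finite sets with labels and a linear order on every fibre. In this
  description the distributive law is the pullback square: the fibre product of the underlying maps,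
  where each leg carries the order pulled back from the opposite leg and the labels make the square
  commute. Cutting a cospan along its target and peeling off one multiplication at a time builds all
  these squares from the four squares of \<open>m\<close> and \<open>u\<close>, so the law is unique and the composite is
  generated by \<open>m\<close>, \<open>u\<close>, their duals, the symmetry and the labels.

  For a bimonoid with \<open>G\<close>-action, an arrow of \<open>Q\<close> is evaluated by permuting and relabelling
  the inputs and multiplying up the fibres. An opposite arrow is evaluated in the opposite PROP,
  and the induction over pullback squares shows that the two evaluations satisfy the law, hence
  glue to the composite. A PROP morphism is determined on generators, so this is inverse to
  restricting an algebra to the generators: the two categories are even isomorphic. A category that
  is not strict enters only through the endomorphism PROP of an object, whose arrows \<open>n \<rightarrow> m\<close>
  are the arrows between the tensor powers, with tensor product conjugated by the canonical
  isomorphisms.\<close>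

section \<open>Strict calculus in a PROP\<close>

text \<open>The obstacle is that \<open>Q\<close> and the composite do not come with a presentation
  by generators and relations, so a map out of them cannot be defined by naming its values on
  \<open>m\<close>, \<open>u\<close>, symmetries and labels. The evaluation \<open>N\<close> is
  therefore defined on normal forms, the lists of labelled inputs over each output, and
  compatibility is checked by hand only for one elementary arrow composed on the left; generation of
  \<open>Q\<close> extends it to all composites and tensor products. For opposite legs the same is
  done in \<open>opp E\<close>. There a label acts by its inverse, because a span with an invertible
  left leg and an identity is the embedded inverse of that leg. The fibre orders of a pullback
  square are crossed between the legs since \<open>b x\<close> and \<open>c y\<close> order a common
  fibre by the two lexicographic orders on pairs; for \<open>m\<close> against \<open>m\<close> the
  difference is the middle transposition. Algebras are strict about tensor powers, so their object
  part is fixed by its value at \<open>1\<close> and their transformations by the component at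
  \<open>1\<close>. This is why bijections on objects and arrows come out.\<close>

lemma Hom_iff: "f \<in> Hom C X Y \<longleftrightarrow> f \<in> Arr C \<and> Dom C f = X \<and> Cod C f = Y"
  by (auto simp: Hom_def)

context category
begin

lemma comp_in [simp]: "\<lbrakk>f \<in> Arr C; g \<in> Arr C; Cod C f = Dom C g\<rbrakk> \<Longrightarrow> g \<cdot> f \<in> Arr C"
  and dom_comp [simp]: "\<lbrakk>f \<in> Arr C; g \<in> Arr C; Cod C f = Dom C g\<rbrakk> \<Longrightarrow> Dom C (g \<cdot> f) = Dom C f"
  and cod_comp [simp]: "\<lbrakk>f \<in> Arr C; g \<in> Arr C; Cod C f = Dom C g\<rbrakk> \<Longrightarrow> Cod C (g \<cdot> f) = Cod C g"
  using comp_hom [of f "Dom C f" "Cod C f" g "Cod C g"] by (auto simp: Hom_def)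

lemma ide_in [simp]: "X \<in> Obj C \<Longrightarrow> Ide C X \<in> Arr C"
  and dom_ide [simp]: "X \<in> Obj C \<Longrightarrow> Dom C (Ide C X) = X"
  and cod_ide [simp]: "X \<in> Obj C \<Longrightarrow> Cod C (Ide C X) = X"
  using ide_hom [of X] by (auto simp: Hom_def)

lemma assoc_arr:
  "\<lbrakk>f \<in> Arr C; g \<in> Arr C; h \<in> Arr C; Cod C f = Dom C g; Cod C g = Dom C h\<rbrakk>
    \<Longrightarrow> (h \<cdot> g) \<cdot> f = h \<cdot> (g \<cdot> f)"
  using comp_assoc [of f "Dom C f" "Cod C f" g "Cod C g" h "Cod C h"] by (auto simp: Hom_def)

lemma comp_ide_arr [simp]: "\<lbrakk>f \<in> Arr C; Dom C f = X\<rbrakk> \<Longrightarrow> f \<cdot> Ide C X = f"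
  and ide_comp_arr [simp]: "\<lbrakk>f \<in> Arr C; Cod C f = X\<rbrakk> \<Longrightarrow> Ide C X \<cdot> f = f"
  using comp_ide [of f X "Cod C f"] ide_comp [of f "Dom C f" X] by (auto simp: Hom_def)

lemma inverse_arrows_iff:
  "inverse_arrows C f g \<longleftrightarrow> f \<in> Arr C \<and> g \<in> Arr C \<and> Dom C g = Cod C f \<and> Cod C g = Dom C f \<and>
     g \<cdot> f = Ide C (Dom C f) \<and> f \<cdot> g = Ide C (Cod C f)"
  by (auto simp: inverse_arrows_def Hom_def)

lemma inverse_arrows_sym: "inverse_arrows C f g \<Longrightarrow> inverse_arrows C g f"
  by (auto simp: inverse_arrows_iff)

lemma inverse_arrows_ide: "X \<in> Obj C \<Longrightarrow> inverse_arrows C (Ide C X) (Ide C X)"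
  by (simp add: inverse_arrows_iff)

lemma inverse_arrows_comp:
  assumes "inverse_arrows C f f'" "inverse_arrows C g g'" "Cod C f = Dom C g"
  shows "inverse_arrows C (g \<cdot> f) (f' \<cdot> g')"
proof -
  have a: "f \<in> Arr C" "f' \<in> Arr C" "g \<in> Arr C" "g' \<in> Arr C" "Dom C f' = Cod C f" "Cod C f' = Dom C f"
    "Dom C g' = Cod C g" "Cod C g' = Dom C g" "f' \<cdot> f = Ide C (Dom C f)" "f \<cdot> f' = Ide C (Cod C f)"
    "g' \<cdot> g = Ide C (Dom C g)" "g \<cdot> g' = Ide C (Cod C g)"
    using assms by (simp_all add: inverse_arrows_iff)
  have "(f' \<cdot> g') \<cdot> (g \<cdot> f) = f' \<cdot> ((g' \<cdot> g) \<cdot> f)" using a(1-8) assms(3) by (simp add: assoc_arr)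
  moreover have "(g \<cdot> f) \<cdot> (f' \<cdot> g') = g \<cdot> ((f \<cdot> f') \<cdot> g')" using a(1-8) assms(3) by (simp add: assoc_arr)
  ultimately show ?thesis using a assms(3) by (simp add: inverse_arrows_iff)
qed

lemma inverse_arrows_unique:
  assumes "inverse_arrows C f g" "inverse_arrows C f h"
  shows "g = h"
proof -
  have "g = (h \<cdot> f) \<cdot> g" using assms by (simp add: inverse_arrows_iff)
  also have "\<dots> = h \<cdot> (f \<cdot> g)" using assms by (intro assoc_arr) (simp_all add: inverse_arrows_iff)
  also have "\<dots> = h" using assms by (simp add: inverse_arrows_iff)
  finally show ?thesis .
qed

lemma inv_arr_eq: "inverse_arrows C f g \<Longrightarrow> inv_arr C f = g"
  unfolding inv_arr_def using inverse_arrows_unique by blast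

lemma inverse_arrows_inv_arr: "is_iso C f \<Longrightarrow> inverse_arrows C f (inv_arr C f)"
  unfolding is_iso_def using inv_arr_eq by blast

lemma is_isoI: "inverse_arrows C f g \<Longrightarrow> is_iso C f"
  by (auto simp: is_iso_def)

lemma is_iso_ide: "X \<in> Obj C \<Longrightarrow> is_iso C (Ide C X)"
  using inverse_arrows_ide is_isoI by blast

lemma is_iso_comp: "\<lbrakk>is_iso C f; is_iso C g; Cod C f = Dom C g\<rbrakk> \<Longrightarrow> is_iso C (g \<cdot> f)"
  using inverse_arrows_comp unfolding is_iso_def by blast

lemma is_iso_arr: "is_iso C f \<Longrightarrow> f \<in> Arr C"
  by (auto simp: is_iso_def inverse_arrows_def)

end

context symmetric_monoidal_category
begin

lemma tens_in [simp]: "\<lbrakk>f \<in> Arr S; g \<in> Arr S\<rbrakk> \<Longrightarrow> f \<odot> g \<in> Arr S"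
  and dom_tens [simp]: "\<lbrakk>f \<in> Arr S; g \<in> Arr S\<rbrakk> \<Longrightarrow> Dom S (f \<odot> g) = Dom S f \<boxtimes> Dom S g"
  and cod_tens [simp]: "\<lbrakk>f \<in> Arr S; g \<in> Arr S\<rbrakk> \<Longrightarrow> Cod S (f \<odot> g) = Cod S f \<boxtimes> Cod S g"
  using tens_hom [of f "Dom S f" "Cod S f" g "Dom S g" "Cod S g"] by (auto simp: Hom_def)

lemma interchange:
  "\<lbrakk>f \<in> Arr S; f' \<in> Arr S; g \<in> Arr S; g' \<in> Arr S; Cod S f = Dom S f'; Cod S g = Dom S g'\<rbrakk>
    \<Longrightarrow> (f' \<odot> g') \<cdot> (f \<odot> g) = (f' \<cdot> f) \<odot> (g' \<cdot> g)"
  using tens_comp [of f "Dom S f" "Cod S f" f' "Cod S f'" g "Dom S g" "Cod S g" g' "Cod S g'"]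
  by (auto simp: Hom_def)

lemma sym_in [simp]: "\<lbrakk>X \<in> Obj S; Y \<in> Obj S\<rbrakk> \<Longrightarrow> Sym S X Y \<in> Arr S"
  and dom_sym [simp]: "\<lbrakk>X \<in> Obj S; Y \<in> Obj S\<rbrakk> \<Longrightarrow> Dom S (Sym S X Y) = X \<boxtimes> Y"
  and cod_sym [simp]: "\<lbrakk>X \<in> Obj S; Y \<in> Obj S\<rbrakk> \<Longrightarrow> Cod S (Sym S X Y) = Y \<boxtimes> X"
  using sym_hom [of X Y] by (auto simp: Hom_def)

lemma sym_nat_arr:
  "\<lbrakk>f \<in> Arr S; g \<in> Arr S\<rbrakk> \<Longrightarrow> Sym S (Cod S f) (Cod S g) \<cdot> (f \<odot> g) = (g \<odot> f) \<cdot> Sym S (Dom S f) (Dom S g)"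
  using sym_nat [of f "Dom S f" "Cod S f" g "Dom S g" "Cod S g"] by (auto simp: Hom_def)

lemma inverse_arrows_tens:
  assumes "inverse_arrows S f f'" "inverse_arrows S g g'"
  shows "inverse_arrows S (f \<odot> g) (f' \<odot> g')"
  using assms by (simp add: inverse_arrows_iff interchange tens_ide dom_obj cod_obj)

end

context is_PROP
begin

lemma obj [simp]: "n \<in> Obj T" by (simp add: obj_UNIV)

lemmas tens_add' [simp] = tens_add

lemma assoc_ide: "Assoc T n m k = Ide T (n + m + k)"
  using strict_assoc by simp

lemma tens_assoc:
  assumes "f \<in> Arr T" "g \<in> Arr T" "h \<in> Arr T"
  shows "(f \<odot> g) \<odot> h = f \<odot> (g \<odot> h)"
  using assoc_nat [of f "Dom T f" "Cod T f" g "Dom T g" "Cod T g" h "Dom T h" "Cod T h"] assms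
  by (simp add: Hom_def assoc_ide add.assoc)

lemma tens_unit [simp]:
  assumes "f \<in> Arr T"
  shows "Ide T 0 \<odot> f = f" "f \<odot> Ide T 0 = f"
  using lunit_nat [of f "Dom T f" "Cod T f"] runit_nat [of f "Dom T f" "Cod T f"] assms
  by (simp_all add: Hom_def strict_lunit strict_runit unit_zero)

lemma tens_ide' [simp]: "Ide T n \<odot> Ide T m = Ide T (n + m)"
  using tens_ide by simp

lemma sym_sym' [simp]: "Sym T m n \<cdot> Sym T n m = Ide T (n + m)"
  using sym_sym by simp

lemma sym_hex1: "Sym T x (y + z) = (Ide T y \<odot> Sym T x z) \<cdot> (Sym T x y \<odot> Ide T z)"
  using hexagon [of x y z] by (simp add: assoc_ide ac_simps)

lemma inverse_sym: "inverse_arrows T (Sym T n m) (Sym T m n)"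
  by (simp add: inverse_arrows_iff)

text \<open>The axioms contain one hexagon. Both sides here are inverse to
  \<open>Sym T z (x + y)\<close>, the right one by inverting the factorisation
  \<open>sym_hex1\<close>, so uniqueness of inverses gives the other hexagon.\<close>

lemma sym_hex2: "Sym T (x + y) z = (Sym T x z \<odot> Ide T y) \<cdot> (Ide T x \<odot> Sym T y z)"
proof (rule inverse_arrows_unique)
  show "inverse_arrows T (Sym T z (x + y)) (Sym T (x + y) z)" by (rule inverse_sym)
  show "inverse_arrows T (Sym T z (x + y)) ((Sym T x z \<odot> Ide T y) \<cdot> (Ide T x \<odot> Sym T y z))"
    unfolding sym_hex1
    by (intro inverse_arrows_comp inverse_arrows_tens inverse_sym inverse_arrows_ide) simp_all
qed

text \<open>The hexagon at \<open>y = z = 0\<close> makes \<open>Sym T n 0\<close> idempotent; being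
  invertible, it is the identity.\<close>

lemma sym_0 [simp]: "Sym T n 0 = Ide T n" "Sym T 0 n = Ide T n"
proof -
  have "Sym T n 0 = Sym T n 0 \<cdot> Sym T n 0" using sym_hex1 [of n 0 0] by simp
  then have "Sym T 0 n \<cdot> Sym T n 0 = Sym T 0 n \<cdot> (Sym T n 0 \<cdot> Sym T n 0)" by simp
  also have "\<dots> = (Sym T 0 n \<cdot> Sym T n 0) \<cdot> Sym T n 0" by (rule assoc_arr [symmetric]) simp_all
  finally show r: "Sym T n 0 = Ide T n" by simp
  have "Sym T 0 n \<cdot> Sym T n 0 = Ide T n" by simp
  then show "Sym T 0 n = Ide T n" by (simp add: r)
qed

lemma sym_nat1:
  "\<lbrakk>f \<in> Arr T; g \<in> Arr T; Cod T f = x; Cod T g = y; Dom T f = x'; Dom T g = y'\<rbrakk>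
    \<Longrightarrow> Sym T x y \<cdot> (f \<odot> g) = (g \<odot> f) \<cdot> Sym T x' y'"
  using sym_nat_arr [of f g] by auto

end

text \<open>In the strict case pentagon and triangle hold by identities, and the hexagon is one
  factorisation of the symmetry. What remains is the list below. It is checked for \<open>Q\<close>,
  for the composite, for opposites and for the endomorphism PROP.\<close>

lemma is_PROP_intro:
  fixes T :: "(nat, 'a, 'z) smc_scheme" (structure)
  assumes cat: "category T" and O: "Obj T = UNIV" and tO: "TensO T = (+)" and U: "Unit T = 0"
    and A: "\<And>n m k. Assoc T n m k = Ide T (n + m + k)"
    and L: "\<And>n. LUnit T n = Ide T n" and R: "\<And>n. RUnit T n = Ide T n"
    and th: "\<And>f g. \<lbrakk>f \<in> Arr T; g \<in> Arr T\<rbrakk>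
      \<Longrightarrow> f \<odot> g \<in> Hom T (Dom T f + Dom T g) (Cod T f + Cod T g)"
    and ti: "\<And>n m. Ide T n \<odot> Ide T m = Ide T (n + m)"
    and tc: "\<And>f f' g g'. \<lbrakk>f \<in> Arr T; f' \<in> Arr T; g \<in> Arr T; g' \<in> Arr T; Cod T f = Dom T f'; Cod T g = Dom T g'\<rbrakk>
      \<Longrightarrow> (f' \<cdot> f) \<odot> (g' \<cdot> g) = (f' \<odot> g') \<cdot> (f \<odot> g)"
    and ta: "\<And>f g h. \<lbrakk>f \<in> Arr T; g \<in> Arr T; h \<in> Arr T\<rbrakk> \<Longrightarrow> (f \<odot> g) \<odot> h = f \<odot> (g \<odot> h)"
    and tl: "\<And>f. f \<in> Arr T \<Longrightarrow> Ide T 0 \<odot> f = f"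
    and tr: "\<And>f. f \<in> Arr T \<Longrightarrow> f \<odot> Ide T 0 = f"
    and sh: "\<And>n m. Sym T n m \<in> Hom T (n + m) (m + n)"
    and sn: "\<And>f g. \<lbrakk>f \<in> Arr T; g \<in> Arr T\<rbrakk>
      \<Longrightarrow> Sym T (Cod T f) (Cod T g) \<cdot> (f \<odot> g) = (g \<odot> f) \<cdot> Sym T (Dom T f) (Dom T g)"
    and ss: "\<And>n m. Sym T m n \<cdot> Sym T n m = Ide T (n + m)"
    and hex: "\<And>x y z. Sym T x (y + z) = (Ide T y \<odot> Sym T x z) \<cdot> (Sym T x y \<odot> Ide T z)"
  shows "is_PROP T"
proof -
  interpret category T by (rule cat)
  have [simp]: "n \<in> Obj T" for n by (simp add: O)
  have iso: "is_iso T (Ide T n)" for n by (rule is_iso_ide) simp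
  have th1: "f \<odot> g \<in> Arr T" "Dom T (f \<odot> g) = Dom T f + Dom T g" "Cod T (f \<odot> g) = Cod T f + Cod T g"
    if "f \<in> Arr T" "g \<in> Arr T" for f g
    using th [OF that] by (simp_all add: Hom_def)
  have sh1: "Sym T n m \<in> Arr T" "Dom T (Sym T n m) = n + m" "Cod T (Sym T n m) = m + n" for n m
    using sh [of n m] by (simp_all add: Hom_def)
  have "symmetric_monoidal_category T"
  proof
    show "Sym T X' Y' \<cdot> (f \<odot> g) = (g \<odot> f) \<cdot> Sym T X Y" if "f \<in> Hom T X X'" "g \<in> Hom T Y Y'" for f X X' g Y Y'
      using that sn [of f g] by (auto simp: Hom_def)
  qed (auto simp: O tO U A L R Hom_def th1 ti tc ta tl tr ss sh1 iso hex ac_simps dest!: arg_cong [of _ _ "Dom T"])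
  then interpret symmetric_monoidal_category T .
  show ?thesis
    by unfold_locales (simp_all add: O tO U A L R ac_simps)
qed

section \<open>The composite along a distributive law\<close>

context category
begin

section \<open>Equivalence of spans and of cospans under isomorphisms of the middle object\<close>

lemma span_rel_iff:
  "((a, b), (a', b')) \<in> span_rel C \<longleftrightarrow> (a, b) \<in> spans C \<and> (a', b') \<in> spans C \<and>
     (\<exists>h. is_iso C h \<and> Dom C h = Dom C a \<and> Cod C h = Dom C a' \<and> a = a' \<cdot> h \<and> b = b' \<cdot> h)"
  by (simp add: span_rel_def)

lemma span_rel_spans: "((a, b), (a', b')) \<in> span_rel C \<Longrightarrow> (a, b) \<in> spans C \<and> (a', b') \<in> spans C"
  by (simp add: span_rel_def)

lemma spans_iff: "(a, b) \<in> spans C \<longleftrightarrow> a \<in> Arr C \<and> b \<in> Arr C \<and> Dom C a = Dom C b"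
  by (simp add: spans_def)

lemma cospans_iff: "(a, b) \<in> cospans C \<longleftrightarrow> a \<in> Arr C \<and> b \<in> Arr C \<and> Cod C a = Cod C b"
  by (simp add: cospans_def)

lemma inv_cancel:
  assumes "inverse_arrows C h k" "a \<in> Arr C"
  shows "Dom C a = Dom C h \<Longrightarrow> (a \<cdot> k) \<cdot> h = a" "Dom C a = Cod C h \<Longrightarrow> (a \<cdot> h) \<cdot> k = a"
    "Cod C a = Dom C h \<Longrightarrow> k \<cdot> (h \<cdot> a) = a" "Cod C a = Cod C h \<Longrightarrow> h \<cdot> (k \<cdot> a) = a"
  using assms by (simp_all add: inverse_arrows_iff assoc_arr [symmetric]) (simp_all add: inverse_arrows_iff assoc_arr)

lemma equiv_span_rel: "equiv (spans C) (span_rel C)"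
proof (rule equivI)
  show "span_rel C \<subseteq> spans C \<times> spans C" by (auto simp: span_rel_def)
  show "refl_on (spans C) (span_rel C)"
  proof (rule refl_onI)
    fix s assume s: "s \<in> spans C"
    obtain a b where ab: "s = (a, b)" by (cases s)
    have "is_iso C (Ide C (Dom C a))" using s ab by (intro is_iso_ide) (auto simp: spans_iff dom_obj)
    then show "(s, s) \<in> span_rel C" using s unfolding ab span_rel_iff
      by (intro conjI exI [of _ "Ide C (Dom C a)"]) (auto simp: spans_iff dom_obj)
  qed
  show "sym (span_rel C)"
  proof (rule symI)
    fix s t assume st: "(s, t) \<in> span_rel C"
    obtain a b a' b' where e: "s = (a, b)" "t = (a', b')" by (cases s, cases t)
    obtain h where h: "is_iso C h" "Dom C h = Dom C a" "Cod C h = Dom C a'" "a = a' \<cdot> h" "b = b' \<cdot> h"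
      and sp: "(a, b) \<in> spans C" "(a', b') \<in> spans C" using st unfolding e span_rel_iff by blast
    obtain k where k: "inverse_arrows C h k" using h(1) by (auto simp: is_iso_def)
    then have "is_iso C k" "Dom C k = Dom C a'" "Cod C k = Dom C a"
      using inverse_arrows_sym is_isoI h by (blast, simp_all add: inverse_arrows_iff)
    moreover have "a' = a \<cdot> k" "b' = b \<cdot> k"
      using inv_cancel(2) [OF k, of a'] inv_cancel(2) [OF k, of b'] h sp by (simp_all add: spans_iff)
    ultimately show "(t, s) \<in> span_rel C" using sp unfolding e span_rel_iff by blast
  qed
  show "trans (span_rel C)"
  proof (rule transI)
    fix s t u assume st: "(s, t) \<in> span_rel C" and tu: "(t, u) \<in> span_rel C"
    obtain a b a' b' a'' b'' where e: "s = (a, b)" "t = (a', b')" "u = (a'', b'')" by (cases s, cases t, cases u)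
    obtain h where h: "is_iso C h" "Dom C h = Dom C a" "Cod C h = Dom C a'" "a = a' \<cdot> h" "b = b' \<cdot> h"
      and sp: "(a, b) \<in> spans C" "(a', b') \<in> spans C" using st unfolding e span_rel_iff by blast
    obtain k where k: "is_iso C k" "Dom C k = Dom C a'" "Cod C k = Dom C a''" "a' = a'' \<cdot> k" "b' = b'' \<cdot> k"
      and sp2: "(a'', b'') \<in> spans C" using tu unfolding e span_rel_iff by blast
    have "is_iso C (k \<cdot> h)" using h k by (intro is_iso_comp) auto
    moreover have "Dom C (k \<cdot> h) = Dom C a" "Cod C (k \<cdot> h) = Dom C a''"
      using h(1-3) k(1-3) by (simp_all add: is_iso_arr)
    moreover have "(a'' \<cdot> k) \<cdot> h = a'' \<cdot> (k \<cdot> h)" "(b'' \<cdot> k) \<cdot> h = b'' \<cdot> (k \<cdot> h)"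
      by (rule assoc_arr; use sp2 is_iso_arr [OF h(1)] is_iso_arr [OF k(1)] h(3) k(2,3) in \<open>simp add: spans_iff\<close>)+
    then have "a = a'' \<cdot> (k \<cdot> h)" "b = b'' \<cdot> (k \<cdot> h)"
      using h(4,5) k(4,5) by simp_all
    ultimately show "(s, u) \<in> span_rel C" unfolding e span_rel_iff
      by - (intro conjI exI [of _ "k \<cdot> h"]; (assumption | rule sp sp2))
  qed
qed

lemma equiv_cospan_rel: "equiv (cospans C) (cospan_rel C)"
proof (rule equivI)
  show "cospan_rel C \<subseteq> cospans C \<times> cospans C" by (auto simp: cospan_rel_def)
  show "refl_on (cospans C) (cospan_rel C)"
  proof (rule refl_onI)
    fix s assume s: "s \<in> cospans C"
    obtain a b where ab: "s = (a, b)" by (cases s)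
    have "is_iso C (Ide C (Cod C a))" using s ab by (intro is_iso_ide) (auto simp: cospans_iff cod_obj)
    moreover have "a = Ide C (Cod C a) \<cdot> a" "b = Ide C (Cod C a) \<cdot> b" "Dom C (Ide C (Cod C a)) = Cod C a"
      "Cod C (Ide C (Cod C a)) = Cod C a" using s ab by (auto simp: cospans_iff cod_obj)
    ultimately show "(s, s) \<in> cospan_rel C" using s unfolding ab cospan_rel_def by blast
  qed
  show "sym (cospan_rel C)"
  proof (rule symI)
    fix s t assume st: "(s, t) \<in> cospan_rel C"
    obtain a b a' b' where e: "s = (a, b)" "t = (a', b')" by (cases s, cases t)
    obtain h where h: "is_iso C h" "Dom C h = Cod C a" "Cod C h = Cod C a'" "a' = h \<cdot> a" "b' = h \<cdot> b"
      and sp: "(a, b) \<in> cospans C" "(a', b') \<in> cospans C" using st unfolding e cospan_rel_def by blast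
    obtain k where k: "inverse_arrows C h k" using h(1) by (auto simp: is_iso_def)
    then have "is_iso C k" "Dom C k = Cod C a'" "Cod C k = Cod C a"
      using inverse_arrows_sym is_isoI h by (blast, simp_all add: inverse_arrows_iff)
    moreover have "a = k \<cdot> a'" "b = k \<cdot> b'"
      using inv_cancel(3) [OF k, of a] inv_cancel(3) [OF k, of b] h sp by (simp_all add: cospans_iff)
    ultimately show "(t, s) \<in> cospan_rel C" using sp unfolding e cospan_rel_def by blast
  qed
  show "trans (cospan_rel C)"
  proof (rule transI)
    fix s t u assume st: "(s, t) \<in> cospan_rel C" and tu: "(t, u) \<in> cospan_rel C"
    obtain a b a' b' a'' b'' where e: "s = (a, b)" "t = (a', b')" "u = (a'', b'')" by (cases s, cases t, cases u)
    obtain h where h: "is_iso C h" "Dom C h = Cod C a" "Cod C h = Cod C a'" "a' = h \<cdot> a" "b' = h \<cdot> b"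
      and sp: "(a, b) \<in> cospans C" "(a', b') \<in> cospans C" using st unfolding e cospan_rel_def by blast
    obtain k where k: "is_iso C k" "Dom C k = Cod C a'" "Cod C k = Cod C a''" "a'' = k \<cdot> a'" "b'' = k \<cdot> b'"
      and sp2: "(a'', b'') \<in> cospans C" using tu unfolding e cospan_rel_def by blast
    have "is_iso C (k \<cdot> h)" using h k by (intro is_iso_comp) auto
    moreover have "Dom C (k \<cdot> h) = Cod C a" "Cod C (k \<cdot> h) = Cod C a''"
      using h(1-3) k(1-3) by (simp_all add: is_iso_arr)
    moreover have "(k \<cdot> h) \<cdot> a = k \<cdot> (h \<cdot> a)" "(k \<cdot> h) \<cdot> b = k \<cdot> (h \<cdot> b)"
      by (rule assoc_arr; use sp is_iso_arr [OF h(1)] is_iso_arr [OF k(1)] h(2,3) k(2) in \<open>simp add: cospans_iff\<close>)+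
    then have "a'' = (k \<cdot> h) \<cdot> a" "b'' = (k \<cdot> h) \<cdot> b"
      using h(4,5) k(4,5) by simp_all
    ultimately have "(a, b) \<in> cospans C \<and> (a'', b'') \<in> cospans C \<and>
        (\<exists>h. is_iso C h \<and> Dom C h = Cod C a \<and> Cod C h = Cod C a'' \<and> a'' = h \<cdot> a \<and> b'' = h \<cdot> b)"
      by - (intro conjI exI [of _ "k \<cdot> h"]; (assumption | rule sp sp2))
    then show "(s, u) \<in> cospan_rel C" unfolding e cospan_rel_def by blast
  qed
qed

lemma span_class_eq_iff:
  assumes "(a, b) \<in> spans C" "(a', b') \<in> spans C"
  shows "span_class C a b = span_class C a' b' \<longleftrightarrow> ((a, b), (a', b')) \<in> span_rel C"
  using eq_equiv_class_iff [OF equiv_span_rel assms] .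

lemma span_class_eqI:
  assumes "is_iso C h" "(a', b') \<in> spans C" "Cod C h = Dom C a'" "a = a' \<cdot> h" "b = b' \<cdot> h"
  shows "span_class C a b = span_class C a' b'"
proof -
  have "(a, b) \<in> spans C" using assms is_iso_arr [OF assms(1)] by (auto simp: spans_iff)
  moreover have "((a, b), (a', b')) \<in> span_rel C"
    unfolding span_rel_iff using calculation assms is_iso_arr [OF assms(1)]
    by (intro conjI exI [of _ h]) (auto simp: spans_iff)
  ultimately show ?thesis using span_class_eq_iff assms(2) by blast
qed

lemma span_class_self: "(a, b) \<in> spans C \<Longrightarrow> (a, b) \<in> span_class C a b"
  using equiv_class_self [OF equiv_span_rel] .

lemma span_class_cod:
  assumes "(a', b') \<in> span_class C a b"
  shows "Cod C a' = Cod C a" "Cod C b' = Cod C b"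
proof -
  obtain h where "is_iso C h" "Cod C h = Dom C a'" "a = a' \<cdot> h" "b = b' \<cdot> h" "(a', b') \<in> spans C"
    using assms by (auto simp: span_rel_iff)
  then show "Cod C a' = Cod C a" "Cod C b' = Cod C b"
    using is_iso_arr [of h] by (simp_all add: spans_iff)
qed

lemma span_class_some:
  assumes "(a, b) \<in> spans C"
  shows "Cod C (fst (SOME s. s \<in> span_class C a b)) = Cod C a"
    "Cod C (snd (SOME s. s \<in> span_class C a b)) = Cod C b"
proof -
  have "(SOME s. s \<in> span_class C a b) \<in> span_class C a b"
    using span_class_self [OF assms] by (rule someI)
  then show "Cod C (fst (SOME s. s \<in> span_class C a b)) = Cod C a"
    "Cod C (snd (SOME s. s \<in> span_class C a b)) = Cod C b"
    using span_class_cod by (metis prod.collapse)+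
qed

lemma spans_quotientE:
  assumes "X \<in> spans C // span_rel C"
  obtains a b where "(a, b) \<in> spans C" "X = span_class C a b"
  using assms by (metis quotientE surj_pair)

end

section \<open>A distributive law as a relation, and the operations of the composite on
  representatives\<close>

context distributive_law
begin

text \<open>\<open>\<Lambda>\<close> maps classes to classes; \<open>L b c x y\<close> says that the
  span \<open>x\<close>, \<open>y\<close> represents its value at the cospan \<open>b\<close>,
  \<open>c\<close>. In this form the axioms of a law are closure rules that can be chained on
  representatives.\<close>

definition L :: "'a \<Rightarrow> 'a \<Rightarrow> 'a \<Rightarrow> 'a \<Rightarrow> bool" where
  "L b c x y \<longleftrightarrow> (b, c) \<in> cospans C \<and> (x, y) \<in> \<Lambda> (cospan_class C b c)"

lemma law_class:
  assumes "(b, c) \<in> cospans C"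
  obtains x y where "(x, y) \<in> spans C" "\<Lambda> (cospan_class C b c) = span_class C x y" "L b c x y"
proof -
  have "\<Lambda> (cospan_class C b c) \<in> spans C // span_rel C"
    using law_fun assms by (auto intro: quotientI)
  then obtain x y where "(x, y) \<in> spans C" "\<Lambda> (cospan_class C b c) = span_class C x y"
    by (rule spans_quotientE)
  with span_class_self assms show thesis by (intro that [of x y]) (auto simp: L_def)
qed

text \<open>The value of the law at a cospan is one whole class of spans, so any two of its members
  are related; \<open>L_span_rel\<close> is the converse.\<close>

lemma L_unique: "L b c x y \<Longrightarrow> L b c x' y' \<Longrightarrow> ((x, y), (x', y')) \<in> span_rel C"
  using law_class [of b c] equiv_span_rel unfolding L_def
  by (metis Image_singleton_iff equivE symE transE)

lemma L_span_rel: "L b c x y \<Longrightarrow> ((x, y), (x', y')) \<in> span_rel C \<Longrightarrow> L b c x' y'"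
  using law_class [of b c] equiv_span_rel unfolding L_def
  by (metis Image_singleton_iff equivE transE)

lemma L_span:
  assumes "L b c x y"
  shows "b \<in> Arr C" "c \<in> Arr C" "Cod C b = Cod C c" "x \<in> Arr C" "y \<in> Arr C" "Dom C x = Dom C y"
    "Cod C x = Dom C b" "Cod C y = Dom C c"
proof -
  show "b \<in> Arr C" "c \<in> Arr C" "Cod C b = Cod C c" "Cod C x = Dom C b" "Cod C y = Dom C c"
    using assms law_ends [of b c x y] by (simp_all add: L_def cospans_iff)
  have "((x, y), (x, y)) \<in> span_rel C" using L_unique [OF assms assms] .
  then show "x \<in> Arr C" "y \<in> Arr C" "Dom C x = Dom C y" using span_rel_spans by (auto simp: spans_iff)
qed

lemma L_ide_right: "f \<in> Arr C \<Longrightarrow> L f (Ide C (Cod C f)) (Ide C (Dom C f)) f"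
  using law_ide_right [of f "Dom C f" "Cod C f"] span_class_self [of "Ide C (Dom C f)" f]
  by (auto simp: L_def cospans_iff spans_iff Hom_iff cod_obj dom_obj)

lemma L_ide_left: "f \<in> Arr C \<Longrightarrow> L (Ide C (Cod C f)) f f (Ide C (Dom C f))"
  using law_ide_left [of f "Dom C f" "Cod C f"] span_class_self [of f "Ide C (Dom C f)"]
  by (auto simp: L_def cospans_iff spans_iff Hom_iff cod_obj dom_obj)

lemma L_iso:
  assumes l: "L b c x y" and i: "inverse_arrows C g g'" "inverse_arrows C h h'"
    and e: "Cod C g = Dom C b" "Cod C h = Dom C c"
  shows "L (b \<cdot> g) (c \<cdot> h) (g' \<cdot> x) (h' \<cdot> y)"
proof -
  have "(g' \<cdot> x, h' \<cdot> y) \<in> \<Lambda> (cospan_class C (b \<cdot> g) (c \<cdot> h))"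
    by (rule law_iso [OF _ _ i e]) (use l in \<open>simp_all add: L_def\<close>)
  then show ?thesis using L_span [OF l] i e unfolding L_def by (simp add: cospans_iff inverse_arrows_iff)
qed

lemma L_comp_left:
  assumes l: "L b c x y" and l': "L f x z w"
  shows "L (b \<cdot> f) c z (y \<cdot> w)"
proof -
  note s = L_span [OF l] and s' = L_span [OF l']
  have "(z, y \<cdot> w) \<in> \<Lambda> (cospan_class C (b \<cdot> f) c)"
    by (rule law_comp_left [of b c f x y z w]) (use l l' s s' in \<open>simp_all add: L_def\<close>)
  then show ?thesis using s s' unfolding L_def by (simp add: cospans_iff)
qed

lemma L_comp_right:
  assumes l: "L b c x y" and l': "L y h z w"
  shows "L b (c \<cdot> h) (x \<cdot> z) w"
proof -
  note s = L_span [OF l] and s' = L_span [OF l']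
  have "(x \<cdot> z, w) \<in> \<Lambda> (cospan_class C b (c \<cdot> h))"
    by (rule law_comp_right [of b c h x y z w]) (use l l' s s' in \<open>simp_all add: L_def\<close>)
  then show ?thesis using s s' unfolding L_def by (simp add: cospans_iff)
qed

lemma L_tens:
  assumes l: "L b c x y" and l': "L b' c' x' y'"
  shows "L (b \<odot> b') (c \<odot> c') (x \<odot> x') (y \<odot> y')"
proof -
  note s = L_span [OF l] and s' = L_span [OF l']
  have "(x \<odot> x', y \<odot> y') \<in> \<Lambda> (cospan_class C (b \<odot> b') (c \<odot> c'))"
    by (rule law_tens) (use l l' in \<open>simp_all add: L_def\<close>)
  then show ?thesis using s s' unfolding L_def by (simp add: cospans_iff)
qed

lemma composite_simps [simp]:
  "Obj (composite C \<Lambda>) = Obj C" "Arr (composite C \<Lambda>) = spans C // span_rel C"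
  "Ide (composite C \<Lambda>) = (\<lambda>n. span_class C (Ide C n) (Ide C n))"
  "TensO (composite C \<Lambda>) = TensO C" "Unit (composite C \<Lambda>) = Unit C"
  "Assoc (composite C \<Lambda>) n m k = span_embed C (Assoc C n m k)"
  "LUnit (composite C \<Lambda>) n = span_embed C (LUnit C n)"
  "RUnit (composite C \<Lambda>) n = span_embed C (RUnit C n)"
  "Sym (composite C \<Lambda>) n m = span_embed C (Sym C n m)"
  by (simp_all add: composite_def)

lemma span_class_in [simp]: "(a, b) \<in> spans C \<Longrightarrow> span_class C a b \<in> spans C // span_rel C"
  by (rule quotientI)

lemma composite_dom [simp]:
  assumes "(a, b) \<in> spans C"
  shows "Dom (composite C \<Lambda>) (span_class C a b) = Cod C a" "Cod (composite C \<Lambda>) (span_class C a b) = Cod C b"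
  using span_class_some [OF assms] by (simp_all add: composite_def)

text \<open>\<open>Comp\<close> is a union over all representatives of both spans and of the
  exchanged cospan. Replacing the two middle objects changes the inner cospan by isomorphisms, so
  \<open>L_iso\<close> and the uniqueness of the value up to \<open>span_rel\<close> show that all
  members of the union are the same class.\<close>

lemma composite_comp:
  assumes s: "(a, b) \<in> spans C" "(c, d) \<in> spans C" and l: "L b c x y"
  shows "span_class C c d \<cdot>\<^bsub>composite C \<Lambda>\<^esub> span_class C a b = span_class C (a \<cdot> x) (d \<cdot> y)"
proof -
  note ls = L_span [OF l]
  have sp: "(a \<cdot> x, d \<cdot> y) \<in> spans C" using s ls by (simp add: spans_iff)
  have eq: "span_class C (a' \<cdot> x') (d' \<cdot> y') = span_class C (a \<cdot> x) (d \<cdot> y)"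
    if ab: "(a', b') \<in> span_class C a b" and cd: "(c', d') \<in> span_class C c d"
      and xy: "(x', y') \<in> \<Lambda> (cospan_class C b' c')" for a' b' c' d' x' y'
  proof -
    obtain h where h: "is_iso C h" "Dom C h = Dom C a" "Cod C h = Dom C a'" "a = a' \<cdot> h" "b = b' \<cdot> h"
      and s1: "(a', b') \<in> spans C" using ab by (auto simp: span_rel_iff)
    obtain k where k: "is_iso C k" "Dom C k = Dom C c" "Cod C k = Dom C c'" "c = c' \<cdot> k" "d = d' \<cdot> k"
      and s2: "(c', d') \<in> spans C" using cd by (auto simp: span_rel_iff)
    obtain h' k' where i: "inverse_arrows C h h'" "inverse_arrows C k k'" using h(1) k(1) by (auto simp: is_iso_def)
    note ha = is_iso_arr [OF h(1)] and ka = is_iso_arr [OF k(1)]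
    have "L (b \<cdot> h') (c \<cdot> k') (h \<cdot> x) (k \<cdot> y)"
      by (rule L_iso [OF l inverse_arrows_sym [OF i(1)] inverse_arrows_sym [OF i(2)]])
        (use s i h(2) k(2) ls in \<open>auto simp: inverse_arrows_iff spans_iff\<close>)
    moreover have "b \<cdot> h' = b'" "c \<cdot> k' = c'"
      using inv_cancel(2) [OF i(1), of b'] inv_cancel(2) [OF i(2), of c'] s1 s2 h(3) k(3)
      by (simp_all add: spans_iff h(5) k(4))
    \<comment> \<open>The span exchanged for the new inner cospan is the old one transported along
      \<open>h\<close> and \<open>k\<close>; the isomorphism \<open>t\<close> below compares it with
      the given \<open>x'\<close>, \<open>y'\<close>.\<close>
    ultimately have l': "L b' c' (h \<cdot> x) (k \<cdot> y)" by simp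
    then have "L b' c' x' y'" using xy by (auto simp: L_def)
    from L_unique [OF l' this] obtain t where t: "is_iso C t" "Dom C t = Dom C (h \<cdot> x)" "Cod C t = Dom C x'"
        "h \<cdot> x = x' \<cdot> t" "k \<cdot> y = y' \<cdot> t" by (auto simp: span_rel_iff)
    note l2 = L_span [OF \<open>L b' c' x' y'\<close>] and ta = is_iso_arr [OF t(1)]
    have "span_class C (a \<cdot> x) (d \<cdot> y) = span_class C (a' \<cdot> x') (d' \<cdot> y')"
    proof (rule span_class_eqI [OF t(1)])
      show "(a' \<cdot> x', d' \<cdot> y') \<in> spans C" using s1 s2 l2 by (simp add: spans_iff)
      show "Cod C t = Dom C (a' \<cdot> x')" using t l2 s1 by (simp add: spans_iff)
      show "a \<cdot> x = a' \<cdot> x' \<cdot> t"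
      proof -
        have "a \<cdot> x = a' \<cdot> (h \<cdot> x)" unfolding h(4) using s1 s ha h(2,3) ls by (intro assoc_arr) (auto simp: spans_iff)
        also have "\<dots> = a' \<cdot> x' \<cdot> t" unfolding t(4) using s1 l2 t(3) ta by (intro assoc_arr [symmetric]) (auto simp: spans_iff)
        finally show ?thesis .
      qed
      show "d \<cdot> y = d' \<cdot> y' \<cdot> t"
      proof -
        have "d \<cdot> y = d' \<cdot> (k \<cdot> y)" unfolding k(5) using s2 s ka k(2,3) ls by (intro assoc_arr) (auto simp: spans_iff)
        also have "\<dots> = d' \<cdot> y' \<cdot> t" unfolding t(5) using s2 l2 t(3) ta by (intro assoc_arr [symmetric]) (auto simp: spans_iff)
        finally show ?thesis .
      qed
    qed
    then show ?thesis by simp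
  qed
  have mem: "(a, b) \<in> span_class C a b" "(c, d) \<in> span_class C c d" "(x, y) \<in> \<Lambda> (cospan_class C b c)"
    using s l span_class_self by (auto simp: L_def)
  have "span_class C c d \<cdot>\<^bsub>composite C \<Lambda>\<^esub> span_class C a b = (\<Union>(a, b)\<in>span_class C a b. \<Union>(c, d)\<in>span_class C c d.
      \<Union>(x, y)\<in>\<Lambda> (cospan_class C b c). span_class C (a \<cdot> x) (d \<cdot> y))"
    by (simp add: composite_def)
  also have "\<dots> = span_class C (a \<cdot> x) (d \<cdot> y)"
  proof (intro equalityI subsetI)
    fix s assume "s \<in> (\<Union>(a, b)\<in>span_class C a b. \<Union>(c, d)\<in>span_class C c d.
      \<Union>(x, y)\<in>\<Lambda> (cospan_class C b c). span_class C (a \<cdot> x) (d \<cdot> y))"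
    then obtain a' b' c' d' x' y' where "(a', b') \<in> span_class C a b" "(c', d') \<in> span_class C c d"
      "(x', y') \<in> \<Lambda> (cospan_class C b' c')" "s \<in> span_class C (a' \<cdot> x') (d' \<cdot> y')"
      by blast
    then show "s \<in> span_class C (a \<cdot> x) (d \<cdot> y)" using eq by metis
  next
    fix s assume "s \<in> span_class C (a \<cdot> x) (d \<cdot> y)"
    with mem show "s \<in> (\<Union>(a, b)\<in>span_class C a b. \<Union>(c, d)\<in>span_class C c d.
      \<Union>(x, y)\<in>\<Lambda> (cospan_class C b c). span_class C (a \<cdot> x) (d \<cdot> y))" by blast
  qed
  finally show ?thesis .
qed

text \<open>As for composition, the union is a single class: the tensor product of the two
  isomorphisms of middle objects relates any two choices of representatives.\<close>

lemma composite_tens: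
  assumes s: "(a, b) \<in> spans C" "(c, d) \<in> spans C"
  shows "span_class C a b \<odot>\<^bsub>composite C \<Lambda>\<^esub> span_class C c d = span_class C (a \<odot> c) (b \<odot> d)"
proof -
  have eq: "span_class C (a' \<odot> c') (b' \<odot> d') = span_class C (a \<odot> c) (b \<odot> d)"
    if ab: "(a', b') \<in> span_class C a b" and cd: "(c', d') \<in> span_class C c d" for a' b' c' d'
  proof -
    obtain h where h: "is_iso C h" "Dom C h = Dom C a" "Cod C h = Dom C a'" "a = a' \<cdot> h" "b = b' \<cdot> h"
      and s1: "(a', b') \<in> spans C" using ab by (auto simp: span_rel_iff)
    obtain k where k: "is_iso C k" "Dom C k = Dom C c" "Cod C k = Dom C c'" "c = c' \<cdot> k" "d = d' \<cdot> k"
      and s2: "(c', d') \<in> spans C" using cd by (auto simp: span_rel_iff)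
    note ha = is_iso_arr [OF h(1)] and ka = is_iso_arr [OF k(1)]
    have "is_iso C (h \<odot> k)" using h(1) k(1) inverse_arrows_tens unfolding is_iso_def by blast
    then have "span_class C (a \<odot> c) (b \<odot> d) = span_class C (a' \<odot> c') (b' \<odot> d')"
      by (rule span_class_eqI)
        (use s1 s2 ha ka h(3) k(3) in \<open>simp_all add: spans_iff h(4,5) k(4,5) interchange\<close>)
    then show ?thesis by simp
  qed
  have mem: "(a, b) \<in> span_class C a b" "(c, d) \<in> span_class C c d"
    using s span_class_self by auto
  have "span_class C a b \<odot>\<^bsub>composite C \<Lambda>\<^esub> span_class C c d =
      (\<Union>(a, b)\<in>span_class C a b. \<Union>(c, d)\<in>span_class C c d. span_class C (a \<odot> c) (b \<odot> d))"
    by (simp add: composite_def)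
  also have "\<dots> = span_class C (a \<odot> c) (b \<odot> d)"
  proof (intro equalityI subsetI)
    fix s assume "s \<in> (\<Union>(a, b)\<in>span_class C a b. \<Union>(c, d)\<in>span_class C c d. span_class C (a \<odot> c) (b \<odot> d))"
    then obtain a' b' c' d' where "(a', b') \<in> span_class C a b" "(c', d') \<in> span_class C c d"
      "s \<in> span_class C (a' \<odot> c') (b' \<odot> d')" by blast
    then show "s \<in> span_class C (a \<odot> c) (b \<odot> d)" using eq by metis
  next
    fix s assume "s \<in> span_class C (a \<odot> c) (b \<odot> d)"
    with mem show "s \<in> (\<Union>(a, b)\<in>span_class C a b. \<Union>(c, d)\<in>span_class C c d. span_class C (a \<odot> c) (b \<odot> d))" by blast
  qed
  finally show ?thesis .
qed

text \<open>The backward counterpart of \<open>span_embed\<close>: together they are the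
  contravariant and the covariant copy of \<open>C\<close> inside the composite.\<close>

definition coembed :: "'a \<Rightarrow> ('a \<times> 'a) set" where
  "coembed f = span_class C f (Ide C (Dom C f))"

text \<open>The inner cospan has an identity leg, so the unit axioms of the law compute the
  composite.\<close>

lemma comp_embed:
  assumes s: "(a, b) \<in> spans C" and f: "f \<in> Arr C" "Dom C f = Cod C b"
  shows "span_embed C f \<cdot>\<^bsub>composite C \<Lambda>\<^esub> span_class C a b = span_class C a (f \<cdot> b)"
proof -
  have s': "a \<in> Arr C" "b \<in> Arr C" "Dom C a = Dom C b" using s by (simp_all add: spans_iff)
  have l: "L b (Ide C (Dom C f)) (Ide C (Dom C b)) b" using L_ide_right [OF s'(2)] f by simp
  have sp: "(Ide C (Dom C f), f) \<in> spans C" using f(1) by (simp add: spans_iff dom_obj)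
  show ?thesis using composite_comp [OF s sp l] s' by (simp add: span_embed_def)
qed

lemma coembed_comp:
  assumes s: "(c, d) \<in> spans C" and f: "f \<in> Arr C" "Dom C f = Cod C c"
  shows "span_class C c d \<cdot>\<^bsub>composite C \<Lambda>\<^esub> coembed f = span_class C (f \<cdot> c) d"
proof -
  have s': "c \<in> Arr C" "d \<in> Arr C" "Dom C c = Dom C d" using s by (simp_all add: spans_iff)
  have l: "L (Ide C (Dom C f)) c c (Ide C (Dom C c))" using L_ide_left [OF s'(1)] f by simp
  have sp: "(f, Ide C (Dom C f)) \<in> spans C" using f(1) by (simp add: spans_iff dom_obj)
  show ?thesis using composite_comp [OF sp s l] s' by (simp add: coembed_def)
qed

text \<open>Every span is its left leg taken backwards, followed by its right leg. Hence the two
  copies generate the composite, and a functor on it is known from its values on both.\<close>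

lemma embed_coembed:
  assumes s: "(a, b) \<in> spans C"
  shows "span_embed C b \<cdot>\<^bsub>composite C \<Lambda>\<^esub> coembed a = span_class C a b"
proof -
  have s': "a \<in> Arr C" "b \<in> Arr C" "Dom C a = Dom C b" using s by (simp_all add: spans_iff)
  have sp: "(a, Ide C (Dom C b)) \<in> spans C" using s' by (simp add: spans_iff dom_obj)
  show ?thesis using comp_embed [OF sp s'(2)] s' by (simp add: coembed_def dom_obj)
qed

text \<open>The law as an equation inside the composite: a forward arrow followed by a backward one
  is rewritten so that the backward arrow comes in front.\<close>

lemma coembed_embed:
  assumes l: "L b c x y"
  shows "coembed c \<cdot>\<^bsub>composite C \<Lambda>\<^esub> span_embed C b = span_embed C y \<cdot>\<^bsub>composite C \<Lambda>\<^esub> coembed x"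
proof -
  note ls = L_span [OF l]
  have s: "(Ide C (Dom C b), b) \<in> spans C" "(c, Ide C (Dom C c)) \<in> spans C" "(x, y) \<in> spans C"
    using ls by (simp_all add: spans_iff dom_obj)
  show ?thesis unfolding embed_coembed [OF s(3)]
    using composite_comp [OF s(1,2) l] ls by (simp add: coembed_def span_embed_def)
qed

lemma embed_in [simp]: "f \<in> Arr C \<Longrightarrow> span_embed C f \<in> spans C // span_rel C"
  and embed_dom [simp]: "f \<in> Arr C \<Longrightarrow> Dom (composite C \<Lambda>) (span_embed C f) = Dom C f"
    "f \<in> Arr C \<Longrightarrow> Cod (composite C \<Lambda>) (span_embed C f) = Cod C f"
  and coembed_in [simp]: "f \<in> Arr C \<Longrightarrow> coembed f \<in> spans C // span_rel C"
  and coembed_dom [simp]: "f \<in> Arr C \<Longrightarrow> Dom (composite C \<Lambda>) (coembed f) = Cod C f"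
    "f \<in> Arr C \<Longrightarrow> Cod (composite C \<Lambda>) (coembed f) = Dom C f"
  by (simp_all add: span_embed_def coembed_def spans_iff dom_obj)

lemma embed_comp:
  "\<lbrakk>f \<in> Arr C; g \<in> Arr C; Cod C f = Dom C g\<rbrakk>
    \<Longrightarrow> span_embed C (g \<cdot> f) = span_embed C g \<cdot>\<^bsub>composite C \<Lambda>\<^esub> span_embed C f"
  using comp_embed [of "Ide C (Dom C f)" f g] by (simp add: span_embed_def spans_iff dom_obj)

lemma coembed_comp':
  "\<lbrakk>f \<in> Arr C; g \<in> Arr C; Cod C f = Dom C g\<rbrakk>
    \<Longrightarrow> coembed (g \<cdot> f) = coembed f \<cdot>\<^bsub>composite C \<Lambda>\<^esub> coembed g"
  using coembed_comp [of f "Ide C (Dom C f)" g] by (simp add: coembed_def spans_iff dom_obj)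

lemma embed_tens:
  "\<lbrakk>f \<in> Arr C; g \<in> Arr C\<rbrakk>
    \<Longrightarrow> span_embed C (f \<odot> g) = span_embed C f \<odot>\<^bsub>composite C \<Lambda>\<^esub> span_embed C g"
  by (simp add: span_embed_def spans_iff dom_obj composite_tens tens_ide)

lemma coembed_tens:
  "\<lbrakk>f \<in> Arr C; g \<in> Arr C\<rbrakk>
    \<Longrightarrow> coembed (f \<odot> g) = coembed f \<odot>\<^bsub>composite C \<Lambda>\<^esub> coembed g"
  by (simp add: coembed_def spans_iff dom_obj composite_tens tens_ide)

text \<open>The isomorphism \<open>h\<close> of middle objects carries the span of \<open>h\<close>
  and an identity to the span of an identity and \<open>k\<close>. Backward symmetries and labels
  are thus forward ones.\<close>

lemma coembed_iso:
  assumes i: "inverse_arrows C h k"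
  shows "coembed h = span_embed C k"
  unfolding coembed_def span_embed_def
  by (rule span_class_eqI [of h]) (use i is_isoI [OF i] in \<open>auto simp: inverse_arrows_iff spans_iff dom_obj cod_obj\<close>)

end

section \<open>The composite along a law is again a PROP\<close>

locale PROP_law = is_PROP C + distributive_law C \<Lambda>
  for C :: "(nat, 'b, 'z) smc_scheme" (structure) and \<Lambda>
begin

lemma composite_category: "category (composite C \<Lambda>)"
proof
  let ?T = "composite C \<Lambda>"
  show "Dom ?T f \<in> Obj ?T" "Cod ?T f \<in> Obj ?T" if "f \<in> Arr ?T" for f by simp_all
  show "Ide ?T X \<in> Hom ?T X X" for X by (simp add: Hom_iff spans_iff)
  show "g \<cdot>\<^bsub>?T\<^esub> f \<in> Hom ?T X Z" if f: "f \<in> Hom ?T X Y" and g: "g \<in> Hom ?T Y Z" for f g X Y Z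
  proof -
    obtain a b where ab: "(a, b) \<in> spans C" "f = span_class C a b"
      using f by (auto simp: Hom_iff elim: spans_quotientE)
    obtain c d where cd: "(c, d) \<in> spans C" "g = span_class C c d"
      using g by (auto simp: Hom_iff elim: spans_quotientE)
    have "(b, c) \<in> cospans C" using f g ab cd by (auto simp: Hom_iff cospans_iff spans_iff)
    then obtain x y where l: "L b c x y" by (rule law_class)
    then show ?thesis using composite_comp [OF ab(1) cd(1) l] f g ab cd L_span [OF l]
      by (auto simp: Hom_iff spans_iff)
  qed
  show "h \<cdot>\<^bsub>?T\<^esub> g \<cdot>\<^bsub>?T\<^esub> f = h \<cdot>\<^bsub>?T\<^esub> (g \<cdot>\<^bsub>?T\<^esub> f)"
    if f: "f \<in> Hom ?T W X" and g: "g \<in> Hom ?T X Y" and h: "h \<in> Hom ?T Y Z" for f g h W X Y Z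
  proof -
    obtain a b where ab: "(a, b) \<in> spans C" "f = span_class C a b"
      using f by (auto simp: Hom_iff elim: spans_quotientE)
    obtain c d where cd: "(c, d) \<in> spans C" "g = span_class C c d"
      using g by (auto simp: Hom_iff elim: spans_quotientE)
    obtain p q where pq: "(p, q) \<in> spans C" "h = span_class C p q"
      using h by (auto simp: Hom_iff elim: spans_quotientE)
    have "(b, c) \<in> cospans C" "(d, p) \<in> cospans C" using f g h ab cd pq by (auto simp: Hom_iff cospans_iff spans_iff)
    then obtain x y x' y' where l: "L b c x y" "L d p x' y'" by (metis law_class)
    note l1 = L_span [OF l(1)] and l2 = L_span [OF l(2)]
    \<comment> \<open>Exchanging the two neighbouring cospans leaves the cospan \<open>y\<close>,
      \<open>x'\<close>. Exchanging it as well completes a pyramid from which both bracketings are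
      read off, one by \<open>L_comp_left\<close> and one by \<open>L_comp_right\<close>.\<close>
    have "(y, x') \<in> cospans C" using cd(1) l1 l2 by (simp add: cospans_iff spans_iff)
    then obtain z w where l3: "L y x' z w" by (rule law_class)
    note l3s = L_span [OF l3]
    have s: "(a \<cdot> x, d \<cdot> y) \<in> spans C" "(c \<cdot> x', q \<cdot> y') \<in> spans C"
      using ab(1) cd(1) pq(1) l1 l2 by (simp_all add: spans_iff)
    have "h \<cdot>\<^bsub>?T\<^esub> (g \<cdot>\<^bsub>?T\<^esub> f) = span_class C (a \<cdot> x \<cdot> z) (q \<cdot> (y' \<cdot> w))"
      using composite_comp [OF ab(1) cd(1) l(1)] composite_comp [OF s(1) pq(1) L_comp_left [OF l(2) l3]]
      by (simp add: ab cd pq)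
    moreover have "h \<cdot>\<^bsub>?T\<^esub> g \<cdot>\<^bsub>?T\<^esub> f = span_class C (a \<cdot> (x \<cdot> z)) (q \<cdot> y' \<cdot> w)"
      using composite_comp [OF cd(1) pq(1) l(2)] composite_comp [OF ab(1) s(2) L_comp_right [OF l(1) l3]]
      by (simp add: ab cd pq)
    moreover have "a \<cdot> (x \<cdot> z) = a \<cdot> x \<cdot> z" "q \<cdot> y' \<cdot> w = q \<cdot> (y' \<cdot> w)"
      using ab(1) cd(1) pq(1) l1 l2 l3s by (auto simp: spans_iff assoc_arr)
    ultimately show ?thesis by simp
  qed
  show "f \<cdot>\<^bsub>?T\<^esub> Ide ?T X = f" if f: "f \<in> Hom ?T X Y" for f X Y
  proof -
    obtain a b where ab: "(a, b) \<in> spans C" "f = span_class C a b"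
      using f by (auto simp: Hom_iff elim: spans_quotientE)
    then show ?thesis using coembed_comp [of a b "Ide C X"] f by (auto simp: coembed_def Hom_iff spans_iff)
  qed
  show "Ide ?T Y \<cdot>\<^bsub>?T\<^esub> f = f" if f: "f \<in> Hom ?T X Y" for f X Y
  proof -
    obtain a b where ab: "(a, b) \<in> spans C" "f = span_class C a b"
      using f by (auto simp: Hom_iff elim: spans_quotientE)
    then show ?thesis using comp_embed [of a b "Ide C Y"] f by (auto simp: span_embed_def Hom_iff spans_iff)
  qed
qed

text \<open>Precomposition with a symmetry acts on the left leg by the inverse symmetry, the forward
  copy of the one being the backward copy of the other.\<close>

lemma embed_sym_comp:
  assumes s: "(a, b) \<in> spans C" and c: "Cod C a = m + n"
  shows "span_class C a b \<cdot>\<^bsub>composite C \<Lambda>\<^esub> span_embed C (Sym C n m) = span_class C (Sym C m n \<cdot> a) b"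
  using coembed_comp [of a b "Sym C m n"] coembed_iso [OF inverse_sym, of m n] s c
  by (simp add: spans_iff)

lemma composite_is_PROP: "is_PROP (composite C \<Lambda>)"
proof (rule is_PROP_intro)
  let ?T = "composite C \<Lambda>"
  show "category ?T" by (rule composite_category)
  show "Obj ?T = UNIV" "Unit ?T = 0" by (simp_all add: obj_UNIV unit_zero)
  show "TensO ?T = (+)" by (intro ext) simp
  show "Assoc ?T n m k = Ide ?T (n + m + k)" "LUnit ?T n = Ide ?T n" "RUnit ?T n = Ide ?T n" for n m k
    by (simp_all add: assoc_ide strict_lunit strict_runit span_embed_def)
  show "f \<odot>\<^bsub>?T\<^esub> g \<in> Hom ?T (Dom ?T f + Dom ?T g) (Cod ?T f + Cod ?T g)"
    if fg: "f \<in> Arr ?T" "g \<in> Arr ?T" for f g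
  proof -
    obtain a b c d where ab: "(a, b) \<in> spans C" "f = span_class C a b" "(c, d) \<in> spans C" "g = span_class C c d"
      using fg by (auto elim!: spans_quotientE)
    then show ?thesis using composite_tens [OF ab(1,3)] by (auto simp: Hom_iff spans_iff)
  qed
  show "Ide ?T n \<odot>\<^bsub>?T\<^esub> Ide ?T m = Ide ?T (n + m)" for n m
    using composite_tens [of "Ide C n" "Ide C n" "Ide C m" "Ide C m"] by (simp add: spans_iff)
  show "(f' \<cdot>\<^bsub>?T\<^esub> f) \<odot>\<^bsub>?T\<^esub> (g' \<cdot>\<^bsub>?T\<^esub> g) = (f' \<odot>\<^bsub>?T\<^esub> g') \<cdot>\<^bsub>?T\<^esub> (f \<odot>\<^bsub>?T\<^esub> g)"
    if fg: "f \<in> Arr ?T" "f' \<in> Arr ?T" "g \<in> Arr ?T" "g' \<in> Arr ?T" "Cod ?T f = Dom ?T f'" "Cod ?T g = Dom ?T g'" for f f' g g'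
  proof -
    obtain a b where ab: "(a, b) \<in> spans C" "f = span_class C a b" using fg by (auto elim: spans_quotientE)
    obtain c d where cd: "(c, d) \<in> spans C" "f' = span_class C c d" using fg by (auto elim: spans_quotientE)
    obtain a' b' where ab': "(a', b') \<in> spans C" "g = span_class C a' b'" using fg by (auto elim: spans_quotientE)
    obtain c' d' where cd': "(c', d') \<in> spans C" "g' = span_class C c' d'" using fg by (auto elim: spans_quotientE)
    have "(b, c) \<in> cospans C" "(b', c') \<in> cospans C" using fg(5,6) ab cd ab' cd' by (auto simp: cospans_iff spans_iff)
    then obtain x y x' y' where l: "L b c x y" "L b' c' x' y'" by (metis law_class)
    note l1 = L_span [OF l(1)] and l2 = L_span [OF l(2)]
    have s: "(a \<cdot> x, d \<cdot> y) \<in> spans C" "(a' \<cdot> x', d' \<cdot> y') \<in> spans C"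
      "(a \<odot> a', b \<odot> b') \<in> spans C" "(c \<odot> c', d \<odot> d') \<in> spans C"
      using ab(1) cd(1) ab'(1) cd'(1) l1 l2 by (simp_all add: spans_iff)
    show ?thesis
      unfolding ab cd ab' cd' composite_comp [OF ab(1) cd(1) l(1)] composite_comp [OF ab'(1) cd'(1) l(2)]
        composite_tens [OF s(1,2)] composite_tens [OF ab(1) ab'(1)] composite_tens [OF cd(1) cd'(1)]
        composite_comp [OF s(3,4) L_tens [OF l]]
      using ab(1) cd(1) ab'(1) cd'(1) l1 l2 by (simp add: interchange spans_iff)
  qed
  show "(f \<odot>\<^bsub>?T\<^esub> g) \<odot>\<^bsub>?T\<^esub> h = f \<odot>\<^bsub>?T\<^esub> (g \<odot>\<^bsub>?T\<^esub> h)" if fgh: "f \<in> Arr ?T" "g \<in> Arr ?T" "h \<in> Arr ?T" for f g h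
  proof -
    obtain a b where ab: "(a, b) \<in> spans C" "f = span_class C a b" using fgh by (auto elim: spans_quotientE)
    obtain c d where cd: "(c, d) \<in> spans C" "g = span_class C c d" using fgh by (auto elim: spans_quotientE)
    obtain p q where pq: "(p, q) \<in> spans C" "h = span_class C p q" using fgh by (auto elim: spans_quotientE)
    have s: "(a \<odot> c, b \<odot> d) \<in> spans C" "(c \<odot> p, d \<odot> q) \<in> spans C" using ab cd pq by (auto simp: spans_iff)
    show ?thesis unfolding ab cd pq composite_tens [OF ab(1) cd(1)] composite_tens [OF cd(1) pq(1)]
        composite_tens [OF s(1) pq(1)] composite_tens [OF ab(1) s(2)]
      using ab(1) cd(1) pq(1) by (simp add: tens_assoc spans_iff)
  qed
  show "Ide ?T 0 \<odot>\<^bsub>?T\<^esub> f = f" "f \<odot>\<^bsub>?T\<^esub> Ide ?T 0 = f" if f: "f \<in> Arr ?T" for f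
  proof -
    obtain a b where ab: "(a, b) \<in> spans C" "f = span_class C a b" using f by (auto elim: spans_quotientE)
    have s: "(Ide C 0, Ide C 0) \<in> spans C" by (simp add: spans_iff)
    show "Ide ?T 0 \<odot>\<^bsub>?T\<^esub> f = f" "f \<odot>\<^bsub>?T\<^esub> Ide ?T 0 = f"
      using composite_tens [OF s ab(1)] composite_tens [OF ab(1) s] ab by (simp_all add: spans_iff)
  qed
  show "Sym ?T n m \<in> Hom ?T (n + m) (m + n)" for n m by (simp add: Hom_iff)
  show "Sym ?T (Cod ?T f) (Cod ?T g) \<cdot>\<^bsub>?T\<^esub> (f \<odot>\<^bsub>?T\<^esub> g) = (g \<odot>\<^bsub>?T\<^esub> f) \<cdot>\<^bsub>?T\<^esub> Sym ?T (Dom ?T f) (Dom ?T g)"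
    if fg: "f \<in> Arr ?T" "g \<in> Arr ?T" for f g
  proof -
    obtain a b where ab: "(a, b) \<in> spans C" "f = span_class C a b" using fg by (auto elim: spans_quotientE)
    obtain c d where cd: "(c, d) \<in> spans C" "g = span_class C c d" using fg by (auto elim: spans_quotientE)
    have s: "(a \<odot> c, b \<odot> d) \<in> spans C" "(c \<odot> a, d \<odot> b) \<in> spans C" using ab cd by (auto simp: spans_iff)
    \<comment> \<open>The two spans agree only up to the symmetry of the middle objects
      \<open>Dom C a\<close> and \<open>Dom C c\<close>, which serves as the isomorphism between
      them.\<close>
    have "span_class C (a \<odot> c) (Sym C (Cod C b) (Cod C d) \<cdot> (b \<odot> d)) =
        span_class C (Sym C (Cod C c) (Cod C a) \<cdot> (c \<odot> a)) (d \<odot> b)"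
    proof (rule span_class_eqI [OF is_isoI [OF inverse_sym, of "Dom C a" "Dom C c"]])
      have "Sym C (Cod C c) (Cod C a) \<cdot> (Sym C (Cod C a) (Cod C c) \<cdot> (a \<odot> c)) = a \<odot> c"
        using ab cd by (intro inv_cancel(3) [OF inverse_sym]) (auto simp: spans_iff)
      then show "a \<odot> c = Sym C (Cod C c) (Cod C a) \<cdot> (c \<odot> a) \<cdot> Sym C (Dom C a) (Dom C c)"
        using ab(1) cd(1) by (simp add: sym_nat_arr assoc_arr spans_iff)
      show "Sym C (Cod C b) (Cod C d) \<cdot> (b \<odot> d) = (d \<odot> b) \<cdot> Sym C (Dom C a) (Dom C c)"
        using ab(1) cd(1) by (simp add: sym_nat_arr spans_iff)
    qed (use ab cd in \<open>auto simp: spans_iff\<close>)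
    then show ?thesis
      unfolding ab cd composite_tens [OF ab(1) cd(1)] composite_tens [OF cd(1) ab(1)]
      using ab(1) cd(1) by (simp add: comp_embed [OF s(1)] embed_sym_comp [OF s(2)] spans_iff)
  qed
  show "Sym ?T m n \<cdot>\<^bsub>?T\<^esub> Sym ?T n m = Ide ?T (n + m)" for n m
    using embed_comp [of "Sym C n m" "Sym C m n", symmetric] by (simp add: span_embed_def)
  show "Sym ?T x (y + z) = (Ide ?T y \<odot>\<^bsub>?T\<^esub> Sym ?T x z) \<cdot>\<^bsub>?T\<^esub> (Sym ?T x y \<odot>\<^bsub>?T\<^esub> Ide ?T z)" for x y z
  proof -
    have e: "span_class C (Ide C n) (Ide C n) = span_embed C (Ide C n)" for n by (simp add: span_embed_def)
    show ?thesis by (simp add: e embed_tens [symmetric] embed_comp [symmetric] sym_hex1)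
  qed
qed

end

section \<open>Ranks and monotone maps\<close>

text \<open>The position of \<open>j\<close> in the order \<open>r\<close>; points outside
  \<open>{1..n}\<close> stay fixed, as \<open>permutes\<close> demands.\<close>

definition rank :: "nat \<Rightarrow> (nat \<Rightarrow> nat \<Rightarrow> bool) \<Rightarrow> nat \<Rightarrow> nat" where
  "rank n r j = (if j \<in> {1..n} then Suc (card {i \<in> {1..n}. r i j}) else j)"

lemma rank_less_iff:
  assumes irr: "\<And>i. i \<in> {1..n} \<Longrightarrow> \<not> r i i"
    and tr: "\<And>i j k. \<lbrakk>i \<in> {1..n}; j \<in> {1..n}; k \<in> {1..n}; r i j; r j k\<rbrakk> \<Longrightarrow> r i k"
    and tot: "\<And>i j. \<lbrakk>i \<in> {1..n}; j \<in> {1..n}; i \<noteq> j\<rbrakk> \<Longrightarrow> r i j \<or> r j i"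
    and ij: "i \<in> {1..n}" "j \<in> {1..n}"
  shows "rank n r i < rank n r j \<longleftrightarrow> r i j"
proof -
  have less: "rank n r i < rank n r j" if "r i j" "i \<in> {1..n}" "j \<in> {1..n}" for i j
  proof -
    have "{k \<in> {1..n}. r k i} \<subset> {k \<in> {1..n}. r k j}"
      using that tr irr by blast
    then have "card {k \<in> {1..n}. r k i} < card {k \<in> {1..n}. r k j}"
      by (intro psubset_card_mono) auto
    then show ?thesis using that by (simp add: rank_def)
  qed
  show ?thesis using less ij tot by (metis less_asym less_irrefl)
qed

lemma rank_permutes:
  assumes irr: "\<And>i. i \<in> {1..n} \<Longrightarrow> \<not> r i i"
    and tr: "\<And>i j k. \<lbrakk>i \<in> {1..n}; j \<in> {1..n}; k \<in> {1..n}; r i j; r j k\<rbrakk> \<Longrightarrow> r i k"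
    and tot: "\<And>i j. \<lbrakk>i \<in> {1..n}; j \<in> {1..n}; i \<noteq> j\<rbrakk> \<Longrightarrow> r i j \<or> r j i"
  shows "rank n r permutes {1..n}"
proof (rule bij_imp_permutes)
  have less: "rank n r i < rank n r j \<longleftrightarrow> r i j" if "i \<in> {1..n}" "j \<in> {1..n}" for i j
    using rank_less_iff [of n r i j] irr tr tot that by blast
  have inj: "inj_on (rank n r) {1..n}"
    by (intro inj_onI) (metis less tot less_irrefl)
  have "rank n r ` {1..n} \<subseteq> {1..n}"
  proof clarify
    fix j assume j: "j \<in> {1..n}"
    have "{i \<in> {1..n}. r i j} \<subseteq> {1..n} - {j}" using irr j by auto
    then have "card {i \<in> {1..n}. r i j} \<le> card ({1..n} - {j})" by (intro card_mono) auto
    with j show "rank n r j \<in> {1..n}" by (simp add: rank_def) arith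
  qed
  with inj show "bij_betw (rank n r) {1..n} {1..n}"
    by (simp add: bij_betw_def endo_inj_surj)
  show "rank n r j = j" if "j \<notin> {1..n}" for j using that unfolding rank_def by (rule if_not_P)
qed

text \<open>The value at \<open>j\<close> of a permutation of \<open>{1..n}\<close> counts the
  points that do not come after \<open>j\<close> in the order which it induces, so this order
  determines the permutation.\<close>

lemma permutes_order_eq:
  fixes \<sigma> \<tau> :: "nat \<Rightarrow> nat"
  assumes s: "\<sigma> permutes {1..n}" and t: "\<tau> permutes {1..n}"
    and ord: "\<And>i j. \<lbrakk>i \<in> {1..n}; j \<in> {1..n}\<rbrakk> \<Longrightarrow> \<sigma> i < \<sigma> j \<longleftrightarrow> \<tau> i < \<tau> j"
  shows "\<sigma> = \<tau>"
proof
  fix j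
  have c: "\<rho> j = card {i \<in> {1..n}. \<not> \<rho> j < \<rho> i}" if p: "\<rho> permutes {1..n}" and j: "j \<in> {1..n}" for \<rho> :: "nat \<Rightarrow> nat"
  proof -
    have "\<rho> ` {i \<in> {1..n}. \<not> \<rho> j < \<rho> i} = {1..\<rho> j}"
    proof (intro equalityI subsetI)
      fix k assume "k \<in> \<rho> ` {i \<in> {1..n}. \<not> \<rho> j < \<rho> i}"
      then obtain i where "k = \<rho> i" "i \<in> {1..n}" "\<not> \<rho> j < \<rho> i" by blast
      then show "k \<in> {1..\<rho> j}" using permutes_in_image [OF p, of i] by auto
    next
      fix k assume k: "k \<in> {1..\<rho> j}"
      then have "k \<in> {1..n}" using permutes_in_image [OF p, of j] j by auto
      then obtain i where "i \<in> {1..n}" "k = \<rho> i" using permutes_image [OF p] by blast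
      then show "k \<in> \<rho> ` {i \<in> {1..n}. \<not> \<rho> j < \<rho> i}" using k by auto
    qed
    then have "card {1..\<rho> j} = card (\<rho> ` {i \<in> {1..n}. \<not> \<rho> j < \<rho> i})" by simp
    also have "\<dots> = card {i \<in> {1..n}. \<not> \<rho> j < \<rho> i}"
      by (rule card_image) (rule inj_on_subset [OF permutes_inj [OF p]], simp)
    finally show ?thesis by simp
  qed
  show "\<sigma> j = \<tau> j"
  proof (cases "j \<in> {1..n}")
    case True
    then have "{i \<in> {1..n}. \<not> \<sigma> j < \<sigma> i} = {i \<in> {1..n}. \<not> \<tau> j < \<tau> i}" using ord by blast
    then show ?thesis using c [OF s True] c [OF t True] by simp
  next
    case False
    then show ?thesis using permutes_not_in [OF s] permutes_not_in [OF t] by simp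
  qed
qed

section \<open>Order-preserving maps, and the explicit form of \<open>push\<close> and
  \<open>pull_perm\<close>\<close>

lemma HomD_range: "\<lbrakk>\<phi> \<in> HomD n m; j \<in> {1..n}\<rbrakk> \<Longrightarrow> \<phi> j \<in> {1..m}"
  and HomD_mono: "\<lbrakk>\<phi> \<in> HomD n m; i \<in> {1..n}; j \<in> {1..n}; i \<le> j\<rbrakk> \<Longrightarrow> \<phi> i \<le> \<phi> j"
  and HomD_extensional: "\<phi> \<in> HomD n m \<Longrightarrow> \<phi> \<in> extensional {1..n}"
  using PiE_mem [of \<phi> "{1..n}" "\<lambda>_. {1..m}" j] by (simp_all add: HomD_def mono_on_def PiE_def)

lemma HomDI:
  "\<lbrakk>\<And>j. j \<in> {1..n} \<Longrightarrow> \<phi> j \<in> {1..m}; \<And>i j. \<lbrakk>i \<in> {1..n}; j \<in> {1..n}; i \<le> j\<rbrakk> \<Longrightarrow> \<phi> i \<le> \<phi> j;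
    \<phi> \<in> extensional {1..n}\<rbrakk> \<Longrightarrow> \<phi> \<in> HomD n m"
  by (auto simp: HomD_def mono_on_def PiE_iff)

text \<open>The points that a monotone map sends to values at most \<open>k\<close> form an initial
  segment, so membership in it is a comparison with its length.\<close>

lemma HomD_le_iff:
  assumes f: "\<phi> \<in> HomD n m" and j: "j \<in> {1..n}"
  shows "\<phi> j \<le> k \<longleftrightarrow> j \<le> card {i \<in> {1..n}. \<phi> i \<le> k}"
proof
  assume "\<phi> j \<le> k"
  then have "\<phi> i \<le> k" if "i \<in> {1..j}" for i using HomD_mono [OF f, of i j] that j by auto
  then have "{1..j} \<subseteq> {i \<in> {1..n}. \<phi> i \<le> k}" using j by auto
  then have "card {1..j} \<le> card {i \<in> {1..n}. \<phi> i \<le> k}" by (intro card_mono) auto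
  then show "j \<le> card {i \<in> {1..n}. \<phi> i \<le> k}" by simp
next
  assume c: "j \<le> card {i \<in> {1..n}. \<phi> i \<le> k}"
  show "\<phi> j \<le> k"
  proof (rule ccontr)
    assume "\<not> \<phi> j \<le> k"
    then have "i < j" if "\<phi> i \<le> k" "i \<in> {1..n}" for i using HomD_mono [OF f j, of i] that by (rule_tac ccontr) auto
    then have "{i \<in> {1..n}. \<phi> i \<le> k} \<subseteq> {1..<j}" by auto
    then have "card {i \<in> {1..n}. \<phi> i \<le> k} \<le> card {1..<j}" by (intro card_mono) auto
    then have "card {i \<in> {1..n}. \<phi> i \<le> k} < j" using j by simp arith
    with c show False by linarith
  qed
qed

text \<open>The partial sums of the fibre sizes are the lengths of the initial segments in
  \<open>HomD_le_iff\<close>, and these determine a monotone map.\<close>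

lemma HomD_eqI:
  assumes p: "\<phi> \<in> HomD n m" and q: "\<psi> \<in> HomD n m"
    and c: "\<And>k. k \<in> {1..m} \<Longrightarrow> card {j \<in> {1..n}. \<phi> j = k} = card {j \<in> {1..n}. \<psi> j = k}"
  shows "\<phi> = \<psi>"
proof -
  have sum: "card {j \<in> {1..n}. \<phi> j \<le> k} = (\<Sum>l\<in>{1..k}. card {j \<in> {1..n}. \<phi> j = l})"
    if "\<phi> \<in> HomD n m" for \<phi> k
  proof (induction k)
    case 0
    have "\<not> \<phi> j \<le> 0" if "j \<in> {1..n}" for j using HomD_range [OF \<open>\<phi> \<in> HomD n m\<close> that] by simp
    then have "{j \<in> {1..n}. \<phi> j \<le> 0} = {}" by blast
    then show ?case by (simp only: card.empty) simp
  next
    case (Suc k)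
    have "{j \<in> {1..n}. \<phi> j \<le> Suc k} = {j \<in> {1..n}. \<phi> j \<le> k} \<union> {j \<in> {1..n}. \<phi> j = Suc k}" by auto
    then have "card {j \<in> {1..n}. \<phi> j \<le> Suc k} = card {j \<in> {1..n}. \<phi> j \<le> k} + card {j \<in> {1..n}. \<phi> j = Suc k}"
      by (simp only:) (rule card_Un_disjoint, auto)
    then show ?case unfolding Suc by simp
  qed
  have ceq: "card {i \<in> {1..n}. \<phi> i \<le> k} = card {i \<in> {1..n}. \<psi> i \<le> k}" if "k \<le> m" for k
    unfolding sum [OF p] sum [OF q] using that by (intro sum.cong c) auto
  show ?thesis
  proof (rule extensionalityI [of _ "{1..n}"])
    show "\<phi> \<in> extensional {1..n}" "\<psi> \<in> extensional {1..n}" using p q by (blast intro: HomD_extensional)+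
    fix j assume j: "j \<in> {1..n}"
    have b: "\<phi> j \<le> m" "\<psi> j \<le> m" using HomD_range [OF p j] HomD_range [OF q j] by auto
    have "\<phi> j \<le> \<psi> j" unfolding HomD_le_iff [OF p j] ceq [OF b(2)] using HomD_le_iff [OF q j, of "\<psi> j"] by simp
    moreover have "\<psi> j \<le> \<phi> j" unfolding HomD_le_iff [OF q j] ceq [OF b(1), symmetric] using HomD_le_iff [OF p j, of "\<phi> j"] by simp
    ultimately show "\<phi> j = \<psi> j" by simp
  qed
qed

text \<open>One reordering of \<open>{1..n}\<close> resolves both definite descriptions. The
  relation \<open>r\<close> sorts by the new position of the fibre and keeps the old order inside a
  fibre. Its rank function is the pulled-back permutation, and transport along it gives the pushed
  map.\<close>

lemma push_pull_facts:
  assumes f: "\<phi> \<in> HomD n m" and s: "snd g permutes {1..m}"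
  shows push_HomD: "push n m g \<phi> \<in> HomD n m"
    and pull_permutes: "pull_perm n m g \<phi> permutes {1..n}"
    and push_pull: "j \<in> {1..n} \<Longrightarrow> push n m g \<phi> (pull_perm n m g \<phi> j) = snd g (\<phi> j)"
    and pull_less: "\<lbrakk>a \<in> {1..n}; b \<in> {1..n}\<rbrakk> \<Longrightarrow> pull_perm n m g \<phi> a < pull_perm n m g \<phi> b \<longleftrightarrow>
      snd g (\<phi> a) < snd g (\<phi> b) \<or> \<phi> a = \<phi> b \<and> a < b"
proof -
  let ?s = "snd g"
  define r where "r a b \<longleftrightarrow> ?s (\<phi> a) < ?s (\<phi> b) \<or> \<phi> a = \<phi> b \<and> a < b" for a b
  define \<tau> where "\<tau> = rank n r"
  have inj: "?s i = ?s j \<longleftrightarrow> i = j" for i j using permutes_inj [OF s] by (auto simp: inj_eq)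
  have tot: "r i j \<or> r j i" if "i \<noteq> j" for i j
    using that inj [of "\<phi> i" "\<phi> j"] by (auto simp: r_def)
  have tr: "r i k" if "r i j" "r j k" for i j k
    using that by (auto simp: r_def)
  have irr: "\<not> r i i" for i by (simp add: r_def)
  have \<tau>p: "\<tau> permutes {1..n}" unfolding \<tau>_def by (rule rank_permutes) (use irr tr tot in blast)+
  have \<tau>l: "\<tau> a < \<tau> b \<longleftrightarrow> r a b" if "a \<in> {1..n}" "b \<in> {1..n}" for a b
    unfolding \<tau>_def by (rule rank_less_iff) (use irr tr tot that in blast)+
  define \<psi> where "\<psi> = restrict (\<lambda>k. ?s (\<phi> (inv_into UNIV \<tau> k))) {1..n}"
  have \<psi>\<tau>: "\<psi> (\<tau> j) = ?s (\<phi> j)" if "j \<in> {1..n}" for j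
    using that permutes_in_image [OF \<tau>p, of j] permutes_inverses [OF \<tau>p] by (simp add: \<psi>_def)
  have sur: "\<exists>a\<in>{1..n}. k = \<tau> a" if "k \<in> {1..n}" for k
    using permutes_image [OF \<tau>p] that by blast
  have fr: "\<phi> j \<in> {1..m}" if "j \<in> {1..n}" for j using HomD_range [OF f that] .
  have \<psi>H: "\<psi> \<in> HomD n m"
  proof (rule HomDI)
      fix k assume "k \<in> {1..n}"
      then obtain a where a: "a \<in> {1..n}" "k = \<tau> a" using sur by blast
      then show "\<psi> k \<in> {1..m}" using \<psi>\<tau> [OF a(1)] permutes_in_image [OF s, of "\<phi> a"] fr [OF a(1)] by simp
  next
      fix k l assume k: "k \<in> {1..n}" and l: "l \<in> {1..n}" and kl: "k \<le> l"
      obtain a b where ab: "a \<in> {1..n}" "k = \<tau> a" "b \<in> {1..n}" "l = \<tau> b" using sur k l by blast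
      then have "\<not> r b a" using kl \<tau>l [of b a] by simp
      then have "?s (\<phi> a) \<le> ?s (\<phi> b)" by (auto simp: r_def)
      then show "\<psi> k \<le> \<psi> l" using ab \<psi>\<tau> by simp
  qed (simp add: \<psi>_def)
  have \<psi>c: "card {j \<in> {1..n}. \<psi> j = ?s i} = card {j \<in> {1..n}. \<phi> j = i}" for i
  proof -
    have "{j \<in> {1..n}. \<psi> j = ?s i} = \<tau> ` {j \<in> {1..n}. \<phi> j = i}"
    proof (intro equalityI subsetI)
      fix k assume k: "k \<in> {j \<in> {1..n}. \<psi> j = ?s i}"
      then obtain a where a: "a \<in> {1..n}" "k = \<tau> a" using sur by blast
      then have "\<phi> a = i" using k \<psi>\<tau> inj by simp
      with a show "k \<in> \<tau> ` {j \<in> {1..n}. \<phi> j = i}" by blast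
    next
      fix k assume "k \<in> \<tau> ` {j \<in> {1..n}. \<phi> j = i}"
      then show "k \<in> {j \<in> {1..n}. \<psi> j = ?s i}" using \<psi>\<tau> permutes_in_image [OF \<tau>p] by auto
    qed
    then show ?thesis
      by (simp only:) (rule card_image, rule inj_on_subset [OF permutes_inj [OF \<tau>p]], simp)
  qed
  have push: "push n m g \<phi> = \<psi>"
    unfolding push_def
  proof (rule the_equality)
    show "\<psi> \<in> HomD n m \<and> (\<forall>i\<in>{1..m}. card {j \<in> {1..n}. \<psi> j = ?s i} = card {j \<in> {1..n}. \<phi> j = i})"
      using \<psi>H \<psi>c by blast
    fix \<psi>' assume p: "\<psi>' \<in> HomD n m \<and> (\<forall>i\<in>{1..m}. card {j \<in> {1..n}. \<psi>' j = ?s i} = card {j \<in> {1..n}. \<phi> j = i})"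
    show "\<psi>' = \<psi>"
    proof (rule HomD_eqI [of _ n m])
      fix k assume "k \<in> {1..m}"
      then obtain i where "i \<in> {1..m}" "k = ?s i" using permutes_image [OF s] by blast
      then show "card {j \<in> {1..n}. \<psi>' j = k} = card {j \<in> {1..n}. \<psi> j = k}" using p \<psi>c by simp
    qed (use p \<psi>H in auto)
  qed
  \<comment> \<open>A permutation with the three properties is monotone for \<open>r\<close>: across
    fibres because the pushed map is monotone, inside a fibre by assumption. Permutations that
    induce the same order are equal.\<close>
  have pull: "pull_perm n m g \<phi> = \<tau>"
    unfolding pull_perm_def push
  proof (rule the_equality)
    have "mono_on {j \<in> {1..n}. \<phi> j = i} \<tau>" for i
    proof (rule mono_onI)
      fix a b assume "a \<in> {j \<in> {1..n}. \<phi> j = i}" "b \<in> {j \<in> {1..n}. \<phi> j = i}" "a \<le> b"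
      then show "\<tau> a \<le> \<tau> b" using \<tau>l [of a b] by (cases "a = b") (auto simp: r_def)
    qed
    then show "\<tau> permutes {1..n} \<and> (\<forall>i\<in>{1..m}. mono_on {j \<in> {1..n}. \<phi> j = i} \<tau>) \<and>
       (\<forall>j\<in>{1..n}. ?s (\<phi> j) = \<psi> (\<tau> j))" using \<tau>p \<psi>\<tau> by auto
    fix \<tau>' assume t: "\<tau>' permutes {1..n} \<and> (\<forall>i\<in>{1..m}. mono_on {j \<in> {1..n}. \<phi> j = i} \<tau>') \<and>
       (\<forall>j\<in>{1..n}. ?s (\<phi> j) = \<psi> (\<tau>' j))"
    then have tp: "\<tau>' permutes {1..n}" by blast
    have imp: "\<tau>' a < \<tau>' b" if "r a b" and ab: "a \<in> {1..n}" "b \<in> {1..n}" for a b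
    proof (cases "?s (\<phi> a) < ?s (\<phi> b)")
      case True
      then have "\<psi> (\<tau>' a) < \<psi> (\<tau>' b)" using t ab by auto
      moreover have "\<psi> (\<tau>' b) \<le> \<psi> (\<tau>' a)" if "\<tau>' b \<le> \<tau>' a"
        using HomD_mono [OF \<psi>H _ _ that] permutes_in_image [OF tp, of a] permutes_in_image [OF tp, of b] ab by simp
      ultimately show ?thesis by force
    next
      case False
      then have e: "\<phi> a = \<phi> b" "a < b" using that by (auto simp: r_def)
      moreover have "mono_on {j \<in> {1..n}. \<phi> j = \<phi> a} \<tau>'" using t fr ab by blast
      ultimately have "\<tau>' a \<le> \<tau>' b" using ab by (auto simp: mono_on_def)
      moreover have "\<tau>' a \<noteq> \<tau>' b" using e permutes_inj [OF tp] by (auto simp: inj_eq)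
      ultimately show ?thesis by simp
    qed
    show "\<tau>' = \<tau>"
    proof (rule permutes_order_eq [OF tp \<tau>p])
      fix i j assume "i \<in> {1..n}" "j \<in> {1..n}"
      then show "\<tau>' i < \<tau>' j \<longleftrightarrow> \<tau> i < \<tau> j" using imp [of i j] imp [of j i] \<tau>l tot irr
        by (metis less_asym less_irrefl)
    qed
  qed
  show "push n m g \<phi> \<in> HomD n m" using push \<psi>H by simp
  show "pull_perm n m g \<phi> permutes {1..n}" using pull \<tau>p by simp
  show "push n m g \<phi> (pull_perm n m g \<phi> j) = ?s (\<phi> j)" if "j \<in> {1..n}"
    using \<psi>\<tau> that push pull by simp
  show "pull_perm n m g \<phi> a < pull_perm n m g \<phi> b \<longleftrightarrow>
      ?s (\<phi> a) < ?s (\<phi> b) \<or> \<phi> a = \<phi> b \<and> a < b" if "a \<in> {1..n}" "b \<in> {1..n}"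
    using \<tau>l that pull by (simp add: r_def)
qed

section \<open>Morphisms of \<open>Q\<close> as labelled maps with ordered fibres\<close>

text \<open>\<open>\<phi> \<circ> (x; \<sigma>)\<close> is encoded by its underlying map \<open>\<phi> \<circ> \<sigma>\<close>, its labels, and the order of each fibre in which
  \<open>\<sigma>\<close> lists it. In these terms composition needs no \<open>push\<close> and \<open>pull\<close>.\<close>

definition qfun :: "'g qarr \<Rightarrow> nat \<Rightarrow> nat" where
  "qfun q j = qmap q (snd (qlab q) j)"

definition qlb :: "'g qarr \<Rightarrow> nat \<Rightarrow> 'g" where
  "qlb q = fst (qlab q)"

definition qlt :: "'g qarr \<Rightarrow> nat \<Rightarrow> nat \<Rightarrow> bool" where
  "qlt q i j \<longleftrightarrow> qfun q i = qfun q j \<and> snd (qlab q) i < snd (qlab q) j"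

lemma QPROP_simps [simp]:
  "Obj (QPROP G) = UNIV" "Dom (QPROP G) = qdom" "Cod (QPROP G) = qcod" "Ide (QPROP G) = qide G"
  "Comp (QPROP G) = qcomp G" "TensO (QPROP G) = (+)" "TensA (QPROP G) = qtens" "Unit (QPROP G) = 0"
  "Assoc (QPROP G) = (\<lambda>n m k. qide G (n + m + k))" "LUnit (QPROP G) = qide G" "RUnit (QPROP G) = qide G"
  by (simp_all add: QPROP_def)

lemma Q_arr_iff:
  "q \<in> Arr (QPROP G) \<longleftrightarrow> qmap q \<in> HomD (qdom q) (qcod q) \<and>
     qlb q \<in> {1..qdom q} \<rightarrow>\<^sub>E carrier G \<and> snd (qlab q) permutes {1..qdom q}"
  by (cases "qlab q") (auto simp: QPROP_def lperm_group_def qlb_def)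

lemma qlt_fun: "qlt q i j \<Longrightarrow> qfun q i = qfun q j" by (simp add: qlt_def)
lemma qlt_irrefl [simp]: "\<not> qlt q i i" by (simp add: qlt_def)
lemma qlt_trans: "qlt q i j \<Longrightarrow> qlt q j k \<Longrightarrow> qlt q i k" by (simp add: qlt_def)
lemma qlt_asym: "qlt q i j \<Longrightarrow> \<not> qlt q j i" by (simp add: qlt_def)

lemma qfun_in: "\<lbrakk>q \<in> Arr (QPROP G); j \<in> {1..qdom q}\<rbrakk> \<Longrightarrow> qfun q j \<in> {1..qcod q}"
  using permutes_in_image [of "snd (qlab q)" "{1..qdom q}" j] HomD_range [of "qmap q" "qdom q" "qcod q"]
  by (simp add: Q_arr_iff qfun_def)

lemma qfun_bounds:
  "\<lbrakk>q \<in> Arr (QPROP G); Suc 0 \<le> j; j \<le> qdom q\<rbrakk> \<Longrightarrow> Suc 0 \<le> qfun q j \<and> qfun q j \<le> qcod q"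
  using qfun_in [of q G j] by simp

lemma qlb_in: "\<lbrakk>q \<in> Arr (QPROP G); j \<in> {1..qdom q}\<rbrakk> \<Longrightarrow> qlb q j \<in> carrier G"
  by (auto simp: Q_arr_iff)

lemma qlt_total:
  "\<lbrakk>q \<in> Arr (QPROP G); qfun q i = qfun q j; i \<noteq> j\<rbrakk> \<Longrightarrow> qlt q i j \<or> qlt q j i"
  using permutes_inj [of "snd (qlab q)" "{1..qdom q}"]
  by (auto simp: Q_arr_iff qlt_def) (metis inj_eq nat_neq_iff)

text \<open>Since \<open>qmap q\<close> is monotone, the permutation lists the inputs fibre by
  fibre. Its order is therefore lexicographic, by output and inside a fibre by
  \<open>qlt\<close>.\<close>

lemma qlab_less_iff:
  assumes q: "q \<in> Arr (QPROP G)" and ij: "i \<in> {1..qdom q}" "j \<in> {1..qdom q}"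
  shows "snd (qlab q) i < snd (qlab q) j \<longleftrightarrow> qfun q i < qfun q j \<or> qlt q i j"
proof -
  have p: "snd (qlab q) permutes {1..qdom q}" and h: "qmap q \<in> HomD (qdom q) (qcod q)"
    using q by (auto simp: Q_arr_iff)
  have le: "qfun q i \<le> qfun q j" if "snd (qlab q) i \<le> snd (qlab q) j" "i \<in> {1..qdom q}" "j \<in> {1..qdom q}" for i j
    using HomD_mono [OF h _ _ that(1)] that permutes_in_image [OF p, of i] permutes_in_image [OF p, of j]
    by (simp add: qfun_def)
  show ?thesis
  proof
    assume l: "snd (qlab q) i < snd (qlab q) j"
    then have "qfun q i \<le> qfun q j" using le ij by simp
    then show "qfun q i < qfun q j \<or> qlt q i j" using l by (auto simp: qlt_def)
  next
    assume "qfun q i < qfun q j \<or> qlt q i j"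
    then show "snd (qlab q) i < snd (qlab q) j" using le [of j i] ij by (force simp: qlt_def)
  qed
qed

text \<open>The lexicographic order recovers the permutation, and the permutation recovers the
  monotone map from \<open>qfun\<close>. The bounds are written with \<open>Suc 0\<close>, the form
  into which the simplifier brings them.\<close>

lemma Q_eqI:
  assumes q: "q \<in> Arr (QPROP G)" and q': "q' \<in> Arr (QPROP G)"
    and d: "qdom q = qdom q'" and c: "qcod q = qcod q'"
    and f: "\<And>j. \<lbrakk>Suc 0 \<le> j; j \<le> qdom q'\<rbrakk> \<Longrightarrow> qfun q j = qfun q' j"
    and x: "\<And>j. \<lbrakk>Suc 0 \<le> j; j \<le> qdom q'\<rbrakk> \<Longrightarrow> qlb q j = qlb q' j"
    and l: "\<And>i j. \<lbrakk>Suc 0 \<le> i; i \<le> qdom q'; Suc 0 \<le> j; j \<le> qdom q'; qfun q' i = qfun q' j\<rbrakk> \<Longrightarrow> qlt q i j = qlt q' i j"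
  shows "q = q'"
proof -
  have p: "snd (qlab q) permutes {1..qdom q'}" "snd (qlab q') permutes {1..qdom q'}"
    using q q' d by (auto simp: Q_arr_iff)
  have s: "snd (qlab q) = snd (qlab q')"
  proof (rule permutes_order_eq [OF p])
    fix i j assume "i \<in> {1..qdom q'}" "j \<in> {1..qdom q'}"
    then show "snd (qlab q) i < snd (qlab q) j \<longleftrightarrow> snd (qlab q') i < snd (qlab q') j"
      using qlab_less_iff [OF q, of i j] qlab_less_iff [OF q', of i j] d f l [of i j]
        qlt_fun [of q i j] qlt_fun [of q' i j]
      by (cases "qfun q' i = qfun q' j") auto
  qed
  have "qmap q = qmap q'"
  proof (rule extensionalityI [of _ "{1..qdom q'}"])
    show "qmap q \<in> extensional {1..qdom q'}" "qmap q' \<in> extensional {1..qdom q'}"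
      using q q' d HomD_extensional by (auto simp: Q_arr_iff simp del: atLeastAtMost_iff)
    fix k assume "k \<in> {1..qdom q'}"
    then obtain j where "j \<in> {1..qdom q'}" "k = snd (qlab q') j" using permutes_image [OF p(2)] by blast
    then show "qmap q k = qmap q' k" using f [of j] s by (simp add: qfun_def)
  qed
  moreover have "fst (qlab q) = fst (qlab q')"
  proof (rule extensionalityI [of _ "{1..qdom q'}"])
    show "fst (qlab q) \<in> extensional {1..qdom q'}" "fst (qlab q') \<in> extensional {1..qdom q'}"
      using q q' d by (simp_all add: Q_arr_iff qlb_def PiE_def)
    fix k assume "k \<in> {1..qdom q'}"
    then show "fst (qlab q) k = fst (qlab q') k" using x [of k] by (simp add: qlb_def)
  qed
  ultimately show ?thesis using s d c by (intro qarr.equality) (auto intro: prod_eqI)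
qed

text \<open>Conversely every encoding is realised. \<open>R\<close> takes effect only inside the
  fibres of \<open>f\<close>; together with the values of \<open>f\<close> it gives a total order on
  \<open>{1..n}\<close>, whose rank function is the permutation of the arrow.\<close>

lemma Q_exists:
  assumes f: "f \<in> {1..n} \<rightarrow> {1..m}" and x: "x \<in> {1..n} \<rightarrow> carrier G"
    and irr: "\<And>i. i \<in> {1..n} \<Longrightarrow> \<not> R i i"
    and tr: "\<And>i j k. \<lbrakk>i \<in> {1..n}; j \<in> {1..n}; k \<in> {1..n}; R i j; R j k\<rbrakk> \<Longrightarrow> R i k"
    and tot: "\<And>i j. \<lbrakk>i \<in> {1..n}; j \<in> {1..n}; i \<noteq> j; f i = f j\<rbrakk> \<Longrightarrow> R i j \<or> R j i"
  obtains q where "q \<in> Arr (QPROP G)" "qdom q = n" "qcod q = m"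
    "\<And>j. j \<in> {1..n} \<Longrightarrow> qfun q j = f j" "\<And>j. j \<in> {1..n} \<Longrightarrow> qlb q j = x j"
    "\<And>i j. \<lbrakk>i \<in> {1..n}; j \<in> {1..n}\<rbrakk> \<Longrightarrow> qlt q i j \<longleftrightarrow> f i = f j \<and> R i j"
proof -
  define r where "r i j \<longleftrightarrow> f i < f j \<or> f i = f j \<and> R i j" for i j
  define \<tau> where "\<tau> = rank n r"
  have 1: "\<not> r i i" if "i \<in> {1..n}" for i using irr that by (simp add: r_def)
  have 2: "r i k" if "i \<in> {1..n}" "j \<in> {1..n}" "k \<in> {1..n}" "r i j" "r j k" for i j k
    using tr [OF that(1-3)] that(4,5) by (auto simp: r_def)
  have 3: "r i j \<or> r j i" if "i \<in> {1..n}" "j \<in> {1..n}" "i \<noteq> j" for i j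
    using tot [OF that] by (auto simp: r_def)
  have \<tau>p: "\<tau> permutes {1..n}" unfolding \<tau>_def by (rule rank_permutes [OF 1 2 3])
  have \<tau>l: "\<tau> a < \<tau> b \<longleftrightarrow> r a b" if "a \<in> {1..n}" "b \<in> {1..n}" for a b
    unfolding \<tau>_def by (rule rank_less_iff [OF 1 2 3 that])
  define \<phi> where "\<phi> = restrict (\<lambda>k. f (inv_into UNIV \<tau> k)) {1..n}"
  have \<phi>\<tau>: "\<phi> (\<tau> j) = f j" if "j \<in> {1..n}" for j
    using that permutes_in_image [OF \<tau>p, of j] permutes_inverses [OF \<tau>p] by (simp add: \<phi>_def)
  have sur: "\<exists>a\<in>{1..n}. k = \<tau> a" if "k \<in> {1..n}" for k
    using permutes_image [OF \<tau>p] that by blast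
  define q where "q = \<lparr>qdom = n, qcod = m, qmap = \<phi>, qlab = (restrict x {1..n}, \<tau>)\<rparr>"
  have "\<phi> \<in> HomD n m"
  proof (rule HomDI)
      fix k assume "k \<in> {1..n}"
      then obtain a where a: "a \<in> {1..n}" "k = \<tau> a" using sur by blast
      then show "\<phi> k \<in> {1..m}" using \<phi>\<tau> [OF a(1)] f by auto
  next
      fix k l assume k: "k \<in> {1..n}" and l: "l \<in> {1..n}" and kl: "k \<le> l"
      obtain a b where ab: "a \<in> {1..n}" "k = \<tau> a" "b \<in> {1..n}" "l = \<tau> b" using sur k l by blast
      then have "\<not> r b a" using kl \<tau>l [of b a] by simp
      then have "f a \<le> f b" by (auto simp: r_def)
      then show "\<phi> k \<le> \<phi> l" using ab \<phi>\<tau> by simp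
  qed (simp add: \<phi>_def)
  then have "q \<in> Arr (QPROP G)" using x \<tau>p by (auto simp: Q_arr_iff q_def qlb_def)
  moreover have "qfun q j = f j" if "j \<in> {1..n}" for j using \<phi>\<tau> that by (simp add: qfun_def q_def)
  moreover have "qlb q j = x j" if "j \<in> {1..n}" for j using that by (simp add: qlb_def q_def)
  moreover have "qlt q i j \<longleftrightarrow> f i = f j \<and> R i j" if "i \<in> {1..n}" "j \<in> {1..n}" for i j
    using \<tau>l [OF that] calculation(2) that by (auto simp: qlt_def q_def r_def)
  ultimately show ?thesis by (intro that [of q]) (simp_all add: q_def)
qed

section \<open>Composition, tensor product and symmetries of \<open>Q\<close> in the
  encoding\<close>

context group
begin

abbreviation QG where "QG \<equiv> QPROP G"

text \<open>Here \<open>push\<close> and \<open>pull\<close> disappear. The underlying maps compose,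
  the labels multiply along them, and a fibre of the composite is ordered lexicographically: by
  \<open>q2\<close> on the images, and by \<open>q1\<close> where the images agree.\<close>

lemma qcomp_facts:
  assumes q1: "q1 \<in> Arr QG" and q2: "q2 \<in> Arr QG" and e: "qcod q1 = qdom q2"
  shows qcomp_in [simp]: "qcomp G q2 q1 \<in> Arr QG"
    and qfun_qcomp [simp]: "\<lbrakk>Suc 0 \<le> j; j \<le> qdom q1\<rbrakk> \<Longrightarrow> qfun (qcomp G q2 q1) j = qfun q2 (qfun q1 j)"
    and qlb_qcomp [simp]: "\<lbrakk>Suc 0 \<le> j; j \<le> qdom q1\<rbrakk>
      \<Longrightarrow> qlb (qcomp G q2 q1) j = qlb q2 (qfun q1 j) \<otimes> qlb q1 j"
    and qlt_qcomp [simp]: "\<lbrakk>Suc 0 \<le> i; i \<le> qdom q1; Suc 0 \<le> j; j \<le> qdom q1\<rbrakk>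
      \<Longrightarrow> qlt (qcomp G q2 q1) i j \<longleftrightarrow> qlt q1 i j \<or> qlt q2 (qfun q1 i) (qfun q1 j)"
proof -
  let ?n = "qdom q1" and ?m = "qcod q1"
  have s1: "snd (qlab q1) permutes {1..?n}" and s2: "snd (qlab q2) permutes {1..?m}"
    and p1: "qmap q1 \<in> HomD ?n ?m" and p2: "qmap q2 \<in> HomD ?m (qcod q2)"
    using q1 q2 e by (auto simp: Q_arr_iff)
  note pp = push_pull_facts [OF p1 s2]
  let ?t = "pull_perm ?n ?m (qlab q2) (qmap q1)" and ?psi = "push ?n ?m (qlab q2) (qmap q1)"
  have i1: "snd (qlab q1) j \<in> {1..?n}" if "j \<in> {1..?n}" for j using permutes_in_image [OF s1] that by blast
  have it: "?t j \<in> {1..?n}" if "j \<in> {1..?n}" for j using permutes_in_image [OF pp(2)] that by blast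
  have f1: "qmap q1 j \<in> {1..?m}" if "j \<in> {1..?n}" for j using HomD_range [OF p1 that] .
  have lab: "qlab (qcomp G q2 q1) = (restrict (\<lambda>i. qlb q2 (qmap q1 (snd (qlab q1) i)) \<otimes> qlb q1 i) {1..?n}, ?t \<circ> snd (qlab q1))"
    using i1 by (auto simp: qcomp_def Let_def lperm_group_def pull_def qlb_def split_beta cong: restrict_cong)
  have map: "qmap (qcomp G q2 q1) = compose {1..?n} (qmap q2) ?psi"
    by (simp add: qcomp_def Let_def)
  have dc: "qdom (qcomp G q2 q1) = ?n" "qcod (qcomp G q2 q1) = qcod q2"
    by (simp_all add: qcomp_def Let_def)
  have perm: "?t \<circ> snd (qlab q1) permutes {1..?n}" using permutes_compose [OF s1 pp(2)] .
  have "compose {1..?n} (qmap q2) ?psi \<in> HomD ?n (qcod q2)"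
  proof -
    have a: "?psi k \<in> {1..?m}" if "k \<in> {1..?n}" for k using HomD_range [OF pp(1) that] .
    show ?thesis
    proof (rule HomDI)
      show "compose {1..?n} (qmap q2) ?psi j \<in> {1..qcod q2}" if "j \<in> {1..?n}" for j
        using HomD_range [OF p2 a [OF that]] that by (simp add: compose_def)
      show "compose {1..?n} (qmap q2) ?psi i \<le> compose {1..?n} (qmap q2) ?psi j"
        if "i \<in> {1..?n}" "j \<in> {1..?n}" "i \<le> j" for i j
        using HomD_mono [OF p2 a a HomD_mono [OF pp(1)]] that by (simp add: compose_def)
    qed (simp add: compose_def)
  qed
  moreover have "qlb q2 (qmap q1 (snd (qlab q1) i)) \<otimes> qlb q1 i \<in> carrier G" if "i \<in> {1..?n}" for i
    using qlb_in [OF q1 that] qlb_in [OF q2, of "qmap q1 (snd (qlab q1) i)"] f1 [OF i1 [OF that]] e by auto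
  ultimately show "qcomp G q2 q1 \<in> Arr QG"
    using perm by (auto simp: Q_arr_iff map dc lab qlb_def)
  have fn: "qfun (qcomp G q2 q1) j = qfun q2 (qfun q1 j)" if "j \<in> {1..?n}" for j
    using pp(3) [OF i1 [OF that]] it [OF i1 [OF that]] by (simp add: qfun_def map lab compose_def)
  then show "qfun (qcomp G q2 q1) j = qfun q2 (qfun q1 j)" if "Suc 0 \<le> j" "j \<le> ?n" for j using that by simp
  show "qlb (qcomp G q2 q1) j = qlb q2 (qfun q1 j) \<otimes> qlb q1 j" if "Suc 0 \<le> j" "j \<le> ?n" for j
    using that by (simp add: lab qfun_def qlb_def)
  show "qlt (qcomp G q2 q1) i j \<longleftrightarrow> qlt q1 i j \<or> qlt q2 (qfun q1 i) (qfun q1 j)"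
    if "Suc 0 \<le> i" "i \<le> ?n" "Suc 0 \<le> j" "j \<le> ?n" for i j
  proof -
    have ij: "i \<in> {1..?n}" "j \<in> {1..?n}" using that by auto
    show ?thesis unfolding qlt_def fn [OF ij(1)] fn [OF ij(2)]
      using pp(4) [OF i1 [OF ij(1)] i1 [OF ij(2)]] by (auto simp: lab qfun_def)
  qed
qed

lemma qdom_qcomp [simp]: "qdom (qcomp G q2 q1) = qdom q1" "qcod (qcomp G q2 q1) = qcod q2"
  by (simp_all add: qcomp_def Let_def)

lemma qdom_qtens [simp]: "qdom (qtens q q') = qdom q + qdom q'" "qcod (qtens q q') = qcod q + qcod q'"
  by (simp_all add: qtens_def Let_def)

lemma juxt_permutes:
  assumes s: "\<sigma> permutes {1..n}" and t: "\<tau> permutes {1..m}"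
  shows "juxt n \<sigma> ((+) n) \<tau> permutes {1..n + m}"
proof (rule bij_imp_permutes)
  let ?j = "juxt n \<sigma> ((+) n) \<tau>"
  have in1: "\<sigma> j \<in> {1..n} \<longleftrightarrow> j \<in> {1..n}" and in2: "\<tau> j \<in> {1..m} \<longleftrightarrow> j \<in> {1..m}" for j
    by (rule permutes_in_image [OF s], rule permutes_in_image [OF t])
  have "?j ` {1..n + m} \<subseteq> {1..n + m}"
  proof clarify
    fix j assume "j \<in> {1..n + m}"
    then show "?j j \<in> {1..n + m}" using in1 [of j] in2 [of "j - n"] by (auto simp: juxt_def)
  qed
  moreover have "inj_on ?j {1..n + m}"
  proof (rule inj_onI)
    fix i j assume i: "i \<in> {1..n + m}" and j: "j \<in> {1..n + m}" and e: "?j i = ?j j"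
    have "\<sigma> i = \<sigma> j \<Longrightarrow> i = j" "\<tau> (i - n) = \<tau> (j - n) \<Longrightarrow> i - n = j - n"
      using permutes_inj [OF s] permutes_inj [OF t] by (auto simp: inj_eq)
    then show "i = j" using i j e in1 [of i] in1 [of j] in2 [of "i - n"] in2 [of "j - n"]
      by (auto simp: juxt_def split: if_splits)
  qed
  ultimately show "bij_betw ?j {1..n + m} {1..n + m}" by (simp add: bij_betw_def endo_inj_surj)
  show "?j j = j" if "j \<notin> {1..n + m}" for j
    using that permutes_not_in [OF s, of j] permutes_not_in [OF t, of "j - n"] by (auto simp: juxt_def Suc_le_eq not_le)
qed

lemma qtens_facts:
  assumes q1: "q \<in> Arr QG" and q2: "q' \<in> Arr QG"
  shows qtens_in [simp]: "qtens q q' \<in> Arr QG"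
    and qfun_qtens: "\<lbrakk>Suc 0 \<le> j; j \<le> qdom q + qdom q'\<rbrakk>
      \<Longrightarrow> qfun (qtens q q') j = (if j \<le> qdom q then qfun q j else qcod q + qfun q' (j - qdom q))"
    and qlb_qtens: "\<lbrakk>Suc 0 \<le> j; j \<le> qdom q + qdom q'\<rbrakk>
      \<Longrightarrow> qlb (qtens q q') j = (if j \<le> qdom q then qlb q j else qlb q' (j - qdom q))"
    and qlt_qtens: "\<lbrakk>Suc 0 \<le> i; i \<le> qdom q + qdom q'; Suc 0 \<le> j; j \<le> qdom q + qdom q'\<rbrakk>
      \<Longrightarrow> qlt (qtens q q') i j \<longleftrightarrow> i \<le> qdom q \<and> j \<le> qdom q \<and> qlt q i j \<or>
        qdom q < i \<and> qdom q < j \<and> qlt q' (i - qdom q) (j - qdom q)"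
proof -
  let ?n = "qdom q" and ?m = "qcod q" and ?n' = "qdom q'"
  have s1: "snd (qlab q) permutes {1..?n}" and s2: "snd (qlab q') permutes {1..?n'}"
    and p1: "qmap q \<in> HomD ?n ?m" and p2: "qmap q' \<in> HomD ?n' (qcod q')"
    using q1 q2 by (auto simp: Q_arr_iff)
  note jp = juxt_permutes [OF s1 s2]
  have in1: "snd (qlab q) j \<in> {1..?n} \<longleftrightarrow> j \<in> {1..?n}" and in2: "snd (qlab q') j \<in> {1..?n'} \<longleftrightarrow> j \<in> {1..?n'}" for j
    by (rule permutes_in_image [OF s1], rule permutes_in_image [OF s2])
  have r1: "Suc 0 \<le> qmap q j \<and> qmap q j \<le> ?m" if "Suc 0 \<le> j" "j \<le> ?n" for j using HomD_range [OF p1, of j] that by simp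
  have r2: "Suc 0 \<le> qmap q' j \<and> qmap q' j \<le> qcod q'" if "Suc 0 \<le> j" "j \<le> ?n'" for j using HomD_range [OF p2, of j] that by simp
  have "restrict (juxt ?n (qmap q) ((+) ?m) (qmap q')) {1..?n + ?n'} \<in> HomD (?n + ?n') (?m + qcod q')"
  proof (rule HomDI)
    fix j assume "j \<in> {1..?n + ?n'}"
    then show "restrict (juxt ?n (qmap q) ((+) ?m) (qmap q')) {1..?n + ?n'} j \<in> {1..?m + qcod q'}"
      using r1 [of j] r2 [of "j - ?n"] by (auto simp: juxt_def Suc_le_eq not_le le_diff_conv add.commute)
  next
    fix i j assume ij: "i \<in> {1..?n + ?n'}" "j \<in> {1..?n + ?n'}" "i \<le> j"
    have "\<lbrakk>Suc 0 \<le> i; i \<le> j; j \<le> ?n\<rbrakk> \<Longrightarrow> qmap q i \<le> qmap q j" using HomD_mono [OF p1, of i j] by simp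
    moreover have "\<lbrakk>?n < i; i \<le> j; j \<le> ?n + ?n'\<rbrakk> \<Longrightarrow> qmap q' (i - ?n) \<le> qmap q' (j - ?n)"
      using HomD_mono [OF p2, of "i - ?n" "j - ?n"] by simp
    ultimately show "restrict (juxt ?n (qmap q) ((+) ?m) (qmap q')) {1..?n + ?n'} i \<le>
        restrict (juxt ?n (qmap q) ((+) ?m) (qmap q')) {1..?n + ?n'} j"
      using r1 [of i] r2 [of "j - ?n"] ij by (auto simp: juxt_def)
  qed simp
  moreover have "qlb q j \<in> carrier G" if "Suc 0 \<le> j" "j \<le> ?n" for j using qlb_in [OF q1, of j] that by simp
  moreover have "qlb q' j \<in> carrier G" if "Suc 0 \<le> j" "j \<le> ?n'" for j using qlb_in [OF q2, of j] that by simp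
  ultimately show "qtens q q' \<in> Arr QG"
    using jp by (auto simp: Q_arr_iff qtens_def Let_def qlb_def) (auto simp: juxt_def qlb_def)
  have fn: "qfun (qtens q q') j = (if j \<le> qdom q then qfun q j else qcod q + qfun q' (j - qdom q))"
    if "Suc 0 \<le> j" "j \<le> ?n + ?n'" for j
    using that in1 [of j] in2 [of "j - ?n"] by (auto simp: qfun_def qtens_def Let_def juxt_def)
  show "qfun (qtens q q') j = (if j \<le> qdom q then qfun q j else qcod q + qfun q' (j - qdom q))"
    if "Suc 0 \<le> j" "j \<le> ?n + ?n'" for j using fn that .
  show "qlb (qtens q q') j = (if j \<le> qdom q then qlb q j else qlb q' (j - qdom q))"
    if "Suc 0 \<le> j" "j \<le> ?n + ?n'" for j using that by (simp add: qlb_def qtens_def Let_def juxt_def)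
  show "qlt (qtens q q') i j \<longleftrightarrow> i \<le> qdom q \<and> j \<le> qdom q \<and> qlt q i j \<or>
        qdom q < i \<and> qdom q < j \<and> qlt q' (i - qdom q) (j - qdom q)"
    if "Suc 0 \<le> i" "i \<le> ?n + ?n'" "Suc 0 \<le> j" "j \<le> ?n + ?n'" for i j
    unfolding qlt_def fn [OF that(1,2)] fn [OF that(3,4)]
    using that qfun_in [OF q1, of i] qfun_in [OF q1, of j] qfun_in [OF q2, of "i - ?n"] qfun_in [OF q2, of "j - ?n"]
    by (auto simp: qtens_def Let_def juxt_def Suc_le_eq not_le le_diff_conv add.commute)
qed

lemma split_sum_range:
  assumes "Suc 0 \<le> j" "j \<le> n + m"
  obtains "j \<le> n" | i where "j = n + i" "Suc 0 \<le> i" "i \<le> m"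
proof (cases "j \<le> n")
  case True
  then show thesis by (rule that(1))
next
  case False
  then show thesis using assms by (intro that(2) [of "j - n"]) auto
qed

lemma split_sum_range':
  "\<lbrakk>Suc 0 \<le> j; j \<le> n + m\<rbrakk> \<Longrightarrow> j \<le> n \<or> (\<exists>i. j = n + i \<and> Suc 0 \<le> i \<and> i \<le> m)"
  using split_sum_range by metis

lemma qtens_left [simp]:
  assumes "q \<in> Arr QG" "q' \<in> Arr QG" "Suc 0 \<le> j" "j \<le> qdom q"
  shows "qfun (qtens q q') j = qfun q j" "qlb (qtens q q') j = qlb q j"
    "\<lbrakk>Suc 0 \<le> i; i \<le> qdom q\<rbrakk> \<Longrightarrow> qlt (qtens q q') i j = qlt q i j"
    "\<lbrakk>qdom q = n; Suc 0 \<le> i; i \<le> qdom q'\<rbrakk> \<Longrightarrow> \<not> qlt (qtens q q') (n + i) j"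
    "\<lbrakk>qdom q = n; Suc 0 \<le> i; i \<le> qdom q'\<rbrakk> \<Longrightarrow> \<not> qlt (qtens q q') j (n + i)"
  using assms qfun_qtens [of q q' j] qlb_qtens [of q q' j] qlt_qtens [of q q' i j]
    qlt_qtens [of q q' "n + i" j] qlt_qtens [of q q' j "n + i"] by simp_all

lemma qtens_right [simp]:
  assumes "q \<in> Arr QG" "q' \<in> Arr QG" "qdom q = n" "Suc 0 \<le> j" "j \<le> qdom q'"
  shows "qfun (qtens q q') (n + j) = qcod q + qfun q' j" "qlb (qtens q q') (n + j) = qlb q' j"
    "\<lbrakk>Suc 0 \<le> i; i \<le> qdom q'\<rbrakk> \<Longrightarrow> qlt (qtens q q') (n + i) (n + j) = qlt q' i j"
  using assms qfun_qtens [of q q' "n + j"] qlb_qtens [of q q' "n + j"] qlt_qtens [of q q' "n + i" "n + j"] by simp_all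

lemma qiso_facts:
  assumes "x \<in> {1..n} \<rightarrow>\<^sub>E carrier G" "\<sigma> permutes {1..n}"
  shows "qiso n (x, \<sigma>) \<in> Arr QG" "qdom (qiso n (x, \<sigma>)) = n" "qcod (qiso n (x, \<sigma>)) = n"
    "\<lbrakk>Suc 0 \<le> j; j \<le> n\<rbrakk> \<Longrightarrow> qfun (qiso n (x, \<sigma>)) j = \<sigma> j"
    "qlb (qiso n (x, \<sigma>)) = x"
    "\<lbrakk>Suc 0 \<le> i; i \<le> n; Suc 0 \<le> j; j \<le> n\<rbrakk> \<Longrightarrow> \<not> qlt (qiso n (x, \<sigma>)) i j"
  using assms permutes_in_image [OF assms(2), of j] permutes_in_image [OF assms(2), of i]
    permutes_inj [OF assms(2)]
  by (auto simp: Q_arr_iff qiso_def HomD_def mono_on_def qfun_def qlb_def qlt_def inj_eq)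

lemma qmor_facts:
  assumes "\<phi> \<in> HomD n m"
  shows "qmor G n m \<phi> \<in> Arr QG" "qdom (qmor G n m \<phi>) = n" "qcod (qmor G n m \<phi>) = m"
    "qfun (qmor G n m \<phi>) j = \<phi> j"
    "\<lbrakk>Suc 0 \<le> j; j \<le> n\<rbrakk> \<Longrightarrow> qlb (qmor G n m \<phi>) j = \<one>"
    "qlt (qmor G n m \<phi>) i j \<longleftrightarrow> \<phi> i = \<phi> j \<and> i < j"
  using assms permutes_id [of "{1..n}"]
  by (auto simp: Q_arr_iff qmor_def HomD_def qfun_def qlb_def qlt_def lperm_group_def)

lemma qide_facts [simp]:
  "qide G n \<in> Arr QG" "qdom (qide G n) = n" "qcod (qide G n) = n"
  "\<lbrakk>Suc 0 \<le> j; j \<le> n\<rbrakk> \<Longrightarrow> qfun (qide G n) j = j"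
  "\<lbrakk>Suc 0 \<le> j; j \<le> n\<rbrakk> \<Longrightarrow> qlb (qide G n) j = \<one>"
  "\<lbrakk>Suc 0 \<le> i; i \<le> n; Suc 0 \<le> j; j \<le> n\<rbrakk> \<Longrightarrow> \<not> qlt (qide G n) i j"
  using qiso_facts [where x = "restrict (\<lambda>_. \<one>) {1..n}" and n = n and \<sigma> = id] permutes_id [of "{1..n}"]
  by (auto simp: qide_def lperm_group_def)

lemma block_perm_permutes: "block_perm n m permutes {1..n + m}"
proof (rule bij_imp_permutes)
  show "bij_betw (block_perm n m) {1..n + m} {1..n + m}"
    by (rule bij_betw_byWitness [where f' = "block_perm m n"]) (auto simp: block_perm_def)
qed (auto simp: block_perm_def)

lemma qsym_facts [simp]:
  "Sym QG n m \<in> Arr QG" "qdom (Sym QG n m) = n + m" "qcod (Sym QG n m) = n + m"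
  "\<lbrakk>Suc 0 \<le> j; j \<le> n\<rbrakk> \<Longrightarrow> qfun (Sym QG n m) j = m + j"
  "\<lbrakk>Suc 0 \<le> j; j \<le> m\<rbrakk> \<Longrightarrow> qfun (Sym QG n m) (n + j) = j"
  "\<lbrakk>Suc 0 \<le> j; j \<le> n + m\<rbrakk> \<Longrightarrow> qlb (Sym QG n m) j = \<one>"
  "\<lbrakk>Suc 0 \<le> i; i \<le> n + m; Suc 0 \<le> j; j \<le> n + m\<rbrakk> \<Longrightarrow> \<not> qlt (Sym QG n m) i j"
  using qiso_facts [where x = "restrict (\<lambda>_. \<one>) {1..n + m}" and n = "n + m" and \<sigma> = "block_perm n m", OF _ block_perm_permutes]
  by (auto simp: QPROP_def lperm_group_def) (auto simp: block_perm_def)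

lemma qlb_closed [simp]: "\<lbrakk>q \<in> Arr QG; Suc 0 \<le> j; j \<le> qdom q\<rbrakk> \<Longrightarrow> qlb q j \<in> carrier G"
  using qlb_in [of q G j] by simp

lemma qfun_range [simp]:
  "\<lbrakk>q \<in> Arr QG; Suc 0 \<le> j; j \<le> qdom q\<rbrakk> \<Longrightarrow> Suc 0 \<le> qfun q j"
  "\<lbrakk>q \<in> Arr QG; Suc 0 \<le> j; j \<le> qdom q; qcod q = m\<rbrakk> \<Longrightarrow> qfun q j \<le> m"
  using qfun_bounds [of q G j] by auto

lemmas Q_ext = Q_eqI [where G = G]

lemma QPROP_category: "category QG"
proof
  show "h \<cdot>\<^bsub>QPROP G\<^esub> g \<cdot>\<^bsub>QPROP G\<^esub> f = h \<cdot>\<^bsub>QPROP G\<^esub> (g \<cdot>\<^bsub>QPROP G\<^esub> f)"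
    if "f \<in> Hom QG W X" "g \<in> Hom QG X Y" "h \<in> Hom QG Y Z" for f g h W X Y Z
    unfolding QPROP_simps by (rule Q_ext) (use that in \<open>auto simp: Hom_def m_assoc\<close>)
  show "f \<cdot>\<^bsub>QPROP G\<^esub> Ide QG X = f" if "f \<in> Hom QG X Y" for f X Y
    unfolding QPROP_simps by (rule Q_ext) (use that in \<open>auto simp: Hom_def\<close>)
  show "Ide QG Y \<cdot>\<^bsub>QPROP G\<^esub> f = f" if "f \<in> Hom QG X Y" for f X Y
    unfolding QPROP_simps by (rule Q_ext) (use that in \<open>auto simp: Hom_def\<close>)
qed (auto simp: Hom_def)

end

section \<open>The PROP axioms for \<open>Q\<close>\<close>

context group
begin

text \<open>A case split for two indices of a juxtaposition. Indices of the second block appear as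
  \<open>n + j'\<close>, the pattern on which the rules \<open>qtens_right\<close> act.\<close>

lemma sum_range_cases2:
  assumes "Suc 0 \<le> i" "i \<le> n + m" "Suc 0 \<le> j" "j \<le> n + m"
    and "i \<le> n \<Longrightarrow> j \<le> n \<Longrightarrow> P i j"
    and "\<And>j'. i \<le> n \<Longrightarrow> Suc 0 \<le> j' \<Longrightarrow> j' \<le> m \<Longrightarrow> P i (n + j')"
    and "\<And>i'. Suc 0 \<le> i' \<Longrightarrow> i' \<le> m \<Longrightarrow> j \<le> n \<Longrightarrow> P (n + i') j"
    and "\<And>i' j'. Suc 0 \<le> i' \<Longrightarrow> i' \<le> m \<Longrightarrow> Suc 0 \<le> j' \<Longrightarrow> j' \<le> m \<Longrightarrow> P (n + i') (n + j')"
  shows "P i j"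
  using assms split_sum_range' by metis

lemma sum_range_cases:
  assumes "Suc 0 \<le> j" "j \<le> n + m" and "j \<le> n \<Longrightarrow> P j"
    and "\<And>j'. Suc 0 \<le> j' \<Longrightarrow> j' \<le> m \<Longrightarrow> P (n + j')"
  shows "P j"
  using assms split_sum_range' by metis

lemma qtens_assoc:
  assumes fgh: "f \<in> Arr QG" "g \<in> Arr QG" "h \<in> Arr QG"
  shows "qtens (qtens f g) h = qtens f (qtens g h)"
proof (rule Q_ext)
  have fg: "qtens f g \<in> Arr QG" "qdom (qtens f g) = qdom f + qdom g" using fgh by simp_all
  \<comment> \<open>Indices of the third factor have to be regrouped from \<open>(p + q) + k\<close>
    to \<open>p + (q + k)\<close> before the two bracketings can be compared.\<close>
  have R: "qfun (qtens (qtens f g) h) (qdom f + (qdom g + k)) = qcod f + (qcod g + qfun h k)"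
    "qlb (qtens (qtens f g) h) (qdom f + (qdom g + k)) = qlb h k"
    if "Suc 0 \<le> k" "k \<le> qdom h" for k
    using qtens_right(1,2) [OF fg(1) fgh(3) fg(2) that] by (simp_all add: add.assoc)
  have RL: "qlt (qtens (qtens f g) h) (qdom f + (qdom g + k)) (qdom f + (qdom g + l)) = qlt h k l"
    if "Suc 0 \<le> k" "k \<le> qdom h" "Suc 0 \<le> l" "l \<le> qdom h" for k l
    using qtens_right(3) [OF fg(1) fgh(3) fg(2) that(3,4,1,2)] by (simp add: add.assoc)
  have RR: "\<not> qlt (qtens (qtens f g) h) j (qdom f + (qdom g + k))" "\<not> qlt (qtens (qtens f g) h) (qdom f + (qdom g + k)) j"
    if "Suc 0 \<le> k" "k \<le> qdom h" and j: "Suc 0 \<le> j" "j \<le> qdom f + qdom g" for k j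
    using qtens_left(4,5) [OF fg(1) fgh(3) j(1) _ fg(2) that(1,2)] j(2) fg(2) by (simp_all add: add.assoc)
  fix j assume "Suc 0 \<le> j" "j \<le> qdom (qtens f (qtens g h))"
  then have j: "Suc 0 \<le> j" "j \<le> qdom f + (qdom g + qdom h)" by simp_all
  show "qfun (qtens (qtens f g) h) j = qfun (qtens f (qtens g h)) j"
  proof (rule sum_range_cases [OF j])
    fix j' assume j': "Suc 0 \<le> j'" "j' \<le> qdom g + qdom h"
    show "qfun (qtens (qtens f g) h) (qdom f + j') = qfun (qtens f (qtens g h)) (qdom f + j')"
      by (rule sum_range_cases [OF j']) (use fgh j' R in simp_all)
  qed (use fgh j in simp)
  show "qlb (qtens (qtens f g) h) j = qlb (qtens f (qtens g h)) j"
  proof (rule sum_range_cases [OF j])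
    fix j' assume j': "Suc 0 \<le> j'" "j' \<le> qdom g + qdom h"
    show "qlb (qtens (qtens f g) h) (qdom f + j') = qlb (qtens f (qtens g h)) (qdom f + j')"
      by (rule sum_range_cases [OF j']) (use fgh j' R in simp_all)
  qed (use fgh j in simp)
  fix i assume "Suc 0 \<le> i" "i \<le> qdom (qtens f (qtens g h))"
  then have i: "Suc 0 \<le> i" "i \<le> qdom f + (qdom g + qdom h)" by simp_all
  show "qlt (qtens (qtens f g) h) i j = qlt (qtens f (qtens g h)) i j"
  proof (rule sum_range_cases2 [OF i j])
    fix j' assume j': "i \<le> qdom f" "Suc 0 \<le> j'" "j' \<le> qdom g + qdom h"
    show "qlt (qtens (qtens f g) h) i (qdom f + j') = qlt (qtens f (qtens g h)) i (qdom f + j')"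
      by (rule sum_range_cases [OF j'(2,3)]) (use fgh i j' RR in simp_all)
  next
    fix j' assume j': "Suc 0 \<le> j'" "j' \<le> qdom g + qdom h" "j \<le> qdom f"
    show "qlt (qtens (qtens f g) h) (qdom f + j') j = qlt (qtens f (qtens g h)) (qdom f + j') j"
      by (rule sum_range_cases [OF j'(1,2)]) (use fgh j j' RR in simp_all)
  next
    fix i' j' assume i': "Suc 0 \<le> i'" "i' \<le> qdom g + qdom h" and j': "Suc 0 \<le> j'" "j' \<le> qdom g + qdom h"
    show "qlt (qtens (qtens f g) h) (qdom f + i') (qdom f + j') = qlt (qtens f (qtens g h)) (qdom f + i') (qdom f + j')"
      by (rule sum_range_cases2 [OF i' j']) (use fgh i' j' RR RL in simp_all)
  qed (use fgh i j in simp)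
qed (use fgh in auto)

lemma Q_interchange:
  assumes a: "f \<in> Arr QG" "f' \<in> Arr QG" "g \<in> Arr QG" "g' \<in> Arr QG"
    "qcod f = qdom f'" "qcod g = qdom g'"
  shows "qcomp G (qtens f' g') (qtens f g) = qtens (qcomp G f' f) (qcomp G g' g)"
proof (rule Q_ext)
  let ?l = "qcomp G (qtens f' g') (qtens f g)" and ?r = "qtens (qcomp G f' f) (qcomp G g' g)"
  fix j assume "Suc 0 \<le> j" "j \<le> qdom ?r"
  then have j: "Suc 0 \<le> j" "j \<le> qdom f + qdom g" by simp_all
  show "qfun ?l j = qfun ?r j" by (rule sum_range_cases [OF j]) (use a j in simp_all)
  show "qlb ?l j = qlb ?r j" by (rule sum_range_cases [OF j]) (use a j in simp_all)
  fix i assume "Suc 0 \<le> i" "i \<le> qdom ?r"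
  then have i: "Suc 0 \<le> i" "i \<le> qdom f + qdom g" by simp_all
  show "qlt ?l i j = qlt ?r i j" by (rule sum_range_cases2 [OF i j]) (use a i j in simp_all)
qed (use a in auto)

lemma Q_sym_nat:
  assumes a: "f \<in> Arr QG" "g \<in> Arr QG"
  shows "qcomp G (Sym QG (qcod f) (qcod g)) (qtens f g) = qcomp G (qtens g f) (Sym QG (qdom f) (qdom g))"
proof (rule Q_ext)
  let ?l = "qcomp G (Sym QG (qcod f) (qcod g)) (qtens f g)"
  let ?r = "qcomp G (qtens g f) (Sym QG (qdom f) (qdom g))"
  have e: "qdom (qtens g f) = qdom f + qdom g" by simp
  fix j assume "Suc 0 \<le> j" "j \<le> qdom ?r"
  then have j: "Suc 0 \<le> j" "j \<le> qdom f + qdom g" by simp_all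
  show "qfun ?l j = qfun ?r j" by (rule sum_range_cases [OF j]) (use a j e in \<open>simp_all add: trans_le_add1 trans_le_add2\<close>)
  show "qlb ?l j = qlb ?r j" by (rule sum_range_cases [OF j]) (use a j e in \<open>simp_all add: trans_le_add1 trans_le_add2\<close>)
  fix i assume "Suc 0 \<le> i" "i \<le> qdom ?r"
  then have i: "Suc 0 \<le> i" "i \<le> qdom f + qdom g" by simp_all
  show "qlt ?l i j = qlt ?r i j"
    by (rule sum_range_cases2 [OF i j]) (use a i j e in \<open>simp_all add: trans_le_add1 trans_le_add2\<close>)
qed (use a in auto)

lemma Q_sym_sym: "qcomp G (Sym QG m n) (Sym QG n m) = qide G (n + m)"
proof (rule Q_ext)
  let ?l = "qcomp G (Sym QG m n) (Sym QG n m)"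
  fix j assume "Suc 0 \<le> j" "j \<le> qdom (qide G (n + m))"
  then have j: "Suc 0 \<le> j" "j \<le> n + m" by simp_all
  show "qfun ?l j = qfun (qide G (n + m)) j" by (rule sum_range_cases [OF j]) (use j in simp_all)
  show "qlb ?l j = qlb (qide G (n + m)) j" by (rule sum_range_cases [OF j]) (use j in simp_all)
  fix i assume "Suc 0 \<le> i" "i \<le> qdom (qide G (n + m))"
  then have i: "Suc 0 \<le> i" "i \<le> n + m" by simp_all
  show "qlt ?l i j = qlt (qide G (n + m)) i j"
    by (rule sum_range_cases2 [OF i j]) (use i j in simp_all)
qed auto

lemma Q_sym_hex:
  "Sym QG x (y + z) = qcomp G (qtens (qide G y) (Sym QG x z)) (qtens (Sym QG x y) (qide G z))"
proof (rule Q_ext)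
  let ?l = "Sym QG x (y + z)"
  let ?r = "qcomp G (qtens (qide G y) (Sym QG x z)) (qtens (Sym QG x y) (qide G z))"
  have d: "qdom (Sym QG x y) = x + y" "Sym QG x y \<in> Arr QG" "qide G z \<in> Arr QG" "qdom (qide G z) = z"
    "qdom (qide G y) = y" "Sym QG x z \<in> Arr QG" "qide G y \<in> Arr QG" "qdom (Sym QG x z) = x + z" by simp_all
  show "?l \<in> Arr QG" "?r \<in> Arr QG" "qdom ?l = qdom ?r" "qcod ?l = qcod ?r" by simp_all
  have r1: "qfun ?r k = qfun ?l k" if "Suc 0 \<le> k" "k \<le> x" for k using that by (simp add: trans_le_add1)
  have r2: "qfun ?r (x + k) = qfun ?l (x + k)" if "Suc 0 \<le> k" "k \<le> y" for k using that by (simp add: trans_le_add1)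
  have r3: "qfun ?r (x + (y + k)) = qfun ?l (x + (y + k))" if "Suc 0 \<le> k" "k \<le> z" for k
  proof -
    have "qfun (qtens (Sym QG x y) (qide G z)) (x + (y + k)) = y + (x + k)"
      using qtens_right(1) [OF d(2,3,1) that(1)] that by (simp add: add.assoc add.left_commute)
    then show ?thesis using that by simp
  qed
  fix j assume "Suc 0 \<le> j" "j \<le> qdom ?r"
  then have j: "Suc 0 \<le> j" "j \<le> x + (y + z)" by simp_all
  have f: "qfun ?l k = qfun ?r k" if "Suc 0 \<le> k" "k \<le> x + (y + z)" for k
  proof (rule sum_range_cases [OF that])
    fix j' assume j': "Suc 0 \<le> j'" "j' \<le> y + z"
    show "qfun ?l (x + j') = qfun ?r (x + j')"
      by (rule sum_range_cases [OF j']) (use r2 r3 j' in auto)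
  qed (use r1 that in auto)
  show "qfun ?l j = qfun ?r j" using f j by blast
  have q: "Suc 0 \<le> qfun (qtens (Sym QG x y) (qide G z)) j \<and> qfun (qtens (Sym QG x y) (qide G z)) j \<le> y + (x + z)"
    using qfun_in [of "qtens (Sym QG x y) (qide G z)" G j] j by simp
  have q1: "qlb (qtens (Sym QG x y) (qide G z)) k = \<one>" if "Suc 0 \<le> k" "k \<le> (x + y) + z" for k
    by (rule sum_range_cases [OF that]) (use that in \<open>simp_all add: d(1)\<close>)
  have q2: "qlb (qtens (qide G y) (Sym QG x z)) k = \<one>" if "Suc 0 \<le> k" "k \<le> y + (x + z)" for k
    by (rule sum_range_cases [OF that]) (use that in simp_all)
  show "qlb ?l j = qlb ?r j" using j q q1 [of j] q2 by (simp add: add.assoc)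
  fix i assume "Suc 0 \<le> i" "i \<le> qdom ?r" and e: "qfun ?r i = qfun ?r j"
  then have i: "Suc 0 \<le> i" "i \<le> x + (y + z)" by simp_all
  \<comment> \<open>The underlying map is injective, so fibre orders are only compared at equal
    indices, where both sides are false.\<close>
  have "qfun ?l i = qfun ?l j \<longrightarrow> i = j"
    by (rule sum_range_cases2 [OF i j]) (use i j in simp_all)
  then have "i = j" using e f [OF i] f [OF j] by simp
  then show "qlt ?l i j = qlt ?r i j" by (simp del: qlt_qcomp)
qed

lemma QPROP_is_PROP: "is_PROP QG"
proof (rule is_PROP_intro)
  show "category QG" by (rule QPROP_category)
  show "Ide QG n \<odot>\<^bsub>QPROP G\<^esub> Ide QG m = Ide QG (n + m)" for n m
    unfolding QPROP_simps by (rule Q_ext) (auto simp: qfun_qtens qlb_qtens qlt_qtens)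
  show "Ide QG 0 \<odot>\<^bsub>QPROP G\<^esub> f = f" "f \<odot>\<^bsub>QPROP G\<^esub> Ide QG 0 = f"
    if "f \<in> Arr QG" for f
    unfolding QPROP_simps by (rule Q_ext; use that in \<open>auto simp: qfun_qtens qlb_qtens qlt_qtens\<close>)+
qed (auto simp: Hom_def qtens_assoc Q_interchange Q_sym_nat Q_sym_sym Q_sym_hex)

end

sublocale group \<subseteq> Q: is_PROP "QPROP G" by (rule QPROP_is_PROP)

section \<open>Pullback squares in \<open>Q\<close>\<close>

context group
begin

lemmas Q_assoc = Q.assoc_arr [unfolded QPROP_simps]
lemmas Q_inverse_iff = Q.inverse_arrows_iff [unfolded QPROP_simps]

lemma Q_unit [simp]:
  "\<lbrakk>q \<in> Arr QG; qdom q = n\<rbrakk> \<Longrightarrow> qcomp G q (qide G n) = q"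
  "\<lbrakk>q \<in> Arr QG; qcod q = n\<rbrakk> \<Longrightarrow> qcomp G (qide G n) q = q"
  using Q.comp_ide_arr [of q n] Q.ide_comp_arr [of q n] by simp_all

text \<open>A bijective underlying map has one-point fibres, which carry no order. The inverse map
  with the inverse labels is then an inverse arrow.\<close>

lemma Q_isoI:
  assumes h: "h \<in> Arr QG" and b: "bij_betw (qfun h) {1..qdom h} {1..qcod h}"
  obtains k where "inverse_arrows QG h k"
proof -
  have d: "qdom h = qcod h" using bij_betw_same_card [OF b] by simp
  define e where "e = inv_into {1..qdom h} (qfun h)"
  have e: "e i \<in> {1..qdom h}" "qfun h (e i) = i" if "i \<in> {1..qdom h}" for i
    using that b d unfolding e_def by (metis bij_betw_def inv_into_into) (metis bij_betw_inv_into_right b d that)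
  have e': "e (qfun h j) = j" if "j \<in> {1..qdom h}" for j
    using that b unfolding e_def by (metis bij_betw_inv_into_left)
  obtain k where k: "k \<in> Arr QG" "qdom k = qdom h" "qcod k = qdom h"
    and kf: "\<And>j. j \<in> {1..qdom h} \<Longrightarrow> qfun k j = e j"
    and kx: "\<And>j. j \<in> {1..qdom h} \<Longrightarrow> qlb k j = inv (qlb h (e j))"
    and kl: "\<And>i j. \<lbrakk>i \<in> {1..qdom h}; j \<in> {1..qdom h}\<rbrakk> \<Longrightarrow> qlt k i j \<longleftrightarrow> e i = e j \<and> False"
  proof (rule Q_exists [of e "qdom h" "qdom h" "\<lambda>j. inv (qlb h (e j))" G "\<lambda>_ _. False"])
    show "e \<in> {1..qdom h} \<rightarrow> {1..qdom h}" using e by blast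
    show "(\<lambda>j. inv qlb h (e j)) \<in> {1..qdom h} \<rightarrow> carrier G" using e(1) qlb_in [OF h] by auto
    show "False \<or> False" if "i \<in> {1..qdom h}" "j \<in> {1..qdom h}" "i \<noteq> j" "e i = e j" for i j
      using that e(2) by metis
  qed auto
  have hl: "\<not> qlt h i j" if "i \<in> {1..qdom h}" "j \<in> {1..qdom h}" for i j
    using that e' qlt_fun [of h i j] qlt_irrefl by metis
  have hf: "qfun h j \<in> {1..qdom h}" if "j \<in> {1..qdom h}" for j using qfun_in [OF h that] d by simp
  have "qcomp G k h = qide G (qdom h)"
  proof (rule Q_ext)
    fix j assume "Suc 0 \<le> j" "j \<le> qdom (qide G (qdom h))"
    then have j: "j \<in> {1..qdom h}" by simp
    then show "qfun (qcomp G k h) j = qfun (qide G (qdom h)) j" "qlb (qcomp G k h) j = qlb (qide G (qdom h)) j"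
      using h k d kf [OF hf [OF j]] kx [OF hf [OF j]] e' [OF j] by simp_all
  next
    fix i j assume "Suc 0 \<le> i" "i \<le> qdom (qide G (qdom h))" "Suc 0 \<le> j" "j \<le> qdom (qide G (qdom h))"
    then have ij: "i \<in> {1..qdom h}" "j \<in> {1..qdom h}" by simp_all
    then show "qlt (qcomp G k h) i j = qlt (qide G (qdom h)) i j"
      using h k d kl [OF hf hf, of i j] hl [of i j] by simp
  qed (use h k d in simp_all)
  moreover have "qcomp G h k = qide G (qdom h)"
  proof (rule Q_ext)
    fix j assume "Suc 0 \<le> j" "j \<le> qdom (qide G (qdom h))"
    then have j: "j \<in> {1..qdom h}" by simp
    then show "qfun (qcomp G h k) j = qfun (qide G (qdom h)) j" "qlb (qcomp G h k) j = qlb (qide G (qdom h)) j"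
      using h k d kf [OF j] kx [OF j] e [OF j] by simp_all
  next
    fix i j assume "Suc 0 \<le> i" "i \<le> qdom (qide G (qdom h))" "Suc 0 \<le> j" "j \<le> qdom (qide G (qdom h))"
    then have ij: "i \<in> {1..qdom h}" "j \<in> {1..qdom h}" by simp_all
    then show "qlt (qcomp G h k) i j = qlt (qide G (qdom h)) i j"
      using h k d kl [OF ij] kf [OF ij(1)] kf [OF ij(2)] hl [OF e(1) e(1), of i j] by simp
  qed (use h k d in simp_all)
  ultimately show thesis using h k d by (intro that [of k]) (simp add: Q_inverse_iff)
qed

text \<open>Converse of \<open>Q_isoI\<close>: the underlying map of an inverse arrow inverts the
  underlying map, and by injectivity no two points of the source are related by
  \<open>qlt\<close>.\<close>

lemma Q_iso_facts:
  assumes h: "is_iso QG h"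
  shows "h \<in> Arr QG" "bij_betw (qfun h) {1..qdom h} {1..qcod h}"
    "\<lbrakk>i \<in> {1..qdom h}; j \<in> {1..qdom h}; qfun h i = qfun h j\<rbrakk> \<Longrightarrow> i = j"
    "\<lbrakk>i \<in> {1..qdom h}; j \<in> {1..qdom h}\<rbrakk> \<Longrightarrow> \<not> qlt h i j"
proof -
  obtain k where k: "inverse_arrows QG h k" using h by (auto simp: is_iso_def)
  then show a: "h \<in> Arr QG" by (simp add: Q_inverse_iff)
  have k': "k \<in> Arr QG" "qdom k = qcod h" "qcod k = qdom h" "qcomp G k h = qide G (qdom h)" "qcomp G h k = qide G (qcod h)"
    using k by (simp_all add: Q_inverse_iff)
  have 1: "qfun k (qfun h j) = j" if "j \<in> {1..qdom h}" for j
  proof -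
    have "qfun (qcomp G k h) j = qfun k (qfun h j)" using that a k'(1-3) by simp
    then show ?thesis using k'(4) that by simp
  qed
  have 2: "qfun h (qfun k j) = j" if "j \<in> {1..qcod h}" for j
  proof -
    have "qfun (qcomp G h k) j = qfun h (qfun k j)" using that a k'(1-3) by simp
    then show ?thesis using k'(5) that by simp
  qed
  show b: "bij_betw (qfun h) {1..qdom h} {1..qcod h}"
  proof (rule bij_betw_byWitness [where f' = "qfun k"])
    show "qfun h ` {1..qdom h} \<subseteq> {1..qcod h}" using qfun_in [OF a] by blast
    show "qfun k ` {1..qcod h} \<subseteq> {1..qdom h}" using qfun_in [OF k'(1)] k' by auto
  qed (use 1 2 in blast)+
  show inj: "i = j" if "i \<in> {1..qdom h}" "j \<in> {1..qdom h}" "qfun h i = qfun h j" for i j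
    using that 1 by metis
  show "\<not> qlt h i j" if "i \<in> {1..qdom h}" "j \<in> {1..qdom h}"
    using inj [OF that] qlt_fun [of h i j] qlt_irrefl by metis
qed

text \<open>The fibre product of the underlying maps, commuting on labels. In the last two
  conditions each leg takes its fibre order from the opposite leg. The square need not commute in
  \<open>Q\<close>: \<open>b x\<close> and \<open>c y\<close> induce the two lexicographic orders on
  the pairs over a point.\<close>

definition PB :: "'a qarr \<Rightarrow> 'a qarr \<Rightarrow> 'a qarr \<Rightarrow> 'a qarr \<Rightarrow> bool" where
  "PB b c x y \<longleftrightarrow> b \<in> Arr QG \<and> c \<in> Arr QG \<and> x \<in> Arr QG \<and> y \<in> Arr QG \<and>
     qcod b = qcod c \<and> qdom x = qdom y \<and> qcod x = qdom b \<and> qcod y = qdom c \<and>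
     (\<forall>t\<in>{1..qdom y}. qfun b (qfun x t) = qfun c (qfun y t)) \<and>
     (\<forall>t\<in>{1..qdom y}. qlb b (qfun x t) \<otimes> qlb x t = qlb c (qfun y t) \<otimes> qlb y t) \<and>
     (\<forall>i\<in>{1..qdom b}. \<forall>j\<in>{1..qdom c}. qfun b i = qfun c j \<longrightarrow> (\<exists>t\<in>{1..qdom y}. qfun x t = i \<and> qfun y t = j)) \<and>
     (\<forall>s\<in>{1..qdom y}. \<forall>t\<in>{1..qdom y}. qfun x s = qfun x t \<longrightarrow> qfun y s = qfun y t \<longrightarrow> s = t) \<and>
     (\<forall>s\<in>{1..qdom y}. \<forall>t\<in>{1..qdom y}. qlt x s t \<longleftrightarrow> qfun x s = qfun x t \<and> qlt c (qfun y s) (qfun y t)) \<and>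
     (\<forall>s\<in>{1..qdom y}. \<forall>t\<in>{1..qdom y}. qlt y s t \<longleftrightarrow> qfun y s = qfun y t \<and> qlt b (qfun x s) (qfun x t))"

lemma PB_facts:
  assumes "PB b c x y"
  shows "b \<in> Arr QG" "c \<in> Arr QG" "x \<in> Arr QG" "y \<in> Arr QG"
    "qcod b = qcod c" "qdom x = qdom y" "qcod x = qdom b" "qcod y = qdom c"
    "t \<in> {1..qdom y} \<Longrightarrow> qfun b (qfun x t) = qfun c (qfun y t)"
    "t \<in> {1..qdom y} \<Longrightarrow> qlb b (qfun x t) \<otimes> qlb x t = qlb c (qfun y t) \<otimes> qlb y t"
    "\<lbrakk>i \<in> {1..qdom b}; j \<in> {1..qdom c}; qfun b i = qfun c j\<rbrakk> \<Longrightarrow> \<exists>t\<in>{1..qdom y}. qfun x t = i \<and> qfun y t = j"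
    "\<lbrakk>s \<in> {1..qdom y}; t \<in> {1..qdom y}; qfun x s = qfun x t; qfun y s = qfun y t\<rbrakk> \<Longrightarrow> s = t"
    "\<lbrakk>s \<in> {1..qdom y}; t \<in> {1..qdom y}\<rbrakk> \<Longrightarrow> qlt x s t \<longleftrightarrow> qfun x s = qfun x t \<and> qlt c (qfun y s) (qfun y t)"
    "\<lbrakk>s \<in> {1..qdom y}; t \<in> {1..qdom y}\<rbrakk> \<Longrightarrow> qlt y s t \<longleftrightarrow> qfun y s = qfun y t \<and> qlt b (qfun x s) (qfun x t)"
    "t \<in> {1..qdom y} \<Longrightarrow> qfun x t \<in> {1..qdom b}"
    "t \<in> {1..qdom y} \<Longrightarrow> qfun y t \<in> {1..qdom c}"
  using assms qfun_in [of x G t] qfun_in [of y G t] unfolding PB_def by (blast, blast, blast, blast, metis+)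

lemma PB_I:
  assumes "b \<in> Arr QG" "c \<in> Arr QG" "x \<in> Arr QG" "y \<in> Arr QG"
    "qcod b = qcod c" "qdom x = qdom y" "qcod x = qdom b" "qcod y = qdom c"
    "\<And>t. t \<in> {1..qdom y} \<Longrightarrow> qfun b (qfun x t) = qfun c (qfun y t)"
    "\<And>t. t \<in> {1..qdom y} \<Longrightarrow> qlb b (qfun x t) \<otimes> qlb x t = qlb c (qfun y t) \<otimes> qlb y t"
    "\<And>i j. \<lbrakk>i \<in> {1..qdom b}; j \<in> {1..qdom c}; qfun b i = qfun c j\<rbrakk> \<Longrightarrow> \<exists>t\<in>{1..qdom y}. qfun x t = i \<and> qfun y t = j"
    "\<And>s t. \<lbrakk>s \<in> {1..qdom y}; t \<in> {1..qdom y}; qfun x s = qfun x t; qfun y s = qfun y t\<rbrakk> \<Longrightarrow> s = t"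
    "\<And>s t. \<lbrakk>s \<in> {1..qdom y}; t \<in> {1..qdom y}\<rbrakk> \<Longrightarrow> qlt x s t \<longleftrightarrow> qfun x s = qfun x t \<and> qlt c (qfun y s) (qfun y t)"
    "\<And>s t. \<lbrakk>s \<in> {1..qdom y}; t \<in> {1..qdom y}\<rbrakk> \<Longrightarrow> qlt y s t \<longleftrightarrow> qfun y s = qfun y t \<and> qlt b (qfun x s) (qfun x t)"
  shows "PB b c x y"
  unfolding PB_def by (intro conjI ballI impI; rule assms; assumption)

lemma PB_sym:
  assumes "PB b c x y"
  shows "PB c b y x"
proof -
  note p = PB_facts [OF assms]
  have d: "qdom y = qdom x" using p(6) by simp
  note p' = p(9-16) [unfolded d]
  show ?thesis
  proof (rule PB_I)
    show "\<exists>t\<in>{1..qdom x}. qfun y t = i \<and> qfun x t = j"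
      if "i \<in> {1..qdom c}" "j \<in> {1..qdom b}" "qfun c i = qfun b j" for i j
      using p'(3) [OF that(2,1) that(3) [symmetric]] by blast
    show "s = t" if "s \<in> {1..qdom x}" "t \<in> {1..qdom x}" "qfun y s = qfun y t" "qfun x s = qfun x t" for s t
      by (rule p'(4) [OF that(1,2,4,3)])
  qed (fact p(1-4,7,8) p(5,6) [symmetric] | rule p'(1,2) [symmetric] p'(5,6), assumption+)+
qed

text \<open>The apex is an arbitrary enumeration of the matching pairs; \<open>PB_unique\<close>
  shows that the choice only affects the span up to equivalence.\<close>

lemma PB_exists:
  assumes b: "b \<in> Arr QG" and c: "c \<in> Arr QG" and e: "qcod b = qcod c"
  obtains x y where "PB b c x y"
proof -
  define M where "M = {(i, j). i \<in> {1..qdom b} \<and> j \<in> {1..qdom c} \<and> qfun b i = qfun c j}"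
  have "M \<subseteq> {1..qdom b} \<times> {1..qdom c}" by (auto simp: M_def)
  then have "finite M" by (rule finite_subset) simp
  then obtain e where e: "bij_betw e {1..card M} M" using ex_bij_betw_nat_finite_1 by blast
  define r where "r = card M"
  define f where "f t = fst (e t)" for t
  define g where "g t = snd (e t)" for t
  have em: "f t \<in> {1..qdom b}" "g t \<in> {1..qdom c}" "qfun b (f t) = qfun c (g t)" if "t \<in> {1..r}" for t
  proof -
    have "e t \<in> M" using e that by (auto simp: bij_betw_def r_def)
    then show "f t \<in> {1..qdom b}" "g t \<in> {1..qdom c}" "qfun b (f t) = qfun c (g t)"
      by (auto simp: M_def f_def g_def)
  qed
  have ei: "s = t" if "s \<in> {1..r}" "t \<in> {1..r}" "f s = f t" "g s = g t" for s t
    using e that unfolding bij_betw_def inj_on_def r_def f_def g_def by (metis prod_eqI)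
  have es: "\<exists>t\<in>{1..r}. f t = i \<and> g t = j" if "i \<in> {1..qdom b}" "j \<in> {1..qdom c}" "qfun b i = qfun c j" for i j
  proof -
    have "(i, j) \<in> M" using that by (simp add: M_def)
    then obtain t where "t \<in> {1..r}" "e t = (i, j)" using e unfolding bij_betw_def r_def by (metis imageE)
    then show ?thesis by (intro bexI [of _ t]) (simp_all add: f_def g_def)
  qed
  \<comment> \<open>With inverse labels both sides of the label condition become the unit. The order
    on a fibre of \<open>x\<close> is total, because two pairs with the same first entry have
    distinct second entries in a common fibre of \<open>c\<close>.\<close>
  obtain x where x: "x \<in> Arr QG" "qdom x = r" "qcod x = qdom b"
    "\<And>j. j \<in> {1..r} \<Longrightarrow> qfun x j = f j" "\<And>j. j \<in> {1..r} \<Longrightarrow> qlb x j = inv (qlb b (f j))"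
    "\<And>i j. \<lbrakk>i \<in> {1..r}; j \<in> {1..r}\<rbrakk> \<Longrightarrow> qlt x i j \<longleftrightarrow> f i = f j \<and> qlt c (g i) (g j)"
  proof (rule Q_exists [of f r "qdom b" "\<lambda>j. inv (qlb b (f j))" G "\<lambda>i j. qlt c (g i) (g j)"])
    show "f \<in> {1..r} \<rightarrow> {1..qdom b}" using em by blast
    show "(\<lambda>j. inv qlb b (f j)) \<in> {1..r} \<rightarrow> carrier G" using em(1) qlb_in [OF b] by blast
    show "qlt c (g i) (g j) \<or> qlt c (g j) (g i)" if "i \<in> {1..r}" "j \<in> {1..r}" "i \<noteq> j" "f i = f j" for i j
      using qlt_total [OF c, of "g i" "g j"] em(3) [OF that(1)] em(3) [OF that(2)] ei [OF that(1,2)] that(3,4) by auto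
  qed (auto intro: qlt_trans)
  obtain y where y: "y \<in> Arr QG" "qdom y = r" "qcod y = qdom c"
    "\<And>j. j \<in> {1..r} \<Longrightarrow> qfun y j = g j" "\<And>j. j \<in> {1..r} \<Longrightarrow> qlb y j = inv (qlb c (g j))"
    "\<And>i j. \<lbrakk>i \<in> {1..r}; j \<in> {1..r}\<rbrakk> \<Longrightarrow> qlt y i j \<longleftrightarrow> g i = g j \<and> qlt b (f i) (f j)"
  proof (rule Q_exists [of g r "qdom c" "\<lambda>j. inv (qlb c (g j))" G "\<lambda>i j. qlt b (f i) (f j)"])
    show "g \<in> {1..r} \<rightarrow> {1..qdom c}" using em by blast
    show "(\<lambda>j. inv qlb c (g j)) \<in> {1..r} \<rightarrow> carrier G" using em(2) qlb_in [OF c] by blast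
    show "qlt b (f i) (f j) \<or> qlt b (f j) (f i)" if "i \<in> {1..r}" "j \<in> {1..r}" "i \<noteq> j" "g i = g j" for i j
      using qlt_total [OF b, of "f i" "f j"] em(3) [OF that(1)] em(3) [OF that(2)] ei [OF that(1,2)] that(3,4) by auto
  qed (auto intro: qlt_trans)
  have "PB b c x y"
  proof (rule PB_I)
    fix t assume "t \<in> {1..qdom y}"
    then have t: "t \<in> {1..r}" using y(2) by simp
    show "qfun b (qfun x t) = qfun c (qfun y t)" using x(4) [OF t] y(4) [OF t] em(3) [OF t] by simp
    show "qlb b (qfun x t) \<otimes> qlb x t = qlb c (qfun y t) \<otimes> qlb y t"
      using x(4,5) [OF t] y(4,5) [OF t] qlb_in [OF b em(1) [OF t]] qlb_in [OF c em(2) [OF t]] by simp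
  next
    fix i j assume "i \<in> {1..qdom b}" "j \<in> {1..qdom c}" "qfun b i = qfun c j"
    from es [OF this] show "\<exists>t\<in>{1..qdom y}. qfun x t = i \<and> qfun y t = j" using x(4) y(2,4) by auto
  next
    fix s t assume "s \<in> {1..qdom y}" "t \<in> {1..qdom y}"
    then have st: "s \<in> {1..r}" "t \<in> {1..r}" using y(2) by simp_all
    show "s = t" if "qfun x s = qfun x t" "qfun y s = qfun y t" using that ei [OF st] x(4) y(4) st by simp
    show "qlt x s t \<longleftrightarrow> qfun x s = qfun x t \<and> qlt c (qfun y s) (qfun y t)"
      using x(4,6) y(4) st by simp
    show "qlt y s t \<longleftrightarrow> qfun y s = qfun y t \<and> qlt b (qfun x s) (qfun x t)"
      using x(4) y(4,6) st by simp
  qed (use b c x y \<open>qcod b = qcod c\<close> in simp_all)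
  then show thesis by (rule that)
qed

text \<open>If two pairs of labels solve the same equation, the quotient
  \<open>inv x' \<otimes> x\<close> of the left labels also relates the right ones. A comparison
  arrow labelled through one leg is therefore correct for the other.\<close>

lemma label_cancel:
  assumes "a \<in> carrier G" "c \<in> carrier G" "x \<in> carrier G" "y \<in> carrier G" "x' \<in> carrier G" "y' \<in> carrier G"
    and e: "a \<otimes> x = c \<otimes> y" "a \<otimes> x' = c \<otimes> y'"
  shows "y' \<otimes> (inv x' \<otimes> x) = y"
proof -
  have "c \<otimes> (y' \<otimes> (inv x' \<otimes> x)) = a \<otimes> x' \<otimes> (inv x' \<otimes> x)" unfolding e(2) using assms by (simp add: m_assoc)
  also have "\<dots> = a \<otimes> x" using assms by (metis inv_closed m_assoc m_closed r_cancel_one' inv_solve_left)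
  finally show ?thesis unfolding e(1) using assms by simp
qed

text \<open>The apexes of two squares over the same cospan are both in bijection with the matching
  pairs. The resulting bijection \<open>e\<close>, labelled by the quotient of the labels of the
  left legs, is the isomorphism of middle objects.\<close>

lemma PB_unique:
  assumes p: "PB b c x y" and p': "PB b c x' y'"
  shows "((x, y), (x', y')) \<in> span_rel QG"
proof -
  note P = PB_facts [OF p] and P' = PB_facts [OF p']
  have ex: "\<exists>t'\<in>{1..qdom y'}. qfun x' t' = qfun x t \<and> qfun y' t' = qfun y t" if "t \<in> {1..qdom y}" for t
    by (rule P'(11)) (use P(9,15,16) [OF that] in auto)
  then obtain e where e: "\<And>t. t \<in> {1..qdom y} \<Longrightarrow> e t \<in> {1..qdom y'}"
    "\<And>t. t \<in> {1..qdom y} \<Longrightarrow> qfun x' (e t) = qfun x t" "\<And>t. t \<in> {1..qdom y} \<Longrightarrow> qfun y' (e t) = qfun y t"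
    by metis
  have inj: "s = t" if "s \<in> {1..qdom y}" "t \<in> {1..qdom y}" "e s = e t" for s t
    using P(12) [OF that(1,2)] e(2,3) [OF that(1)] e(2,3) [OF that(2)] that(3) by simp
  have sur: "\<exists>t\<in>{1..qdom y}. e t = t'" if t': "t' \<in> {1..qdom y'}" for t'
  proof -
    obtain t where t: "t \<in> {1..qdom y}" "qfun x t = qfun x' t'" "qfun y t = qfun y' t'"
      using P(11) [OF P'(15,16,9) [OF t' ]] t' by blast
    then have "e t = t'" using P'(12) [OF e(1) [OF t(1)] t'] e(2,3) [OF t(1)] by simp
    then show ?thesis using t by blast
  qed
  have lx: "qlb x t \<in> carrier G" "qlb y t \<in> carrier G" "qlb b (qfun x t) \<in> carrier G" "qlb c (qfun y t) \<in> carrier G"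
    "qlb x' (e t) \<in> carrier G" "qlb y' (e t) \<in> carrier G" if t: "t \<in> {1..qdom y}" for t
    using qlb_in [OF P(3)] qlb_in [OF P(4)] qlb_in [OF P(1) P(15) [OF t]] qlb_in [OF P(2) P(16) [OF t]]
      qlb_in [OF P'(3)] qlb_in [OF P'(4)] t e(1) [OF t] P(6) P'(6) by metis+
  obtain h where h: "h \<in> Arr QG" "qdom h = qdom y" "qcod h = qdom y'"
    "\<And>j. j \<in> {1..qdom y} \<Longrightarrow> qfun h j = e j" "\<And>j. j \<in> {1..qdom y} \<Longrightarrow> qlb h j = inv (qlb x' (e j)) \<otimes> qlb x j"
    "\<And>i j. \<lbrakk>i \<in> {1..qdom y}; j \<in> {1..qdom y}\<rbrakk> \<Longrightarrow> qlt h i j \<longleftrightarrow> e i = e j \<and> False"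
  proof (rule Q_exists [of e "qdom y" "qdom y'" "\<lambda>j. inv (qlb x' (e j)) \<otimes> qlb x j" G "\<lambda>_ _. False"])
    show "e \<in> {1..qdom y} \<rightarrow> {1..qdom y'}" using e(1) by blast
    show "(\<lambda>j. inv qlb x' (e j) \<otimes> qlb x j) \<in> {1..qdom y} \<rightarrow> carrier G" using lx by blast
    show "False \<or> False" if "i \<in> {1..qdom y}" "j \<in> {1..qdom y}" "i \<noteq> j" "e i = e j" for i j
      using that inj by blast
  qed auto
  have "bij_betw (qfun h) {1..qdom h} {1..qcod h}"
    unfolding bij_betw_def inj_on_def
  proof (intro conjI equalityI subsetI ballI impI)
    show "i = j" if "i \<in> {1..qdom h}" "j \<in> {1..qdom h}" "qfun h i = qfun h j" for i j
      using that inj [of i j] h by simp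
    show "k \<in> {1..qcod h}" if "k \<in> qfun h ` {1..qdom h}" for k using that qfun_in [OF h(1)] by blast
    show "k \<in> qfun h ` {1..qdom h}" if "k \<in> {1..qcod h}" for k
      using sur [of k] that h(2,3,4) by (metis image_eqI)
  qed
  then have iso: "is_iso QG h" using Q_isoI [OF h(1)] unfolding is_iso_def by metis
  have hx: "x = qcomp G x' h"
  proof (rule Q_ext)
    fix t assume "Suc 0 \<le> t" "t \<le> qdom (qcomp G x' h)"
    then have t: "t \<in> {1..qdom y}" using h by simp
    then have s: "Suc 0 \<le> t" "t \<le> qdom h" using h by auto
    show "qfun x t = qfun (qcomp G x' h) t" using s h P'(3,6) e(2) [OF t] h(4) [OF t] by simp
    show "qlb x t = qlb (qcomp G x' h) t"
      using s h P'(3,6) h(4,5) [OF t] lx [OF t] by (simp add: m_assoc [symmetric])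
  next
    fix s t assume "Suc 0 \<le> s" "s \<le> qdom (qcomp G x' h)" "Suc 0 \<le> t" "t \<le> qdom (qcomp G x' h)"
    then have st: "s \<in> {1..qdom y}" "t \<in> {1..qdom y}" using h by simp_all
    then have s: "Suc 0 \<le> s" "s \<le> qdom h" "Suc 0 \<le> t" "t \<le> qdom h" using h by auto
    show "qlt x s t = qlt (qcomp G x' h) s t"
      using s h(1,3) P'(3,6) h(4) [OF st(1)] h(4) [OF st(2)] h(6) [OF st] e(2,3) [OF st(1)] e(2,3) [OF st(2)]
        P(13) [OF st] P'(13) [OF e(1) e(1)] st by simp
  qed (use P(1-8) P'(1-8) h(1-3) in simp_all)
  have hy: "y = qcomp G y' h"
  proof (rule Q_ext)
    fix t assume "Suc 0 \<le> t" "t \<le> qdom (qcomp G y' h)"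
    then have t: "t \<in> {1..qdom y}" using h by simp
    then have s: "Suc 0 \<le> t" "t \<le> qdom h" using h by auto
    show "qfun y t = qfun (qcomp G y' h) t" using s h P'(4) e(3) [OF t] h(4) [OF t] by simp
    have "qlb y' (e t) \<otimes> (inv (qlb x' (e t)) \<otimes> qlb x t) = qlb y t"
      using label_cancel [OF lx(3) [OF t] lx(4) [OF t] lx(1) [OF t] lx(2) [OF t] lx(5) [OF t] lx(6) [OF t]] P(10) [OF t] P'(10) [OF e(1) [OF t]] e(2,3) [OF t] t lx by simp
    then show "qlb y t = qlb (qcomp G y' h) t"
      using s h P'(4) h(4,5) [OF t] by simp
  next
    fix s t assume "Suc 0 \<le> s" "s \<le> qdom (qcomp G y' h)" "Suc 0 \<le> t" "t \<le> qdom (qcomp G y' h)"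
    then have st: "s \<in> {1..qdom y}" "t \<in> {1..qdom y}" using h by simp_all
    then have s: "Suc 0 \<le> s" "s \<le> qdom h" "Suc 0 \<le> t" "t \<le> qdom h" using h by auto
    show "qlt y s t = qlt (qcomp G y' h) s t"
      using s h(1,3) P'(4) h(4) [OF st(1)] h(4) [OF st(2)] h(6) [OF st] e(2,3) [OF st(1)] e(2,3) [OF st(2)]
        P(14) [OF st] P'(14) [OF e(1) e(1)] st by simp
  qed (use P(1-8) P'(1-8) h(1-3) in simp_all)
  show ?thesis
    unfolding Q.span_rel_iff Q.spans_iff QPROP_simps
    by (intro conjI exI [of _ h] hx hy iso) (use P(1-8) P'(1-8) h(1-3) in simp_all)
qed

section \<open>Closure properties of pullback squares\<close>

lemma PB_precomp:
  assumes p: "PB b c x y" and h: "is_iso QG h" "qcod h = qdom y"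
  shows "PB b c (qcomp G x h) (qcomp G y h)"
proof -
  note P = PB_facts [OF p] and H = Q_iso_facts [OF h(1)]
  have r: "qfun h t \<in> {1..qdom y}" if "t \<in> {1..qdom h}" for t using qfun_in [OF H(1) that] h(2) by simp
  have f: "qfun (qcomp G x h) t = qfun x (qfun h t)" "qfun (qcomp G y h) t = qfun y (qfun h t)"
    "qlb (qcomp G x h) t = qlb x (qfun h t) \<otimes> qlb h t" "qlb (qcomp G y h) t = qlb y (qfun h t) \<otimes> qlb h t"
    if "t \<in> {1..qdom h}" for t using that P(3,4,6) H(1) h(2) by simp_all
  have l: "qlt (qcomp G x h) s t = qlt x (qfun h s) (qfun h t)" "qlt (qcomp G y h) s t = qlt y (qfun h s) (qfun h t)"
    if "s \<in> {1..qdom h}" "t \<in> {1..qdom h}" for s t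
    using that P(3,4,6) H(1) H(4) [OF that] h(2) by simp_all
  show ?thesis
  proof (rule PB_I)
    fix t assume "t \<in> {1..qdom (qcomp G y h)}"
    then have t: "t \<in> {1..qdom h}" by simp
    show "qfun b (qfun (qcomp G x h) t) = qfun c (qfun (qcomp G y h) t)" using P(9) [OF r [OF t]] f [OF t] by simp
    show "qlb b (qfun (qcomp G x h) t) \<otimes> qlb (qcomp G x h) t = qlb c (qfun (qcomp G y h) t) \<otimes> qlb (qcomp G y h) t"
      unfolding f [OF t]
      using P(10) [OF r [OF t]] qlb_in [OF H(1) t] qlb_in [OF P(1) P(15) [OF r [OF t]]] qlb_in [OF P(2) P(16) [OF r [OF t]]]
        qlb_in [OF P(3)] qlb_in [OF P(4)] r [OF t] P(6)
      by (simp add: m_assoc [symmetric])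
  next
    fix i j assume "i \<in> {1..qdom b}" "j \<in> {1..qdom c}" "qfun b i = qfun c j"
    from P(11) [OF this] obtain t where t: "t \<in> {1..qdom y}" "qfun x t = i" "qfun y t = j" by blast
    obtain s where s: "s \<in> {1..qdom h}" "qfun h s = t" using H(2) t(1) h(2) unfolding bij_betw_def by (metis imageE)
    then show "\<exists>t\<in>{1..qdom (qcomp G y h)}. qfun (qcomp G x h) t = i \<and> qfun (qcomp G y h) t = j"
      using f t by auto
  next
    fix s t assume "s \<in> {1..qdom (qcomp G y h)}" "t \<in> {1..qdom (qcomp G y h)}"
    then have st: "s \<in> {1..qdom h}" "t \<in> {1..qdom h}" by simp_all
    note r2 = r [OF st(1)] r [OF st(2)]
    show "s = t" if "qfun (qcomp G x h) s = qfun (qcomp G x h) t" "qfun (qcomp G y h) s = qfun (qcomp G y h) t"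
      using that P(12) [OF r2] H(3) [OF st] f [OF st(1)] f [OF st(2)] by simp
    show "qlt (qcomp G x h) s t \<longleftrightarrow> qfun (qcomp G x h) s = qfun (qcomp G x h) t \<and> qlt c (qfun (qcomp G y h) s) (qfun (qcomp G y h) t)"
      using P(13) [OF r2] f [OF st(1)] f [OF st(2)] l [OF st] by simp
    show "qlt (qcomp G y h) s t \<longleftrightarrow> qfun (qcomp G y h) s = qfun (qcomp G y h) t \<and> qlt b (qfun (qcomp G x h) s) (qfun (qcomp G x h) t)"
      using P(14) [OF r2] f [OF st(1)] f [OF st(2)] l [OF st] by simp
  qed (use P(1-8) H(1) h(2) in simp_all)
qed

lemma PB_span_rel:
  assumes p: "PB b c x y" and r: "((x, y), (x', y')) \<in> span_rel QG"
  shows "PB b c x' y'"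
proof -
  have "((x', y'), (x, y)) \<in> span_rel QG" using r Q.equiv_span_rel by (meson equivE symE)
  then obtain h where "is_iso QG h" "qcod h = qdom x" "x' = qcomp G x h" "y' = qcomp G y h"
    by (auto simp: Q.span_rel_iff)
  then show ?thesis using PB_precomp [OF p] PB_facts(6) [OF p] by simp
qed

text \<open>Gives independence of the representative of a cospan: an isomorphism after both legs is
  injective, has trivial fibre orders, and multiplies both labels over a matching pair by the same
  element.\<close>

lemma PB_postcomp:
  assumes p: "PB b c x y" and h: "is_iso QG h" "qdom h = qcod b"
  shows "PB (qcomp G h b) (qcomp G h c) x y"
proof -
  note P = PB_facts [OF p] and H = Q_iso_facts [OF h(1)]
  have rb: "qfun b i \<in> {1..qdom h}" if "i \<in> {1..qdom b}" for i using qfun_in [OF P(1) that] h(2) by simp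
  have rc: "qfun c i \<in> {1..qdom h}" if "i \<in> {1..qdom c}" for i using qfun_in [OF P(2) that] h(2) P(5) by simp
  have fb: "qfun (qcomp G h b) t = qfun h (qfun b t)" "qlb (qcomp G h b) t = qlb h (qfun b t) \<otimes> qlb b t"
    if "t \<in> {1..qdom b}" for t using that P(1,5) H(1) h(2) by simp_all
  have fc: "qfun (qcomp G h c) t = qfun h (qfun c t)" "qlb (qcomp G h c) t = qlb h (qfun c t) \<otimes> qlb c t"
    if "t \<in> {1..qdom c}" for t using that P(2,5) H(1) h(2) by simp_all
  have lb: "qlt (qcomp G h b) s t = qlt b s t" if "s \<in> {1..qdom b}" "t \<in> {1..qdom b}" for s t
    using that P(1,5) H(1) H(4) [OF rb rb, of s t] h(2) by simp
  have lc: "qlt (qcomp G h c) s t = qlt c s t" if "s \<in> {1..qdom c}" "t \<in> {1..qdom c}" for s t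
    using that P(2,5) H(1) H(4) [OF rc rc, of s t] h(2) by simp
  show ?thesis
  proof (rule PB_I)
    fix t assume t: "t \<in> {1..qdom y}"
    note u = P(15) [OF t] P(16) [OF t]
    show "qfun (qcomp G h b) (qfun x t) = qfun (qcomp G h c) (qfun y t)" using P(9) [OF t] fb u fc by simp
    show "qlb (qcomp G h b) (qfun x t) \<otimes> qlb x t = qlb (qcomp G h c) (qfun y t) \<otimes> qlb y t"
      unfolding fb [OF u(1)] fc [OF u(2)]
      using P(9,10) [OF t] qlb_in [OF H(1) rb [OF u(1)]] qlb_in [OF P(1) u(1)] qlb_in [OF P(2) u(2)]
        qlb_in [OF P(3)] qlb_in [OF P(4)] t P(6)
      by (simp add: m_assoc)
  next
    fix i j assume "i \<in> {1..qdom (qcomp G h b)}" "j \<in> {1..qdom (qcomp G h c)}" "qfun (qcomp G h b) i = qfun (qcomp G h c) j"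
    then show "\<exists>t\<in>{1..qdom y}. qfun x t = i \<and> qfun y t = j"
      using P(11) [of i j] H(3) [OF rb rc, of i j] fb [of i] fc [of j] by simp
  next
    fix s t assume st: "s \<in> {1..qdom y}" "t \<in> {1..qdom y}"
    show "s = t" if "qfun x s = qfun x t" "qfun y s = qfun y t" using P(12) st that by blast
    show "qlt x s t \<longleftrightarrow> qfun x s = qfun x t \<and> qlt (qcomp G h c) (qfun y s) (qfun y t)"
      using P(13) [OF st] lc [OF P(16) P(16)] st by simp
    show "qlt y s t \<longleftrightarrow> qfun y s = qfun y t \<and> qlt (qcomp G h b) (qfun x s) (qfun x t)"
      using P(14) [OF st] lb [OF P(15) P(15)] st by simp
  qed (use P(1-8) H(1) h(2) in simp_all)
qed

text \<open>Pasting of squares. The fibre orders fit together because \<open>z\<close> is ordered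
  through \<open>x\<close>, whose order comes from \<open>c\<close> in turn, while the order of
  \<open>y w\<close> combines those of \<open>f\<close> and \<open>b\<close>
  lexicographically.\<close>

lemma PB_comp_left:
  assumes p: "PB b c x y" and p': "PB f x z w"
  shows "PB (qcomp G b f) c z (qcomp G y w)"
proof -
  note P = PB_facts [OF p] and R = PB_facts [OF p']
  have e: "qcod f = qdom b" "qcod w = qdom y" using P(6,7) R(5,8) by simp_all
  have rf: "qfun f i \<in> {1..qdom b}" if "i \<in> {1..qdom f}" for i using qfun_in [OF R(1) that] e by simp
  have rw: "qfun w t \<in> {1..qdom y}" if "t \<in> {1..qdom w}" for t using qfun_in [OF R(4) that] e by simp
  have fb: "qfun (qcomp G b f) i = qfun b (qfun f i)" "qlb (qcomp G b f) i = qlb b (qfun f i) \<otimes> qlb f i"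
    if "i \<in> {1..qdom f}" for i using that P(1) R(1) e by simp_all
  have fw: "qfun (qcomp G y w) t = qfun y (qfun w t)" "qlb (qcomp G y w) t = qlb y (qfun w t) \<otimes> qlb w t"
    if "t \<in> {1..qdom w}" for t using that P(4) R(4) e by simp_all
  have lb: "qlt (qcomp G b f) s t \<longleftrightarrow> qlt f s t \<or> qlt b (qfun f s) (qfun f t)" if "s \<in> {1..qdom f}" "t \<in> {1..qdom f}" for s t
    using that P(1) R(1) e by simp
  have lw: "qlt (qcomp G y w) s t \<longleftrightarrow> qlt w s t \<or> qlt y (qfun w s) (qfun w t)" if "s \<in> {1..qdom w}" "t \<in> {1..qdom w}" for s t
    using that P(4) R(4) e by simp
  show ?thesis
  proof (rule PB_I)
    fix t assume "t \<in> {1..qdom (qcomp G y w)}"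
    then have t: "t \<in> {1..qdom w}" by simp
    note u = R(15) [OF t] R(16) [OF t] rw [OF t]
    show "qfun (qcomp G b f) (qfun z t) = qfun c (qfun (qcomp G y w) t)"
      using fb [OF u(1)] fw [OF t] R(9) [OF t] P(9) [OF u(3)] by simp
    have c: "qlb b (qfun f (qfun z t)) \<in> carrier G" "qlb f (qfun z t) \<in> carrier G" "qlb z t \<in> carrier G"
      "qlb c (qfun y (qfun w t)) \<in> carrier G" "qlb y (qfun w t) \<in> carrier G" "qlb w t \<in> carrier G" "qlb x (qfun w t) \<in> carrier G"
      using qlb_in [OF P(1) rf [OF u(1)]] qlb_in [OF R(1) u(1)] qlb_in [OF R(3), of t] qlb_in [OF P(2) P(16) [OF u(3)]]
        qlb_in [OF P(4) u(3)] qlb_in [OF R(4) t] qlb_in [OF P(3), of "qfun w t"] u t R(6) by simp_all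
    have "qlb b (qfun f (qfun z t)) \<otimes> (qlb f (qfun z t) \<otimes> qlb z t) = qlb b (qfun x (qfun w t)) \<otimes> (qlb x (qfun w t) \<otimes> qlb w t)"
      using R(9,10) [OF t] by simp
    also have "\<dots> = (qlb c (qfun y (qfun w t)) \<otimes> qlb y (qfun w t)) \<otimes> qlb w t"
      using P(10) [OF u(3)] c R(9) [OF t] by (metis m_assoc)
    finally show "qlb (qcomp G b f) (qfun z t) \<otimes> qlb z t = qlb c (qfun (qcomp G y w) t) \<otimes> qlb (qcomp G y w) t"
      unfolding fb [OF u(1)] fw [OF t] using c by (simp add: m_assoc)
  next
    fix i j assume "i \<in> {1..qdom (qcomp G b f)}" "j \<in> {1..qdom c}" "qfun (qcomp G b f) i = qfun c j"
    then have ij: "i \<in> {1..qdom f}" "j \<in> {1..qdom c}" "qfun b (qfun f i) = qfun c j" using fb by simp_all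
    obtain k where k: "k \<in> {1..qdom y}" "qfun x k = qfun f i" "qfun y k = j" using P(11) [OF rf [OF ij(1)] ij(2,3)] by blast
    have "k \<in> {1..qdom x}" using k(1) P(6) by simp
    from R(11) [OF ij(1) this] k(2) obtain t where "t \<in> {1..qdom w}" "qfun z t = i" "qfun w t = k" by auto
    then show "\<exists>t\<in>{1..qdom (qcomp G y w)}. qfun z t = i \<and> qfun (qcomp G y w) t = j" using fw k by auto
  next
    fix s t assume "s \<in> {1..qdom (qcomp G y w)}" "t \<in> {1..qdom (qcomp G y w)}"
    then have st: "s \<in> {1..qdom w}" "t \<in> {1..qdom w}" by simp_all
    note zz = R(15) [OF st(1)] R(15) [OF st(2)] and ww = rw [OF st(1)] rw [OF st(2)]
    note fz = R(9) [OF st(1)] R(9) [OF st(2)]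
    \<comment> \<open>A point of the inner apex is determined by its images under \<open>x\<close>
      and \<open>y\<close>, and the image of \<open>w s\<close> under \<open>x\<close> is the image
      of \<open>z s\<close> under \<open>f\<close>.\<close>
    have *: "qfun w s = qfun w t" if "qfun f (qfun z s) = qfun f (qfun z t)" "qfun y (qfun w s) = qfun y (qfun w t)"
      using P(12) [OF ww] that fz by simp
    show "s = t" if "qfun z s = qfun z t" "qfun (qcomp G y w) s = qfun (qcomp G y w) t"
      using R(12) [OF st] * that fw st by simp
    show "qlt z s t \<longleftrightarrow> qfun z s = qfun z t \<and> qlt c (qfun (qcomp G y w) s) (qfun (qcomp G y w) t)"
      using R(13) [OF st] P(13) [OF ww] fw [OF st(1)] fw [OF st(2)] fz by auto
    show "qlt (qcomp G y w) s t \<longleftrightarrow> qfun (qcomp G y w) s = qfun (qcomp G y w) t \<and> qlt (qcomp G b f) (qfun z s) (qfun z t)"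
      unfolding lw [OF st] lb [OF zz] fw [OF st(1)] fw [OF st(2)]
      using R(14) [OF st] P(14) [OF ww] fz * qlt_fun [of f "qfun z s" "qfun z t"] by auto
  qed (use P(1-8) R(1-8) e in simp_all)
qed

lemma PB_comp_right:
  assumes p: "PB b c x y" and p': "PB y h z w"
  shows "PB b (qcomp G c h) (qcomp G x z) w"
  using PB_sym [OF PB_comp_left [OF PB_sym [OF p] PB_sym [OF p']]] .

text \<open>If the parallel sides \<open>c\<close> and \<open>x\<close> are isomorphisms, they carry
  no fibre order, and a commuting square is a pullback square. This covers identities, labelled
  permutations, and the exchange of a monotone map with a labelled permutation.\<close>

lemma PB_square:
  assumes c: "is_iso QG c" and x: "is_iso QG x" and b: "b \<in> Arr QG" and y: "y \<in> Arr QG"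
    and d: "qcod x = qdom b" "qcod y = qdom c" and e: "qcomp G b x = qcomp G c y"
  shows "PB b c x y"
proof -
  note C = Q_iso_facts [OF c] and X = Q_iso_facts [OF x]
  have dx: "qdom x = qdom y" "qcod b = qcod c"
    using arg_cong [OF e, of qdom] arg_cong [OF e, of qcod] by simp_all
  have r: "qfun x t \<in> {1..qdom b}" "qfun y t \<in> {1..qdom c}" if "t \<in> {1..qdom y}" for t
    using qfun_in [OF X(1), of t] qfun_in [OF y, of t] that d dx by auto
  have f: "qfun b (qfun x t) = qfun c (qfun y t)" "qlb b (qfun x t) \<otimes> qlb x t = qlb c (qfun y t) \<otimes> qlb y t"
    if "t \<in> {1..qdom y}" for t
    using arg_cong [OF e, of "\<lambda>q. qfun q t"] arg_cong [OF e, of "\<lambda>q. qlb q t"] that b y C(1) X(1) d dx by simp_all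
  show ?thesis
  proof (rule PB_I)
    fix i j assume ij: "i \<in> {1..qdom b}" "j \<in> {1..qdom c}" "qfun b i = qfun c j"
    obtain t where t: "t \<in> {1..qdom y}" "qfun x t = i" using X(2) ij(1) d dx unfolding bij_betw_def by (metis imageE)
    then have "qfun y t = j" using C(3) [OF r(2) [OF t(1)] ij(2)] f(1) [OF t(1)] ij(3) t(2) by simp
    then show "\<exists>t\<in>{1..qdom y}. qfun x t = i \<and> qfun y t = j" using t by blast
  next
    fix s t assume st: "s \<in> {1..qdom y}" "t \<in> {1..qdom y}"
    have st': "s \<in> {1..qdom x}" "t \<in> {1..qdom x}" using st dx by simp_all
    show "s = t" if "qfun x s = qfun x t" using X(3) st' that by blast
    show "qlt x s t \<longleftrightarrow> qfun x s = qfun x t \<and> qlt c (qfun y s) (qfun y t)"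
      using X(4) [OF st'] C(4) [OF r(2) r(2)] st by blast
    have "qlt b (qfun x s) (qfun x t) \<longleftrightarrow> qlt y s t"
      using arg_cong [OF e, of "\<lambda>q. qlt q s t"] st st' b y C(1) X(1) d dx X(4) [OF st'] C(4) [OF r(2) r(2)] by simp
    then show "qlt y s t \<longleftrightarrow> qfun y s = qfun y t \<and> qlt b (qfun x s) (qfun x t)" using qlt_fun by blast
  qed (use f b y C(1) X(1) d dx in auto)
qed

lemma Q_iso_ide: "is_iso QG (qide G n)"
  using Q.is_iso_ide [of n] by simp

lemma PB_ide_right: "f \<in> Arr QG \<Longrightarrow> PB f (qide G (qcod f)) (qide G (qdom f)) f"
  by (rule PB_square) (simp_all add: Q_iso_ide)

lemma PB_ide_left: "f \<in> Arr QG \<Longrightarrow> PB (qide G (qcod f)) f f (qide G (qdom f))"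
  by (rule PB_sym [OF PB_ide_right])

text \<open>The square over \<open>x\<close> and \<open>g\<close> with an identity at the apex is an
  instance of \<open>PB_square\<close>; pasting it on absorbs \<open>g\<close>.\<close>

lemma PB_iso_left:
  assumes p: "PB b c x y" and g: "inverse_arrows QG g g'" "qcod g = qdom b"
  shows "PB (qcomp G b g) c (qcomp G g' x) y"
proof -
  note P = PB_facts [OF p]
  have a: "g \<in> Arr QG" "g' \<in> Arr QG" "qdom g' = qcod g" "qcod g' = qdom g" using g by (simp_all add: Q_inverse_iff)
  have "PB x g (qide G (qdom x)) (qcomp G g' x)"
    using Q.inv_cancel(4) [OF g(1), of x] P(3,7) g(2) a Q.is_isoI [OF g(1)]
    by (intro PB_square) (simp_all add: Q_iso_ide)
  from PB_comp_left [OF p PB_sym [OF this]] show ?thesis using P(1-8) by simp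
qed

lemma PB_iso:
  assumes p: "PB b c x y" and g: "inverse_arrows QG g g'" "qcod g = qdom b"
    and h: "inverse_arrows QG h h'" "qcod h = qdom c"
  shows "PB (qcomp G b g) (qcomp G c h) (qcomp G g' x) (qcomp G h' y)"
  using PB_sym [OF PB_iso_left [OF PB_sym [OF PB_iso_left [OF p g]] h]] .

text \<open>Matching pairs of a juxtaposition have both entries in the same block, so the fibre
  product is the disjoint sum of the two fibre products.\<close>

lemma PB_tens:
  assumes p: "PB b c x y" and p': "PB b' c' x' y'"
  shows "PB (qtens b b') (qtens c c') (qtens x x') (qtens y y')"
proof -
  note P = PB_facts [OF p] and R = PB_facts [OF p']
  let ?r = "qdom y" and ?r' = "qdom y'"
  have A: "qfun (qtens x x') t = qfun x t" "qfun (qtens y y') t = qfun y t"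
    "qlb (qtens x x') t = qlb x t" "qlb (qtens y y') t = qlb y t" if "t \<in> {1..?r}" for t
    using that P(3,4,6) R(3,4,6) by simp_all
  have B: "qfun (qtens x x') (?r + t) = qdom b + qfun x' t" "qfun (qtens y y') (?r + t) = qdom c + qfun y' t"
    "qlb (qtens x x') (?r + t) = qlb x' t" "qlb (qtens y y') (?r + t) = qlb y' t" if "t \<in> {1..?r'}" for t
    using that P(3,4,6-8) R(3,4,6) by simp_all
  have range: "Suc 0 \<le> t" "t \<le> ?r + ?r'" if "t \<in> {1..qdom (qtens y y')}" for t using that by simp_all
  have bA: "qfun (qtens b b') i = qfun b i" "qlb (qtens b b') i = qlb b i" if "i \<in> {1..qdom b}" for i
    using that P(1) R(1) by simp_all
  have bB: "qfun (qtens b b') (qdom b + i) = qcod b + qfun b' i" "qlb (qtens b b') (qdom b + i) = qlb b' i" if "i \<in> {1..qdom b'}" for i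
    using that P(1) R(1) by simp_all
  have cA: "qfun (qtens c c') i = qfun c i" "qlb (qtens c c') i = qlb c i" if "i \<in> {1..qdom c}" for i
    using that P(2) R(2) by simp_all
  have cB: "qfun (qtens c c') (qdom c + i) = qcod c + qfun c' i" "qlb (qtens c c') (qdom c + i) = qlb c' i" if "i \<in> {1..qdom c'}" for i
    using that P(2) R(2) by simp_all
  show ?thesis
  proof (rule PB_I)
    fix t assume t: "t \<in> {1..qdom (qtens y y')}"
    show "qfun (qtens b b') (qfun (qtens x x') t) = qfun (qtens c c') (qfun (qtens y y') t)"
    proof (rule sum_range_cases [OF range [OF t]])
      assume "t \<le> ?r"
      then have 1: "t \<in> {1..?r}" using t by simp
      show ?thesis using A [OF 1] P(9) [OF 1] bA [OF P(15) [OF 1]] cA [OF P(16) [OF 1]] by simp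
    next
      fix t' assume "Suc 0 \<le> t'" "t' \<le> ?r'"
      then have 2: "t' \<in> {1..?r'}" by simp
      show "qfun (qtens b b') (qfun (qtens x x') (?r + t')) = qfun (qtens c c') (qfun (qtens y y') (?r + t'))"
        using B [OF 2] R(9) [OF 2] bB [OF R(15) [OF 2]] cB [OF R(16) [OF 2]] P(5) by simp
    qed
    show "qlb (qtens b b') (qfun (qtens x x') t) \<otimes> qlb (qtens x x') t = qlb (qtens c c') (qfun (qtens y y') t) \<otimes> qlb (qtens y y') t"
    proof (rule sum_range_cases [OF range [OF t]])
      assume "t \<le> ?r"
      then have 1: "t \<in> {1..?r}" using t by simp
      show ?thesis using A [OF 1] P(10) [OF 1] bA [OF P(15) [OF 1]] cA [OF P(16) [OF 1]] by simp
    next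
      fix t' assume "Suc 0 \<le> t'" "t' \<le> ?r'"
      then have 2: "t' \<in> {1..?r'}" by simp
      show "qlb (qtens b b') (qfun (qtens x x') (?r + t')) \<otimes> qlb (qtens x x') (?r + t') =
          qlb (qtens c c') (qfun (qtens y y') (?r + t')) \<otimes> qlb (qtens y y') (?r + t')"
        using B [OF 2] R(10) [OF 2] bB [OF R(15) [OF 2]] cB [OF R(16) [OF 2]] by simp
    qed
  next
    fix i j assume "i \<in> {1..qdom (qtens b b')}" "j \<in> {1..qdom (qtens c c')}" and e: "qfun (qtens b b') i = qfun (qtens c c') j"
    then have ij: "Suc 0 \<le> i" "i \<le> qdom b + qdom b'" "Suc 0 \<le> j" "j \<le> qdom c + qdom c'" by simp_all
    have "qfun (qtens b b') i = qfun (qtens c c') j \<longrightarrow> (\<exists>t\<in>{1..?r + ?r'}. qfun (qtens x x') t = i \<and> qfun (qtens y y') t = j)"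
      (is "?Q i j")
    proof -
      have 1: "?Q i j" if i: "i \<in> {1..qdom b}" and j: "j \<in> {1..qdom c}" for i j
      proof
        assume "qfun (qtens b b') i = qfun (qtens c c') j"
        then obtain t where t: "t \<in> {1..?r}" "qfun x t = i" "qfun y t = j" using P(11) [OF i j] bA [OF i] cA [OF j] by auto
        then show "\<exists>t\<in>{1..?r + ?r'}. qfun (qtens x x') t = i \<and> qfun (qtens y y') t = j"
          using A [OF t(1)] by (intro bexI [of _ t]) auto
      qed
      have 2: "?Q (qdom b + i) (qdom c + j)" if i: "i \<in> {1..qdom b'}" and j: "j \<in> {1..qdom c'}" for i j
      proof
        assume "qfun (qtens b b') (qdom b + i) = qfun (qtens c c') (qdom c + j)"
        then obtain t where t: "t \<in> {1..?r'}" "qfun x' t = i" "qfun y' t = j" using R(11) [OF i j] bB [OF i] cB [OF j] P(5) by auto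
        then show "\<exists>t\<in>{1..?r + ?r'}. qfun (qtens x x') t = qdom b + i \<and> qfun (qtens y y') t = qdom c + j"
          using B [OF t(1)] by (intro bexI [of _ "?r + t"]) auto
      qed
      have 3: "?Q i (qdom c + j)" if i: "i \<in> {1..qdom b}" and j: "j \<in> {1..qdom c'}" for i j
        using bA [OF i] cB [OF j] qfun_in [OF P(1) i] qfun_in [OF R(2) j] P(5) by auto
      have 4: "?Q (qdom b + i) j" if i: "i \<in> {1..qdom b'}" and j: "j \<in> {1..qdom c}" for i j
        using bB [OF i] cA [OF j] qfun_in [OF R(1) i] qfun_in [OF P(2) j] P(5) by auto
      from split_sum_range' [OF ij(1,2)] split_sum_range' [OF ij(3,4)] show ?thesis
        using 1 [of i j] 2 3 [of i] 4 [of _ j] ij by (metis atLeastAtMost_iff One_nat_def)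
    qed
    then show "\<exists>t\<in>{1..qdom (qtens y y')}. qfun (qtens x x') t = i \<and> qfun (qtens y y') t = j" using e by simp
  next
    fix s t assume s0: "s \<in> {1..qdom (qtens y y')}" and t0: "t \<in> {1..qdom (qtens y y')}"
    have lb1: "qlt (qtens b b') i j \<longleftrightarrow> qlt b i j" if "i \<in> {1..qdom b}" "j \<in> {1..qdom b}" for i j using that P(1) R(1) by simp
    have lb2: "qlt (qtens b b') (qdom b + i) (qdom b + j) \<longleftrightarrow> qlt b' i j" if "i \<in> {1..qdom b'}" "j \<in> {1..qdom b'}" for i j
      using that P(1) R(1) by simp
    have lc1: "qlt (qtens c c') i j \<longleftrightarrow> qlt c i j" if "i \<in> {1..qdom c}" "j \<in> {1..qdom c}" for i j using that P(2) R(2) by simp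
    have lc2: "qlt (qtens c c') (qdom c + i) (qdom c + j) \<longleftrightarrow> qlt c' i j" if "i \<in> {1..qdom c'}" "j \<in> {1..qdom c'}" for i j
      using that P(2) R(2) by simp
    have "(qfun (qtens x x') s = qfun (qtens x x') t \<longrightarrow> qfun (qtens y y') s = qfun (qtens y y') t \<longrightarrow> s = t) \<and>
      (qlt (qtens x x') s t \<longleftrightarrow> qfun (qtens x x') s = qfun (qtens x x') t \<and> qlt (qtens c c') (qfun (qtens y y') s) (qfun (qtens y y') t)) \<and>
      (qlt (qtens y y') s t \<longleftrightarrow> qfun (qtens y y') s = qfun (qtens y y') t \<and> qlt (qtens b b') (qfun (qtens x x') s) (qfun (qtens x x') t))"
      (is "?Q s t")
    proof (rule sum_range_cases2 [OF range [OF s0] range [OF t0], where P = ?Q])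
      assume "s \<le> ?r" "t \<le> ?r"
      then have 1: "s \<in> {1..?r}" "t \<in> {1..?r}" using s0 t0 by simp_all
      have l: "qlt (qtens x x') s t = qlt x s t" "qlt (qtens y y') s t = qlt y s t"
        using 1 P(3,4,6) R(3,4,6) by simp_all
      show "?Q s t" unfolding l A [OF 1(1)] A [OF 1(2)] lb1 [OF P(15) [OF 1(1)] P(15) [OF 1(2)]] lc1 [OF P(16) [OF 1(1)] P(16) [OF 1(2)]]
        using P(12-14) [OF 1] by auto
    next
      fix t' assume "s \<le> ?r" "Suc 0 \<le> t'" "t' \<le> ?r'"
      then have 2: "s \<in> {1..?r}" "t' \<in> {1..?r'}" using s0 by simp_all
      have l: "\<not> qlt (qtens x x') s (?r + t')" "\<not> qlt (qtens y y') s (?r + t')" using 2 P(3,4,6) R(3,4,6) by simp_all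
      have "qfun (qtens x x') s \<noteq> qfun (qtens x x') (?r + t')" "qfun (qtens y y') s \<noteq> qfun (qtens y y') (?r + t')"
        using A [OF 2(1)] B [OF 2(2)] P(15,16) [OF 2(1)] R(15,16) [OF 2(2)] by auto
      then show "?Q s (?r + t')" using l by blast
    next
      fix s' assume "Suc 0 \<le> s'" "s' \<le> ?r'" "t \<le> ?r"
      then have 3: "t \<in> {1..?r}" "s' \<in> {1..?r'}" using t0 by simp_all
      have l: "\<not> qlt (qtens x x') (?r + s') t" "\<not> qlt (qtens y y') (?r + s') t" using 3 P(3,4,6) R(3,4,6) by simp_all
      have "qfun (qtens x x') (?r + s') \<noteq> qfun (qtens x x') t" "qfun (qtens y y') (?r + s') \<noteq> qfun (qtens y y') t"
        using A [OF 3(1)] B [OF 3(2)] P(15,16) [OF 3(1)] R(15,16) [OF 3(2)] by auto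
      then show "?Q (?r + s') t" using l by blast
    next
      fix s' t' assume "Suc 0 \<le> s'" "s' \<le> ?r'" "Suc 0 \<le> t'" "t' \<le> ?r'"
      then have 4: "s' \<in> {1..?r'}" "t' \<in> {1..?r'}" by simp_all
      have l: "qlt (qtens x x') (?r + s') (?r + t') = qlt x' s' t'" "qlt (qtens y y') (?r + s') (?r + t') = qlt y' s' t'"
        using 4 P(3,4,6) R(3,4,6) by simp_all
      show "?Q (?r + s') (?r + t')"
        unfolding l B [OF 4(1)] B [OF 4(2)] lb2 [OF R(15) [OF 4(1)] R(15) [OF 4(2)]] lc2 [OF R(16) [OF 4(1)] R(16) [OF 4(2)]]
        using R(12-14) [OF 4] by auto
    qed
    then show "qlt (qtens x x') s t \<longleftrightarrow> qfun (qtens x x') s = qfun (qtens x x') t \<and> qlt (qtens c c') (qfun (qtens y y') s) (qfun (qtens y y') t)"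
      "qlt (qtens y y') s t \<longleftrightarrow> qfun (qtens y y') s = qfun (qtens y y') t \<and> qlt (qtens b b') (qfun (qtens x x') s) (qfun (qtens x x') t)"
      "\<lbrakk>qfun (qtens x x') s = qfun (qtens x x') t; qfun (qtens y y') s = qfun (qtens y y') t\<rbrakk> \<Longrightarrow> s = t" by blast+
  qed (use P(1-8) R(1-8) in simp_all)
qed

end

section \<open>The distributive law for bimonoids\<close>

context group
begin

text \<open>The product of \<open>k\<close> factors. \<open>mul 2\<close> and \<open>mul 0\<close>
  are the generators \<open>m\<close> and \<open>u\<close>, and a single name for all arities allows
  induction on \<open>k\<close>.\<close>

definition mul :: "nat \<Rightarrow> 'a qarr" where
  "mul k = qmor G k 1 (restrict (\<lambda>_. 1) {1..k})"

lemma mul_HomD: "restrict (\<lambda>_. 1) {1..k} \<in> HomD k 1"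
  by (rule HomDI) auto

lemma mul_facts [simp]:
  "mul k \<in> Arr QG" "qdom (mul k) = k" "qcod (mul k) = 1"
  "\<lbrakk>Suc 0 \<le> j; j \<le> k\<rbrakk> \<Longrightarrow> qfun (mul k) j = 1"
  "\<lbrakk>Suc 0 \<le> j; j \<le> k\<rbrakk> \<Longrightarrow> qlb (mul k) j = \<one>"
  "\<lbrakk>Suc 0 \<le> i; i \<le> k; Suc 0 \<le> j; j \<le> k\<rbrakk> \<Longrightarrow> qlt (mul k) i j \<longleftrightarrow> i < j"
  unfolding mul_def using qmor_facts(1-4,6) [OF mul_HomD, of k] qmor_facts(5) [OF mul_HomD [of k], of j] by simp_all

lemma m_arr_eq: "m_arr G = mul 2" and u_arr_eq: "u_arr G = mul 0"
  by (simp_all add: m_arr_def u_arr_def mul_def)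

text \<open>Both sides order all inputs increasingly over one point. Peeling off the last input
  reduces every arity to \<open>mul 2\<close> and \<open>mul 0\<close>.\<close>

lemma mul_Suc: "mul (Suc k) = qcomp G (mul 2) (qtens (mul k) (qide G 1))"
proof -
  let ?q = "qtens (mul k) (qide G (Suc 0))"
  have R: "qfun ?q (Suc k) = 2" "qlb ?q (Suc k) = \<one>" "\<not> qlt ?q (Suc k) (Suc k)"
    by (simp_all add: qfun_qtens qlb_qtens qlt_qtens Suc_diff_le)
  have L: "\<not> qlt ?q (Suc k) i" "\<not> qlt ?q i (Suc k)" if "Suc 0 \<le> i" "i \<le> k" for i
    using that by (simp_all add: qlt_qtens)
  have c: "j \<le> k \<or> j = Suc k" if "j \<le> Suc k" for j using that by linarith
  have d': "qdom (qcomp G (mul 2) ?q) = Suc k" by simp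
  have "mul (Suc k) = qcomp G (mul 2) ?q"
  proof (rule Q_ext)
    fix j assume "Suc 0 \<le> j" "j \<le> qdom (qcomp G (mul 2) ?q)"
    then have j: "Suc 0 \<le> j" "j \<le> k \<or> j = Suc k" using c d' by auto
    show "qfun (mul (Suc k)) j = qfun (qcomp G (mul 2) ?q) j" "qlb (mul (Suc k)) j = qlb (qcomp G (mul 2) ?q) j"
      using j by (auto simp: R)
    fix i assume "Suc 0 \<le> i" "i \<le> qdom (qcomp G (mul 2) ?q)"
    then have i: "Suc 0 \<le> i" "i \<le> k \<or> i = Suc k" using c d' by auto
    show "qlt (mul (Suc k)) i j = qlt (qcomp G (mul 2) ?q) i j"
      using i(2) j(2) i(1) j(1) by (elim disjE) (simp_all add: R L)
  qed simp_all
  then show ?thesis by simp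
qed

lemma mul_1: "mul 1 = qide G 1"
  by (rule Q_ext) simp_all

section \<open>The group of labelled permutations and its action on monotone maps\<close>

lemma lperm_carrier: "(x, \<sigma>) \<in> carrier (lperm_group G n) \<longleftrightarrow> x \<in> {1..n} \<rightarrow>\<^sub>E carrier G \<and> \<sigma> permutes {1..n}"
  by (simp add: lperm_group_def)

lemma lperm_mult: "(y, \<tau>) \<otimes>\<^bsub>lperm_group G n\<^esub> (x, \<sigma>) = (restrict (\<lambda>i. y (\<sigma> i) \<otimes> x i) {1..n}, \<tau> \<circ> \<sigma>)"
  by (simp add: lperm_group_def)

lemma lperm_one: "\<one>\<^bsub>lperm_group G n\<^esub> = (restrict (\<lambda>_. \<one>) {1..n}, id)"
  by (simp add: lperm_group_def)

text \<open>The \<open>inv\<close> in the axioms of the law is a definite description; the group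
  laws make it an actual inverse.\<close>

lemma lperm_group: "group (lperm_group G n)"
proof (rule groupI)
  let ?L = "lperm_group G n"
  show c: "g \<otimes>\<^bsub>?L\<^esub> h \<in> carrier ?L" if gh: "g \<in> carrier ?L" "h \<in> carrier ?L" for g h
  proof -
    obtain y \<tau> x \<sigma> where e: "g = (y, \<tau>)" "h = (x, \<sigma>)" by (cases g, cases h)
    have "y (\<sigma> i) \<otimes> x i \<in> carrier G" if "i \<in> {1..n}" for i
      using gh that permutes_in_image [of \<sigma> "{1..n}" i] unfolding e lperm_carrier by blast
    then show ?thesis using gh unfolding e lperm_mult lperm_carrier by (auto intro: permutes_compose)
  qed
  show "\<one>\<^bsub>?L\<^esub> \<in> carrier ?L" by (auto simp: lperm_one lperm_carrier permutes_id)
  show "f \<otimes>\<^bsub>?L\<^esub> g \<otimes>\<^bsub>?L\<^esub> h = f \<otimes>\<^bsub>?L\<^esub> (g \<otimes>\<^bsub>?L\<^esub> h)"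
    if gh: "f \<in> carrier ?L" "g \<in> carrier ?L" "h \<in> carrier ?L" for f g h
  proof -
    obtain z \<rho> y \<tau> x \<sigma> where e: "f = (z, \<rho>)" "g = (y, \<tau>)" "h = (x, \<sigma>)" by (cases f, cases g, cases h)
    have p: "\<sigma> permutes {1..n}" "\<tau> permutes {1..n}" using gh by (simp_all add: e lperm_carrier)
    have i: "\<sigma> i \<in> {1..n}" "\<tau> (\<sigma> i) \<in> {1..n}" if "i \<in> {1..n}" for i
      using that permutes_in_image [OF p(1)] permutes_in_image [OF p(2)] by blast+
    have "z (\<tau> (\<sigma> i)) \<otimes> y (\<sigma> i) \<otimes> x i = z (\<tau> (\<sigma> i)) \<otimes> (y (\<sigma> i) \<otimes> x i)" if "i \<in> {1..n}" for i
      using gh i [OF that] that unfolding e lperm_carrier by (intro m_assoc) blast+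
    then show ?thesis unfolding e lperm_mult using i by (auto simp: o_assoc intro!: restrict_ext simp del: atLeastAtMost_iff)
  qed
  show "\<one>\<^bsub>?L\<^esub> \<otimes>\<^bsub>?L\<^esub> h = h" if h: "h \<in> carrier ?L" for h
  proof -
    obtain x \<sigma> where e: "h = (x, \<sigma>)" by (cases h)
    have x: "x \<in> {1..n} \<rightarrow>\<^sub>E carrier G" "\<sigma> permutes {1..n}" using h by (simp_all add: e lperm_carrier)
    have "restrict (\<lambda>i. restrict (\<lambda>_. \<one>) {1..n} (\<sigma> i) \<otimes> x i) {1..n} = x"
      by (rule extensionalityI [of _ "{1..n}"])
        (use x permutes_in_image [OF x(2)] in \<open>auto simp: PiE_iff\<close>)
    then show ?thesis by (simp add: e lperm_one lperm_mult)
  qed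
  show "\<exists>g\<in>carrier ?L. g \<otimes>\<^bsub>?L\<^esub> h = \<one>\<^bsub>?L\<^esub>" if h: "h \<in> carrier ?L" for h
  proof -
    obtain x \<sigma> where e: "h = (x, \<sigma>)" by (cases h)
    have x: "x \<in> {1..n} \<rightarrow>\<^sub>E carrier G" and p: "\<sigma> permutes {1..n}" using h by (simp_all add: e lperm_carrier)
    \<comment> \<open>The inverse has to undo at \<open>i\<close> the label of the preimage of
      \<open>i\<close>, since labels are indexed by sources.\<close>
    let ?g = "(restrict (\<lambda>i. inv (x (inv_into UNIV \<sigma> i))) {1..n}, inv_into UNIV \<sigma>)"
    have "x (inv_into UNIV \<sigma> i) \<in> carrier G" if "i \<in> {1..n}" for i
      using that x permutes_in_image [OF permutes_inv [OF p], of i] by blast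
    then have "?g \<in> carrier ?L" using permutes_inv [OF p] by (auto simp: lperm_carrier simp del: atLeastAtMost_iff)
    moreover have "x i \<in> carrier G" if "i \<in> {1..n}" for i using that x by blast
    then have "?g \<otimes>\<^bsub>?L\<^esub> h = \<one>\<^bsub>?L\<^esub>"
      unfolding e lperm_mult lperm_one using permutes_in_image [OF p] permutes_inverses [OF p] permutes_inv_o [OF p]
      by (auto intro!: restrict_ext simp del: atLeastAtMost_iff)
    ultimately show ?thesis by blast
  qed
qed

lemma qiso_in:
  assumes "g \<in> carrier (lperm_group G n)"
  shows "qiso n g \<in> Arr QG" "qdom (qiso n g) = n" "qcod (qiso n g) = n"
    "\<lbrakk>Suc 0 \<le> j; j \<le> n\<rbrakk> \<Longrightarrow> qfun (qiso n g) j = snd g j"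
    "qlb (qiso n g) = fst g"
    "\<lbrakk>Suc 0 \<le> i; i \<le> n; Suc 0 \<le> j; j \<le> n\<rbrakk> \<Longrightarrow> \<not> qlt (qiso n g) i j"
    "\<lbrakk>Suc 0 \<le> j; j \<le> n\<rbrakk> \<Longrightarrow> Suc 0 \<le> snd g j \<and> snd g j \<le> n"
  using assms qiso_facts [of "fst g" n "snd g"] permutes_in_image [of "snd g" "{1..n}" j]
  by (auto simp: lperm_group_def split_beta)

lemma qiso_comp:
  assumes g: "g \<in> carrier (lperm_group G n)" and h: "h \<in> carrier (lperm_group G n)"
  shows "qcomp G (qiso n g) (qiso n h) = qiso n (g \<otimes>\<^bsub>lperm_group G n\<^esub> h)"
proof -
  interpret L: group "lperm_group G n" by (rule lperm_group)
  note gh = L.m_closed [OF g h]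
  have m: "g \<otimes>\<^bsub>lperm_group G n\<^esub> h = (restrict (\<lambda>i. fst g (snd h i) \<otimes> fst h i) {1..n}, snd g \<circ> snd h)"
    by (simp add: lperm_group_def split_beta)
  show ?thesis
  proof (rule Q_ext)
    show "qcomp G (qiso n g) (qiso n h) \<in> Arr QG" "qiso n (g \<otimes>\<^bsub>lperm_group G n\<^esub> h) \<in> Arr QG"
      using qiso_in [OF g] qiso_in [OF h] qiso_in [OF gh] by simp_all
  next
    fix j assume j: "Suc 0 \<le> j" "j \<le> qdom (qiso n (g \<otimes>\<^bsub>lperm_group G n\<^esub> h))"
    then show "qfun (qcomp G (qiso n g) (qiso n h)) j = qfun (qiso n (g \<otimes>\<^bsub>lperm_group G n\<^esub> h)) j"
      "qlb (qcomp G (qiso n g) (qiso n h)) j = qlb (qiso n (g \<otimes>\<^bsub>lperm_group G n\<^esub> h)) j"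
      using qiso_in [OF g] qiso_in(1-3) [OF h] qiso_in(4) [OF h, of j] qiso_in(5) [OF h] qiso_in(7) [OF h, of j]
        qiso_in(2,4,5) [OF gh] by (simp_all add: m)
  next
    fix i j assume ij: "Suc 0 \<le> i" "i \<le> qdom (qiso n (g \<otimes>\<^bsub>lperm_group G n\<^esub> h))"
      "Suc 0 \<le> j" "j \<le> qdom (qiso n (g \<otimes>\<^bsub>lperm_group G n\<^esub> h))"
    then show "qlt (qcomp G (qiso n g) (qiso n h)) i j = qlt (qiso n (g \<otimes>\<^bsub>lperm_group G n\<^esub> h)) i j"
      using qiso_in(1-3) [OF g] qiso_in(6) [OF g, of "snd h i" "snd h j"] qiso_in(1-3) [OF h] qiso_in(4) [OF h, of j] qiso_in(4) [OF h, of i]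
        qiso_in(6) [OF h, of i j] qiso_in(7) [OF h, of i] qiso_in(7) [OF h, of j] qiso_in(2) [OF gh] qiso_in(6) [OF gh, of i j]
      by simp
  qed (simp_all add: qiso_def)
qed

lemma qiso_inverse:
  assumes g: "g \<in> carrier (lperm_group G n)"
  shows "inverse_arrows QG (qiso n g) (qiso n (inv\<^bsub>lperm_group G n\<^esub> g))"
proof -
  interpret L: group "lperm_group G n" by (rule lperm_group)
  note gi = L.inv_closed [OF g]
  show ?thesis unfolding Q_inverse_iff
    using qiso_in(1-3) [OF g] qiso_in(1-3) [OF gi] qiso_comp [OF g gi] qiso_comp [OF gi g] g by (simp add: qide_def)
qed

lemma qiso_iso: "g \<in> carrier (lperm_group G n) \<Longrightarrow> is_iso QG (qiso n g)"
  using qiso_inverse Q.is_isoI by blast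

text \<open>The exchange rule of \<open>Q\<close>. In the encoding the underlying maps match by
  \<open>push_pull\<close> and the fibre orders by \<open>pull_less\<close>, while all labels are
  those of \<open>g\<close> along \<open>\<phi>\<close>.\<close>

lemma push_pull_comp:
  assumes p: "\<phi> \<in> HomD n m" and g: "g \<in> carrier (lperm_group G m)"
  shows "pull n m g \<phi> \<in> carrier (lperm_group G n)"
    and "qcomp G (qiso m g) (qmor G n m \<phi>) = qcomp G (qmor G n m (push n m g \<phi>)) (qiso n (pull n m g \<phi>))"
proof -
  have s: "snd g permutes {1..m}" and gx: "fst g \<in> {1..m} \<rightarrow>\<^sub>E carrier G" using g by (auto simp: lperm_group_def)
  note pp = push_pull_facts [OF p s]
  have r: "\<phi> j \<in> {1..m}" if "j \<in> {1..n}" for j using HomD_range [OF p that] .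
  show pc: "pull n m g \<phi> \<in> carrier (lperm_group G n)"
    using pp(2) gx r by (auto simp: pull_def lperm_carrier simp del: atLeastAtMost_iff)
  have sp: "snd (pull n m g \<phi>) = pull_perm n m g \<phi>" "fst (pull n m g \<phi>) = restrict (\<lambda>j. fst g (\<phi> j)) {1..n}"
    by (simp_all add: pull_def)
  note I = qiso_in [OF g] and J = qiso_in [OF pc] and M = qmor_facts [OF p] and N = qmor_facts [OF pp(1)]
  have r': "Suc 0 \<le> \<phi> j" "\<phi> j \<le> m" if "Suc 0 \<le> j" "j \<le> n" for j using r [of j] that by simp_all
  have pr: "Suc 0 \<le> pull_perm n m g \<phi> j" "pull_perm n m g \<phi> j \<le> n" if "Suc 0 \<le> j" "j \<le> n" for j
    using permutes_in_image [OF pp(2), of j] that by simp_all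
  show "qcomp G (qiso m g) (qmor G n m \<phi>) = qcomp G (qmor G n m (push n m g \<phi>)) (qiso n (pull n m g \<phi>))"
  proof (rule Q_ext)
    fix j assume "Suc 0 \<le> j" "j \<le> qdom (qcomp G (qmor G n m (push n m g \<phi>)) (qiso n (pull n m g \<phi>)))"
    then have j: "Suc 0 \<le> j" "j \<le> n" using J by simp_all
    show "qfun (qcomp G (qiso m g) (qmor G n m \<phi>)) j = qfun (qcomp G (qmor G n m (push n m g \<phi>)) (qiso n (pull n m g \<phi>))) j"
      using j I(1-3) I(4) [OF r' [OF j]] J(1-3) J(4) [OF j] M(1-4) N(1-4) pp(3) [of j] by (simp add: sp)
    have "fst g (\<phi> j) \<in> carrier G" using gx r [of j] j by auto
    then show "qlb (qcomp G (qiso m g) (qmor G n m \<phi>)) j = qlb (qcomp G (qmor G n m (push n m g \<phi>)) (qiso n (pull n m g \<phi>))) j"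
      using j I(1-3,5) J(1-3,5) J(4) [OF j] M(1-4) M(5) [OF j] N(1-4) N(5) [OF pr [OF j]] by (simp add: sp)
  next
    fix i j assume "Suc 0 \<le> i" "i \<le> qdom (qcomp G (qmor G n m (push n m g \<phi>)) (qiso n (pull n m g \<phi>)))"
      "Suc 0 \<le> j" "j \<le> qdom (qcomp G (qmor G n m (push n m g \<phi>)) (qiso n (pull n m g \<phi>)))"
    then have ij: "Suc 0 \<le> i" "i \<le> n" "Suc 0 \<le> j" "j \<le> n" using J by simp_all
    have 1: "snd g (\<phi> i) = snd g (\<phi> j) \<longleftrightarrow> \<phi> i = \<phi> j" using permutes_inj [OF s] by (auto simp: inj_eq)
    have 2: "qlt (qcomp G (qiso m g) (qmor G n m \<phi>)) i j \<longleftrightarrow> \<phi> i = \<phi> j \<and> i < j"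
      using ij I(1-3) I(6) [OF r' [OF ij(1,2)] r' [OF ij(3,4)]] M by simp
    have 3: "qlt (qcomp G (qmor G n m (push n m g \<phi>)) (qiso n (pull n m g \<phi>))) i j \<longleftrightarrow>
        snd g (\<phi> i) = snd g (\<phi> j) \<and> pull_perm n m g \<phi> i < pull_perm n m g \<phi> j"
      using ij J(1-3) J(4) [OF ij(1,2)] J(4) [OF ij(3,4)] J(6) [OF ij] N pp(3) [of i] pp(3) [of j] by (simp add: sp)
    show "qlt (qcomp G (qiso m g) (qmor G n m \<phi>)) i j = qlt (qcomp G (qmor G n m (push n m g \<phi>)) (qiso n (pull n m g \<phi>))) i j"
      unfolding 2 3 using 1 pp(4) [of i j] ij by auto
  qed (use I J M N in simp_all)
qed

section \<open>Normal forms of arrows of \<open>Q\<close>\<close>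

lemma Q_decompose:
  assumes q: "q \<in> Arr QG"
  shows "q = qcomp G (qmor G (qdom q) (qcod q) (qmap q)) (qiso (qdom q) (qlab q))"
    and "qmap q \<in> HomD (qdom q) (qcod q)" and "qlab q \<in> carrier (lperm_group G (qdom q))"
proof -
  show c: "qlab q \<in> carrier (lperm_group G (qdom q))" and h: "qmap q \<in> HomD (qdom q) (qcod q)"
    using q by (auto simp: QPROP_def)
  note I = qiso_in [OF c] and M = qmor_facts [OF h]
  have E: "qmap q (snd (qlab q) j) = qfun q j" "fst (qlab q) j = qlb q j"
    "qlt q i j \<longleftrightarrow> qfun q i = qfun q j \<and> snd (qlab q) i < snd (qlab q) j" for i j
    by (simp_all add: qfun_def qlb_def qlt_def)
  show "q = qcomp G (qmor G (qdom q) (qcod q) (qmap q)) (qiso (qdom q) (qlab q))"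
  proof (rule Q_ext)
    fix j assume "Suc 0 \<le> j" "j \<le> qdom (qcomp G (qmor G (qdom q) (qcod q) (qmap q)) (qiso (qdom q) (qlab q)))"
    then have j: "Suc 0 \<le> j" "j \<le> qdom q" using I by simp_all
    show "qfun q j = qfun (qcomp G (qmor G (qdom q) (qcod q) (qmap q)) (qiso (qdom q) (qlab q))) j"
      "qlb q j = qlb (qcomp G (qmor G (qdom q) (qcod q) (qmap q)) (qiso (qdom q) (qlab q))) j"
      using j q I(1-3,5) I(4) [OF j] I(7) [OF j] M(1-4) M(5) [of "snd (qlab q) j"] qlb_closed [OF q j]
      by (simp_all add: E)
  next
    fix i j assume "Suc 0 \<le> i" "i \<le> qdom (qcomp G (qmor G (qdom q) (qcod q) (qmap q)) (qiso (qdom q) (qlab q)))"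
      "Suc 0 \<le> j" "j \<le> qdom (qcomp G (qmor G (qdom q) (qcod q) (qmap q)) (qiso (qdom q) (qlab q)))"
    then have ij: "Suc 0 \<le> i" "i \<le> qdom q" "Suc 0 \<le> j" "j \<le> qdom q" using I by simp_all
    show "qlt q i j = qlt (qcomp G (qmor G (qdom q) (qcod q) (qmap q)) (qiso (qdom q) (qlab q))) i j"
      using ij I(1-3) I(4) [OF ij(1,2)] I(4) [OF ij(3,4)] I(6) [OF ij] I(7) [OF ij(1,2)] I(7) [OF ij(3,4)] M(1-4,6) by (simp add: E)
  qed (use q I M in simp_all)
qed

text \<open>By monotonicity the fibre over the last point is a final segment, of length
  \<open>k\<close>; what precedes it is a map onto the first \<open>m\<close> points of the target,
  not necessarily surjective.\<close>

lemma HomD_Suc_split: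
  assumes p: "\<phi> \<in> HomD n (Suc m)"
  obtains l k \<phi>' where "n = l + k" "\<phi>' \<in> HomD l m" "qmor G n (Suc m) \<phi> = qtens (qmor G l m \<phi>') (mul k)"
proof -
  define l where "l = card {i \<in> {1..n}. \<phi> i \<le> m}"
  have "{i \<in> {1..n}. \<phi> i \<le> m} \<subseteq> {1..n}" by auto
  from card_mono [OF finite_atLeastAtMost this] have "l \<le> n" by (simp add: l_def)
  then obtain k where n: "n = l + k" using le_iff_add by blast
  have le: "\<phi> j \<le> m \<longleftrightarrow> j \<le> l" if "Suc 0 \<le> j" "j \<le> n" for j
    unfolding l_def using HomD_le_iff [OF p, of j] that by simp
  have gt: "\<phi> (l + j) = Suc m" if "Suc 0 \<le> j" "j \<le> k" for j
    using le [of "l + j"] HomD_range [OF p, of "l + j"] that n by simp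
  define \<phi>' where "\<phi>' = restrict \<phi> {1..l}"
  have lo: "\<phi>' j = \<phi> j" "\<phi> j \<le> m" if "Suc 0 \<le> j" "j \<le> l" for j using le [of j] that n by (simp_all add: \<phi>'_def)
  have p': "\<phi>' \<in> HomD l m"
  proof (rule HomDI)
    show "\<phi>' j \<in> {1..m}" if "j \<in> {1..l}" for j using that lo [of j] HomD_range [OF p, of j] n by simp
    show "\<phi>' i \<le> \<phi>' j" if "i \<in> {1..l}" "j \<in> {1..l}" "i \<le> j" for i j
      using that HomD_mono [OF p, of i j] n by (simp add: \<phi>'_def)
  qed (simp add: \<phi>'_def)
  note M = qmor_facts [OF p] and N = qmor_facts [OF p']
  have M5: "qlb (qmor G n (Suc m) \<phi>) j = \<one>" if "Suc 0 \<le> j" "j \<le> l + k" for j using M(5) that n by simp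
  have ne: "\<phi> j \<noteq> Suc m" "Suc m \<noteq> \<phi> j" if "Suc 0 \<le> j" "j \<le> l" for j using lo [OF that] by simp_all
  let ?q = "qtens (qmor G l m \<phi>') (mul k)"
  have "qmor G n (Suc m) \<phi> = ?q"
  proof (rule Q_ext)
    fix j assume "Suc 0 \<le> j" "j \<le> qdom ?q"
    then have j: "Suc 0 \<le> j" "j \<le> l + k" using N by simp_all
    show "qfun (qmor G n (Suc m) \<phi>) j = qfun ?q j"
      by (rule sum_range_cases [OF j]) (simp_all add: j M(1-4) N(1-4) gt lo)
    show "qlb (qmor G n (Suc m) \<phi>) j = qlb ?q j"
      by (rule sum_range_cases [OF j]) (simp_all add: j M(1-3) M5 N(1-3,5))
    fix i assume "Suc 0 \<le> i" "i \<le> qdom ?q"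
    then have i: "Suc 0 \<le> i" "i \<le> l + k" using N by simp_all
    show "qlt (qmor G n (Suc m) \<phi>) i j = qlt ?q i j"
      by (rule sum_range_cases2 [OF i j]) (simp_all add: i j M(1-3,6) N(1-3,6) gt lo ne)
  qed (use M N n in simp_all)
  then show thesis using p' n by (intro that [of l k \<phi>']) simp_all
qed

lemma HomD_0: "\<phi> \<in> HomD n 0 \<Longrightarrow> n = 0 \<and> qmor G n 0 \<phi> = qide G 0"
proof -
  assume p: "\<phi> \<in> HomD n 0"
  have n: "n = 0" using HomD_range [OF p, of 1] by (cases n) auto
  moreover have "qmor G n 0 \<phi> = qide G 0"
    by (rule Q_ext) (use qmor_facts [OF p] n in simp_all)
  ultimately show ?thesis by blast
qed

lemma HomD_1: "\<phi> \<in> HomD n 1 \<Longrightarrow> qmor G n 1 \<phi> = mul n"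
proof -
  assume p: "\<phi> \<in> HomD n 1"
  have "\<phi> j = 1" if "Suc 0 \<le> j" "j \<le> n" for j using HomD_range [OF p, of j] that by simp
  then show ?thesis by (intro Q_ext) (use qmor_facts [OF p] in simp_all)
qed

text \<open>An arrow with target \<open>2\<close> is a juxtaposition of two multiplications after an
  isomorphism. It serves to analyse the left leg of a square over \<open>mul 2\<close> and
  \<open>mul l\<close>, about which nothing but its target is known.\<close>

lemma Q_over_2:
  assumes x: "x \<in> Arr QG" "qcod x = 2"
  obtains k l h where "x = qcomp G (qtens (mul k) (mul l)) h" "is_iso QG h" "qcod h = k + l"
proof -
  note d = Q_decompose [OF x(1)]
  have h2: "qmap x \<in> HomD (qdom x) (Suc 1)" using d(2) x(2) by (simp add: numeral_2_eq_2)
  then obtain k l \<phi>' where k: "qdom x = k + l" "\<phi>' \<in> HomD k 1"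
    "qmor G (qdom x) (Suc 1) (qmap x) = qtens (qmor G k 1 \<phi>') (mul l)" by (rule HomD_Suc_split)
  have "x = qcomp G (qtens (mul k) (mul l)) (qiso (qdom x) (qlab x))"
    using d(1) k(3) HomD_1 [OF k(2)] x(2) by (simp add: numeral_2_eq_2)
  then show thesis using qiso_iso [OF d(3)] qiso_in(3) [OF d(3)] k(1) by (intro that [of k l "qiso (qdom x) (qlab x)"]) simp_all
qed

text \<open>The apex lists the matching pairs as \<open>(1,1)\<close>, \<open>(2,1)\<close>,
  \<open>(1,2)\<close>, \<open>(2,2)\<close>. The right leg groups neighbours by the second entry;
  the transposition in \<open>sigma23\<close> is what groups them by the first entry on the left
  leg.\<close>

lemma PB_mul_2_2:
  "PB (mul 2) (mul 2) (qcomp G (qtens (mul 2) (mul 2)) (sigma23 G)) (qtens (mul 2) (mul 2))"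
proof -
  let ?s = "sigma23 G" and ?y = "qtens (mul 2) (mul 2)"
  have four: "t \<in> {1, 2, 3, 4}" if "t \<in> {1..4}" for t :: nat using that by auto
  have "qfun (Sym QG 1 1) (1 + 1) = 1" by (rule qsym_facts(5)) simp_all
  then have S: "qfun (Sym QG (Suc 0) (Suc 0)) 2 = Suc 0" by (simp only: one_add_one) (simp only: One_nat_def)
  have S': "qfun (Sym QG (Suc 0) (Suc 0)) (Suc 0) = 2" by (simp add: numeral_2_eq_2)
  have s: "?s \<in> Arr QG" "qdom ?s = 4" "qcod ?s = 4"
    "qfun ?s 1 = 1" "qfun ?s 2 = 3" "qfun ?s 3 = 2" "qfun ?s 4 = 4"
    by (simp_all add: sigma23_def qfun_qtens S S')
  have sl: "qlb ?s t = \<one>" "\<not> qlt ?s s t" if "s \<in> {1..4}" "t \<in> {1..4}" for s t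
    using four [OF that(1)] four [OF that(2)] by (auto simp: sigma23_def qlb_qtens qlt_qtens)
  have y: "qfun ?y 1 = 1" "qfun ?y 2 = 1" "qfun ?y 3 = 2" "qfun ?y 4 = 2" by (simp_all add: qfun_qtens)
  have yl: "qlb ?y t = \<one>" "qlt ?y s t \<longleftrightarrow> qfun ?y s = qfun ?y t \<and> s < t" if "s \<in> {1..4}" "t \<in> {1..4}" for s t
    using four [OF that(1)] four [OF that(2)] by (auto simp: qfun_qtens qlb_qtens qlt_qtens)
  let ?x = "qcomp G ?y ?s"
  have x: "qfun ?x 1 = 1" "qfun ?x 2 = 2" "qfun ?x 3 = 1" "qfun ?x 4 = 2"
    using s y by simp_all
  have xl: "qlb ?x t = \<one>" "qlt ?x s t \<longleftrightarrow> qfun ?x s = qfun ?x t \<and> s < t" if "s \<in> {1..4}" "t \<in> {1..4}" for s t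
    using that four [OF that(1)] four [OF that(2)] s sl [OF that] by (auto simp: yl y)
  show ?thesis
  proof (rule PB_I)
    fix t assume "t \<in> {1..qdom ?y}"
    then have t: "t \<in> {1..4}" by simp
    show "qfun (mul 2) (qfun ?x t) = qfun (mul 2) (qfun ?y t)" using four [OF t] x y by auto
    show "qlb (mul 2) (qfun ?x t) \<otimes> qlb ?x t = qlb (mul 2) (qfun ?y t) \<otimes> qlb ?y t"
      using four [OF t] x y xl(1) [OF t t] yl(1) [OF t t] by auto
  next
    fix i j assume "i \<in> {1..qdom (mul 2)}" "j \<in> {1..qdom (mul 2)}"
    then have "i = 1 \<or> i = 2" "j = 1 \<or> j = 2" by auto
    moreover have "1 \<in> {1..qdom ?y}" "2 \<in> {1..qdom ?y}" "3 \<in> {1..qdom ?y}" "4 \<in> {1..qdom ?y}" by simp_all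
    ultimately show "\<exists>t\<in>{1..qdom ?y}. qfun ?x t = i \<and> qfun ?y t = j" using x y by metis
  next
    fix s t assume "s \<in> {1..qdom ?y}" "t \<in> {1..qdom ?y}"
    then have st: "s \<in> {1..4}" "t \<in> {1..4}" by simp_all
    show "s = t" if "qfun ?x s = qfun ?x t" "qfun ?y s = qfun ?y t"
      using that four [OF st(1)] four [OF st(2)] x y by auto
    show "qlt ?x s t \<longleftrightarrow> qfun ?x s = qfun ?x t \<and> qlt (mul 2) (qfun ?y s) (qfun ?y t)"
      unfolding xl(2) [OF st] using four [OF st(1)] four [OF st(2)] x y by auto
    show "qlt ?y s t \<longleftrightarrow> qfun ?y s = qfun ?y t \<and> qlt (mul 2) (qfun ?x s) (qfun ?x t)"
      unfolding yl(2) [OF st] using four [OF st(1)] four [OF st(2)] x y by auto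
  qed (simp_all add: s)
qed

lemma PB_mul_0:
  "PB (mul 0) (mul 0) (qide G 0) (qide G 0)"
  "PB (mul 2) (mul 0) (qtens (mul 0) (mul 0)) (qide G 0)"
  "PB (mul 0) (mul 2) (qide G 0) (qtens (mul 0) (mul 0))"
proof -
  show "PB (mul 0) (mul 0) (qide G 0) (qide G 0)" by (rule PB_I) simp_all
  show "PB (mul 2) (mul 0) (qtens (mul 0) (mul 0)) (qide G 0)"
  proof (rule PB_I)
    fix i j assume "j \<in> {1..qdom (mul 0)}"
    then show "\<exists>t\<in>{1..qdom (qide G 0)}. qfun (qtens (mul 0) (mul 0)) t = i \<and> qfun (qide G 0) t = j" by simp
  qed simp_all
  then show "PB (mul 0) (mul 2) (qide G 0) (qtens (mul 0) (mul 0))" by (rule PB_sym)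
qed

section \<open>Existence and uniqueness of the law\<close>

lemma PB_cospan_rel:
  assumes p: "PB b c x y" and r: "((b, c), (b', c')) \<in> cospan_rel QG"
  shows "PB b' c' x y"
proof -
  obtain h where "is_iso QG h" "qdom h = qcod b" "b' = qcomp G h b" "c' = qcomp G h c"
    using r by (auto simp: cospan_rel_def)
  then show ?thesis using PB_postcomp [OF p] by simp
qed

text \<open>Restriction to the cospan classes makes the function extensional, as
  \<open>law_fun\<close> demands; otherwise a law could not be unique.\<close>

definition law0 :: "('a qarr \<times> 'a qarr) set \<Rightarrow> ('a qarr \<times> 'a qarr) set" where
  "law0 = restrict (\<lambda>X. {(x, y). \<exists>b c. (b, c) \<in> X \<and> PB b c x y}) (cospans QG // cospan_rel QG)"

lemma law0_iff:
  assumes "(b, c) \<in> cospans QG"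
  shows "(x, y) \<in> law0 (cospan_class QG b c) \<longleftrightarrow> PB b c x y"
proof -
  have q: "cospan_class QG b c \<in> cospans QG // cospan_rel QG"
    using assms by (rule quotientI)
  have "(b, c) \<in> cospan_class QG b c" using equiv_class_self [OF Q.equiv_cospan_rel assms] .
  moreover have "PB b c x y" if "((b, c), (b', c')) \<in> cospan_rel QG" "PB b' c' x y" for b' c'
    using PB_cospan_rel [OF that(2)] that(1) Q.equiv_cospan_rel by (meson equivE symE)
  ultimately show ?thesis unfolding law0_def using q by auto
qed

lemma law0_class:
  assumes p: "PB b c x y"
  shows "law0 (cospan_class QG b c) = span_class QG x y"
proof -
  have c: "(b, c) \<in> cospans QG" using PB_facts(1-8) [OF p] by (simp add: Q.cospans_iff)
  show ?thesis
  proof (intro equalityI subsetI)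
    fix s assume s: "s \<in> law0 (cospan_class QG b c)"
    obtain x' y' where e: "s = (x', y')" by (cases s)
    show "s \<in> span_class QG x y" using s PB_unique [OF p] unfolding e law0_iff [OF c] by blast
  next
    fix s assume s: "s \<in> span_class QG x y"
    obtain x' y' where e: "s = (x', y')" by (cases s)
    show "s \<in> law0 (cospan_class QG b c)" using s PB_span_rel [OF p] unfolding e law0_iff [OF c] by blast
  qed
qed

lemma cospans_PB: "(b, c) \<in> cospans QG \<Longrightarrow> \<exists>x y. PB b c x y"
  using PB_exists [of b c] by (simp add: Q.cospans_iff) blast

text \<open>Each axiom is a closure property of pullback squares: pasting gives compatibility with
  composition, \<open>PB_tens\<close> that with the tensor product, and the prescribed values are
  explicit squares.\<close>

lemma law0_law: "bimonoid_law G law0"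
proof (intro bimonoid_law.intro distributive_law.intro distributive_law_axioms.intro bimonoid_law_axioms.intro)
  show "symmetric_monoidal_category QG" by (rule Q.symmetric_monoidal_category_axioms)
  show "law0 \<in> cospans QG // cospan_rel QG \<rightarrow>\<^sub>E spans QG // span_rel QG"
  proof
    fix X assume "X \<in> cospans QG // cospan_rel QG"
    then obtain b c where bc: "(b, c) \<in> cospans QG" "X = cospan_class QG b c"
      by (metis quotientE surj_pair)
    obtain x y where p: "PB b c x y" using cospans_PB [OF bc(1)] by blast
    then have "(x, y) \<in> spans QG" using PB_facts(1-8) [OF p] by (simp add: Q.spans_iff)
    then show "law0 X \<in> spans QG // span_rel QG" unfolding bc(2) law0_class [OF p] by (rule quotientI)
  qed (simp add: law0_def)
next
  fix b c x y assume "(b, c) \<in> cospans QG" "(x, y) \<in> law0 (cospan_class QG b c)"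
  then have p: "PB b c x y" using law0_iff by blast
  show "Cod QG x = Dom QG b \<and> Cod QG y = Dom QG c" using PB_facts(1-8) [OF p] by simp
next
  fix b c x y g g' h h' assume c: "(b, c) \<in> cospans QG" and l: "(x, y) \<in> law0 (cospan_class QG b c)"
    and g: "inverse_arrows QG g g'" "inverse_arrows QG h h'" "Cod QG g = Dom QG b" "Cod QG h = Dom QG c"
  then have p: "PB b c x y" using law0_iff by blast
  have q: "PB (qcomp G b g) (qcomp G c h) (qcomp G g' x) (qcomp G h' y)" using PB_iso [OF p g(1) _ g(2)] g by simp
  then have "(qcomp G b g, qcomp G c h) \<in> cospans QG" using PB_facts(1-8) [OF q] by (simp add: Q.cospans_iff)
  then show "(g' \<cdot>\<^bsub>QPROP G\<^esub> x, h' \<cdot>\<^bsub>QPROP G\<^esub> y) \<in> law0 (cospan_class QG (b \<cdot>\<^bsub>QPROP G\<^esub> g) (c \<cdot>\<^bsub>QPROP G\<^esub> h))"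
    using q law0_iff by simp
next
  fix f p m assume "f \<in> Hom QG p m"
  then have f: "f \<in> Arr QG" "qdom f = p" "qcod f = m" by (simp_all add: Hom_iff)
  show "law0 (cospan_class QG f (Ide QG m)) = span_class QG (Ide QG p) f"
    using law0_class [OF PB_ide_right [OF f(1)]] f by simp
next
  fix f p m assume "f \<in> Hom QG p m"
  then have f: "f \<in> Arr QG" "qdom f = p" "qcod f = m" by (simp_all add: Hom_iff)
  show "law0 (cospan_class QG (Ide QG m) f) = span_class QG f (Ide QG p)"
    using law0_class [OF PB_ide_left [OF f(1)]] f by simp
next
  fix b c f x y z w assume c: "(b, c) \<in> cospans QG" "f \<in> Arr QG" "Cod QG f = Dom QG b"
    "(x, y) \<in> law0 (cospan_class QG b c)" "(z, w) \<in> law0 (cospan_class QG f x)"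
  have p: "PB b c x y" using c(1,4) law0_iff by blast
  then have "(f, x) \<in> cospans QG" using PB_facts(1-8) [OF p] c(2,3) by (simp add: Q.cospans_iff)
  then have p': "PB f x z w" using c(5) law0_iff by blast
  note q = PB_comp_left [OF p p']
  then have "(qcomp G b f, c) \<in> cospans QG" using PB_facts(1-8) [OF q] by (simp add: Q.cospans_iff)
  then show "(z, y \<cdot>\<^bsub>QPROP G\<^esub> w) \<in> law0 (cospan_class QG (b \<cdot>\<^bsub>QPROP G\<^esub> f) c)"
    using q law0_iff by simp
next
  fix b c h x y z w assume c: "(b, c) \<in> cospans QG" "h \<in> Arr QG" "Cod QG h = Dom QG c"
    "(x, y) \<in> law0 (cospan_class QG b c)" "(z, w) \<in> law0 (cospan_class QG y h)"
  have p: "PB b c x y" using c(1,4) law0_iff by blast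
  then have "(y, h) \<in> cospans QG" using PB_facts(1-8) [OF p] c(2,3) by (simp add: Q.cospans_iff)
  then have p': "PB y h z w" using c(5) law0_iff by blast
  note q = PB_comp_right [OF p p']
  then have "(b, qcomp G c h) \<in> cospans QG" using PB_facts(1-8) [OF q] by (simp add: Q.cospans_iff)
  then show "(x \<cdot>\<^bsub>QPROP G\<^esub> z, w) \<in> law0 (cospan_class QG b (c \<cdot>\<^bsub>QPROP G\<^esub> h))"
    using q law0_iff by simp
next
  fix b c b' c' x y x' y' assume c: "(b, c) \<in> cospans QG" "(b', c') \<in> cospans QG"
    "(x, y) \<in> law0 (cospan_class QG b c)" "(x', y') \<in> law0 (cospan_class QG b' c')"
  have p: "PB b c x y" "PB b' c' x' y'" using c law0_iff by blast+
  note q = PB_tens [OF p]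
  then have "(qtens b b', qtens c c') \<in> cospans QG" using PB_facts(1-8) [OF q] by (simp add: Q.cospans_iff)
  then show "(x \<odot>\<^bsub>QPROP G\<^esub> x', y \<odot>\<^bsub>QPROP G\<^esub> y') \<in> law0 (cospan_class QG (b \<odot>\<^bsub>QPROP G\<^esub> b') (c \<odot>\<^bsub>QPROP G\<^esub> c'))"
    using q law0_iff by simp
next
  fix g h n assume g: "g \<in> carrier (lperm_group G n)" and h: "h \<in> carrier (lperm_group G n)"
  interpret L: group "lperm_group G n" by (rule lperm_group)
  note gi = L.inv_closed [OF g] and hi = L.inv_closed [OF h]
  show "law0 (cospan_class QG (qiso n g) (qiso n h)) =
      span_class QG (qiso n (inv\<^bsub>lperm_group G n\<^esub> g)) (qiso n (inv\<^bsub>lperm_group G n\<^esub> h))"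
    by (intro law0_class PB_square qiso_iso)
      (use g h gi hi qiso_in(1-3) [OF gi] qiso_in(1-3) [OF hi] qiso_in(1-3) [OF g] qiso_in(1-3) [OF h]
        qiso_comp [OF g gi] qiso_comp [OF h hi] in simp_all)
next
  fix \<phi> n m g assume p: "\<phi> \<in> HomD n m" and g: "g \<in> carrier (lperm_group G m)"
  interpret L: group "lperm_group G m" by (rule lperm_group)
  interpret K: group "lperm_group G n" by (rule lperm_group)
  let ?p = "pull n m g \<phi>" and ?q = "qmor G n m (push n m g \<phi>)"
  note pc = push_pull_comp(1) [OF p g] and pq = push_pull_comp(2) [OF p g]
  note gi = L.inv_closed [OF g] and pi = K.inv_closed [OF pc]
  have s: "snd g permutes {1..m}" using g by (auto simp: lperm_group_def)
  note I = qiso_in(1-3) [OF g] qiso_in(1-3) [OF gi] qiso_in(1-3) [OF pc] qiso_in(1-3) [OF pi]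
    qmor_facts(1-3) [OF p] qmor_facts(1-3) [OF push_HomD [OF p s]]
  \<comment> \<open>The product of \<open>inv g\<close> and \<open>g\<close> is inserted so that
    \<open>push_pull_comp\<close> can move \<open>g\<close> across \<open>\<phi>\<close>. The
    resulting equation is the commuting square with inverses that the axioms prescribe.\<close>
  have "qcomp G (qmor G n m \<phi>) (qiso n (inv\<^bsub>lperm_group G n\<^esub> ?p)) =
      qcomp G (qcomp G (qiso m (inv\<^bsub>lperm_group G m\<^esub> g)) (qiso m g)) (qcomp G (qmor G n m \<phi>) (qiso n (inv\<^bsub>lperm_group G n\<^esub> ?p)))"
    using I qiso_comp [OF gi g] L.l_inv [OF g] by (simp add: qide_def [symmetric])
  also have "\<dots> = qcomp G (qiso m (inv\<^bsub>lperm_group G m\<^esub> g)) (qcomp G (qcomp G (qiso m g) (qmor G n m \<phi>)) (qiso n (inv\<^bsub>lperm_group G n\<^esub> ?p)))"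
    using I by (simp add: Q_assoc)
  also have "\<dots> = qcomp G (qiso m (inv\<^bsub>lperm_group G m\<^esub> g)) (qcomp G ?q (qcomp G (qiso n ?p) (qiso n (inv\<^bsub>lperm_group G n\<^esub> ?p))))"
    unfolding pq using I by (simp add: Q_assoc)
  also have "\<dots> = qcomp G (qiso m (inv\<^bsub>lperm_group G m\<^esub> g)) ?q"
    using I qiso_comp [OF pc pi] K.r_inv [OF pc] by (simp add: qide_def [symmetric])
  finally have e: "qcomp G (qmor G n m \<phi>) (qiso n (inv\<^bsub>lperm_group G n\<^esub> ?p)) = qcomp G (qiso m (inv\<^bsub>lperm_group G m\<^esub> g)) ?q" .
  have P: "PB (qmor G n m \<phi>) (qiso m (inv\<^bsub>lperm_group G m\<^esub> g)) (qiso n (inv\<^bsub>lperm_group G n\<^esub> ?p)) ?q"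
    by (rule PB_square [OF qiso_iso [OF gi] qiso_iso [OF pi] _ _ _ _ e]) (use I in simp_all)
  show "law0 (cospan_class QG (qmor G n m \<phi>) (qiso m (inv\<^bsub>lperm_group G m\<^esub> g))) =
      span_class QG (qiso n (inv\<^bsub>lperm_group G n\<^esub> ?p)) ?q" by (rule law0_class [OF P])
  show "law0 (cospan_class QG (qiso m (inv\<^bsub>lperm_group G m\<^esub> g)) (qmor G n m \<phi>)) =
      span_class QG ?q (qiso n (inv\<^bsub>lperm_group G n\<^esub> ?p))" by (rule law0_class [OF PB_sym [OF P]])
next
  show "law0 (cospan_class QG (m_arr G) (m_arr G)) =
      span_class QG (qcomp G (qtens (m_arr G) (m_arr G)) (sigma23 G)) (qtens (m_arr G) (m_arr G))"
    unfolding m_arr_eq by (rule law0_class [OF PB_mul_2_2])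
  show "law0 (cospan_class QG (u_arr G) (u_arr G)) = span_class QG (qide G 0) (qide G 0)"
    "law0 (cospan_class QG (m_arr G) (u_arr G)) = span_class QG (qtens (u_arr G) (u_arr G)) (qide G 0)"
    "law0 (cospan_class QG (u_arr G) (m_arr G)) = span_class QG (qide G 0) (qtens (u_arr G) (u_arr G))"
    unfolding m_arr_eq u_arr_eq by (rule law0_class [OF PB_mul_0(1)] law0_class [OF PB_mul_0(2)] law0_class [OF PB_mul_0(3)])+
qed

text \<open>Cutting a cospan over \<open>n\<close> into cospans over \<open>1\<close> reduces every pullback square to the four
  squares built from \<open>m\<close> and \<open>u\<close>.\<close>

lemma PB_induct [consumes 1, case_names equiv iso ide_right ide_left comp_left comp_right tens mm uu mu um]:
  assumes PB0: "PB b0 c0 x0 y0"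
    and cls: "\<And>b c x y x' y'. \<lbrakk>PB b c x y; P b c x y; PB b c x' y'\<rbrakk> \<Longrightarrow> P b c x' y'"
    and iso: "\<And>b c x y g g' h h'. \<lbrakk>PB b c x y; P b c x y; inverse_arrows QG g g'; inverse_arrows QG h h';
      qcod g = qdom b; qcod h = qdom c\<rbrakk> \<Longrightarrow> P (qcomp G b g) (qcomp G c h) (qcomp G g' x) (qcomp G h' y)"
    and idr: "\<And>f. f \<in> Arr QG \<Longrightarrow> P f (qide G (qcod f)) (qide G (qdom f)) f"
    and idl: "\<And>f. f \<in> Arr QG \<Longrightarrow> P (qide G (qcod f)) f f (qide G (qdom f))"
    and cl: "\<And>b c x y f z w. \<lbrakk>PB b c x y; P b c x y; PB f x z w; P f x z w\<rbrakk> \<Longrightarrow> P (qcomp G b f) c z (qcomp G y w)"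
    and cr: "\<And>b c x y h z w. \<lbrakk>PB b c x y; P b c x y; PB y h z w; P y h z w\<rbrakk> \<Longrightarrow> P b (qcomp G c h) (qcomp G x z) w"
    and te: "\<And>b c x y b' c' x' y'. \<lbrakk>PB b c x y; P b c x y; PB b' c' x' y'; P b' c' x' y'\<rbrakk>
      \<Longrightarrow> P (qtens b b') (qtens c c') (qtens x x') (qtens y y')"
    and mm: "P (mul 2) (mul 2) (qcomp G (qtens (mul 2) (mul 2)) (sigma23 G)) (qtens (mul 2) (mul 2))"
    and uu: "P (mul 0) (mul 0) (qide G 0) (qide G 0)"
    and mu: "P (mul 2) (mul 0) (qtens (mul 0) (mul 0)) (qide G 0)"
    and um: "P (mul 0) (mul 2) (qide G 0) (qtens (mul 0) (mul 0))"
  shows "P b0 c0 x0 y0"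
proof -
  \<comment> \<open>By \<open>cls\<close> it is enough to verify \<open>P\<close> for one square
    over a cospan. \<open>A b c\<close> joins existence with validity for all squares, which makes
    it a property of the cospan alone.\<close>
  define A where "A b c \<longleftrightarrow> (\<exists>x y. PB b c x y) \<and> (\<forall>x y. PB b c x y \<longrightarrow> P b c x y)" for b c
  have AI: "A b c" if "PB b c x y" "P b c x y" for b c x y using that cls unfolding A_def by blast
  have A_left: "A (qcomp G b f) c" if a: "A b c" "PB b c x y" "A f x" for b c f x y
  proof -
    obtain z w where "PB f x z w" "P f x z w" using a(3) unfolding A_def by blast
    then show ?thesis using AI [OF PB_comp_left cl] a(1,2) unfolding A_def by blast
  qed
  have A_right: "A b (qcomp G c h)" if a: "A b c" "PB b c x y" "A y h" for b c h x y
  proof -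
    obtain z w where "PB y h z w" "P y h z w" using a(3) unfolding A_def by blast
    then show ?thesis using AI [OF PB_comp_right cr] a(1,2) unfolding A_def by blast
  qed
  have A_tens: "A (qtens b b') (qtens c c')" if a: "A b c" "A b' c'" for b c b' c'
  proof -
    obtain x y where 1: "PB b c x y" "P b c x y" using a(1) unfolding A_def by blast
    obtain x' y' where 2: "PB b' c' x' y'" "P b' c' x' y'" using a(2) unfolding A_def by blast
    show ?thesis by (rule AI [OF PB_tens [OF 1(1) 2(1)] te [OF 1 2]])
  qed
  have A_iso: "A (qcomp G b g) (qcomp G c h)"
    if a: "A b c" and i: "is_iso QG g" "is_iso QG h" and d: "qcod g = qdom b" "qcod h = qdom c" for b c g h
  proof -
    obtain x y where 1: "PB b c x y" "P b c x y" using a unfolding A_def by blast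
    obtain g' h' where gh: "inverse_arrows QG g g'" "inverse_arrows QG h h'" using i by (auto simp: is_iso_def)
    show ?thesis by (rule AI [OF PB_iso [OF 1(1) gh(1) d(1) gh(2) d(2)] iso [OF 1 gh d]])
  qed
  have A_idr: "A f (qide G n)" if "f \<in> Arr QG" "qcod f = n" for f n
    using AI [OF PB_ide_right idr] that by blast
  have A_idl: "A (qide G n) f" if "f \<in> Arr QG" "qcod f = n" for f n
    using AI [OF PB_ide_left idl] that by blast
  \<comment> \<open>Peeling one multiplication off the right leg, the square over \<open>u\<close>
    and \<open>m\<close> leaves a smaller cospan beside one with an identity leg. The next step does
    the same with the square over \<open>m\<close> and \<open>m\<close>.\<close>
  have ul: "A (mul 0) (mul l)" for l
  proof (induction l)
    case 0
    show ?case by (rule AI [OF PB_mul_0(1) uu])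
  next
    case (Suc l)
    have "A (qtens (mul 0) (mul 0)) (qtens (mul l) (qide G 1))" by (intro A_tens Suc A_idr) simp_all
    then show ?case unfolding mul_Suc [of l] by (rule A_right [OF AI [OF PB_mul_0(3) um] PB_mul_0(3)])
  qed
  have ml: "A (mul 2) (mul l)" for l
  proof (induction l)
    case 0
    show ?case by (rule AI [OF PB_mul_0(2) mu])
  next
    case (Suc l)
    have "A (qtens (mul 2) (mul 2)) (qtens (mul l) (qide G 1))" by (intro A_tens Suc A_idr) simp_all
    then show ?case unfolding mul_Suc [of l] by (rule A_right [OF AI [OF PB_mul_2_2 mm] PB_mul_2_2])
  qed
  \<comment> \<open>The induction on \<open>k\<close> needs arbitrary \<open>l\<close>: once
    \<open>mul 2\<close> is peeled off the left, its square with \<open>mul l\<close> replaces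
    \<open>mul l\<close> by some \<open>x\<close> into \<open>2\<close>, and \<open>Q_over_2\<close>
    splits \<open>x\<close> into multiplications of other arities.\<close>
  have kl: "A (mul k) (mul l)" for k l
  proof (induction k arbitrary: l)
    case 0
    show ?case by (rule ul)
  next
    case (Suc k)
    obtain x y where p: "PB (mul 2) (mul l) x y" using ml [of l] unfolding A_def by blast
    then have "x \<in> Arr QG" "qcod x = 2" using PB_facts(1-8) [OF p] by simp_all
    then obtain k1 k2 h where x: "x = qcomp G (qtens (mul k1) (mul k2)) h" "is_iso QG h" "qcod h = k1 + k2"
      by (rule Q_over_2)
    have "A (qtens (mul k) (qide G 1)) (qtens (mul k1) (mul k2))" by (intro A_tens Suc A_idl) simp_all
    from A_iso [OF this Q_iso_ide x(2), of "k + 1"] have "A (qtens (mul k) (qide G 1)) x"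
      using x by simp
    then show ?case unfolding mul_Suc [of k] by (rule A_left [OF ml p])
  qed
  \<comment> \<open>Cutting off the last point of the common target splits the cospan into a smaller
    one and a cospan of two multiplications, side by side.\<close>
  have H: "A (qmor G n m \<phi>) (qmor G n' m \<psi>)" if "\<phi> \<in> HomD n m" "\<psi> \<in> HomD n' m" for n n' m \<phi> \<psi>
    using that
  proof (induction m arbitrary: n n' \<phi> \<psi>)
    case 0
    then show ?case using HomD_0 A_idr [of "qide G 0" 0] by simp
  next
    case (Suc m)
    obtain l k \<phi>' where 1: "\<phi>' \<in> HomD l m" "qmor G n (Suc m) \<phi> = qtens (qmor G l m \<phi>') (mul k)"
      using Suc.prems(1) by (rule HomD_Suc_split)
    obtain l' k' \<psi>' where 2: "\<psi>' \<in> HomD l' m" "qmor G n' (Suc m) \<psi> = qtens (qmor G l' m \<psi>') (mul k')"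
      using Suc.prems(2) by (rule HomD_Suc_split)
    show ?case unfolding 1(2) 2(2) by (rule A_tens [OF Suc.IH [OF 1(1) 2(1)] kl])
  qed
  note F = PB_facts(1-8) [OF PB0]
  note B = Q_decompose [OF F(1)] and C = Q_decompose [OF F(2)]
  have "A (qcomp G (qmor G (qdom b0) (qcod b0) (qmap b0)) (qiso (qdom b0) (qlab b0)))
      (qcomp G (qmor G (qdom c0) (qcod c0) (qmap c0)) (qiso (qdom c0) (qlab c0)))"
  proof (rule A_iso [OF _ qiso_iso [OF B(3)] qiso_iso [OF C(3)]])
    show "A (qmor G (qdom b0) (qcod b0) (qmap b0)) (qmor G (qdom c0) (qcod c0) (qmap c0))"
      using H [OF B(2)] C(2) F(5) by simp
  qed (simp_all add: qiso_def qmor_def)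
  then have "A b0 c0" using B(1) C(1) by simp
  then show ?thesis using PB0 unfolding A_def by blast
qed

text \<open>Every rule of \<open>PB_induct\<close> holds for the relation \<open>L\<close> of any
  law, so \<open>L\<close> contains all pullback squares. As the value at a cospan is a single
  class, this determines it.\<close>

lemma bimonoid_law_unique:
  assumes "bimonoid_law G \<Lambda>"
  shows "\<Lambda> = law0"
proof -
  interpret B: bimonoid_law G \<Lambda> by (rule assms)
  have L: "B.L b c x y" if "PB b c x y" for b c x y
    using that
  proof (induction rule: PB_induct)
    case (equiv b c x y x' y')
    then show ?case using B.L_span_rel PB_unique by blast
  next
    case (iso b c x y g g' h h')
    then show ?case using B.L_iso [of b c x y g g' h h'] by simp
  next
    case (ide_right f)
    then show ?case using B.L_ide_right [of f] by simp
  next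
    case (ide_left f)
    then show ?case using B.L_ide_left [of f] by simp
  next
    case (comp_left b c x y f z w)
    then show ?case using B.L_comp_left [of b c x y f z w] by simp
  next
    case (comp_right b c x y h z w)
    then show ?case using B.L_comp_right [of b c x y h z w] by simp
  next
    case (tens b c x y b' c' x' y')
    then show ?case using B.L_tens [of b c x y b' c' x' y'] by simp
  next
    case mm
    have "(qcomp G (qtens (mul 2) (mul 2)) (sigma23 G), qtens (mul 2) (mul 2)) \<in> spans QG"
      using PB_facts(1-8) [OF PB_mul_2_2] by (simp add: Q.spans_iff)
    then show ?case unfolding B.L_def
      using B.law_m_m Q.span_class_self by (simp add: m_arr_eq Q.cospans_iff)
  next
    case uu
    show ?case unfolding B.L_def
      using B.law_u_u Q.span_class_self [of "qide G 0" "qide G 0"] by (simp add: u_arr_eq Q.cospans_iff Q.spans_iff)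
  next
    case mu
    show ?case unfolding B.L_def
      using B.law_m_u Q.span_class_self [of "qtens (mul 0) (mul 0)" "qide G 0"]
      by (simp add: u_arr_eq m_arr_eq Q.cospans_iff Q.spans_iff)
  next
    case um
    show ?case unfolding B.L_def
      using B.law_u_m Q.span_class_self [of "qide G 0" "qtens (mul 0) (mul 0)"]
      by (simp add: u_arr_eq m_arr_eq Q.cospans_iff Q.spans_iff)
  qed
  show ?thesis
  proof
    fix X
    show "\<Lambda> X = law0 X"
    proof (cases "X \<in> cospans QG // cospan_rel QG")
      case True
      then obtain b c where bc: "(b, c) \<in> cospans QG" "X = cospan_class QG b c"
        by (metis quotientE surj_pair)
      obtain x y where p: "PB b c x y" using cospans_PB [OF bc(1)] by blast
      obtain x' y' where xy: "(x', y') \<in> spans QG" "\<Lambda> X = span_class QG x' y'"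
        using B.law_class [OF bc(1)] bc(2) by metis
      have "(x, y) \<in> span_class QG x' y'" using L [OF p] xy(2) bc(2) by (simp add: B.L_def)
      then have "span_class QG x' y' = span_class QG x y"
        using equiv_class_eq [OF Q.equiv_span_rel] by blast
      then show ?thesis using law0_class [OF p] xy(2) bc(2) by simp
    next
      \<comment> \<open>Outside the cospan classes both functions are \<open>undefined\<close>, by
        extensionality.\<close>
      case False
      then show ?thesis using B.law_fun by (auto simp: law0_def PiE_def extensional_def)
    qed
  qed
qed

lemma the_law_eq: "the_law G = law0"
  unfolding the_law_def by (rule the_equality [of "bimonoid_law G", OF law0_law bimonoid_law_unique])

lemma the_law_law: "bimonoid_law G (the_law G)"
  using law0_law the_law_eq by simp

end

sublocale group \<subseteq> T: PROP_law "QPROP G" "the_law G"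
  by (intro PROP_law.intro QPROP_is_PROP bimonoid_law.axioms(1) the_law_law)

context group
begin

lemma T_L_iff: "T.L b c x y \<longleftrightarrow> PB b c x y"
  unfolding T.L_def unfolding the_law_eq using law0_iff PB_facts(1-8) [of b c x y] by (auto simp: Q.cospans_iff)

end

section \<open>Generated PROPs, opposite PROPs, morphisms of PROPs\<close>

text \<open>Identities are given on \<open>0\<close> and \<open>1\<close> only, the others being
  tensor products of these. Symmetries have to come from \<open>B\<close>. The composition rule asks
  for matching ends, since \<open>Comp\<close> is a total function.\<close>

inductive gen_by :: "(nat, 'a, 'z) smc_scheme \<Rightarrow> 'a set \<Rightarrow> 'a \<Rightarrow> bool" for T B where
  base: "f \<in> B \<Longrightarrow> gen_by T B f"
| ide0: "gen_by T B (Ide T 0)"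
| ide1: "gen_by T B (Ide T 1)"
| comp: "\<lbrakk>gen_by T B f; gen_by T B g; Cod T f = Dom T g\<rbrakk> \<Longrightarrow> gen_by T B (Comp T g f)"
| tens: "\<lbrakk>gen_by T B f; gen_by T B g\<rbrakk> \<Longrightarrow> gen_by T B (TensA T f g)"

text \<open>Under reversal a symmetry keeps its type only if its two arguments are
  exchanged.\<close>

definition opp :: "(nat, 'a, 'z) smc_scheme \<Rightarrow> (nat, 'a) smc" where
  "opp T = \<lparr>Obj = Obj T, Arr = Arr T, Dom = Cod T, Cod = Dom T, Ide = Ide T,
     Comp = (\<lambda>g f. f \<cdot>\<^bsub>T\<^esub> g), TensO = TensO T, TensA = TensA T, Unit = Unit T,
     Assoc = (\<lambda>n m k. Ide T (n + m + k)), LUnit = Ide T, RUnit = Ide T, Sym = (\<lambda>n m. Sym T m n)\<rparr>"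

lemma opp_simps [simp]:
  "Obj (opp T) = Obj T" "Arr (opp T) = Arr T" "Dom (opp T) = Cod T" "Cod (opp T) = Dom T" "Ide (opp T) = Ide T"
  "Comp (opp T) g f = f \<cdot>\<^bsub>T\<^esub> g" "TensO (opp T) = TensO T" "TensA (opp T) = TensA T" "Unit (opp T) = Unit T"
  "Sym (opp T) n m = Sym T m n"
  by (simp_all add: opp_def)

context is_PROP
begin

lemma gen_ide: "gen_by T B (Ide T n)"
proof (induction n)
  case 0
  show ?case by (rule gen_by.ide0)
next
  case (Suc n)
  have "gen_by T B (Ide T n \<odot> Ide T 1)" by (intro gen_by.tens Suc gen_by.ide1)
  then show ?case by simp
qed

lemma gen_arr: "gen_by T B f \<Longrightarrow> B \<subseteq> Arr T \<Longrightarrow> f \<in> Arr T"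
  by (induction rule: gen_by.induct) auto

text \<open>The two hexagons build a block symmetry from the exchange of two strands, by induction
  on each block.\<close>

lemma gen_sym:
  assumes s: "gen_by T B (Sym T 1 1)"
  shows "gen_by T B (Sym T n m)"
proof -
  have 1: "gen_by T B (Sym T 1 m)" for m
  proof (induction m)
    case 0
    show ?case by (simp add: gen_ide)
  next
    case (Suc m)
    have "gen_by T B ((Ide T m \<odot> Sym T 1 1) \<cdot> (Sym T 1 m \<odot> Ide T 1))"
      by (intro gen_by.comp gen_by.tens Suc s gen_ide) simp_all
    then show ?case using sym_hex1 [of 1 m 1] by simp
  qed
  show ?thesis
  proof (induction n)
    case 0
    show ?case by (simp add: gen_ide)
  next
    case (Suc n)
    have "gen_by T B ((Sym T n m \<odot> Ide T 1) \<cdot> (Ide T n \<odot> Sym T 1 m))"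
      by (intro gen_by.comp gen_by.tens Suc 1 gen_ide) simp_all
    then show ?case using sym_hex2 [of n 1 m] by simp
  qed
qed

lemma opp_is_PROP: "is_PROP (opp T)"
proof (rule is_PROP_intro)
  show "category (opp T)"
    by unfold_locales (auto simp: Hom_iff assoc_arr)
  show "Sym (opp T) x (y + z) = Ide (opp T) y \<odot>\<^bsub>opp T\<^esub> Sym (opp T) x z \<cdot>\<^bsub>opp T\<^esub> (Sym (opp T) x y \<odot>\<^bsub>opp T\<^esub> Ide (opp T) z)" for x y z
    using sym_hex2 [of y z x] by simp
  show "Sym (opp T) (Cod (opp T) f) (Cod (opp T) g) \<cdot>\<^bsub>opp T\<^esub> (f \<odot>\<^bsub>opp T\<^esub> g) =
      (g \<odot>\<^bsub>opp T\<^esub> f) \<cdot>\<^bsub>opp T\<^esub> Sym (opp T) (Dom (opp T) f) (Dom (opp T) g)"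
    if "f \<in> Arr (opp T)" "g \<in> Arr (opp T)" for f g
    using that sym_nat_arr [of g f] by simp
  show "TensO (opp T) = (+)" by (intro ext) simp
qed (auto simp: opp_def Hom_iff unit_zero interchange tens_assoc)

lemma slide:
  "\<lbrakk>A \<in> Arr T; B \<in> Arr T; Dom T A = p; Cod T A = p'; Dom T B = q; Cod T B = q'\<rbrakk>
    \<Longrightarrow> (Ide T p' \<odot> B) \<cdot> (A \<odot> Ide T q) = (A \<odot> Ide T q') \<cdot> (Ide T p \<odot> B)"
  by (simp add: interchange)

end

text \<open>Objects are fixed, so a morphism is a map of arrows. Only the exchange of two strands is
  prescribed among the symmetries; the hexagons yield the others in \<open>F_sym\<close>.\<close>

locale PROP_morphism = T: is_PROP T + E: is_PROP E
  for T :: "(nat, 'b, 'y) smc_scheme" and E :: "(nat, 'e, 'z) smc_scheme" and F :: "'b \<Rightarrow> 'e" +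
  assumes F_in [simp]: "f \<in> Arr T \<Longrightarrow> F f \<in> Arr E"
    and F_dom [simp]: "f \<in> Arr T \<Longrightarrow> Dom E (F f) = Dom T f"
    and F_cod [simp]: "f \<in> Arr T \<Longrightarrow> Cod E (F f) = Cod T f"
    and F_ide [simp]: "F (Ide T n) = Ide E n"
    and F_comp: "\<lbrakk>f \<in> Arr T; g \<in> Arr T; Cod T f = Dom T g\<rbrakk> \<Longrightarrow> F (g \<cdot>\<^bsub>T\<^esub> f) = F g \<cdot>\<^bsub>E\<^esub> F f"
    and F_tens: "\<lbrakk>f \<in> Arr T; g \<in> Arr T\<rbrakk> \<Longrightarrow> F (f \<odot>\<^bsub>T\<^esub> g) = F f \<odot>\<^bsub>E\<^esub> F g"
    and F_sym1: "F (Sym T 1 1) = Sym E 1 1"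
begin

lemma F_sym: "F (Sym T n m) = Sym E n m"
proof -
  have 1: "F (Sym T 1 m) = Sym E 1 m" for m
  proof (induction m)
    case 0
    show ?case by simp
  next
    case (Suc m)
    show ?case using T.sym_hex1 [of 1 m 1] E.sym_hex1 [of 1 m 1] F_sym1 unfolding Suc_eq_plus1 by (simp add: F_comp F_tens Suc [unfolded One_nat_def])
  qed
  show ?thesis
  proof (induction n)
    case 0
    show ?case by simp
  next
    case (Suc n)
    show ?case using T.sym_hex2 [of n 1 m] E.sym_hex2 [of n 1 m] 1 unfolding Suc_eq_plus1 by (simp add: F_comp F_tens Suc)
  qed
qed

end

section \<open>Evaluation of words in a monoid with a group action\<close>

text \<open>A monoid on the object \<open>1\<close> of a PROP with \<open>G\<close> acting by monoid
  endomorphisms. It is stated over an abstract PROP so that comonoids are covered by passing to the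
  opposite one.\<close>

locale G_monoid = is_PROP E + G: group G
  for E :: "(nat, 'e, 'z) smc_scheme" (structure) and G :: "('g, 'y) monoid_scheme" +
  fixes mu eta :: 'e and act :: "'g \<Rightarrow> 'e"
  assumes mu_in [simp]: "mu \<in> Arr E" "Dom E mu = 2" "Cod E mu = 1"
    and eta_in [simp]: "eta \<in> Arr E" "Dom E eta = 0" "Cod E eta = 1"
    and act_in [simp]: "g \<in> carrier G \<Longrightarrow> act g \<in> Arr E" "g \<in> carrier G \<Longrightarrow> Dom E (act g) = 1"
      "g \<in> carrier G \<Longrightarrow> Cod E (act g) = 1"
    and act_one [simp]: "act \<one>\<^bsub>G\<^esub> = Ide E 1"
    and act_mult: "\<lbrakk>g \<in> carrier G; h \<in> carrier G\<rbrakk> \<Longrightarrow> act (g \<otimes>\<^bsub>G\<^esub> h) = act g \<cdot> act h"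
    and mu_assoc: "mu \<cdot> (mu \<odot> Ide E 1) = mu \<cdot> (Ide E 1 \<odot> mu)"
    and mu_eta: "mu \<cdot> (eta \<odot> Ide E 1) = Ide E 1" "mu \<cdot> (Ide E 1 \<odot> eta) = Ide E 1"
    and act_mu: "g \<in> carrier G \<Longrightarrow> act g \<cdot> mu = mu \<cdot> (act g \<odot> act g)"
    and act_eta: "g \<in> carrier G \<Longrightarrow> act g \<cdot> eta = eta"
begin

primrec mulp :: "nat \<Rightarrow> 'e" where
  "mulp 0 = eta"
| "mulp (Suc k) = mu \<cdot> (mulp k \<odot> Ide E 1)"

lemma mulp_in [simp]: "mulp k \<in> Arr E" "Dom E (mulp k) = k" "Cod E (mulp k) = 1"
proof -
  have "mulp k \<in> Arr E \<and> Dom E (mulp k) = k \<and> Cod E (mulp k) = 1" by (induction k) auto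
  then show "mulp k \<in> Arr E" "Dom E (mulp k) = k" "Cod E (mulp k) = 1" by auto
qed

lemma mulp_1: "mulp (Suc 0) = Ide E 1" and mulp_2: "mulp 2 = mu"
proof -
  show 1: "mulp (Suc 0) = Ide E 1" by (simp add: mu_eta del: One_nat_def)
  have "mulp 2 = mu \<cdot> (mulp (Suc 0) \<odot> Ide E 1)" by (simp only: numeral_2_eq_2 mulp.simps)
  also have "\<dots> = mu" unfolding 1 by (simp add: numeral_2_eq_2)
  finally show "mulp 2 = mu" .
qed

text \<open>General associativity, with the right unit law as its base; it merges the inputs of two
  adjacent blocks.\<close>

lemma mulp_add: "mu \<cdot> (mulp k \<odot> mulp l) = mulp (k + l)"
proof (induction l)
  case 0
  have "mu \<cdot> (mulp k \<odot> eta) = mu \<cdot> ((Ide E 1 \<odot> eta) \<cdot> (mulp k \<odot> Ide E 0))"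
    by (simp add: interchange del: tens_unit)
  also have "\<dots> = (mu \<cdot> (Ide E 1 \<odot> eta)) \<cdot> (mulp k \<odot> Ide E 0)"
    by (rule assoc_arr [symmetric]) simp_all
  finally show ?case by (simp add: mu_eta del: One_nat_def)
next
  case (Suc l)
  have "mu \<cdot> (mulp k \<odot> mulp (Suc l)) = mu \<cdot> ((Ide E 1 \<odot> mu) \<cdot> ((mulp k \<odot> mulp l) \<odot> Ide E 1))"
    by (simp add: interchange tens_assoc)
  also have "\<dots> = (mu \<cdot> (mu \<odot> Ide E 1)) \<cdot> ((mulp k \<odot> mulp l) \<odot> Ide E 1)"
    unfolding mu_assoc by (rule assoc_arr [symmetric]) simp_all
  also have "\<dots> = mu \<cdot> ((mu \<cdot> (mulp k \<odot> mulp l)) \<odot> Ide E 1)"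
    by (subst assoc_arr) (simp_all add: interchange)
  finally show ?case by (simp add: Suc)
qed

primrec actp :: "nat \<Rightarrow> 'g \<Rightarrow> 'e" where
  "actp 0 g = Ide E 0"
| "actp (Suc k) g = act g \<odot> actp k g"

lemma actp_in [simp]:
  assumes "g \<in> carrier G"
  shows "actp k g \<in> Arr E" "Dom E (actp k g) = k" "Cod E (actp k g) = k"
proof -
  have "actp k g \<in> Arr E \<and> Dom E (actp k g) = k \<and> Cod E (actp k g) = k" using assms by (induction k) auto
  then show "actp k g \<in> Arr E" "Dom E (actp k g) = k" "Cod E (actp k g) = k" by auto
qed

lemma actp_Suc: "g \<in> carrier G \<Longrightarrow> actp (Suc k) g = actp k g \<odot> act g"
proof (induction k)
  case (Suc k)
  have "actp (Suc (Suc k)) g = act g \<odot> (actp k g \<odot> act g)" using Suc by simp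
  also have "\<dots> = actp (Suc k) g \<odot> act g" using Suc.prems by (simp add: tens_assoc)
  finally show ?case .
qed simp

text \<open>The action respects products of every arity, so a label on an output can be moved to all
  inputs of its block.\<close>

lemma act_mulp:
  assumes g: "g \<in> carrier G"
  shows "act g \<cdot> mulp k = mulp k \<cdot> actp k g"
proof (induction k)
  case 0
  show ?case using g by (simp add: act_eta)
next
  case (Suc k)
  have "act g \<cdot> mulp (Suc k) = (act g \<cdot> mu) \<cdot> (mulp k \<odot> Ide E 1)"
    using g by (simp add: assoc_arr)
  also have "\<dots> = mu \<cdot> ((act g \<odot> act g) \<cdot> (mulp k \<odot> Ide E 1))"
    unfolding act_mu [OF g] using g by (intro assoc_arr) simp_all
  also have "\<dots> = mu \<cdot> ((mulp k \<odot> Ide E 1) \<cdot> (actp k g \<odot> act g))"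
    using g by (simp add: interchange Suc)
  also have "\<dots> = mulp (Suc k) \<cdot> actp (Suc k) g"
    unfolding actp_Suc [OF g] mulp.simps using g by (intro assoc_arr [symmetric]) simp_all
  finally show ?case .
qed

text \<open>A word lists, for each output position, the index of the input that goes there and the label
  that acts on it. The last input is inserted at its position by a symmetry.\<close>

primrec rho :: "nat \<Rightarrow> (nat \<times> 'g) list \<Rightarrow> 'e" where
  "rho 0 ws = Ide E 0"
| "rho (Suc n) ws = (let us = takeWhile (\<lambda>p. fst p \<noteq> Suc n) ws; r = dropWhile (\<lambda>p. fst p \<noteq> Suc n) ws
     in (Ide E (length us) \<odot> Sym E (length (tl r)) 1) \<cdot> (rho n (us @ tl r) \<odot> act (snd (hd r))))"

text \<open>The recursion in usable form. The strand of the last input arrives on the far right and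
  is moved to the left across the strands that follow it in the word.\<close>

lemma rho_Suc:
  assumes "Suc n \<notin> fst ` set us"
  shows "rho (Suc n) (us @ (Suc n, g) # vs) = (Ide E (length us) \<odot> Sym E (length vs) 1) \<cdot> (rho n (us @ vs) \<odot> act g)"
proof -
  have "\<And>p. p \<in> set us \<Longrightarrow> fst p \<noteq> Suc n" using assms by force
  then show ?thesis by (simp add: Let_def takeWhile_append2 dropWhile_append2 del: One_nat_def)
qed

text \<open>Such a word is a labelled permutation of the inputs, listed by output position. The
  multiset form survives removing the last input from the middle of the word.\<close>

definition ok :: "nat \<Rightarrow> (nat \<times> 'g) list \<Rightarrow> bool" where
  "ok n ws \<longleftrightarrow> mset (map fst ws) = mset [1..<Suc n] \<and> snd ` set ws \<subseteq> carrier G"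

lemma ok_length: "ok n ws \<Longrightarrow> length ws = n"
  unfolding ok_def by (metis diff_Suc_1 length_map length_upt mset_eq_length)

lemma ok_set: "ok n ws \<Longrightarrow> fst ` set ws = {1..n}"
  unfolding ok_def by (metis atLeastLessThanSuc_atLeastAtMost mset_eq_setD set_map set_upt)

lemma ok_Suc: "ok (Suc n) (us @ (Suc n, g) # vs) \<longleftrightarrow> ok n (us @ vs) \<and> g \<in> carrier G"
proof -
  have "mset [1..<Suc (Suc n)] = mset [1..<Suc n] + {#Suc n#}" by simp
  then show ?thesis unfolding ok_def by (auto simp del: upt_Suc)
qed

lemma ok_Suc_notin:
  assumes "ok (Suc n) (us @ (Suc n, g) # vs)"
  shows "Suc n \<notin> fst ` set us" "Suc n \<notin> fst ` set vs"
proof -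
  have "fst ` set (us @ vs) = {1..n}" using assms ok_Suc ok_set by blast
  then have "Suc n \<notin> fst ` set (us @ vs)" by simp
  then show "Suc n \<notin> fst ` set us" "Suc n \<notin> fst ` set vs" by auto
qed

lemma ok_split:
  assumes "ok (Suc n) ws"
  obtains us g vs where "ws = us @ (Suc n, g) # vs"
proof -
  have "Suc n \<in> fst ` set ws" using ok_set [OF assms] by simp
  then obtain p where "p \<in> set ws" "fst p = Suc n" by force
  then show thesis using that by (metis prod.collapse split_list)
qed

lemma rho_in:
  assumes "ok n ws"
  shows "rho n ws \<in> Arr E" "Dom E (rho n ws) = n" "Cod E (rho n ws) = n"
proof -
  have "rho n ws \<in> Arr E \<and> Dom E (rho n ws) = n \<and> Cod E (rho n ws) = n"
    using assms
  proof (induction n arbitrary: ws)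
    case 0
    show ?case by simp
  next
    case (Suc n)
    obtain us g vs where ws: "ws = us @ (Suc n, g) # vs" using Suc.prems by (rule ok_split)
    have o: "ok n (us @ vs)" "g \<in> carrier G" using Suc.prems ok_Suc unfolding ws by blast+
    have l: "length us + length vs = n" using ok_length [OF o(1)] by simp
    show ?case unfolding ws rho_Suc [OF ok_Suc_notin(1) [OF Suc.prems [unfolded ws]]]
      using Suc.IH [OF o(1)] o(2) l by simp
  qed
  then show "rho n ws \<in> Arr E" "Dom E (rho n ws) = n" "Cod E (rho n ws) = n" by auto
qed

text \<open>The inductive step shared by all rewritings of a block that does not contain the last
  input. That strand is inserted to the right or to the left of the block, and the insertion slides
  past \<open>X\<close>: by interchange in the one case, by naturality of the symmetry in the
  other.\<close>

lemma rho_outer: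
  assumes X: "X \<in> Arr E" "Dom E X = length ms" "Cod E X = length ms'" "length ms' = length ms"
    and nin: "Suc n \<notin> fst ` set ms" "Suc n \<notin> fst ` set ms'" and o: "ok (Suc n) (us @ ms @ vs)"
    and IH: "\<And>us vs. ok n (us @ ms @ vs) \<Longrightarrow>
      rho n (us @ ms' @ vs) = (Ide E (length us) \<odot> X \<odot> Ide E (length vs)) \<cdot> rho n (us @ ms @ vs)"
  shows "rho (Suc n) (us @ ms' @ vs) = (Ide E (length us) \<odot> X \<odot> Ide E (length vs)) \<cdot> rho (Suc n) (us @ ms @ vs)"
proof -
  obtain p where p: "p \<in> set (us @ ms @ vs)" "fst p = Suc n" using ok_set [OF o] by (metis atLeastAtMost_iff imageE le_Suc_eq le_add1 plus_1_eq_Suc)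
  then have "p \<in> set us \<or> p \<in> set vs" using nin by force
  then show ?thesis
  proof
    assume "p \<in> set vs"
    then obtain v1 g v2 where v: "vs = v1 @ (Suc n, g) # v2" using p(2) by (metis prod.collapse split_list)
    have o': "ok (Suc n) ((us @ ms @ v1) @ (Suc n, g) # v2)" using o v by simp
    have ok: "ok n (us @ ms @ (v1 @ v2))" "g \<in> carrier G" using o' ok_Suc [of n "us @ ms @ v1" g v2] by simp_all
    have n1: "Suc n \<notin> fst ` set (us @ ms @ v1)" "Suc n \<notin> fst ` set (us @ ms' @ v1)"
      using ok_Suc_notin(1) [OF o'] nin by auto
    let ?R = "rho n (us @ ms @ (v1 @ v2))" and ?A = "Ide E (length us) \<odot> X"
    let ?B = "Ide E (length v1) \<odot> Sym E (length v2) 1" and ?d = "length us + length ms"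
    note R = rho_in [OF ok(1)]
    have l: "length us + (length ms + (length v1 + length v2)) = n" using ok_length [OF ok(1)] by simp
    have dA: "?A \<in> Arr E" "Dom E ?A = ?d" "Cod E ?A = ?d" using X by simp_all
    have dB: "?B \<in> Arr E" "Dom E ?B = length v1 + length v2 + 1" "Cod E ?B = length v1 + length v2 + 1" by simp_all
    have BI: "Ide E (length (us @ ms @ v1)) \<odot> Sym E (length v2) 1 = Ide E ?d \<odot> ?B" "length (us @ ms' @ v1) = length (us @ ms @ v1)"
      using X(4) by (simp_all add: tens_assoc [symmetric] add.assoc)
    have L: "rho (Suc n) (us @ ms @ vs) = (Ide E ?d \<odot> ?B) \<cdot> (?R \<odot> act g)"
      using rho_Suc [OF n1(1), of g v2] unfolding BI(1) by (simp add: v)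
    have "rho (Suc n) (us @ ms' @ vs) = (Ide E ?d \<odot> ?B) \<cdot> (((?A \<odot> Ide E (length v1 + length v2)) \<cdot> ?R) \<odot> act g)"
      using rho_Suc [OF n1(2), of g v2] IH [OF ok(1)] unfolding BI by (simp add: v)
    also have "((?A \<odot> Ide E (length v1 + length v2)) \<cdot> ?R) \<odot> act g = (?A \<odot> Ide E (length v1 + length v2 + 1)) \<cdot> (?R \<odot> act g)"
    proof -
      have "?A \<odot> Ide E (length v1 + length v2 + 1) = (?A \<odot> Ide E (length v1 + length v2)) \<odot> Ide E 1"
        using dA(1) by (simp only: tens_assoc ide_in obj tens_ide')
      then show ?thesis using dA R ok(2) l by (simp add: interchange)
    qed
    also have "(Ide E ?d \<odot> ?B) \<cdot> ((?A \<odot> Ide E (length v1 + length v2 + 1)) \<cdot> (?R \<odot> act g)) =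
        ((Ide E ?d \<odot> ?B) \<cdot> (?A \<odot> Ide E (length v1 + length v2 + 1))) \<cdot> (?R \<odot> act g)"
      using dA dB R ok(2) l by (intro assoc_arr [symmetric]) simp_all
    also have "(Ide E ?d \<odot> ?B) \<cdot> (?A \<odot> Ide E (length v1 + length v2 + 1)) = (?A \<odot> Ide E (length v1 + length v2 + 1)) \<cdot> (Ide E ?d \<odot> ?B)"
      by (rule slide) (use dA dB in simp_all)
    also have "\<dots> \<cdot> (?R \<odot> act g) = (?A \<odot> Ide E (length v1 + length v2 + 1)) \<cdot> ((Ide E ?d \<odot> ?B) \<cdot> (?R \<odot> act g))"
      using dA dB R ok(2) l by (intro assoc_arr) simp_all
    finally show ?thesis unfolding L by (simp add: v)
  next
    assume "p \<in> set us"
    then obtain u1 g u2 where u: "us = u1 @ (Suc n, g) # u2" using p(2) by (metis prod.collapse split_list)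
    have o': "ok (Suc n) (u1 @ (Suc n, g) # (u2 @ ms @ vs))" using o u by simp
    have ok: "ok n ((u1 @ u2) @ ms @ vs)" "g \<in> carrier G" using o' ok_Suc by simp_all
    note n1 = ok_Suc_notin(1) [OF o']
    let ?R = "rho n ((u1 @ u2) @ ms @ vs)" and ?B = "Ide E (length u2) \<odot> X \<odot> Ide E (length vs)"
    let ?l = "length u2 + length ms + length vs"
    note R = rho_in [OF ok(1)]
    have l: "length u1 + (length u2 + (length ms + length vs)) = n" using ok_length [OF ok(1)] by simp
    have dB: "?B \<in> Arr E" "Dom E ?B = ?l" "Cod E ?B = ?l" using X by simp_all
    have L: "rho (Suc n) (us @ ms @ vs) = (Ide E (length u1) \<odot> Sym E ?l 1) \<cdot> (?R \<odot> act g)"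
      using rho_Suc [OF n1, of g "u2 @ ms @ vs"] by (simp add: u add.assoc)
    have I: "Ide E (length (u1 @ u2)) \<odot> X \<odot> Ide E (length vs) = Ide E (length u1) \<odot> ?B"
      using X(1) by (simp add: tens_assoc [symmetric])
    have I': "Ide E (length us) \<odot> X \<odot> Ide E (length vs) = Ide E (length u1) \<odot> (Ide E 1 \<odot> ?B)"
      using X(1) by (simp add: tens_assoc [symmetric] u)
    have "rho (Suc n) (us @ ms' @ vs) = (Ide E (length u1) \<odot> Sym E ?l 1) \<cdot> (((Ide E (length u1) \<odot> ?B) \<cdot> ?R) \<odot> act g)"
      using rho_Suc [OF n1, of g "u2 @ ms' @ vs"] IH [OF ok(1)] X(4) unfolding I by (simp add: u add.assoc)
    also have "((Ide E (length u1) \<odot> ?B) \<cdot> ?R) \<odot> act g = (Ide E (length u1) \<odot> (?B \<odot> Ide E 1)) \<cdot> (?R \<odot> act g)"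
    proof -
      have "Ide E (length u1) \<odot> (?B \<odot> Ide E 1) = (Ide E (length u1) \<odot> ?B) \<odot> Ide E 1"
        using dB(1) by (simp only: tens_assoc ide_in obj)
      then show ?thesis using dB R ok(2) l by (simp add: interchange add.assoc)
    qed
    also have "(Ide E (length u1) \<odot> Sym E ?l 1) \<cdot> ((Ide E (length u1) \<odot> (?B \<odot> Ide E 1)) \<cdot> (?R \<odot> act g)) =
        ((Ide E (length u1) \<odot> Sym E ?l 1) \<cdot> (Ide E (length u1) \<odot> (?B \<odot> Ide E 1))) \<cdot> (?R \<odot> act g)"
      using dB R ok(2) l by (intro assoc_arr [symmetric]) simp_all
    also have "(Ide E (length u1) \<odot> Sym E ?l 1) \<cdot> (Ide E (length u1) \<odot> (?B \<odot> Ide E 1)) =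
        (Ide E (length u1) \<odot> (Ide E 1 \<odot> ?B)) \<cdot> (Ide E (length u1) \<odot> Sym E ?l 1)"
      using dB sym_nat1 [of ?B "Ide E 1" ?l 1 ?l 1] by (simp add: interchange)
    also have "\<dots> \<cdot> (?R \<odot> act g) = (Ide E (length u1) \<odot> (Ide E 1 \<odot> ?B)) \<cdot> ((Ide E (length u1) \<odot> Sym E ?l 1) \<cdot> (?R \<odot> act g))"
      using dB R ok(2) l by (intro assoc_arr) simp_all
    finally show ?thesis unfolding L I' .
  qed
qed

text \<open>\<open>X\<close> realises the rewriting of the block \<open>ms\<close> into
  \<open>ms'\<close> inside every word. Demanding this for all contexts and all numbers of inputs
  makes the relation closed under composition and juxtaposition.\<close>

definition M :: "'e \<Rightarrow> (nat \<times> 'g) list \<Rightarrow> (nat \<times> 'g) list \<Rightarrow> bool" where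
  "M X ms ms' \<longleftrightarrow> X \<in> Arr E \<and> Dom E X = length ms \<and> Cod E X = length ms \<and>
     mset (map fst ms') = mset (map fst ms) \<and> (snd ` set ms \<subseteq> carrier G \<longrightarrow> snd ` set ms' \<subseteq> carrier G) \<and>
     (\<forall>n us vs. ok n (us @ ms @ vs) \<longrightarrow>
       rho n (us @ ms' @ vs) = (Ide E (length us) \<odot> X \<odot> Ide E (length vs)) \<cdot> rho n (us @ ms @ vs))"

lemma M_length: "M X ms ms' \<Longrightarrow> length ms' = length ms"
  unfolding M_def by (metis length_map mset_eq_length)

lemma M_arr: "M X ms ms' \<Longrightarrow> X \<in> Arr E \<and> Dom E X = length ms \<and> Cod E X = length ms"
  unfolding M_def by blast

lemma M_ok: "\<lbrakk>M X ms ms'; ok n (us @ ms @ vs)\<rbrakk> \<Longrightarrow> ok n (us @ ms' @ vs)"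
  unfolding M_def ok_def by auto

lemma M_rho: "\<lbrakk>M X ms ms'; ok n (us @ ms @ vs)\<rbrakk> \<Longrightarrow>
    rho n (us @ ms' @ vs) = (Ide E (length us) \<odot> X \<odot> Ide E (length vs)) \<cdot> rho n (us @ ms @ vs)"
  unfolding M_def by blast

lemma M_id: "M (Ide E (length ms)) ms ms"
  unfolding M_def
proof (intro conjI allI impI)
  fix n us vs assume o: "ok n (us @ ms @ vs)"
  then show "rho n (us @ ms @ vs) = (Ide E (length us) \<odot> Ide E (length ms) \<odot> Ide E (length vs)) \<cdot> rho n (us @ ms @ vs)"
    using rho_in [OF o] ok_length [OF o] by (simp add: add.assoc)
qed auto

lemma M_comp:
  assumes 1: "M X ms ms'" and 2: "M Y ms' ms''"
  shows "M (Y \<cdot> X) ms ms''"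
  unfolding M_def
proof (intro conjI allI impI)
  note a = M_arr [OF 1] M_arr [OF 2] M_length [OF 1]
  show "Y \<cdot> X \<in> Arr E" "Dom E (Y \<cdot> X) = length ms" "Cod E (Y \<cdot> X) = length ms" using a by auto
  show "mset (map fst ms'') = mset (map fst ms)" using 1 2 unfolding M_def by simp
  show "snd ` set ms'' \<subseteq> carrier G" if "snd ` set ms \<subseteq> carrier G" using 1 2 that unfolding M_def by blast
  fix n us vs assume o: "ok n (us @ ms @ vs)"
  note r = rho_in [OF o] and l = ok_length [OF o]
  have "rho n (us @ ms'' @ vs) = (Ide E (length us) \<odot> Y \<odot> Ide E (length vs)) \<cdot>
      ((Ide E (length us) \<odot> X \<odot> Ide E (length vs)) \<cdot> rho n (us @ ms @ vs))"
    using M_rho [OF 2 M_ok [OF 1 o]] M_rho [OF 1 o] by simp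
  also have "\<dots> = ((Ide E (length us) \<odot> Y \<odot> Ide E (length vs)) \<cdot> (Ide E (length us) \<odot> X \<odot> Ide E (length vs))) \<cdot> rho n (us @ ms @ vs)"
    using a r l by (intro assoc_arr [symmetric]) (auto simp: add.assoc)
  also have "(Ide E (length us) \<odot> Y \<odot> Ide E (length vs)) \<cdot> (Ide E (length us) \<odot> X \<odot> Ide E (length vs)) =
      Ide E (length us) \<odot> (Y \<cdot> X) \<odot> Ide E (length vs)"
    using a by (simp add: interchange)
  finally show "rho n (us @ ms'' @ vs) = (Ide E (length us) \<odot> (Y \<cdot> X) \<odot> Ide E (length vs)) \<cdot> rho n (us @ ms @ vs)" .
qed

lemma M_context:
  assumes 1: "M X ms ms'"
  shows "M (Ide E (length as) \<odot> X \<odot> Ide E (length bs)) (as @ ms @ bs) (as @ ms' @ bs)"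
  unfolding M_def
proof (intro conjI allI impI)
  note a = M_arr [OF 1] M_length [OF 1]
  let ?X = "Ide E (length as) \<odot> X \<odot> Ide E (length bs)"
  show "?X \<in> Arr E" "Dom E ?X = length (as @ ms @ bs)" "Cod E ?X = length (as @ ms @ bs)" using a by auto
  show "mset (map fst (as @ ms' @ bs)) = mset (map fst (as @ ms @ bs))" using 1 unfolding M_def by simp
  show "snd ` set (as @ ms' @ bs) \<subseteq> carrier G" if "snd ` set (as @ ms @ bs) \<subseteq> carrier G" using 1 that unfolding M_def by auto
  fix n us vs assume "ok n (us @ (as @ ms @ bs) @ vs)"
  then have o: "ok n ((us @ as) @ ms @ (bs @ vs))" by simp
  have "Ide E (length us) \<odot> ?X \<odot> Ide E (length vs) = Ide E (length (us @ as)) \<odot> X \<odot> Ide E (length (bs @ vs))"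
  proof -
    have "Ide E (length us) \<odot> ?X \<odot> Ide E (length vs) =
        (Ide E (length us) \<odot> Ide E (length as)) \<odot> X \<odot> (Ide E (length bs) \<odot> Ide E (length vs))"
      using a by (simp only: tens_assoc tens_in ide_in obj)
    then show ?thesis by simp
  qed
  then show "rho n (us @ (as @ ms' @ bs) @ vs) = (Ide E (length us) \<odot> ?X \<odot> Ide E (length vs)) \<cdot> rho n (us @ (as @ ms @ bs) @ vs)"
    using M_rho [OF 1 o] by simp
qed

lemma M_append:
  assumes 1: "M X ms ms'" and 2: "M Y ns ns'"
  shows "M (X \<odot> Y) (ms @ ns) (ms' @ ns')"
proof -
  note a = M_arr [OF 1] M_arr [OF 2] M_length [OF 1]
  have "M (X \<odot> Ide E (length ns)) (ms @ ns) (ms' @ ns)" using M_context [OF 1, of "[]" ns] a by simp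
  moreover have "M (Ide E (length ms) \<odot> Y) (ms' @ ns) (ms' @ ns')" using M_context [OF 2, of ms' "[]"] a by simp
  ultimately have "M ((Ide E (length ms) \<odot> Y) \<cdot> (X \<odot> Ide E (length ns))) (ms @ ns) (ms' @ ns')" by (rule M_comp)
  then show ?thesis using a by (simp add: interchange)
qed

text \<open>If the relabelled input is the last one, the new label joins the old one before the
  strand is inserted and is carried along by naturality of the symmetry; otherwise
  \<open>rho_outer\<close> applies.\<close>

lemma M_label:
  assumes g: "g \<in> carrier G"
  shows "M (act g) [(i, x)] [(i, g \<otimes>\<^bsub>G\<^esub> x)]"
  unfolding M_def
proof (intro conjI allI impI)
  show "snd ` set [(i, g \<otimes>\<^bsub>G\<^esub> x)] \<subseteq> carrier G" if "snd ` set [(i, x)] \<subseteq> carrier G" using that g by simp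
  fix n us vs
  assume "ok n (us @ [(i, x)] @ vs)"
  then show "rho n (us @ [(i, g \<otimes>\<^bsub>G\<^esub> x)] @ vs) = (Ide E (length us) \<odot> act g \<odot> Ide E (length vs)) \<cdot> rho n (us @ [(i, x)] @ vs)"
  proof (induction n arbitrary: us vs)
    case 0
    then show ?case by (simp add: ok_def)
  next
    case (Suc n)
    show ?case
    proof (cases "i = Suc n")
      case True
      have o: "ok (Suc n) (us @ (Suc n, x) # vs)" using Suc.prems True by simp
      have ok: "ok n (us @ vs)" "x \<in> carrier G" using o ok_Suc by blast+
      note nin = ok_Suc_notin(1) [OF o] and R = rho_in [OF ok(1)]
      let ?R = "rho n (us @ vs)"
      have l: "length us + length vs = n" using ok_length [OF ok(1)] by simp
      have "rho (Suc n) (us @ (Suc n, g \<otimes>\<^bsub>G\<^esub> x) # vs) =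
          (Ide E (length us) \<odot> Sym E (length vs) 1) \<cdot> ((Ide E (length us) \<odot> (Ide E (length vs) \<odot> act g)) \<cdot> (?R \<odot> act x))"
        unfolding rho_Suc [OF nin] act_mult [OF g ok(2)] using R g ok(2) l
        by (simp add: tens_assoc [symmetric] interchange)
      also have "\<dots> = ((Ide E (length us) \<odot> Sym E (length vs) 1) \<cdot> (Ide E (length us) \<odot> (Ide E (length vs) \<odot> act g))) \<cdot> (?R \<odot> act x)"
        using R g ok(2) l by (intro assoc_arr [symmetric]) simp_all
      also have "(Ide E (length us) \<odot> Sym E (length vs) 1) \<cdot> (Ide E (length us) \<odot> (Ide E (length vs) \<odot> act g)) =
          (Ide E (length us) \<odot> (act g \<odot> Ide E (length vs))) \<cdot> (Ide E (length us) \<odot> Sym E (length vs) 1)"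
        using g sym_nat1 [of "Ide E (length vs)" "act g" "length vs" 1 "length vs" 1] by (simp add: interchange)
      also have "\<dots> \<cdot> (?R \<odot> act x) = (Ide E (length us) \<odot> (act g \<odot> Ide E (length vs))) \<cdot> ((Ide E (length us) \<odot> Sym E (length vs) 1) \<cdot> (?R \<odot> act x))"
        using R g ok(2) l by (intro assoc_arr) simp_all
      finally show ?thesis using True g rho_Suc [OF nin, of x vs] by (simp add: tens_assoc)
    next
      case False
      show ?thesis by (rule rho_outer [OF _ _ _ _ _ _ Suc.prems Suc.IH]) (use g False in simp_all)
    qed
  qed
qed (use g in simp_all)

text \<open>If one of the two inputs is the last, exchanging it with its neighbour lengthens or
  shortens its insertion by one strand, which is the hexagon; otherwise \<open>rho_outer\<close>
  applies.\<close>

lemma M_swap: "M (Sym E 1 1) [p, q] [q, p]"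
  unfolding M_def
proof (intro conjI allI impI)
  fix n us vs
  assume "ok n (us @ [p, q] @ vs)"
  then show "rho n (us @ [q, p] @ vs) = (Ide E (length us) \<odot> Sym E 1 1 \<odot> Ide E (length vs)) \<cdot> rho n (us @ [p, q] @ vs)"
  proof (induction n arbitrary: us vs)
    case 0
    then show ?case by (simp add: ok_def)
  next
    case (Suc n)
    let ?k = "length us" and ?l = "length vs"
    have hex: "Sym E (1 + ?l) 1 = (Sym E 1 1 \<odot> Ide E ?l) \<cdot> (Ide E 1 \<odot> Sym E ?l 1)" by (rule sym_hex2)
    have S: "(Ide E ?k \<odot> (Sym E 1 1 \<odot> Ide E ?l)) \<cdot> (Ide E ?k \<odot> (Ide E 1 \<odot> Sym E ?l 1)) = Ide E ?k \<odot> Sym E (Suc ?l) 1"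
      using hex by (simp add: interchange)
    \<comment> \<open>The reverse of \<open>S\<close>, because the exchange of two strands is an
      involution.\<close>
    have S': "(Ide E ?k \<odot> (Sym E 1 1 \<odot> Ide E ?l)) \<cdot> (Ide E ?k \<odot> Sym E (Suc ?l) 1) = Ide E ?k \<odot> (Ide E 1 \<odot> Sym E ?l 1)"
    proof -
      have "(Sym E 1 1 \<odot> Ide E ?l) \<cdot> Sym E (Suc ?l) 1 =
          ((Sym E 1 1 \<odot> Ide E ?l) \<cdot> (Sym E 1 1 \<odot> Ide E ?l)) \<cdot> (Ide E 1 \<odot> Sym E ?l 1)"
        using hex by (simp add: assoc_arr)
      also have "\<dots> = Ide E 1 \<odot> Sym E ?l 1" by (simp add: interchange)
      finally show ?thesis by (simp add: interchange)
    qed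
    have I: "Ide E ?k \<odot> Sym E 1 1 \<odot> Ide E ?l = Ide E ?k \<odot> (Sym E 1 1 \<odot> Ide E ?l)" by (simp add: tens_assoc)
    have J: "Ide E (length (us @ [r])) \<odot> Sym E ?l 1 = Ide E ?k \<odot> (Ide E 1 \<odot> Sym E ?l 1)" for r :: "nat \<times> 'g"
      by (simp add: tens_assoc [symmetric])
    consider g where "p = (Suc n, g)" | g where "q = (Suc n, g)" | "fst p \<noteq> Suc n" "fst q \<noteq> Suc n"
      by (metis prod.collapse)
    then show ?case
    proof cases
      case 1
      have o: "ok (Suc n) (us @ (Suc n, g) # (q # vs))" using Suc.prems 1 by simp
      have ok: "ok n (us @ q # vs)" "g \<in> carrier G" using o ok_Suc by blast+
      note nin = ok_Suc_notin [OF o] and R = rho_in [OF ok(1)]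
      have l: "?k + Suc ?l = n" using ok_length [OF ok(1)] by simp
      have nin': "Suc n \<notin> fst ` set (us @ [q])" using nin by auto
      have "rho (Suc n) (us @ [q, p] @ vs) = (Ide E ?k \<odot> (Ide E 1 \<odot> Sym E ?l 1)) \<cdot> (rho n (us @ q # vs) \<odot> act g)"
        using rho_Suc [OF nin', of g vs] 1 unfolding J by simp
      also have "\<dots> = (Ide E ?k \<odot> (Sym E 1 1 \<odot> Ide E ?l)) \<cdot> ((Ide E ?k \<odot> Sym E (Suc ?l) 1) \<cdot> (rho n (us @ q # vs) \<odot> act g))"
        unfolding S' [symmetric] using R ok(2) l by (intro assoc_arr) simp_all
      finally show ?thesis unfolding I using rho_Suc [OF nin(1), of g "q # vs"] 1 by simp
    next
      case 2
      have o: "ok (Suc n) ((us @ [p]) @ (Suc n, g) # vs)" using Suc.prems 2 by simp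
      have ok: "ok n (us @ p # vs)" "g \<in> carrier G" using o ok_Suc [of n "us @ [p]" g vs] by simp_all
      note nin = ok_Suc_notin [OF o] and R = rho_in [OF ok(1)]
      have l: "?k + Suc ?l = n" using ok_length [OF ok(1)] by simp
      have nin': "Suc n \<notin> fst ` set us" using nin by auto
      have "rho (Suc n) (us @ [q, p] @ vs) = (Ide E ?k \<odot> Sym E (Suc ?l) 1) \<cdot> (rho n (us @ p # vs) \<odot> act g)"
        using rho_Suc [OF nin', of g "p # vs"] 2 by simp
      also have "\<dots> = (Ide E ?k \<odot> (Sym E 1 1 \<odot> Ide E ?l)) \<cdot> ((Ide E ?k \<odot> (Ide E 1 \<odot> Sym E ?l 1)) \<cdot> (rho n (us @ p # vs) \<odot> act g))"
        unfolding S [symmetric] using R ok(2) l by (intro assoc_arr) simp_all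
      finally show ?thesis unfolding I using rho_Suc [OF nin(1), of g vs] 2 unfolding J by simp
    next
      case 3
      show ?thesis by (rule rho_outer [OF _ _ _ _ _ _ Suc.prems Suc.IH]) (use 3 in auto)
    qed
  qed
qed auto

lemma M_Sym1: "M (Sym E 1 (length cs)) (p # cs) (cs @ [p])"
proof (induction cs)
  case Nil
  show ?case using M_id [of "[p]"] by simp
next
  case (Cons c cs)
  have "M (Sym E 1 1 \<odot> Ide E (length cs)) ([p, c] @ cs) ([c, p] @ cs)" by (rule M_append [OF M_swap M_id])
  moreover have "M (Ide E (length [c]) \<odot> Sym E 1 (length cs)) ([c] @ p # cs) ([c] @ cs @ [p])"
    by (rule M_append [OF M_id Cons])
  ultimately have "M ((Ide E (length [c]) \<odot> Sym E 1 (length cs)) \<cdot> (Sym E 1 1 \<odot> Ide E (length cs))) ([p, c] @ cs) ([c] @ cs @ [p])"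
    using M_comp by simp
  then show ?case using sym_hex1 [of 1 1 "length cs"] by simp
qed

lemma M_Sym: "M (Sym E (length bs) (length cs)) (bs @ cs) (cs @ bs)"
proof (induction bs)
  case Nil
  show ?case using M_id [of cs] by simp
next
  case (Cons b bs)
  have "M (Ide E (length [b]) \<odot> Sym E (length bs) (length cs)) ([b] @ bs @ cs) ([b] @ cs @ bs)"
    by (rule M_append [OF M_id Cons])
  moreover have "M (Sym E 1 (length cs) \<odot> Ide E (length bs)) ((b # cs) @ bs) ((cs @ [b]) @ bs)"
    by (rule M_append [OF M_Sym1 M_id])
  ultimately have "M ((Sym E 1 (length cs) \<odot> Ide E (length bs)) \<cdot> (Ide E (length [b]) \<odot> Sym E (length bs) (length cs)))
      ([b] @ bs @ cs) ((cs @ [b]) @ bs)"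
    using M_comp by simp
  then show ?case using sym_hex2 [of 1 "length bs" "length cs"] by simp
qed

definition relabel :: "'g \<Rightarrow> (nat \<times> 'g) list \<Rightarrow> (nat \<times> 'g) list" where
  "relabel g ms = map (\<lambda>(i, x). (i, g \<otimes>\<^bsub>G\<^esub> x)) ms"

lemma M_labels: "g \<in> carrier G \<Longrightarrow> M (actp (length ms) g) ms (relabel g ms)"
proof (induction ms)
  case Nil
  show ?case using M_id [of "[]"] by (simp add: relabel_def)
next
  case (Cons p ms)
  obtain i x where p: "p = (i, x)" by (cases p)
  have "M (act g \<odot> actp (length ms) g) ([(i, x)] @ ms) ([(i, g \<otimes>\<^bsub>G\<^esub> x)] @ relabel g ms)"
    by (rule M_append [OF M_label [OF Cons.prems] Cons.IH [OF Cons.prems]])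
  then show ?case by (simp add: relabel_def p)
qed

section \<open>Evaluation of a list of blocks, one for each output\<close>

primrec muls :: "nat list \<Rightarrow> 'e" where
  "muls [] = Ide E 0"
| "muls (k # ks) = mulp k \<odot> muls ks"

lemma muls_in [simp]: "muls ks \<in> Arr E" "Dom E (muls ks) = sum_list ks" "Cod E (muls ks) = length ks"
proof -
  have "muls ks \<in> Arr E \<and> Dom E (muls ks) = sum_list ks \<and> Cod E (muls ks) = length ks" by (induction ks) auto
  then show "muls ks \<in> Arr E" "Dom E (muls ks) = sum_list ks" "Cod E (muls ks) = length ks" by auto
qed

lemma muls_append: "muls (ks @ ls) = muls ks \<odot> muls ls"
  by (induction ks) (simp_all add: tens_assoc)

text \<open>A block holds the labelled inputs of one output in the order of their product, so the
  concatenation is the word into which the inputs have to be brought before they are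
  multiplied.\<close>

definition evalb :: "nat \<Rightarrow> (nat \<times> 'g) list list \<Rightarrow> 'e" where
  "evalb n bs = muls (map length bs) \<cdot> rho n (concat bs)"

lemma evalb_in:
  assumes "ok n (concat bs)"
  shows "evalb n bs \<in> Arr E" "Dom E (evalb n bs) = n" "Cod E (evalb n bs) = length bs"
  using rho_in [OF assms] ok_length [OF assms] by (simp_all add: evalb_def length_concat)

text \<open>An arrow \<open>X\<close> on some of the outputs is absorbed in two stages: by
  \<open>e\<close> it passes through the multiplications and becomes an arrow \<open>Y\<close> on
  their inputs, and by \<open>m\<close> the word absorbs \<open>Y\<close>.\<close>

lemma evalb_step:
  assumes o: "ok n (concat (A @ mid @ B))" and X: "X \<in> Arr E" "Dom E X = length mid" "Cod E X = length mid'"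
    and m: "M Y (concat mid) (concat mid')"
    and e: "X \<cdot> muls (map length mid) = muls (map length mid') \<cdot> Y"
  shows "evalb n (A @ mid' @ B) = (Ide E (length A) \<odot> X \<odot> Ide E (length B)) \<cdot> evalb n (A @ mid @ B)"
proof -
  let ?a = "muls (map length A)" and ?b = "muls (map length B)" and ?m = "muls (map length mid)" and ?m' = "muls (map length mid')"
  let ?R = "rho n (concat A @ concat mid @ concat B)"
  have o': "ok n (concat A @ concat mid @ concat B)" using o by simp
  note R = rho_in [OF o'] and Y = M_arr [OF m]
  have l: "length (concat A) + (length (concat mid) + length (concat B)) = n" using ok_length [OF o'] by simp
  have lc: "sum_list (map length bs) = length (concat bs)" for bs :: "(nat \<times> 'g) list list" by (simp add: length_concat)
  have l': "length (concat mid') = length (concat mid)" using M_length [OF m] .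
  have "evalb n (A @ mid' @ B) = (?a \<odot> (?m' \<odot> ?b)) \<cdot> ((Ide E (length (concat A)) \<odot> Y \<odot> Ide E (length (concat B))) \<cdot> ?R)"
    using M_rho [OF m o'] by (simp add: evalb_def muls_append)
  also have "\<dots> = ((?a \<odot> (?m' \<odot> ?b)) \<cdot> (Ide E (length (concat A)) \<odot> (Y \<odot> Ide E (length (concat B))))) \<cdot> ?R"
    using R Y l l' by (subst assoc_arr [symmetric]) (simp_all add: lc tens_assoc)
  also have "(?a \<odot> (?m' \<odot> ?b)) \<cdot> (Ide E (length (concat A)) \<odot> (Y \<odot> Ide E (length (concat B)))) = ?a \<odot> ((?m' \<cdot> Y) \<odot> ?b)"
    using Y l' by (simp add: interchange lc)
  also have "\<dots> = (Ide E (length A) \<odot> (X \<odot> Ide E (length B))) \<cdot> (?a \<odot> (?m \<odot> ?b))"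
    unfolding e [symmetric] using X by (simp add: interchange)
  also have "\<dots> \<cdot> ?R = (Ide E (length A) \<odot> (X \<odot> Ide E (length B))) \<cdot> ((?a \<odot> (?m \<odot> ?b)) \<cdot> ?R)"
    using R X l by (intro assoc_arr) (simp_all add: lc)
  finally show ?thesis using X by (simp add: evalb_def muls_append tens_assoc)
qed

text \<open>By \<open>act_mulp\<close> a label on an output becomes the same label on every input of
  its block.\<close>

lemma evalb_label:
  assumes o: "ok n (concat (A @ [b] @ B))" and g: "g \<in> carrier G"
  shows "evalb n (A @ [relabel g b] @ B) = (Ide E (length A) \<odot> act g \<odot> Ide E (length B)) \<cdot> evalb n (A @ [b] @ B)"
  by (rule evalb_step [OF o, where Y = "actp (length b) g"])
    (use g M_labels [OF g, of b] act_mulp [OF g, of "length b"] in \<open>simp_all add: relabel_def\<close>)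

text \<open>By naturality, exchanging two products amounts to exchanging the two blocks of their
  inputs.\<close>

lemma evalb_swap:
  assumes o: "ok n (concat (A @ [b, c] @ B))"
  shows "evalb n (A @ [c, b] @ B) = (Ide E (length A) \<odot> Sym E 1 1 \<odot> Ide E (length B)) \<cdot> evalb n (A @ [b, c] @ B)"
  by (rule evalb_step [OF o, where Y = "Sym E (length b) (length c)"])
    (use M_Sym [of b c] sym_nat_arr [of "mulp (length b)" "mulp (length c)"] in simp_all)

lemma evalb_mu:
  assumes o: "ok n (concat (A @ [b, c] @ B))"
  shows "evalb n (A @ [b @ c] @ B) = (Ide E (length A) \<odot> mu \<odot> Ide E (length B)) \<cdot> evalb n (A @ [b, c] @ B)"
  by (rule evalb_step [OF o, where Y = "Ide E (length (b @ c))"])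
    (use M_id [of "b @ c"] mulp_add [of "length b" "length c"] in simp_all)

lemma evalb_eta:
  assumes o: "ok n (concat (A @ [] @ B))"
  shows "evalb n (A @ [[]] @ B) = (Ide E (length A) \<odot> eta \<odot> Ide E (length B)) \<cdot> evalb n (A @ [] @ B)"
  by (rule evalb_step [OF o, where Y = "Ide E 0"]) (use M_id [of "[]"] in simp_all)

lemma evalb_ide: "evalb n (map (\<lambda>k. [(k, \<one>\<^bsub>G\<^esub>)]) [1..<Suc n]) = Ide E n"
proof -
  have m: "muls (map length (map (\<lambda>k. [(k, \<one>\<^bsub>G\<^esub>)]) ks)) = Ide E (length ks)" for ks :: "nat list"
    by (induction ks) (simp_all add: mulp_1 del: mulp.simps)
  have c: "concat (map (\<lambda>k. [(k, \<one>\<^bsub>G\<^esub>)]) ks) = map (\<lambda>k. (k, \<one>\<^bsub>G\<^esub>)) ks" for ks :: "nat list"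
    by (induction ks) simp_all
  have r: "rho n (map (\<lambda>k. (k, \<one>\<^bsub>G\<^esub>)) [1..<Suc n]) = Ide E n"
  proof (induction n)
    case 0
    show ?case by simp
  next
    case (Suc n)
    have "Suc n \<notin> fst ` set (map (\<lambda>k. (k, \<one>\<^bsub>G\<^esub>)) [1..<Suc n])" by auto
    from rho_Suc [OF this, of "\<one>\<^bsub>G\<^esub>" "[]"] have "rho (Suc n) (map (\<lambda>k. (k, \<one>\<^bsub>G\<^esub>)) [1..<Suc (Suc n)]) = Ide E (n + 1)" using Suc
      by (simp add: upt_Suc_append [of 1 "Suc n"] del: upt_Suc rho.simps One_nat_def)
    then show ?case by simp
  qed
  show ?thesis unfolding evalb_def m c r by (simp del: upt_Suc)
qed

end

section \<open>Generators of \<open>Q\<close> and of the composite\<close>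

lemma gen_by_mono: "gen_by T B f \<Longrightarrow> B \<subseteq> B' \<Longrightarrow> gen_by T B' f"
  by (induction rule: gen_by.induct) (auto intro: gen_by.intros simp del: One_nat_def)

definition lab :: "'g \<Rightarrow> 'g qarr" where
  "lab g = qiso 1 (restrict (\<lambda>_. g) {1..1}, id)"

context group
begin

lemma lab_facts [simp]:
  assumes "g \<in> carrier G"
  shows "lab g \<in> Arr QG" "qdom (lab g) = 1" "qcod (lab g) = 1"
    "qfun (lab g) (Suc 0) = 1" "qlb (lab g) (Suc 0) = g" "\<not> qlt (lab g) i i"
  using qiso_facts [of "restrict (\<lambda>_. g) {1..1}" 1 id] assms
  by (auto simp: lab_def permutes_id)

lemma range_1: "Suc 0 \<le> j \<Longrightarrow> j \<le> Suc 0 \<Longrightarrow> j = Suc 0" by simp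

lemma lab_one: "lab \<one> = qide G 1"
  by (rule Q_ext) (auto dest!: range_1)

lemma lab_mult: "g \<in> carrier G \<Longrightarrow> h \<in> carrier G \<Longrightarrow> lab (g \<otimes> h) = qcomp G (lab g) (lab h)"
  by (rule Q_ext) (auto dest!: range_1)

lemma mul_add: "qcomp G (mul 2) (qtens (mul k) (mul l)) = mul (k + l)"
proof (rule Q_ext)
  let ?l = "qcomp G (mul 2) (qtens (mul k) (mul l))"
  fix j assume "Suc 0 \<le> j" "j \<le> qdom (mul (k + l))"
  then have j: "Suc 0 \<le> j" "j \<le> k + l" by simp_all
  show "qfun ?l j = qfun (mul (k + l)) j" by (rule sum_range_cases [OF j]) (use j in simp_all)
  show "qlb ?l j = qlb (mul (k + l)) j" by (rule sum_range_cases [OF j]) (use j in simp_all)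
  fix i assume "Suc 0 \<le> i" "i \<le> qdom (mul (k + l))"
  then have i: "Suc 0 \<le> i" "i \<le> k + l" by simp_all
  show "qlt ?l i j = qlt (mul (k + l)) i j"
    by (rule sum_range_cases2 [OF i j]) (use i j in simp_all)
qed simp_all

lemma lab_mul_2:
  assumes g: "g \<in> carrier G"
  shows "qcomp G (lab g) (mul 2) = qcomp G (mul 2) (qtens (lab g) (lab g))"
proof (rule Q_ext)
  let ?l = "qcomp G (lab g) (mul 2)" and ?r = "qcomp G (mul 2) (qtens (lab g) (lab g))"
  have s: "qfun (qtens (lab g) (lab g)) (Suc 0) = 1" "qfun (qtens (lab g) (lab g)) 2 = 2"
    "qlb (qtens (lab g) (lab g)) (Suc 0) = g" "qlb (qtens (lab g) (lab g)) 2 = g"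
    "\<not> qlt (qtens (lab g) (lab g)) (Suc 0) (Suc 0)" "\<not> qlt (qtens (lab g) (lab g)) 2 2"
    "\<not> qlt (qtens (lab g) (lab g)) (Suc 0) 2" "\<not> qlt (qtens (lab g) (lab g)) 2 (Suc 0)"
    using g by (simp_all add: qfun_qtens qlb_qtens qlt_qtens)
  fix j assume "Suc 0 \<le> j" "j \<le> qdom ?r"
  then have j: "j = Suc 0 \<or> j = 2" using g by auto
  show "qfun ?l j = qfun ?r j" "qlb ?l j = qlb ?r j" using j g s by auto
  fix i assume "Suc 0 \<le> i" "i \<le> qdom ?r"
  then have i: "i = Suc 0 \<or> i = 2" using g by auto
  show "qlt ?l i j = qlt ?r i j" using i j g s by auto
qed (use g in simp_all)

lemma lab_mul_0: "g \<in> carrier G \<Longrightarrow> qcomp G (lab g) (mul 0) = mul 0"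
  by (rule Q_ext) simp_all

lemma lab_inverse: "g \<in> carrier G \<Longrightarrow> inverse_arrows QG (lab g) (lab (inv g))"
  by (simp add: Q_inverse_iff lab_mult [symmetric] lab_one)

definition Igens :: "'a qarr set" where
  "Igens = insert (Sym QG 1 1) (lab ` carrier G)"

definition Qgens :: "'a qarr set" where
  "Qgens = {mul 2, mul 0} \<union> Igens"

lemma Qgens_arr: "Qgens \<subseteq> Arr QG" and Igens_arr: "Igens \<subseteq> Arr QG"
  by (auto simp: Qgens_def Igens_def)

text \<open>A block symmetry moves the image of the last input to the last place. The result is the
  juxtaposition of an isomorphism on \<open>n\<close> strands with one label, and the symmetry is
  undone by its inverse.\<close>

lemma gen_iso:
  "\<lbrakk>is_iso QG h; qdom h = n; qcod h = n\<rbrakk> \<Longrightarrow> gen_by QG Igens h"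
proof (induction n arbitrary: h)
  case 0
  have "h = qide G 0" by (rule Q_ext) (use 0 Q_iso_facts(1) [OF 0(1)] in simp_all)
  then show ?case using gen_by.ide0 [of QG Igens] by simp
next
  case (Suc n)
  note H = Q_iso_facts [OF Suc.prems(1)]
  define k where "k = qfun h (Suc n)"
  have "k \<in> {1..Suc n}" using qfun_in [OF H(1), of "Suc n"] Suc.prems by (simp add: k_def)
  \<comment> \<open>There are \<open>a\<close> outputs before the image of the last input and
    \<open>b\<close> after it.\<close>
  then obtain a b where ab: "k = a + 1" "n = a + b"
    by (metis atLeastAtMost_iff add.commute le_add_diff_inverse plus_1_eq_Suc Suc_le_mono le_Suc_ex)
  let ?c = "qtens (qide G a) (Sym QG 1 b)" and ?c' = "qtens (qide G a) (Sym QG b 1)"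
  have ci: "inverse_arrows QG ?c ?c'"
    using Q.inverse_arrows_tens [OF Q.inverse_arrows_ide [of a] Q.inverse_sym [of 1 b]] by simp
  have ci': "is_iso QG ?c" using Q.is_isoI [OF ci] .
  define h' where "h' = qcomp G ?c h"
  have h'i: "is_iso QG h'" unfolding h'_def using Q.is_iso_comp [OF Suc.prems(1) ci'] Suc.prems(3) ab by simp
  note H' = Q_iso_facts [OF h'i]
  have d': "qdom h' = Suc n" "qcod h' = Suc n" using Suc.prems ab by (simp_all add: h'_def)
  have top: "qfun h' (Suc n) = Suc n"
  proof -
    have "qfun ?c (a + 1) = a + (b + 1)" using qtens_right(1) [of "qide G a" "Sym QG 1 b" a 1] by simp
    moreover have "qfun h (Suc (a + b)) = a + 1" using ab k_def by simp
    ultimately show ?thesis using H(1) Suc.prems ab by (simp add: h'_def)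
  qed
  have inj: "i = j" if "i \<in> {1..Suc n}" "j \<in> {1..Suc n}" "qfun h' i = qfun h' j" for i j
    using H'(3) that d' by simp
  have rg: "qfun h' j \<in> {1..n}" if "j \<in> {1..n}" for j
    using qfun_in [OF H'(1), of j] inj [of j "Suc n"] top that d' by (auto simp: le_Suc_eq)
  have lb: "qlb h' j \<in> carrier G" if "j \<in> {1..Suc n}" for j using qlb_in [OF H'(1)] that d' by simp
  obtain h0 where h0: "h0 \<in> Arr QG" "qdom h0 = n" "qcod h0 = n"
    "\<And>j. j \<in> {1..n} \<Longrightarrow> qfun h0 j = qfun h' j" "\<And>j. j \<in> {1..n} \<Longrightarrow> qlb h0 j = qlb h' j"
    "\<And>i j. \<lbrakk>i \<in> {1..n}; j \<in> {1..n}\<rbrakk> \<Longrightarrow> qlt h0 i j \<longleftrightarrow> qfun h' i = qfun h' j \<and> False"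
  proof (rule Q_exists [of "qfun h'" n n "qlb h'" G "\<lambda>_ _. False"])
    show "qfun h' \<in> {1..n} \<rightarrow> {1..n}" using rg by blast
    show "qlb h' \<in> {1..n} \<rightarrow> carrier G" using lb by auto
    show "False \<or> False" if "i \<in> {1..n}" "j \<in> {1..n}" "i \<noteq> j" "qfun h' i = qfun h' j" for i j
      using that inj [of i j] by auto
  qed auto
  have "inj_on (qfun h0) {1..n}" using inj h0(4) by (intro inj_onI) auto
  moreover have "qfun h0 ` {1..n} \<subseteq> {1..n}" using rg h0(4) by auto
  ultimately have "bij_betw (qfun h0) {1..qdom h0} {1..qcod h0}" using h0(2,3) by (simp add: bij_betw_def endo_inj_surj)
  then have h0i: "is_iso QG h0" using Q_isoI [OF h0(1)] unfolding is_iso_def by metis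
  define x where "x = qlb h' (Suc n)"
  have x: "x \<in> carrier G" using lb by (simp add: x_def)
  have h'e: "h' = qtens h0 (lab x)"
  proof (rule Q_ext)
    let ?q = "qtens h0 (lab x)"
    have R: "qfun ?q (Suc n) = Suc n" "qlb ?q (Suc n) = x" "\<not> qlt ?q (Suc n) (Suc n)"
      using h0(1-3) x by (simp_all add: qfun_qtens qlb_qtens qlt_qtens Suc_diff_le)
    have c: "j \<le> n \<or> j = Suc n" if "j \<le> Suc n" for j using that by linarith
    fix j assume "Suc 0 \<le> j" "j \<le> qdom ?q"
    then have j: "Suc 0 \<le> j" "j \<le> Suc n" using h0(2) x by simp_all
    show "qfun h' j = qfun ?q j" using c [OF j(2)]
    proof
      assume "j \<le> n"
      then show ?thesis using j h0(1,2) h0(4) [of j] x by simp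
    qed (simp only: R top)
    show "qlb h' j = qlb ?q j" using c [OF j(2)]
    proof
      assume "j \<le> n"
      then show ?thesis using j h0(1,2) h0(5) [of j] x by simp
    qed (simp only: R x_def [symmetric])
    fix i assume "Suc 0 \<le> i" "i \<le> qdom ?q"
    then have i: "Suc 0 \<le> i" "i \<le> Suc n" using h0(2) x by simp_all
    have "\<not> qlt h' i j" using H'(4) i j d' by simp
    moreover have "\<not> qlt ?q i j"
      using c [OF i(2)] c [OF j(2)] i j h0(1,2) h0(6) [of i j] x R(3) by (elim disjE) (simp_all add: qlt_qtens)
    ultimately show "qlt h' i j = qlt ?q i j" by blast
  qed (use H'(1) h0 x d' in simp_all)
  have gs: "gen_by QG Igens (Sym QG n m)" for n m
    by (rule Q.gen_sym) (auto simp: Igens_def intro: gen_by.base)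
  have g1: "gen_by QG Igens h'" unfolding h'e
    using gen_by.tens [OF Suc.IH [OF h0i h0(2,3)] gen_by.base [of "lab x"]] x by (auto simp: Igens_def)
  have g2: "gen_by QG Igens ?c'"
    using gen_by.tens [OF Q.gen_ide [of Igens a] gs [of b 1]] by simp
  have "h = qcomp G ?c' h'" unfolding h'_def
    using Q.inv_cancel(3) [OF ci, of h] H(1) Suc.prems ab by simp
  then show ?case using gen_by.comp [OF g1 g2] d' ab by simp
qed

lemma gen_mul: "gen_by QG Qgens (mul k)"
proof (induction k)
  case 0
  show ?case by (rule gen_by.base) (simp add: Qgens_def)
next
  case (Suc k)
  have "gen_by QG Qgens (qtens (mul k) (qide G 1))"
    using gen_by.tens [OF Suc gen_by.ide1] by simp
  moreover have "gen_by QG Qgens (mul 2)" by (rule gen_by.base) (simp add: Qgens_def)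
  ultimately show ?case using gen_by.comp [of QG Qgens "qtens (mul k) (qide G 1)" "mul 2"]
    by (simp add: mul_Suc)
qed

lemma gen_qmor: "\<phi> \<in> HomD n m \<Longrightarrow> gen_by QG Qgens (qmor G n m \<phi>)"
proof (induction m arbitrary: n \<phi>)
  case 0
  then show ?case using HomD_0 gen_by.ide0 [of QG Qgens] by simp
next
  case (Suc m)
  obtain l k \<phi>' where 1: "\<phi>' \<in> HomD l m" "qmor G n (Suc m) \<phi> = qtens (qmor G l m \<phi>') (mul k)"
    using Suc.prems by (rule HomD_Suc_split)
  show ?case using gen_by.tens [OF Suc.IH [OF 1(1)] gen_mul [of k]] 1(2) by simp
qed

lemma Q_gen:
  assumes q: "q \<in> Arr QG"
  shows "gen_by QG Qgens q"
proof -
  note d = Q_decompose [OF q]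
  note I = qiso_in(1-3) [OF d(3)] and M = qmor_facts(1-3) [OF d(2)]
  have "gen_by QG Qgens (qiso (qdom q) (qlab q))"
    by (rule gen_by_mono [OF gen_iso [OF qiso_iso [OF d(3)] I(2,3)]]) (auto simp: Qgens_def)
  from gen_by.comp [OF this gen_qmor [OF d(2)]] show ?thesis using I M d(1) by simp
qed

definition Tgens :: "('a qarr \<times> 'a qarr) set set" where
  "Tgens = span_embed QG ` Qgens \<union> {T.coembed (mul 2), T.coembed (mul 0)}"

lemma gen_embed: "gen_by QG Qgens f \<Longrightarrow> gen_by (GBimon_PROP G) Tgens (span_embed QG f)"
proof (induction rule: gen_by.induct)
  case (base f)
  then show ?case by (intro gen_by.base) (simp add: Tgens_def)
next
  case ide0
  show ?case using gen_by.ide0 [of "GBimon_PROP G" Tgens] by (simp add: GBimon_PROP_def span_embed_def)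
next
  case ide1
  show ?case using gen_by.ide1 [of "GBimon_PROP G" Tgens] by (simp add: GBimon_PROP_def span_embed_def)
next
  case (comp f g)
  have a: "f \<in> Arr QG" "g \<in> Arr QG" using comp Q.gen_arr [OF _ Qgens_arr] by blast+
  show ?case using gen_by.comp [OF comp.IH] comp(3) a T.embed_comp [of f g] by (simp add: GBimon_PROP_def)
next
  case (tens f g)
  have a: "f \<in> Arr QG" "g \<in> Arr QG" using tens Q.gen_arr [OF _ Qgens_arr] by blast+
  show ?case using gen_by.tens [OF tens.IH] a T.embed_tens [of f g] by (simp add: GBimon_PROP_def)
qed

lemma coembed_lab: "g \<in> carrier G \<Longrightarrow> T.coembed (lab g) = span_embed QG (lab (inv g))"
  by (rule T.coembed_iso [OF lab_inverse])

lemma coembed_sym: "T.coembed (Sym QG n m) = span_embed QG (Sym QG m n)"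
  by (rule T.coembed_iso [OF Q.inverse_sym])

text \<open>By \<open>coembed_iso\<close> the backward copies of symmetry and labels are forward
  copies of generators, so \<open>Tgens\<close> adds only the duals of \<open>mul 2\<close> and
  \<open>mul 0\<close>.\<close>

lemma gen_coembed: "gen_by QG Qgens f \<Longrightarrow> gen_by (GBimon_PROP G) Tgens (T.coembed f)"
proof (induction rule: gen_by.induct)
  case (base f)
  then consider "f = mul 2" | "f = mul 0" | "f = Sym QG 1 1" | g where "g \<in> carrier G" "f = lab g"
    by (auto simp: Qgens_def Igens_def)
  then show ?case
  proof cases
    case 3
    then show ?thesis by (auto intro!: gen_by.base simp: coembed_sym Tgens_def Qgens_def Igens_def)
  next
    case 4
    then show ?thesis by (auto intro!: gen_by.base simp: coembed_lab Tgens_def Qgens_def Igens_def)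
  qed (auto intro!: gen_by.base simp: Tgens_def)
next
  case ide0
  show ?case using gen_by.ide0 [of "GBimon_PROP G" Tgens] by (simp add: GBimon_PROP_def T.coembed_def)
next
  case ide1
  show ?case using gen_by.ide1 [of "GBimon_PROP G" Tgens] by (simp add: GBimon_PROP_def T.coembed_def)
next
  case (comp f g)
  have a: "f \<in> Arr QG" "g \<in> Arr QG" using comp Q.gen_arr [OF _ Qgens_arr] by blast+
  show ?case using gen_by.comp [OF comp.IH(2,1)] comp(3) a T.coembed_comp' [of f g] by (simp add: GBimon_PROP_def)
next
  case (tens f g)
  have a: "f \<in> Arr QG" "g \<in> Arr QG" using tens Q.gen_arr [OF _ Qgens_arr] by blast+
  show ?case using gen_by.tens [OF tens.IH] a T.coembed_tens [of f g] by (simp add: GBimon_PROP_def)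
qed

lemma T_gen:
  assumes "X \<in> Arr (GBimon_PROP G)"
  shows "gen_by (GBimon_PROP G) Tgens X"
proof -
  obtain a b where ab: "(a, b) \<in> spans QG" "X = span_class QG a b"
    using assms by (auto simp: GBimon_PROP_def elim: Q.spans_quotientE)
  then have a: "a \<in> Arr QG" "b \<in> Arr QG" "qdom a = qdom b" by (simp_all add: Q.spans_iff)
  show ?thesis
    using gen_by.comp [OF gen_coembed [OF Q_gen [OF a(1)]] gen_embed [OF Q_gen [OF a(2)]]] a T.embed_coembed [OF ab(1)] ab(2)
    by (simp add: GBimon_PROP_def)
qed

lemma GBimon_PROP_is_PROP: "is_PROP (GBimon_PROP G)"
  unfolding GBimon_PROP_def by (rule T.composite_is_PROP)

end

section \<open>Fibres as lists\<close>

text \<open>The heads agree, since otherwise each of them would precede the other; asymmetry also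
  excludes repetitions, so the tails have equal sets.\<close>

lemma sorted_wrt_unique:
  assumes asym: "\<And>x y. R x y \<Longrightarrow> \<not> R y x"
  shows "\<lbrakk>sorted_wrt R xs; sorted_wrt R ys; set xs = set ys\<rbrakk> \<Longrightarrow> xs = ys"
proof (induction xs arbitrary: ys)
  case (Cons x xs)
  then obtain y ys' where y: "ys = y # ys'" by (cases ys) auto
  have nr: "\<not> R z z" for z using asym by blast
  have xy: "x = y"
  proof (rule ccontr)
    assume "x \<noteq> y"
    then have "R x y" "R y x" using Cons.prems y by auto
    then show False using asym by blast
  qed
  have "x \<notin> set xs" "y \<notin> set ys'" using Cons.prems y nr by auto
  then have "set xs = set ys'" using Cons.prems(3) y xy by auto
  then show ?case using Cons y xy by simp
qed simp

lemma sorted_wrt_concat: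
  assumes "\<And>xs. xs \<in> set xss \<Longrightarrow> sorted_wrt R xs"
    and "sorted_wrt (\<lambda>xs ys. \<forall>x\<in>set xs. \<forall>y\<in>set ys. R x y) xss"
  shows "sorted_wrt R (concat xss)"
  using assms by (induction xss) (auto simp: sorted_wrt_append)

text \<open>The inverse permutation lists the inputs by position, so filtering leaves the fibre in
  the order \<open>qlt q\<close>.\<close>

definition fib :: "'g qarr \<Rightarrow> nat \<Rightarrow> nat list" where
  "fib q k = filter (\<lambda>j. qfun q j = k) (map (inv_into UNIV (snd (qlab q))) [1..<Suc (qdom q)])"

definition fibl :: "'g qarr \<Rightarrow> nat \<Rightarrow> (nat \<times> 'g) list" where
  "fibl q k = map (\<lambda>j. (j, qlb q j)) (fib q k)"

definition fibs :: "'g qarr \<Rightarrow> (nat \<times> 'g) list list" where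
  "fibs q = map (fibl q) [1..<Suc (qcod q)]"

lemma map_upt_add: "map f [1..<Suc (a + b)] = map f [1..<Suc a] @ map (\<lambda>k. f (a + k)) [1..<Suc b]"
  by (induction b) simp_all

context group
begin

lemma fib_props:
  assumes q: "q \<in> Arr QG"
  shows fib_set: "set (fib q k) = {j \<in> {1..qdom q}. qfun q j = k}"
    and fib_sorted: "sorted_wrt (qlt q) (fib q k)"
    and fib_distinct: "distinct (fib q k)"
proof -
  let ?s = "snd (qlab q)"
  have p: "?s permutes {1..qdom q}" using q by (simp add: Q_arr_iff)
  note pi = permutes_inv [OF p]
  have "set (map (inv_into UNIV ?s) [1..<Suc (qdom q)]) = {1..qdom q}"
    using permutes_image [OF pi] by (simp only: set_map set_upt atLeastLessThanSuc_atLeastAtMost)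
  then show "set (fib q k) = {j \<in> {1..qdom q}. qfun q j = k}" by (auto simp: fib_def simp del: set_map)
  show "distinct (fib q k)" unfolding fib_def
    by (intro distinct_filter) (simp only: distinct_map distinct_upt permutes_inj_on [OF pi] simp_thms)
  have "sorted_wrt (\<lambda>i j. ?s i < ?s j) (map (inv_into UNIV ?s) [1..<Suc (qdom q)])"
    unfolding sorted_wrt_map permutes_inverses(1) [OF p] by (rule sorted_wrt_upt)
  then have "sorted_wrt (\<lambda>i j. ?s i < ?s j) (fib q k)" unfolding fib_def by (rule sorted_wrt_filter)
  then show "sorted_wrt (qlt q) (fib q k)"
    by (rule sorted_wrt_mono_rel [rotated]) (auto simp: qlt_def fib_def)
qed

text \<open>A fibre list is characterised by its set and by being sorted, so later computations of
  fibres do not touch the permutation.\<close>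

lemma fib_eqI:
  assumes q: "q \<in> Arr QG" and s: "set xs = {j \<in> {1..qdom q}. qfun q j = k}" and r: "sorted_wrt (qlt q) xs"
  shows "fib q k = xs"
  by (rule sorted_wrt_unique [OF _ fib_sorted [OF q] r]) (use qlt_asym s fib_set [OF q] in auto)

text \<open>The lexicographic order of a composite lists its fibre by concatenating the inner fibres
  in the order of the outer one.\<close>

lemma fib_comp:
  assumes q: "q1 \<in> Arr QG" "q2 \<in> Arr QG" "qcod q1 = qdom q2"
  shows "fib (qcomp G q2 q1) k = concat (map (fib q1) (fib q2 k))"
proof (rule fib_eqI)
  have r: "qfun q1 j \<in> {1..qdom q2}" if "j \<in> {1..qdom q1}" for j using qfun_in [OF q(1) that] q(3) by simp
  show "set (concat (map (fib q1) (fib q2 k))) = {j \<in> {1..qdom (qcomp G q2 q1)}. qfun (qcomp G q2 q1) j = k}"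
    using r q by (auto simp: fib_set)
  show "sorted_wrt (qlt (qcomp G q2 q1)) (concat (map (fib q1) (fib q2 k)))"
  proof (rule sorted_wrt_concat)
    fix xs assume "xs \<in> set (map (fib q1) (fib q2 k))"
    then obtain i where xs: "xs = fib q1 i" by auto
    show "sorted_wrt (qlt (qcomp G q2 q1)) xs" unfolding xs
      by (rule sorted_wrt_mono_rel [OF _ fib_sorted [OF q(1)]]) (use q in \<open>auto simp: fib_set\<close>)
  next
    show "sorted_wrt (\<lambda>xs ys. \<forall>x\<in>set xs. \<forall>y\<in>set ys. qlt (qcomp G q2 q1) x y) (map (fib q1) (fib q2 k))"
      unfolding sorted_wrt_map
      by (rule sorted_wrt_mono_rel [OF _ fib_sorted [OF q(2)]]) (use q in \<open>auto simp: fib_set\<close>)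
  qed
qed (use q in simp)

lemma fib_tens_left:
  assumes q: "q \<in> Arr QG" "q' \<in> Arr QG" and k: "k \<le> qcod q"
  shows "fib (qtens q q') k = fib q k"
proof (rule fib_eqI)
  have 1: "j \<le> qdom q" if j: "Suc 0 \<le> j" "j \<le> qdom q + qdom q'" "qfun (qtens q q') j = k" for j
  proof (rule ccontr)
    assume "\<not> j \<le> qdom q"
    then obtain i where i: "j = qdom q + i" "Suc 0 \<le> i" "i \<le> qdom q'" using split_sum_range' [OF j(1,2)] by blast
    have "qfun (qtens q q') j = qcod q + qfun q' i" using i q by simp
    moreover have "Suc 0 \<le> qfun q' i" using i q by simp
    ultimately show False using j(3) k by linarith
  qed
  show "set (fib q k) = {j \<in> {1..qdom (qtens q q')}. qfun (qtens q q') j = k}"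
  proof (intro equalityI subsetI)
    fix j assume "j \<in> set (fib q k)"
    then show "j \<in> {j \<in> {1..qdom (qtens q q')}. qfun (qtens q q') j = k}" using q by (auto simp: fib_set)
  next
    fix j assume j: "j \<in> {j \<in> {1..qdom (qtens q q')}. qfun (qtens q q') j = k}"
    then have "j \<le> qdom q" using 1 [of j] q by simp
    then show "j \<in> set (fib q k)" using j q by (auto simp: fib_set)
  qed
  show "sorted_wrt (qlt (qtens q q')) (fib q k)"
    by (rule sorted_wrt_mono_rel [OF _ fib_sorted [OF q(1)]]) (use q in \<open>auto simp: fib_set\<close>)
qed (use q in simp)

lemma fib_tens_right:
  assumes q: "q \<in> Arr QG" "q' \<in> Arr QG" and k: "Suc 0 \<le> k" and n: "qcod q = n"
  shows "fib (qtens q q') (n + k) = map ((+) (qdom q)) (fib q' k)"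
proof (rule fib_eqI)
  have 1: "qfun (qtens q q') j \<noteq> n + k" if "j \<in> {1..qdom q}" for j
  proof -
    have "qfun q j \<le> n" using qfun_in [OF q(1) that] n by (simp only: atLeastAtMost_iff)
    moreover have "qfun (qtens q q') j = qfun q j" using that q by simp
    ultimately show ?thesis using k by linarith
  qed
  show "set (map ((+) (qdom q)) (fib q' k)) = {j \<in> {1..qdom (qtens q q')}. qfun (qtens q q') j = n + k}"
  proof (intro equalityI subsetI)
    fix j assume "j \<in> set (map ((+) (qdom q)) (fib q' k))"
    then show "j \<in> {j \<in> {1..qdom (qtens q q')}. qfun (qtens q q') j = n + k}" using q n by (auto simp: fib_set)
  next
    fix j assume j: "j \<in> {j \<in> {1..qdom (qtens q q')}. qfun (qtens q q') j = n + k}"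
    then have r: "Suc 0 \<le> j" "j \<le> qdom q + qdom q'" by simp_all
    have "\<not> j \<le> qdom q" using 1 [of j] j by auto
    then obtain i where i: "j = qdom q + i" "Suc 0 \<le> i" "i \<le> qdom q'" using split_sum_range' [OF r] by blast
    then have "i \<in> set (fib q' k)" using j q n by (simp add: fib_set)
    then show "j \<in> set (map ((+) (qdom q)) (fib q' k))" using i(1) by simp
  qed
  show "sorted_wrt (qlt (qtens q q')) (map ((+) (qdom q)) (fib q' k))"
    unfolding sorted_wrt_map
    by (rule sorted_wrt_mono_rel [OF _ fib_sorted [OF q(2)]]) (use q in \<open>auto simp: fib_set\<close>)
qed (use q in simp)

lemma fib_ide: "k \<in> {1..n} \<Longrightarrow> fib (qide G n) k = [k]"
  by (rule fib_eqI) auto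

lemma fib_mul: "fib (mul k) 1 = [1..<Suc k]"
proof (rule fib_eqI)
  show "sorted_wrt (qlt (mul k)) [1..<Suc k]"
    by (rule sorted_wrt_mono_rel [OF _ sorted_wrt_upt]) auto
qed auto

lemma fib_lab: "g \<in> carrier G \<Longrightarrow> fib (lab g) 1 = [1]"
  by (rule fib_eqI) (auto dest!: range_1)

lemma fib_sym: "fib (Sym QG 1 1) 1 = [2]" "fib (Sym QG 1 1) 2 = [1]"
proof -
  have "qfun (Sym QG 1 1) (1 + 1) = 1" by (rule qsym_facts(5)) simp_all
  then have s: "qfun (Sym QG 1 1) 2 = 1" by (simp only: one_add_one)
  have s': "qfun (Sym QG 1 1) 1 = 2" by (simp add: numeral_2_eq_2)
  have r: "{1..qdom (Sym QG 1 1)} = {1, 2}" by auto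
  show "fib (Sym QG 1 1) 1 = [2]" "fib (Sym QG 1 1) 2 = [1]"
    by (rule fib_eqI; use r s s' in \<open>auto simp del: One_nat_def\<close>)+
qed

text \<open>A generator meets only some of the outputs of an arrow; the remaining \<open>a\<close>
  strands on its left and \<open>b\<close> strands on its right form its context.\<close>

definition el :: "nat \<Rightarrow> 'a qarr \<Rightarrow> nat \<Rightarrow> 'a qarr" where
  "el a q b = qtens (qtens (qide G a) q) (qide G b)"

lemma el_arr [simp]: "q \<in> Arr QG \<Longrightarrow> el a q b \<in> Arr QG"
  "qdom (el a q b) = a + qdom q + b" "qcod (el a q b) = a + qcod q + b"
  by (simp_all add: el_def)

lemma el_0: "q \<in> Arr QG \<Longrightarrow> el 0 q 0 = q"
  using Q.tens_unit [of q] by (simp add: el_def)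

lemma el_ide: "el a (qide G n) b = qide G (a + n + b)"
  using Q.tens_ide' [of a n] Q.tens_ide' [of "a + n" b] by (simp add: el_def)

lemma el_comp: "\<lbrakk>q1 \<in> Arr QG; q2 \<in> Arr QG; qcod q1 = qdom q2\<rbrakk> \<Longrightarrow>
    el a (qcomp G q2 q1) b = qcomp G (el a q2 b) (el a q1 b)"
  by (simp add: el_def Q_interchange)

text \<open>A juxtaposition acts by one factor at a time, the other strands being part of the
  context.\<close>

lemma el_tens:
  assumes q: "q \<in> Arr QG" "q' \<in> Arr QG"
  shows "el a (qtens q q') b = qcomp G (el (a + qcod q) q' b) (el a q (qdom q' + b))"
proof -
  have 1: "el (a + qcod q) q' b = qtens (qide G a) (qtens (qide G (qcod q)) (qtens q' (qide G b)))"
    using Q.tens_ide' [of a "qcod q", symmetric] q by (simp add: el_def qtens_assoc)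
  have 2: "el a q (qdom q' + b) = qtens (qide G a) (qtens q (qtens (qide G (qdom q')) (qide G b)))"
    using Q.tens_ide' [of "qdom q'" b] q by (simp add: el_def qtens_assoc)
  show ?thesis unfolding 1 2 using q by (simp add: Q_interchange qtens_assoc el_def)
qed

lemma fib_el:
  assumes q: "q \<in> Arr QG"
  shows "k \<in> {1..a} \<Longrightarrow> fib (el a q b) k = [k]"
    "k \<in> {1..qcod q} \<Longrightarrow> fib (el a q b) (a + k) = map ((+) a) (fib q k)"
    "k \<in> {1..b} \<Longrightarrow> fib (el a q b) (a + qcod q + k) = [a + qdom q + k]"
  using q by (simp_all add: el_def fib_tens_left fib_tens_right fib_ide)

lemma qlb_el:
  assumes q: "q \<in> Arr QG"
  shows "k \<in> {1..a} \<Longrightarrow> qlb (el a q b) k = \<one>"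
    "k \<in> {1..qdom q} \<Longrightarrow> qlb (el a q b) (a + k) = qlb q k"
    "k \<in> {1..b} \<Longrightarrow> qlb (el a q b) (a + qdom q + k) = \<one>"
  using q by (simp_all add: el_def)

end

section \<open>Evaluation of morphisms of \<open>Q\<close>\<close>

context G_monoid
begin

lemma relabel_one: "snd ` set ms \<subseteq> carrier G \<Longrightarrow> relabel \<one>\<^bsub>G\<^esub> ms = ms"
  unfolding relabel_def by (rule map_idI) auto

lemma fibl_carrier: "q \<in> Arr (QPROP G) \<Longrightarrow> snd ` set (fibl q k) \<subseteq> carrier G"
  by (auto simp: fibl_def G.fib_set)

lemma fibl_comp:
  assumes q: "q1 \<in> Arr (QPROP G)" "q2 \<in> Arr (QPROP G)" "qcod q1 = qdom q2"
  shows "fibl (qcomp G q2 q1) k = concat (map (\<lambda>i. relabel (qlb q2 i) (fibl q1 i)) (fib q2 k))"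
proof -
  have "map (\<lambda>j. (j, qlb (qcomp G q2 q1) j)) (fib q1 i) = relabel (qlb q2 i) (fibl q1 i)" for i
    unfolding relabel_def fibl_def map_map by (rule map_cong) (use q in \<open>auto simp: G.fib_set\<close>)
  then show ?thesis unfolding fibl_def G.fib_comp [OF q] by (simp add: map_concat comp_def fibl_def [symmetric])
qed

lemma fibs_ok:
  assumes q: "q \<in> Arr (QPROP G)"
  shows "ok (qdom q) (concat (fibs q))"
  unfolding ok_def
proof
  have m: "map fst (concat (map (fibl q) ks)) = concat (map (fib q) ks)" for ks
    by (induction ks) (simp_all add: fibl_def comp_def)
  have d: "distinct ks \<Longrightarrow> distinct (concat (map (fib q) ks))" for ks
    by (induction ks) (use G.fib_distinct [OF q] G.fib_set [OF q] in auto)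
  have s: "set (concat (map (fib q) [1..<Suc (qcod q)])) = {1..qdom q}"
    using qfun_in [OF q] by (auto simp: G.fib_set [OF q] simp del: upt_Suc) (metis atLeastAtMost_iff le_imp_less_Suc One_nat_def)
  show "mset (map fst (concat (fibs q))) = mset [1..<Suc (qdom q)]"
    unfolding fibs_def m
    by (subst set_eq_iff_mset_eq_distinct [symmetric])
      (use d [of "[1..<Suc (qcod q)]"] s in \<open>simp_all only: distinct_upt set_upt atLeastLessThanSuc_atLeastAtMost\<close>)
  show "snd ` set (concat (fibs q)) \<subseteq> carrier G"
    using fibl_carrier [OF q] by (force simp: fibs_def simp del: upt_Suc)
qed

lemma fibs_split:
  assumes "qcod r = a + c + b"
  shows "fibs r = map (fibl r) [1..<Suc a] @ map (\<lambda>k. fibl r (a + k)) [1..<Suc c] @ map (\<lambda>k. fibl r (a + c + k)) [1..<Suc b]"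
  unfolding fibs_def assms map_upt_add [of "fibl r" "a + c" b] map_upt_add [of "fibl r" a c] by simp

text \<open>Composition with \<open>el a q b\<close> leaves the outer blocks alone; the middle ones
  are relabelled and concatenated along the fibres of \<open>q\<close>. For the generators these are
  the four rewritings that \<open>evalb\<close> is known to respect.\<close>

lemma fibs_el:
  assumes q: "q \<in> Arr (QPROP G)" and r: "r \<in> Arr (QPROP G)" and e: "qcod r = a + qdom q + b"
  shows "fibs (qcomp G (G.el a q b) r) = map (fibl r) [1..<Suc a] @
    map (\<lambda>k. concat (map (\<lambda>i. relabel (qlb q i) (fibl r (a + i))) (fib q k))) [1..<Suc (qcod q)] @
    map (\<lambda>k. fibl r (a + qdom q + k)) [1..<Suc b]"
proof -
  have el: "G.el a q b \<in> Arr (QPROP G)" "qcod r = qdom (G.el a q b)" using q e by simp_all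
  note c = fibl_comp [OF r el] and one = relabel_one [OF fibl_carrier [OF r]]
  have 1: "fibl (qcomp G (G.el a q b) r) k = fibl r k" if "k \<in> set [1..<Suc a]" for k
  proof -
    have k: "k \<in> {1..a}" using that by auto
    show ?thesis unfolding c G.fib_el(1) [OF q k] using G.qlb_el(1) [OF q k] one by simp
  qed
  have 2: "fibl (qcomp G (G.el a q b) r) (a + k) = concat (map (\<lambda>i. relabel (qlb q i) (fibl r (a + i))) (fib q k))"
    if "k \<in> set [1..<Suc (qcod q)]" for k
  proof -
    have k: "k \<in> {1..qcod q}" using that by auto
    have m: "map (\<lambda>i. relabel (qlb (G.el a q b) (a + i)) (fibl r (a + i))) (fib q k) = map (\<lambda>i. relabel (qlb q i) (fibl r (a + i))) (fib q k)"
      by (rule map_cong) (use G.qlb_el(2) [OF q] in \<open>auto simp: G.fib_set [OF q]\<close>)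
    show ?thesis unfolding c G.fib_el(2) [OF q k] by (simp only: map_map comp_def m)
  qed
  have 3: "fibl (qcomp G (G.el a q b) r) (a + qcod q + k) = fibl r (a + qdom q + k)" if "k \<in> set [1..<Suc b]" for k
  proof -
    have k: "k \<in> {1..b}" using that by auto
    show ?thesis unfolding c G.fib_el(3) [OF q k] using G.qlb_el(3) [OF q k] one by simp
  qed
  have "qcod (qcomp G (G.el a q b) r) = a + qcod q + b" by simp
  from fibs_split [OF this] show ?thesis
    using 1 2 3 by (simp cong: map_cong del: upt_Suc)
qed

definition N :: "'g qarr \<Rightarrow> 'e" where
  "N q = evalb (qdom q) (fibs q)"

lemma N_in [simp]:
  assumes "q \<in> Arr (QPROP G)"
  shows "N q \<in> Arr E" "Dom E (N q) = qdom q" "Cod E (N q) = qcod q"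
  using evalb_in [OF fibs_ok [OF assms]] by (simp_all add: N_def fibs_def del: upt_Suc)

lemma N_ide: "N (qide G n) = Ide E n"
proof -
  have "fibs (qide G n) = map (\<lambda>k. [(k, \<one>\<^bsub>G\<^esub>)]) [1..<Suc n]"
    unfolding fibs_def by (simp only: G.qide_facts) (rule map_cong, auto simp: fibl_def G.fib_ide)
  then show ?thesis using evalb_ide by (simp add: N_def del: upt_Suc)
qed

lemma N_el_gen:
  assumes r: "r \<in> Arr (QPROP G)"
  shows "\<lbrakk>g \<in> carrier G; qcod r = a + 1 + b\<rbrakk> \<Longrightarrow> N (qcomp G (G.el a (lab g) b) r) = (Ide E a \<odot> act g \<odot> Ide E b) \<cdot> N r"
    and "qcod r = a + 2 + b \<Longrightarrow> N (qcomp G (G.el a (Sym (QPROP G) 1 1) b) r) = (Ide E a \<odot> Sym E 1 1 \<odot> Ide E b) \<cdot> N r"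
    and "qcod r = a + 2 + b \<Longrightarrow> N (qcomp G (G.el a (G.mul 2) b) r) = (Ide E a \<odot> mu \<odot> Ide E b) \<cdot> N r"
    and "qcod r = a + 0 + b \<Longrightarrow> N (qcomp G (G.el a (G.mul 0) b) r) = (Ide E a \<odot> eta \<odot> Ide E b) \<cdot> N r"
proof -
  note one = relabel_one [OF fibl_carrier [OF r]] and ok = fibs_ok [OF r]
  let ?A = "map (fibl r) [1..<Suc a]"
  have u1: "[1..<Suc 1] = [1]" and u2: "[1..<Suc 2] = [1, 2]" and u0: "[1..<Suc 0] = []" by (simp_all add: upt_rec)
  show "N (qcomp G (G.el a (lab g) b) r) = (Ide E a \<odot> act g \<odot> Ide E b) \<cdot> N r" if g: "g \<in> carrier G" and e: "qcod r = a + 1 + b"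
  proof -
    have L: "lab g \<in> Arr (QPROP G)" "qdom (lab g) = 1" "qcod (lab g) = 1" using g by simp_all
    let ?B = "map (\<lambda>k. fibl r (a + 1 + k)) [1..<Suc b]"
    have f: "fibs r = ?A @ [fibl r (a + 1)] @ ?B" unfolding fibs_split [OF e] u1 by simp
    have "fibs (qcomp G (G.el a (lab g) b) r) = ?A @ [relabel g (fibl r (a + 1))] @ ?B"
      using fibs_el [OF L(1) r, of a b] e g unfolding L(2,3) u1 by (simp add: G.fib_lab [OF g, unfolded One_nat_def] del: upt_Suc)
    then show ?thesis using evalb_label [OF _ g, of "qdom r" ?A "fibl r (a + 1)" ?B] ok f by (simp add: N_def del: upt_Suc)
  qed
  show "N (qcomp G (G.el a (Sym (QPROP G) 1 1) b) r) = (Ide E a \<odot> Sym E 1 1 \<odot> Ide E b) \<cdot> N r" if e: "qcod r = a + 2 + b"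
  proof -
    have L: "Sym (QPROP G) 1 1 \<in> Arr (QPROP G)" "qdom (Sym (QPROP G) 1 1) = 2" "qcod (Sym (QPROP G) 1 1) = 2"
      "qlb (Sym (QPROP G) 1 1) 1 = \<one>\<^bsub>G\<^esub>" "qlb (Sym (QPROP G) 1 1) 2 = \<one>\<^bsub>G\<^esub>" by simp_all
    let ?B = "map (\<lambda>k. fibl r (a + 2 + k)) [1..<Suc b]"
    have f: "fibs r = ?A @ [fibl r (a + 1), fibl r (a + 2)] @ ?B" unfolding fibs_split [OF e] u2 by simp
    have "fibs (qcomp G (G.el a (Sym (QPROP G) 1 1) b) r) = ?A @ [fibl r (a + 2), fibl r (a + 1)] @ ?B"
      using fibs_el [OF L(1) r, of a b] e unfolding L(2,3) u2 by (simp only: list.map concat.simps append_Nil2 append.simps G.fib_sym L(4,5) one)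
    then show ?thesis using evalb_swap [of "qdom r" ?A "fibl r (a + 1)" "fibl r (a + 2)" ?B] ok f by (simp add: N_def del: upt_Suc)
  qed
  show "N (qcomp G (G.el a (G.mul 2) b) r) = (Ide E a \<odot> mu \<odot> Ide E b) \<cdot> N r" if e: "qcod r = a + 2 + b"
  proof -
    have L: "G.mul 2 \<in> Arr (QPROP G)" "qdom (G.mul 2) = 2" "qcod (G.mul 2) = 1"
      "qlb (G.mul 2) 1 = \<one>\<^bsub>G\<^esub>" "qlb (G.mul 2) 2 = \<one>\<^bsub>G\<^esub>" by simp_all
    let ?B = "map (\<lambda>k. fibl r (a + 2 + k)) [1..<Suc b]"
    have f: "fibs r = ?A @ [fibl r (a + 1), fibl r (a + 2)] @ ?B" unfolding fibs_split [OF e] u2 by simp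
    have "fibs (qcomp G (G.el a (G.mul 2) b) r) = ?A @ [fibl r (a + 1) @ fibl r (a + 2)] @ ?B"
      using fibs_el [OF L(1) r, of a b] e unfolding L(2,3) u1 by (simp only: list.map concat.simps append_Nil2 append.simps G.fib_mul u2 L(4,5) one)
    then show ?thesis using evalb_mu [of "qdom r" ?A "fibl r (a + 1)" "fibl r (a + 2)" ?B] ok f by (simp add: N_def del: upt_Suc)
  qed
  show "N (qcomp G (G.el a (G.mul 0) b) r) = (Ide E a \<odot> eta \<odot> Ide E b) \<cdot> N r" if e: "qcod r = a + 0 + b"
  proof -
    have L: "G.mul 0 \<in> Arr (QPROP G)" "qdom (G.mul 0) = 0" "qcod (G.mul 0) = 1" by simp_all
    let ?B = "map (\<lambda>k. fibl r (a + 0 + k)) [1..<Suc b]"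
    have f: "fibs r = ?A @ [] @ ?B" unfolding fibs_split [OF e] u0 by simp
    have "fibs (qcomp G (G.el a (G.mul 0) b) r) = ?A @ [[]] @ ?B"
      using fibs_el [OF L(1) r, of a b] e unfolding L(2,3) u1 by (simp only: list.map concat.simps append_Nil2 append.simps G.fib_mul u0)
    then show ?thesis using evalb_eta [of "qdom r" ?A ?B] ok f by (simp add: N_def del: upt_Suc)
  qed
qed

text \<open>Functoriality by induction on the outer arrow alone. The inner arrow \<open>r\<close>
  and the context stay arbitrary, so \<open>r\<close> enters through its normal form and relations
  between generators need not be examined.\<close>

lemma N_el:
  "gen_by (QPROP G) G.Qgens q \<Longrightarrow> \<forall>a b r. r \<in> Arr (QPROP G) \<longrightarrow> qcod r = a + qdom q + b \<longrightarrow>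
     N (qcomp G (G.el a q b) r) = (Ide E a \<odot> N q \<odot> Ide E b) \<cdot> N r"
proof (induction rule: gen_by.induct)
  case (base q)
  \<comment> \<open>If composition with \<open>q\<close> in every context acts as some arrow
    \<open>e\<close>, then \<open>e\<close> is \<open>N q\<close>: take the identity for
    \<open>r\<close> and the empty context.\<close>
  have *: "\<forall>a b r. r \<in> Arr (QPROP G) \<longrightarrow> qcod r = a + qdom q + b \<longrightarrow> N (qcomp G (G.el a q b) r) = (Ide E a \<odot> N q \<odot> Ide E b) \<cdot> N r"
    if q: "q \<in> Arr (QPROP G)" and e: "e \<in> Arr E" "Dom E e = qdom q"
      and 1: "\<And>a b r. r \<in> Arr (QPROP G) \<Longrightarrow> qcod r = a + qdom q + b \<Longrightarrow> N (qcomp G (G.el a q b) r) = (Ide E a \<odot> e \<odot> Ide E b) \<cdot> N r" for q e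
  proof -
    have "N q = e" using 1 [of "qide G (qdom q)" 0 0] q e by (simp add: G.el_0 N_ide)
    then show ?thesis using 1 by blast
  qed
  consider "q = G.mul 2" | "q = G.mul 0" | "q = Sym (QPROP G) 1 1" | g where "g \<in> carrier G" "q = lab g"
    using base by (auto simp: G.Qgens_def G.Igens_def)
  then show ?case
  proof cases
    case 1
    show ?thesis unfolding 1 by (rule * [where e = "mu"]) (use N_el_gen(3) in simp_all)
  next
    case 2
    show ?thesis unfolding 2 by (rule * [where e = "eta"]) (use N_el_gen(4) in simp_all)
  next
    case 3
    show ?thesis unfolding 3 by (rule * [where e = "Sym E 1 1"]) (use N_el_gen(2) in simp_all)
  next
    case (4 g)
    show ?thesis unfolding 4(2) by (rule * [where e = "act g"]) (use 4(1) N_el_gen(1) in simp_all)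
  qed
next
  case ide0
  show ?case using N_ide by (auto simp: G.el_ide)
next
  case ide1
  show ?case using N_ide by (auto simp: G.el_ide)
next
  case (comp q1 q2)
  have a: "q1 \<in> Arr (QPROP G)" "q2 \<in> Arr (QPROP G)" "qcod q1 = qdom q2" using comp G.Q.gen_arr [OF _ G.Qgens_arr] by auto
  have n: "N (qcomp G q2 q1) = N q2 \<cdot> N q1"
    using comp.IH(2) [rule_format, of q1 0 0] a by (simp add: G.el_0)
  show ?case
  proof (intro allI impI)
    fix a' b r assume r: "r \<in> Arr (QPROP G)" "qcod r = a' + qdom (Comp (QPROP G) q2 q1) + b"
    have "N (qcomp G (qcomp G (G.el a' q2 b) (G.el a' q1 b)) r) = N (qcomp G (G.el a' q2 b) (qcomp G (G.el a' q1 b) r))"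
      using a r by (simp add: G.Q_assoc)
    also have "\<dots> = (Ide E a' \<odot> N q2 \<odot> Ide E b) \<cdot> ((Ide E a' \<odot> N q1 \<odot> Ide E b) \<cdot> N r)"
      using comp.IH a r by simp
    also have "\<dots> = ((Ide E a' \<odot> N q2 \<odot> Ide E b) \<cdot> (Ide E a' \<odot> N q1 \<odot> Ide E b)) \<cdot> N r"
      using a r by (intro assoc_arr [symmetric]) simp_all
    also have "(Ide E a' \<odot> N q2 \<odot> Ide E b) \<cdot> (Ide E a' \<odot> N q1 \<odot> Ide E b) = Ide E a' \<odot> (N q2 \<cdot> N q1) \<odot> Ide E b"
      using a by (simp add: interchange)
    finally show "N (qcomp G (G.el a' (Comp (QPROP G) q2 q1) b) r) = (Ide E a' \<odot> N (Comp (QPROP G) q2 q1) \<odot> Ide E b) \<cdot> N r"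
      using a n by (simp add: G.el_comp)
  qed
next
  case (tens q q')
  have a: "q \<in> Arr (QPROP G)" "q' \<in> Arr (QPROP G)" using tens G.Q.gen_arr [OF _ G.Qgens_arr] by auto
  have *: "N (qcomp G (G.el a' (qtens q q') b) r) = (Ide E a' \<odot> (N q \<odot> N q') \<odot> Ide E b) \<cdot> N r"
    if r: "r \<in> Arr (QPROP G)" "qcod r = a' + (qdom q + qdom q') + b" for a' b r
  proof -
    have "N (qcomp G (G.el a' (qtens q q') b) r) = N (qcomp G (G.el (a' + qcod q) q' b) (qcomp G (G.el a' q (qdom q' + b)) r))"
      unfolding G.el_tens [OF a] using a r by (simp add: G.Q_assoc)
    also have "\<dots> = (Ide E (a' + qcod q) \<odot> N q' \<odot> Ide E b) \<cdot> ((Ide E a' \<odot> N q \<odot> Ide E (qdom q' + b)) \<cdot> N r)"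
      using tens.IH(2) [rule_format, of "qcomp G (G.el a' q (qdom q' + b)) r" "a' + qcod q" b]
        tens.IH(1) [rule_format, of r a' "qdom q' + b"] a r by (simp add: add.assoc)
    also have "\<dots> = ((Ide E (a' + qcod q) \<odot> N q' \<odot> Ide E b) \<cdot> (Ide E a' \<odot> N q \<odot> Ide E (qdom q' + b))) \<cdot> N r"
      using a r by (intro assoc_arr [symmetric]) simp_all
    also have "(Ide E (a' + qcod q) \<odot> N q' \<odot> Ide E b) \<cdot> (Ide E a' \<odot> N q \<odot> Ide E (qdom q' + b)) =
        (Ide E a' \<odot> (Ide E (qcod q) \<odot> (N q' \<odot> Ide E b))) \<cdot> (Ide E a' \<odot> (N q \<odot> (Ide E (qdom q') \<odot> Ide E b)))"
      using a by (simp add: tens_assoc [symmetric])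
    also have "\<dots> = Ide E a' \<odot> (N q \<odot> N q') \<odot> Ide E b"
      using a by (simp add: interchange tens_assoc del: tens_ide')
    finally show ?thesis .
  qed
  have n: "N (qtens q q') = N q \<odot> N q'"
    using * [of "qide G (qdom q + qdom q')" 0 0] a by (simp add: G.el_0 N_ide)
  show ?case using * a n by simp
qed

lemma N_comp:
  assumes q: "q1 \<in> Arr (QPROP G)" "q2 \<in> Arr (QPROP G)" "qcod q1 = qdom q2"
  shows "N (qcomp G q2 q1) = N q2 \<cdot> N q1"
  using N_el [OF G.Q_gen [OF q(2)], rule_format, of q1 0 0] q by (simp add: G.el_0)

text \<open>Applying the two factors one after the other to the identity turns the tensor product
  into two instances of \<open>N_el\<close>.\<close>

lemma N_tens:
  assumes q: "q \<in> Arr (QPROP G)" "q' \<in> Arr (QPROP G)"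
  shows "N (qtens q q') = N q \<odot> N q'"
proof -
  have "N (qtens q q') = N (qcomp G (G.el (0 + qcod q) q' 0) (G.el 0 q (qdom q' + 0)))"
    using G.el_tens [OF q, of 0 0] q by (simp add: G.el_0)
  also have "\<dots> = (Ide E (qcod q) \<odot> N q' \<odot> Ide E 0) \<cdot> N (G.el 0 q (qdom q'))"
    using N_el [OF G.Q_gen [OF q(2)], rule_format, of "G.el 0 q (qdom q')" "qcod q" 0] q by simp
  also have "N (G.el 0 q (qdom q')) = (Ide E 0 \<odot> N q \<odot> Ide E (qdom q')) \<cdot> Ide E (qdom q + qdom q')"
    using N_el [OF G.Q_gen [OF q(1)], rule_format, of "qide G (qdom q + qdom q')" 0 "qdom q'"] q by (simp add: N_ide)
  finally show ?thesis using q by (simp add: interchange)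
qed

lemma N_gens: "N (G.mul 2) = mu" "N (G.mul 0) = eta" "N (Sym (QPROP G) 1 1) = Sym E 1 1"
  "g \<in> carrier G \<Longrightarrow> N (lab g) = act g"
  using N_el_gen(3) [of "qide G 2" 0 0] N_el_gen(4) [of "qide G 0" 0 0] N_el_gen(2) [of "qide G 2" 0 0]
    N_el_gen(1) [of "qide G 1" g 0 0] by (simp_all add: G.el_0 N_ide)

end

text \<open>The axioms are images of equations in \<open>Q\<close>. Associativity and units say that
  the different ways of building \<open>mul 3\<close> and \<open>mul 1\<close> by
  \<open>mul_add\<close> agree.\<close>

lemma G_monoid_of_morphism:
  assumes G: "group G" and F: "PROP_morphism (QPROP G) E F"
  shows "G_monoid E G (F (group.mul G 2)) (F (group.mul G 0)) (\<lambda>g. F (lab g))"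
proof -
  interpret G: group G by (rule G)
  interpret F: PROP_morphism "QPROP G" E F by (rule F)
  have a: "F (qcomp G g f) = F g \<cdot>\<^bsub>E\<^esub> F f" if "f \<in> Arr (QPROP G)" "g \<in> Arr (QPROP G)" "qcod f = qdom g" for f g
    using F.F_comp [of f g] that by simp
  have t: "F (qtens f g) = F f \<odot>\<^bsub>E\<^esub> F g" if "f \<in> Arr (QPROP G)" "g \<in> Arr (QPROP G)" for f g
    using F.F_tens [of f g] that by simp
  have i: "F (qide G n) = Ide E n" for n using F.F_ide [of n] by simp
  have m3: "qcomp G (G.mul 2) (qtens (G.mul 2) (qide G 1)) = qcomp G (G.mul 2) (qtens (qide G 1) (G.mul 2))"
    using G.mul_add [of 2 1] G.mul_add [of 1 2] G.mul_1 by (simp add: numeral_3_eq_3)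
  have m1: "qcomp G (G.mul 2) (qtens (G.mul 0) (qide G 1)) = qide G 1" "qcomp G (G.mul 2) (qtens (qide G 1) (G.mul 0)) = qide G 1"
    using G.mul_add [of 0 1] G.mul_add [of 1 0] G.mul_1 by simp_all
  show ?thesis
  proof unfold_locales
    show "F (G.mul 2) \<cdot>\<^bsub>E\<^esub> (F (G.mul 2) \<odot>\<^bsub>E\<^esub> Ide E 1) = F (G.mul 2) \<cdot>\<^bsub>E\<^esub> (Ide E 1 \<odot>\<^bsub>E\<^esub> F (G.mul 2))"
      using arg_cong [OF m3, of F] by (simp add: a t i)
    show "F (G.mul 2) \<cdot>\<^bsub>E\<^esub> (F (G.mul 0) \<odot>\<^bsub>E\<^esub> Ide E 1) = Ide E 1" "F (G.mul 2) \<cdot>\<^bsub>E\<^esub> (Ide E 1 \<odot>\<^bsub>E\<^esub> F (G.mul 0)) = Ide E 1"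
      using arg_cong [OF m1(1), of F] arg_cong [OF m1(2), of F] by (simp_all add: a t i)
    show "F (lab g) \<cdot>\<^bsub>E\<^esub> F (G.mul 2) = F (G.mul 2) \<cdot>\<^bsub>E\<^esub> (F (lab g) \<odot>\<^bsub>E\<^esub> F (lab g))" if "g \<in> carrier G" for g
      using arg_cong [OF G.lab_mul_2 [OF that], of F] that by (simp add: a t)
    show "F (lab g) \<cdot>\<^bsub>E\<^esub> F (G.mul 0) = F (G.mul 0)" if "g \<in> carrier G" for g
      using arg_cong [OF G.lab_mul_0 [OF that], of F] that by (simp add: a)
    show "F (lab (g \<otimes>\<^bsub>G\<^esub> h)) = F (lab g) \<cdot>\<^bsub>E\<^esub> F (lab h)" if "g \<in> carrier G" "h \<in> carrier G" for g h
      using that by (simp add: G.lab_mult a)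
    show "F (lab \<one>\<^bsub>G\<^esub>) = Ide E 1" by (simp add: G.lab_one i)
  qed simp_all
qed

section \<open>The endomorphism PROP of an object\<close>

context category
begin

lemma iso_epi:
  assumes h: "is_iso C h" and e: "f \<cdot> h = g \<cdot> h"
    and f: "f \<in> Arr C" "g \<in> Arr C" "Dom C f = Cod C h" "Dom C g = Cod C h"
  shows "f = g"
proof -
  obtain k where k: "inverse_arrows C h k" using h by (auto simp: is_iso_def)
  have "f = (f \<cdot> h) \<cdot> k" by (rule inv_cancel(2) [OF k f(1,3), symmetric])
  also have "\<dots> = (g \<cdot> h) \<cdot> k" by (simp only: e)
  also have "\<dots> = g" by (rule inv_cancel(2) [OF k f(2,4)])
  finally show ?thesis .
qed

lemma iso_mono:
  assumes h: "is_iso C h" and e: "h \<cdot> f = h \<cdot> g"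
    and f: "f \<in> Arr C" "g \<in> Arr C" "Cod C f = Dom C h" "Cod C g = Dom C h"
  shows "f = g"
proof -
  obtain k where k: "inverse_arrows C h k" using h by (auto simp: is_iso_def)
  have "f = k \<cdot> (h \<cdot> f)" by (rule inv_cancel(3) [OF k f(1,3), symmetric])
  also have "\<dots> = k \<cdot> (h \<cdot> g)" by (simp only: e)
  also have "\<dots> = g" by (rule inv_cancel(3) [OF k f(2,4)])
  finally show ?thesis .
qed

end

context symmetric_monoidal_category
begin

lemma assoc_in [simp]:
  assumes "X \<in> Obj S" "Y \<in> Obj S" "Z \<in> Obj S"
  shows "Assoc S X Y Z \<in> Arr S" "Dom S (Assoc S X Y Z) = (X \<boxtimes> Y) \<boxtimes> Z" "Cod S (Assoc S X Y Z) = X \<boxtimes> (Y \<boxtimes> Z)"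
  using assoc_hom [OF assms] by (auto simp: Hom_iff)

lemma lunit_in [simp]:
  assumes "X \<in> Obj S"
  shows "LUnit S X \<in> Arr S" "Dom S (LUnit S X) = Unit S \<boxtimes> X" "Cod S (LUnit S X) = X"
  using lunit_hom [OF assms] by (auto simp: Hom_iff)

lemma runit_in [simp]:
  assumes "X \<in> Obj S"
  shows "RUnit S X \<in> Arr S" "Dom S (RUnit S X) = X \<boxtimes> Unit S" "Cod S (RUnit S X) = X"
  using runit_hom [OF assms] by (auto simp: Hom_iff)

lemmas [simp] = unit_obj tens_obj dom_obj cod_obj tens_ide

lemma assoc_nat_arr:
  "\<lbrakk>f \<in> Arr S; g \<in> Arr S; h \<in> Arr S\<rbrakk> \<Longrightarrow>
    Assoc S (Cod S f) (Cod S g) (Cod S h) \<cdot> ((f \<odot> g) \<odot> h) = (f \<odot> (g \<odot> h)) \<cdot> Assoc S (Dom S f) (Dom S g) (Dom S h)"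
  by (rule assoc_nat) (simp_all add: Hom_iff)

lemma lunit_nat_arr: "f \<in> Arr S \<Longrightarrow> LUnit S (Cod S f) \<cdot> (Ide S (Unit S) \<odot> f) = f \<cdot> LUnit S (Dom S f)"
  by (rule lunit_nat) (simp add: Hom_iff)

lemma runit_nat_arr: "f \<in> Arr S \<Longrightarrow> RUnit S (Cod S f) \<cdot> (f \<odot> Ide S (Unit S)) = f \<cdot> RUnit S (Dom S f)"
  by (rule runit_nat) (simp add: Hom_iff)

lemma is_iso_tens: "is_iso S f \<Longrightarrow> is_iso S g \<Longrightarrow> is_iso S (f \<odot> g)"
  using inverse_arrows_tens unfolding is_iso_def by blast

text \<open>By naturality of the unit isomorphisms, tensoring with the unit object is conjugate to
  the identity functor.\<close>

lemma unit_tens_faithful: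
  assumes f: "f \<in> Arr S" "g \<in> Arr S" "Dom S f = Dom S g" "Cod S f = Cod S g"
  shows "Ide S (Unit S) \<odot> f = Ide S (Unit S) \<odot> g \<Longrightarrow> f = g"
    and "f \<odot> Ide S (Unit S) = g \<odot> Ide S (Unit S) \<Longrightarrow> f = g"
proof -
  assume e: "Ide S (Unit S) \<odot> f = Ide S (Unit S) \<odot> g"
  show "f = g"
    by (rule iso_epi [OF lunit_iso [of "Dom S g"]])
      (use f e lunit_nat_arr [of f] lunit_nat_arr [of g] in simp_all)
next
  assume e: "f \<odot> Ide S (Unit S) = g \<odot> Ide S (Unit S)"
  show "f = g"
    by (rule iso_epi [OF runit_iso [of "Dom S g"]])
      (use f e runit_nat_arr [of f] runit_nat_arr [of g] in simp_all)
qed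

text \<open>Kelly's argument: after tensoring with the unit on the left and composing with the
  invertible \<open>?i\<close>, the pentagon, two triangles and naturality of the associator
  identify both sides.\<close>

lemma lunit_tens:
  assumes [simp]: "X \<in> Obj S" "Y \<in> Obj S"
  shows "LUnit S (X \<boxtimes> Y) \<cdot> Assoc S (Unit S) X Y = LUnit S X \<odot> Ide S Y"
proof (rule unit_tens_faithful(1))
  let ?I = "Unit S"
  let ?i = "Assoc S ?I (?I \<boxtimes> X) Y \<cdot> (Assoc S ?I ?I X \<odot> Ide S Y)"
  have iso: "is_iso S ?i"
    by (intro is_iso_comp is_iso_tens assoc_iso is_iso_ide) simp_all
  have E: "Ide S ?I \<odot> (LUnit S (X \<boxtimes> Y) \<cdot> Assoc S ?I X Y) = (Ide S ?I \<odot> LUnit S (X \<boxtimes> Y)) \<cdot> (Ide S ?I \<odot> Assoc S ?I X Y)"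
    by (simp add: interchange)
  have "(Ide S ?I \<odot> (LUnit S (X \<boxtimes> Y) \<cdot> Assoc S ?I X Y)) \<cdot> ?i =
      (Ide S ?I \<odot> LUnit S (X \<boxtimes> Y)) \<cdot> ((Ide S ?I \<odot> Assoc S ?I X Y) \<cdot> Assoc S ?I (?I \<boxtimes> X) Y \<cdot> (Assoc S ?I ?I X \<odot> Ide S Y))"
    by (simp add: E assoc_arr)
  also have "\<dots> = (Ide S ?I \<odot> LUnit S (X \<boxtimes> Y)) \<cdot> (Assoc S ?I ?I (X \<boxtimes> Y) \<cdot> Assoc S (?I \<boxtimes> ?I) X Y)"
    by (simp add: pentagon)
  also have "\<dots> = ((Ide S ?I \<odot> LUnit S (X \<boxtimes> Y)) \<cdot> Assoc S ?I ?I (X \<boxtimes> Y)) \<cdot> Assoc S (?I \<boxtimes> ?I) X Y"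
    by (rule assoc_arr [symmetric]) simp_all
  also have "\<dots> = (RUnit S ?I \<odot> (Ide S X \<odot> Ide S Y)) \<cdot> Assoc S (?I \<boxtimes> ?I) X Y"
    by (simp add: triangle)
  also have "\<dots> = Assoc S ?I X Y \<cdot> ((RUnit S ?I \<odot> Ide S X) \<odot> Ide S Y)"
    using assoc_nat_arr [of "RUnit S ?I" "Ide S X" "Ide S Y"] by simp
  also have "\<dots> = Assoc S ?I X Y \<cdot> (((Ide S ?I \<odot> LUnit S X) \<odot> Ide S Y) \<cdot> (Assoc S ?I ?I X \<odot> Ide S Y))"
    by (simp add: interchange triangle)
  also have "\<dots> = (Assoc S ?I X Y \<cdot> ((Ide S ?I \<odot> LUnit S X) \<odot> Ide S Y)) \<cdot> (Assoc S ?I ?I X \<odot> Ide S Y)"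
    by (rule assoc_arr [symmetric]) simp_all
  also have "\<dots> = ((Ide S ?I \<odot> (LUnit S X \<odot> Ide S Y)) \<cdot> Assoc S ?I (?I \<boxtimes> X) Y) \<cdot> (Assoc S ?I ?I X \<odot> Ide S Y)"
    using assoc_nat_arr [of "Ide S ?I" "LUnit S X" "Ide S Y"] by simp
  also have "\<dots> = (Ide S ?I \<odot> (LUnit S X \<odot> Ide S Y)) \<cdot> ?i"
    by (rule assoc_arr) simp_all
  finally show "Ide S ?I \<odot> (LUnit S (X \<boxtimes> Y) \<cdot> Assoc S ?I X Y) = Ide S ?I \<odot> (LUnit S X \<odot> Ide S Y)"
    by (rule iso_epi [OF iso]) simp_all
qed simp_all

text \<open>The mirror image of \<open>lunit_tens\<close>, obtained after tensoring with the unit on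
  the right.\<close>

lemma runit_tens:
  assumes [simp]: "X \<in> Obj S" "Y \<in> Obj S"
  shows "(Ide S X \<odot> RUnit S Y) \<cdot> Assoc S X Y (Unit S) = RUnit S (X \<boxtimes> Y)"
proof (rule unit_tens_faithful(2))
  let ?I = "Unit S"
  have "Assoc S X Y ?I \<cdot> (RUnit S (X \<boxtimes> Y) \<odot> Ide S ?I) = Assoc S X Y ?I \<cdot> (((Ide S X \<odot> Ide S Y) \<odot> LUnit S ?I) \<cdot> Assoc S (X \<boxtimes> Y) ?I ?I)"
    by (simp add: triangle)
  also have "\<dots> = (Assoc S X Y ?I \<cdot> ((Ide S X \<odot> Ide S Y) \<odot> LUnit S ?I)) \<cdot> Assoc S (X \<boxtimes> Y) ?I ?I"
    by (rule assoc_arr [symmetric]) simp_all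
  also have "\<dots> = ((Ide S X \<odot> (Ide S Y \<odot> LUnit S ?I)) \<cdot> Assoc S X Y (?I \<boxtimes> ?I)) \<cdot> Assoc S (X \<boxtimes> Y) ?I ?I"
    using assoc_nat_arr [of "Ide S X" "Ide S Y" "LUnit S ?I"] by simp
  also have "\<dots> = (Ide S X \<odot> (Ide S Y \<odot> LUnit S ?I)) \<cdot> (Assoc S X Y (?I \<boxtimes> ?I) \<cdot> Assoc S (X \<boxtimes> Y) ?I ?I)"
    by (rule assoc_arr) simp_all
  also have "\<dots> = (Ide S X \<odot> (Ide S Y \<odot> LUnit S ?I)) \<cdot> ((Ide S X \<odot> Assoc S Y ?I ?I) \<cdot> (Assoc S X (Y \<boxtimes> ?I) ?I \<cdot> (Assoc S X Y ?I \<odot> Ide S ?I)))"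
    by (simp add: pentagon assoc_arr)
  also have "\<dots> = ((Ide S X \<odot> (Ide S Y \<odot> LUnit S ?I)) \<cdot> (Ide S X \<odot> Assoc S Y ?I ?I)) \<cdot> (Assoc S X (Y \<boxtimes> ?I) ?I \<cdot> (Assoc S X Y ?I \<odot> Ide S ?I))"
    by (rule assoc_arr [symmetric]) simp_all
  also have "(Ide S X \<odot> (Ide S Y \<odot> LUnit S ?I)) \<cdot> (Ide S X \<odot> Assoc S Y ?I ?I) = Ide S X \<odot> (RUnit S Y \<odot> Ide S ?I)"
    by (simp add: interchange triangle)
  also have "\<dots> \<cdot> (Assoc S X (Y \<boxtimes> ?I) ?I \<cdot> (Assoc S X Y ?I \<odot> Ide S ?I)) = ((Ide S X \<odot> (RUnit S Y \<odot> Ide S ?I)) \<cdot> Assoc S X (Y \<boxtimes> ?I) ?I) \<cdot> (Assoc S X Y ?I \<odot> Ide S ?I)"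
    by (rule assoc_arr [symmetric]) simp_all
  also have "\<dots> = (Assoc S X Y ?I \<cdot> ((Ide S X \<odot> RUnit S Y) \<odot> Ide S ?I)) \<cdot> (Assoc S X Y ?I \<odot> Ide S ?I)"
    using assoc_nat_arr [of "Ide S X" "RUnit S Y" "Ide S ?I"] by simp
  also have "\<dots> = Assoc S X Y ?I \<cdot> (((Ide S X \<odot> RUnit S Y) \<cdot> Assoc S X Y ?I) \<odot> Ide S ?I)"
    by (simp add: assoc_arr interchange)
  finally have "RUnit S (X \<boxtimes> Y) \<odot> Ide S ?I = ((Ide S X \<odot> RUnit S Y) \<cdot> Assoc S X Y ?I) \<odot> Ide S ?I"
    by (rule iso_mono [OF assoc_iso [OF assms unit_obj]]) simp_all
  then show "((Ide S X \<odot> RUnit S Y) \<cdot> Assoc S X Y ?I) \<odot> Ide S ?I = RUnit S (X \<boxtimes> Y) \<odot> Ide S ?I" by simp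
qed simp_all

text \<open>Cancelling \<open>LUnit\<close> in its own naturality square describes the left unit map
  of the doubled unit object. Comparing \<open>lunit_tens\<close> with the triangle identifies both
  maps after tensoring with the unit.\<close>

lemma lunit_runit: "LUnit S (Unit S) = RUnit S (Unit S)"
proof (rule unit_tens_faithful(2))
  let ?I = "Unit S"
  have "LUnit S ?I \<cdot> (Ide S ?I \<odot> LUnit S ?I) = LUnit S ?I \<cdot> LUnit S (?I \<boxtimes> ?I)"
    using lunit_nat_arr [of "LUnit S ?I"] by simp
  then have "Ide S ?I \<odot> LUnit S ?I = LUnit S (?I \<boxtimes> ?I)"
    by (rule iso_mono [OF lunit_iso [OF unit_obj]]) simp_all
  then show "LUnit S ?I \<odot> Ide S ?I = RUnit S ?I \<odot> Ide S ?I"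
    using lunit_tens [of ?I ?I] triangle [of ?I ?I] by simp
qed simp_all

end

section \<open>Canonical isomorphisms between tensor powers of an object\<close>

locale tensor_powers = symmetric_monoidal_category S
  for S :: "('o, 'a, 'z) smc_scheme" (structure) +
  fixes X :: 'o
  assumes X [simp]: "X \<in> Obj S"
begin

abbreviation ainv :: "'o \<Rightarrow> 'o \<Rightarrow> 'o \<Rightarrow> 'a" where
  "ainv A B C \<equiv> inv_arr S (Assoc S A B C)"

lemma ainv_facts [simp]:
  assumes "A \<in> Obj S" "B \<in> Obj S" "C \<in> Obj S"
  shows "ainv A B C \<in> Arr S" "Dom S (ainv A B C) = A \<boxtimes> (B \<boxtimes> C)" "Cod S (ainv A B C) = (A \<boxtimes> B) \<boxtimes> C"
    "ainv A B C \<cdot> Assoc S A B C = Ide S ((A \<boxtimes> B) \<boxtimes> C)" "Assoc S A B C \<cdot> ainv A B C = Ide S (A \<boxtimes> (B \<boxtimes> C))"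
  using inverse_arrows_inv_arr [OF assoc_iso [OF assms]] assms by (simp_all add: inverse_arrows_iff)

lemma ainv_nat:
  assumes "f \<in> Arr S" "g \<in> Arr S" "h \<in> Arr S"
  shows "ainv (Cod S f) (Cod S g) (Cod S h) \<cdot> (f \<odot> (g \<odot> h)) = ((f \<odot> g) \<odot> h) \<cdot> ainv (Dom S f) (Dom S g) (Dom S h)"
proof (rule iso_epi [OF assoc_iso [of "Dom S f" "Dom S g" "Dom S h"]])
  let ?a = "Assoc S (Dom S f) (Dom S g) (Dom S h)" and ?b = "ainv (Cod S f) (Cod S g) (Cod S h)"
  have "?b \<cdot> (f \<odot> (g \<odot> h)) \<cdot> ?a = ?b \<cdot> (Assoc S (Cod S f) (Cod S g) (Cod S h) \<cdot> ((f \<odot> g) \<odot> h))"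
    using assms by (simp add: assoc_arr assoc_nat_arr)
  also have "\<dots> = (?b \<cdot> Assoc S (Cod S f) (Cod S g) (Cod S h)) \<cdot> ((f \<odot> g) \<odot> h)"
    using assms by (intro assoc_arr [symmetric]) simp_all
  also have "\<dots> = ((f \<odot> g) \<odot> h) \<cdot> (ainv (Dom S f) (Dom S g) (Dom S h) \<cdot> ?a)" using assms by simp
  also have "\<dots> = ((f \<odot> g) \<odot> h) \<cdot> ainv (Dom S f) (Dom S g) (Dom S h) \<cdot> ?a"
    using assms by (intro assoc_arr [symmetric]) simp_all
  finally show "?b \<cdot> (f \<odot> (g \<odot> h)) \<cdot> ?a = ((f \<odot> g) \<odot> h) \<cdot> ainv (Dom S f) (Dom S g) (Dom S h) \<cdot> ?a" .
qed (use assms in simp_all)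

abbreviation P :: "nat \<Rightarrow> 'o" where "P n \<equiv> tpow S X n"
abbreviation can :: "nat \<Rightarrow> nat \<Rightarrow> 'a" where "can p q \<equiv> can_tens S X p q"

lemma P_obj [simp]: "P n \<in> Obj S" by (rule tpow_obj) simp

lemma P_Suc: "0 < n \<Longrightarrow> P (Suc n) = P n \<boxtimes> X" by (cases n) simp_all

text \<open>The recursion uses \<open>RUnit\<close> for \<open>q = 0\<close> whatever
  \<open>p\<close> is, so at \<open>p = q = 0\<close> the equality of the two unit maps
  enters.\<close>

lemma can_0_left: "can 0 q = LUnit S (P q)"
  by (cases q) (simp_all add: lunit_runit)

lemma can_1: "0 < p \<Longrightarrow> can p (Suc 0) = Ide S (P p \<boxtimes> X)" by (cases p) simp_all

lemma can_in [simp]: "can p q \<in> Arr S" "Dom S (can p q) = P p \<boxtimes> P q" "Cod S (can p q) = P (p + q)"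
proof -
  have "can p q \<in> Arr S \<and> Dom S (can p q) = P p \<boxtimes> P q \<and> Cod S (can p q) = P (p + q)"
  proof (cases p)
    case 0
    then show ?thesis by (simp add: can_0_left)
  next
    case (Suc p')
    show ?thesis
    proof (induction q)
      case 0
      show ?case using Suc by simp
    next
      case (Suc q)
      then show ?case using \<open>p = Suc p'\<close> by (cases q) (simp_all add: P_Suc)
    qed
  qed
  then show "can p q \<in> Arr S" "Dom S (can p q) = P p \<boxtimes> P q" "Cod S (can p q) = P (p + q)" by auto
qed

text \<open>Extends the recursive equation of \<open>can_tens\<close> to \<open>p = 0\<close>, where
  it amounts to \<open>lunit_tens\<close>.\<close>

lemma can_Suc:
  assumes q: "0 < q"
  shows "can p (Suc q) = (can p q \<odot> Ide S X) \<cdot> ainv (P p) (P q) X"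
proof (cases p)
  case 0
  have "LUnit S (P q \<boxtimes> X) \<cdot> Assoc S (Unit S) (P q) X \<cdot> ainv (Unit S) (P q) X = LUnit S (P q \<boxtimes> X)"
    by (simp add: assoc_arr)
  then show ?thesis using 0 q by (simp add: can_0_left P_Suc lunit_tens)
next
  case (Suc p')
  then show ?thesis using q by (cases q) simp_all
qed

lemma can_iso: "is_iso S (can p q)"
proof (cases "q = 0")
  case True
  then show ?thesis by (simp add: runit_iso)
next
  case False
  then have "0 < q" by simp
  then show ?thesis
  proof (induction q)
    case (Suc q)
    show ?case
    proof (cases "q = 0")
      case True
      then show ?thesis by (cases "p = 0") (simp_all add: can_0_left can_1 lunit_iso is_iso_ide)
    next
      case False
      have "is_iso S (ainv (P p) (P q) X)"
        by (rule is_isoI [OF inverse_arrows_sym [OF inverse_arrows_inv_arr [OF assoc_iso]]]) simp_all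
      then show ?thesis using Suc.IH False by (simp add: can_Suc is_iso_comp is_iso_tens is_iso_ide)
    qed
  qed simp
qed

text \<open>The coherence behind strict associativity of the endomorphism PROP. The induction on
  \<open>r\<close> rests on \<open>runit_tens\<close> at \<open>0\<close>, on the triangle in
  passing to \<open>r = 1\<close> with \<open>q = 0\<close>, and on the pentagon for the later
  steps.\<close>

lemma can_assoc:
  "can (p + q) r \<cdot> (can p q \<odot> Ide S (P r)) = can p (q + r) \<cdot> ((Ide S (P p) \<odot> can q r) \<cdot> Assoc S (P p) (P q) (P r))"
proof (induction r)
  case 0
  show ?case using runit_nat_arr [of "can p q"] by (simp add: runit_tens)
next
  case (Suc r)
  show ?case
  proof (cases "r = 0")
    case True
    show ?thesis
    proof (cases "q = 0")
      case True
      then show ?thesis using \<open>r = 0\<close> by (simp add: can_0_left triangle)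
    next
      case False
      then have q: "0 < q" by simp
      have "((can p q \<odot> Ide S X) \<cdot> ainv (P p) (P q) X) \<cdot> Assoc S (P p) (P q) X = can p q \<odot> Ide S X"
        by (simp add: assoc_arr)
      then show ?thesis using q \<open>r = 0\<close> by (simp add: can_1 can_Suc P_Suc)
    qed
  next
    case False
    then have r: "0 < r" "0 < q + r" by simp_all
    let ?X = "Ide S X" and ?p = "P p" and ?q = "P q" and ?r = "P r"
    let ?a = "Assoc S ?p ?q ?r \<odot> ?X" and ?b = "ainv (?p \<boxtimes> ?q) ?r X"
    \<comment> \<open>The pentagon, solved so that the associators introduced by
      \<open>can_Suc\<close> appear inverted.\<close>
    have pent: "ainv ?p (?q \<boxtimes> ?r) X \<cdot> ((Ide S ?p \<odot> ainv ?q ?r X) \<cdot> Assoc S ?p ?q (?r \<boxtimes> X)) = ?a \<cdot> ?b"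
    proof (rule iso_epi [OF assoc_iso [of "?p \<boxtimes> ?q" ?r X]])
      let ?pe = "(Ide S ?p \<odot> Assoc S ?q ?r X) \<cdot> (Assoc S ?p (?q \<boxtimes> ?r) X \<cdot> ?a)"
      have "(ainv ?p (?q \<boxtimes> ?r) X \<cdot> ((Ide S ?p \<odot> ainv ?q ?r X) \<cdot> Assoc S ?p ?q (?r \<boxtimes> X))) \<cdot> Assoc S (?p \<boxtimes> ?q) ?r X =
          ainv ?p (?q \<boxtimes> ?r) X \<cdot> ((Ide S ?p \<odot> ainv ?q ?r X) \<cdot> (Assoc S ?p ?q (?r \<boxtimes> X) \<cdot> Assoc S (?p \<boxtimes> ?q) ?r X))"
        by (simp add: assoc_arr)
      also have "Assoc S ?p ?q (?r \<boxtimes> X) \<cdot> Assoc S (?p \<boxtimes> ?q) ?r X = ?pe"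
        by (simp add: pentagon assoc_arr)
      also have "(Ide S ?p \<odot> ainv ?q ?r X) \<cdot> ?pe = ((Ide S ?p \<odot> ainv ?q ?r X) \<cdot> (Ide S ?p \<odot> Assoc S ?q ?r X)) \<cdot> (Assoc S ?p (?q \<boxtimes> ?r) X \<cdot> ?a)"
        by (rule assoc_arr [symmetric]) simp_all
      also have "\<dots> = Assoc S ?p (?q \<boxtimes> ?r) X \<cdot> ?a"
        by (simp add: interchange)
      also have "ainv ?p (?q \<boxtimes> ?r) X \<cdot> (Assoc S ?p (?q \<boxtimes> ?r) X \<cdot> ?a) = (ainv ?p (?q \<boxtimes> ?r) X \<cdot> Assoc S ?p (?q \<boxtimes> ?r) X) \<cdot> ?a"
        by (rule assoc_arr [symmetric]) simp_all
      also have "\<dots> = (?a \<cdot> ?b) \<cdot> Assoc S (?p \<boxtimes> ?q) ?r X"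
        by (simp add: assoc_arr)
      finally show "(ainv ?p (?q \<boxtimes> ?r) X \<cdot> ((Ide S ?p \<odot> ainv ?q ?r X) \<cdot> Assoc S ?p ?q (?r \<boxtimes> X))) \<cdot> Assoc S (?p \<boxtimes> ?q) ?r X =
        (?a \<cdot> ?b) \<cdot> Assoc S (?p \<boxtimes> ?q) ?r X" .
    qed simp_all
    have "can (p + q) (Suc r) \<cdot> (can p q \<odot> Ide S (P (Suc r))) = ((can (p + q) r \<odot> ?X) \<cdot> ainv (P (p + q)) ?r X) \<cdot> (can p q \<odot> (Ide S ?r \<odot> ?X))"
      using r by (simp add: can_Suc P_Suc)
    also have "\<dots> = (can (p + q) r \<odot> ?X) \<cdot> (ainv (P (p + q)) ?r X \<cdot> (can p q \<odot> (Ide S ?r \<odot> ?X)))"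
      by (rule assoc_arr) simp_all
    also have "ainv (P (p + q)) ?r X \<cdot> (can p q \<odot> (Ide S ?r \<odot> ?X)) = ((can p q \<odot> Ide S ?r) \<odot> ?X) \<cdot> ?b"
      using ainv_nat [of "can p q" "Ide S ?r" ?X] by simp
    also have "(can (p + q) r \<odot> ?X) \<cdot> (((can p q \<odot> Ide S ?r) \<odot> ?X) \<cdot> ?b) = ((can (p + q) r \<odot> ?X) \<cdot> ((can p q \<odot> Ide S ?r) \<odot> ?X)) \<cdot> ?b"
      by (rule assoc_arr [symmetric]) simp_all
    also have "(can (p + q) r \<odot> ?X) \<cdot> ((can p q \<odot> Ide S ?r) \<odot> ?X) = (can p (q + r) \<odot> ?X) \<cdot> (((Ide S ?p \<odot> can q r) \<odot> ?X) \<cdot> ?a)"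
      using Suc by (simp add: interchange add.assoc)
    also have "\<dots> \<cdot> ?b = (can p (q + r) \<odot> ?X) \<cdot> (((Ide S ?p \<odot> can q r) \<odot> ?X) \<cdot> (?a \<cdot> ?b))"
      by (simp add: assoc_arr add.assoc)
    also have "\<dots> = (can p (q + r) \<odot> ?X) \<cdot> ((((Ide S ?p \<odot> can q r) \<odot> ?X) \<cdot> ainv ?p (?q \<boxtimes> ?r) X) \<cdot> ((Ide S ?p \<odot> ainv ?q ?r X) \<cdot> Assoc S ?p ?q (?r \<boxtimes> X)))"
      unfolding pent [symmetric] by (simp add: assoc_arr)
    also have "((Ide S ?p \<odot> can q r) \<odot> ?X) \<cdot> ainv ?p (?q \<boxtimes> ?r) X = ainv ?p (P (q + r)) X \<cdot> (Ide S ?p \<odot> (can q r \<odot> ?X))"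
      using ainv_nat [of "Ide S ?p" "can q r" ?X] by simp
    also have "(can p (q + r) \<odot> ?X) \<cdot> ((ainv ?p (P (q + r)) X \<cdot> (Ide S ?p \<odot> (can q r \<odot> ?X))) \<cdot> ((Ide S ?p \<odot> ainv ?q ?r X) \<cdot> Assoc S ?p ?q (?r \<boxtimes> X))) =
        ((can p (q + r) \<odot> ?X) \<cdot> ainv ?p (P (q + r)) X) \<cdot> (((Ide S ?p \<odot> (can q r \<odot> ?X)) \<cdot> (Ide S ?p \<odot> ainv ?q ?r X)) \<cdot> Assoc S ?p ?q (?r \<boxtimes> X))"
      by (simp add: assoc_arr add.assoc)
    also have "(Ide S ?p \<odot> (can q r \<odot> ?X)) \<cdot> (Ide S ?p \<odot> ainv ?q ?r X) = Ide S ?p \<odot> can q (Suc r)"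
      using r by (simp add: interchange can_Suc)
    also have "(can p (q + r) \<odot> ?X) \<cdot> ainv ?p (P (q + r)) X = can p (q + Suc r)"
      using r by (simp add: can_Suc)
    finally show ?thesis using r by (simp add: P_Suc)
  qed
qed

section \<open>The endomorphism PROP: tensor product and symmetry conjugated by canonical
  isomorphisms\<close>

abbreviation cinv :: "nat \<Rightarrow> nat \<Rightarrow> 'a" where "cinv p q \<equiv> inv_arr S (can p q)"

lemma cinv_facts [simp]:
  "cinv p q \<in> Arr S" "Dom S (cinv p q) = P (p + q)" "Cod S (cinv p q) = P p \<boxtimes> P q"
  "cinv p q \<cdot> can p q = Ide S (P p \<boxtimes> P q)" "can p q \<cdot> cinv p q = Ide S (P (p + q))"
  using inverse_arrows_inv_arr [OF can_iso [of p q]] by (simp_all add: inverse_arrows_iff)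

definition ten :: "nat \<times> nat \<times> 'a \<Rightarrow> nat \<times> nat \<times> 'a \<Rightarrow> 'a" where
  "ten f g = can (fst (snd f)) (fst (snd g)) \<cdot> ((snd (snd f) \<odot> snd (snd g)) \<cdot> cinv (fst f) (fst g))"

definition sy :: "nat \<Rightarrow> nat \<Rightarrow> 'a" where
  "sy p q = can q p \<cdot> (Sym S (P p) (P q) \<cdot> cinv p q)"

text \<open>Arrows carry their source and target numbers, because an arrow of \<open>S\<close> does
  not determine them: different tensor powers of \<open>X\<close> may be the same object.\<close>

definition E :: "(nat, nat \<times> nat \<times> 'a) smc" where
  "E = \<lparr>Obj = UNIV, Arr = {(n, m, f). f \<in> Arr S \<and> Dom S f = P n \<and> Cod S f = P m},
     Dom = fst, Cod = (\<lambda>f. fst (snd f)), Ide = (\<lambda>n. (n, n, Ide S (P n))),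
     Comp = (\<lambda>g f. (fst f, fst (snd g), snd (snd g) \<cdot> snd (snd f))),
     TensO = (+), TensA = (\<lambda>f g. (fst f + fst g, fst (snd f) + fst (snd g), ten f g)), Unit = 0,
     Assoc = (\<lambda>n m k. (n + m + k, n + m + k, Ide S (P (n + m + k)))),
     LUnit = (\<lambda>n. (n, n, Ide S (P n))), RUnit = (\<lambda>n. (n, n, Ide S (P n))),
     Sym = (\<lambda>n m. (n + m, m + n, sy n m))\<rparr>"

lemma E_simps [simp]:
  "Obj E = UNIV" "(n, m, u) \<in> Arr E \<longleftrightarrow> u \<in> Arr S \<and> Dom S u = P n \<and> Cod S u = P m"
  "Dom E = fst" "Cod E = (\<lambda>f. fst (snd f))" "Ide E n = (n, n, Ide S (P n))"
  "Comp E g f = (fst f, fst (snd g), snd (snd g) \<cdot> snd (snd f))" "TensO E = (+)"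
  "TensA E f g = (fst f + fst g, fst (snd f) + fst (snd g), ten f g)" "Unit E = 0"
  "Sym E n m = (n + m, m + n, sy n m)"
  by (simp_all add: E_def)

lemma E_arr: "f \<in> Arr E \<longleftrightarrow> snd (snd f) \<in> Arr S \<and> Dom S (snd (snd f)) = P (fst f) \<and> Cod S (snd (snd f)) = P (fst (snd f))"
  by (cases f) simp

lemma sy_in [simp]: "sy p q \<in> Arr S" "Dom S (sy p q) = P (p + q)" "Cod S (sy p q) = P (q + p)"
  by (simp_all add: sy_def)

lemma sy_can: "sy p q \<cdot> can p q = can q p \<cdot> Sym S (P p) (P q)"
  by (simp add: sy_def assoc_arr)

lemma ten_in [simp]:
  assumes "(n, m, f) \<in> Arr E" "(n', m', g) \<in> Arr E"
  shows "ten (n, m, f) (n', m', g) \<in> Arr S" "Dom S (ten (n, m, f) (n', m', g)) = P (n + n')"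
    "Cod S (ten (n, m, f) (n', m', g)) = P (m + m')"
  using assms by (simp_all add: ten_def)

lemma ten_can:
  assumes "(n, m, f) \<in> Arr E" "(n', m', g) \<in> Arr E"
  shows "ten (n, m, f) (n', m', g) \<cdot> can n n' = can m m' \<cdot> (f \<odot> g)"
  using assms by (simp add: ten_def assoc_arr)

text \<open>As \<open>can\<close> is invertible, the conjugated product is the only solution of this
  equation, and identities about \<open>ten\<close> are verified through such equations.\<close>

lemma ten_unique:
  assumes "(n, m, f) \<in> Arr E" "(n', m', g) \<in> Arr E" "h \<in> Arr S" "Dom S h = P (n + n')" "Cod S h = P (m + m')"
    and "h \<cdot> can n n' = can m m' \<cdot> (f \<odot> g)"
  shows "ten (n, m, f) (n', m', g) = h"
  by (rule iso_epi [OF can_iso [of n n']]) (use assms ten_can [OF assms(1,2)] in simp_all)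

text \<open>The canonical isomorphism out of a triple product of powers. By \<open>can_assoc\<close>
  it has one factorisation for each bracketing, so triple products are compared after composition
  with it.\<close>

definition D3 :: "nat \<Rightarrow> nat \<Rightarrow> nat \<Rightarrow> 'a" where
  "D3 p q r = can (p + q) r \<cdot> (can p q \<odot> Ide S (P r))"

lemma D3_in [simp]: "D3 p q r \<in> Arr S" "Dom S (D3 p q r) = (P p \<boxtimes> P q) \<boxtimes> P r" "Cod S (D3 p q r) = P (p + q + r)"
  by (simp_all add: D3_def)

lemma D3_iso: "is_iso S (D3 p q r)"
  unfolding D3_def by (intro is_iso_comp is_iso_tens can_iso is_iso_ide) simp_all

lemma D3_alt: "D3 p q r = can p (q + r) \<cdot> ((Ide S (P p) \<odot> can q r) \<cdot> Assoc S (P p) (P q) (P r))"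
  unfolding D3_def by (rule can_assoc)

lemma D3_left:
  assumes f: "(n, m, f) \<in> Arr E" and g: "(n', m', g) \<in> Arr E" and h: "(n'', m'', h) \<in> Arr E"
  shows "ten (n + n', m + m', ten (n, m, f) (n', m', g)) (n'', m'', h) \<cdot> D3 n n' n'' = D3 m m' m'' \<cdot> ((f \<odot> g) \<odot> h)"
proof -
  have fg: "(n + n', m + m', ten (n, m, f) (n', m', g)) \<in> Arr E" using f g by simp
  have "ten (n + n', m + m', ten (n, m, f) (n', m', g)) (n'', m'', h) \<cdot> D3 n n' n'' =
      (can (m + m') m'' \<cdot> (ten (n, m, f) (n', m', g) \<odot> h)) \<cdot> (can n n' \<odot> Ide S (P n''))"
    unfolding D3_def ten_can [OF fg h, symmetric] using fg h by (intro assoc_arr [symmetric]) simp_all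
  also have "\<dots> = can (m + m') m'' \<cdot> ((can m m' \<cdot> (f \<odot> g)) \<odot> h)"
    using f g h ten_can [OF f g] by (simp add: assoc_arr interchange)
  also have "\<dots> = D3 m m' m'' \<cdot> ((f \<odot> g) \<odot> h)"
    unfolding D3_def using f g h by (simp add: assoc_arr interchange)
  finally show ?thesis .
qed

lemma D3_right:
  assumes f: "(n, m, f) \<in> Arr E" and g: "(n', m', g) \<in> Arr E" and h: "(n'', m'', h) \<in> Arr E"
  shows "ten (n, m, f) (n' + n'', m' + m'', ten (n', m', g) (n'', m'', h)) \<cdot> D3 n n' n'' = D3 m m' m'' \<cdot> ((f \<odot> g) \<odot> h)"
proof -
  have gh: "(n' + n'', m' + m'', ten (n', m', g) (n'', m'', h)) \<in> Arr E" using g h by simp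
  let ?a = "Assoc S (P n) (P n') (P n'')"
  have "ten (n, m, f) (n' + n'', m' + m'', ten (n', m', g) (n'', m'', h)) \<cdot> D3 n n' n'' =
      (can m (m' + m'') \<cdot> (f \<odot> ten (n', m', g) (n'', m'', h))) \<cdot> ((Ide S (P n) \<odot> can n' n'') \<cdot> ?a)"
    unfolding D3_alt ten_can [OF f gh, symmetric] using f gh by (intro assoc_arr [symmetric]) (simp_all add: add.assoc)
  also have "\<dots> = can m (m' + m'') \<cdot> (((f \<odot> ten (n', m', g) (n'', m'', h)) \<cdot> (Ide S (P n) \<odot> can n' n'')) \<cdot> ?a)"
    using f g h by (simp add: assoc_arr)
  also have "(f \<odot> ten (n', m', g) (n'', m'', h)) \<cdot> (Ide S (P n) \<odot> can n' n'') = (Ide S (P m) \<odot> can m' m'') \<cdot> (f \<odot> (g \<odot> h))"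
    using f g h ten_can [OF g h] by (simp add: interchange)
  also have "\<dots> \<cdot> ?a = (Ide S (P m) \<odot> can m' m'') \<cdot> (Assoc S (P m) (P m') (P m'') \<cdot> ((f \<odot> g) \<odot> h))"
    using f g h assoc_nat_arr [of f g h] by (simp add: assoc_arr)
  also have "can m (m' + m'') \<cdot> \<dots> = D3 m m' m'' \<cdot> ((f \<odot> g) \<odot> h)"
    unfolding D3_alt using f g h by (simp add: assoc_arr)
  finally show ?thesis .
qed

text \<open>The hexagon of \<open>S\<close> transported along \<open>D3\<close>: every conjugated
  symmetry is moved through \<open>can\<close> until only symmetries and associators of
  \<open>S\<close> remain.\<close>

lemma E_hex: "sy x (y + z) = ten (y, y, Ide S (P y)) (x + z, z + x, sy x z) \<cdot> ten (x + y, y + x, sy x y) (z, z, Ide S (P z))"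
proof (rule iso_epi [OF D3_iso [of x y z]])
  let ?x = "P x" and ?y = "P y" and ?z = "P z"
  let ?D = "can y (z + x) \<cdot> (Ide S ?y \<odot> can z x)"
  have o: "(y, y, Ide S ?y) \<in> Arr E" "(x + z, z + x, sy x z) \<in> Arr E" "(x + y, y + x, sy x y) \<in> Arr E" "(z, z, Ide S ?z) \<in> Arr E"
    by simp_all
  have H: "Assoc S ?y ?z ?x \<cdot> (Sym S ?x (?y \<boxtimes> ?z) \<cdot> Assoc S ?x ?y ?z) =
      (Ide S ?y \<odot> Sym S ?x ?z) \<cdot> (Assoc S ?y ?x ?z \<cdot> (Sym S ?x ?y \<odot> Ide S ?z))"
    using hexagon [of ?x ?y ?z] by (simp add: assoc_arr)
  have "sy x (y + z) \<cdot> D3 x y z = (sy x (y + z) \<cdot> can x (y + z)) \<cdot> ((Ide S ?x \<odot> can y z) \<cdot> Assoc S ?x ?y ?z)"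
    unfolding D3_alt by (rule assoc_arr [symmetric]) (simp_all add: add.assoc)
  also have "\<dots> = can (y + z) x \<cdot> ((Sym S ?x (P (y + z)) \<cdot> (Ide S ?x \<odot> can y z)) \<cdot> Assoc S ?x ?y ?z)"
    unfolding sy_can by (simp add: assoc_arr)
  also have "Sym S ?x (P (y + z)) \<cdot> (Ide S ?x \<odot> can y z) = (can y z \<odot> Ide S ?x) \<cdot> Sym S ?x (?y \<boxtimes> ?z)"
    using sym_nat_arr [of "Ide S ?x" "can y z"] by simp
  also have "can (y + z) x \<cdot> ((can y z \<odot> Ide S ?x) \<cdot> Sym S ?x (?y \<boxtimes> ?z) \<cdot> Assoc S ?x ?y ?z) =
      D3 y z x \<cdot> (Sym S ?x (?y \<boxtimes> ?z) \<cdot> Assoc S ?x ?y ?z)"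
    unfolding D3_def by (simp add: assoc_arr)
  also have "\<dots> = ?D \<cdot> (Assoc S ?y ?z ?x \<cdot> Sym S ?x (?y \<boxtimes> ?z) \<cdot> Assoc S ?x ?y ?z)"
    unfolding D3_alt by (simp add: assoc_arr)
  also have "\<dots> = ?D \<cdot> ((Ide S ?y \<odot> Sym S ?x ?z) \<cdot> (Assoc S ?y ?x ?z \<cdot> (Sym S ?x ?y \<odot> Ide S ?z)))"
    by (simp add: H assoc_arr)
  finally have L: "sy x (y + z) \<cdot> D3 x y z = \<dots>" .
  let ?A = "ten (y, y, Ide S ?y) (x + z, z + x, sy x z)" and ?B = "ten (x + y, y + x, sy x y) (z, z, Ide S ?z)"
  note A = ten_in [OF o(1,2)] and B = ten_in [OF o(3,4)]
  have "?B \<cdot> D3 x y z = (?B \<cdot> can (x + y) z) \<cdot> (can x y \<odot> Ide S ?z)"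
    unfolding D3_def using B by (intro assoc_arr [symmetric]) simp_all
  also have "\<dots> = can (y + x) z \<cdot> ((can y x \<cdot> Sym S ?x ?y) \<odot> Ide S ?z)"
    unfolding ten_can [OF o(3,4)] by (simp add: assoc_arr interchange sy_can)
  also have "\<dots> = D3 y x z \<cdot> (Sym S ?x ?y \<odot> Ide S ?z)"
    unfolding D3_def by (simp add: assoc_arr interchange)
  finally have b: "?B \<cdot> D3 x y z = D3 y x z \<cdot> (Sym S ?x ?y \<odot> Ide S ?z)" .
  have "?A \<cdot> (can y (x + z) \<cdot> (Ide S ?y \<odot> can x z)) = (?A \<cdot> can y (x + z)) \<cdot> (Ide S ?y \<odot> can x z)"
    using A by (intro assoc_arr [symmetric]) simp_all
  also have "\<dots> = can y (z + x) \<cdot> (Ide S ?y \<odot> (can z x \<cdot> Sym S ?x ?z))"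
    unfolding ten_can [OF o(1,2)] by (simp add: assoc_arr interchange sy_can)
  also have "\<dots> = ?D \<cdot> (Ide S ?y \<odot> Sym S ?x ?z)"
    by (simp add: assoc_arr interchange)
  finally have a: "?A \<cdot> (can y (x + z) \<cdot> (Ide S ?y \<odot> can x z)) = ?D \<cdot> (Ide S ?y \<odot> Sym S ?x ?z)" .
  have "(?A \<cdot> ?B) \<cdot> D3 x y z = ?A \<cdot> (?B \<cdot> D3 x y z)"
    using A B by (intro assoc_arr) (simp_all add: ac_simps)
  also have "\<dots> = ?A \<cdot> (D3 y x z \<cdot> (Sym S ?x ?y \<odot> Ide S ?z))" by (simp only: b)
  also have "\<dots> = (?A \<cdot> (can y (x + z) \<cdot> (Ide S ?y \<odot> can x z))) \<cdot> (Assoc S ?y ?x ?z \<cdot> (Sym S ?x ?y \<odot> Ide S ?z))"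
    unfolding D3_alt using A by (simp add: assoc_arr)
  also have "\<dots> = ?D \<cdot> ((Ide S ?y \<odot> Sym S ?x ?z) \<cdot> (Assoc S ?y ?x ?z \<cdot> (Sym S ?x ?y \<odot> Ide S ?z)))"
    unfolding a by (simp add: assoc_arr)
  finally show "sy x (y + z) \<cdot> D3 x y z = (?A \<cdot> ?B) \<cdot> D3 x y z" unfolding L by simp
qed (simp_all add: ac_simps)

lemma E_is_PROP: "is_PROP E"
proof (rule is_PROP_intro)
  show "category E"
    by unfold_locales (auto simp: Hom_iff E_arr assoc_arr)
  show "TensO E = (+)" by simp
  show "f \<odot>\<^bsub>E\<^esub> g \<in> Hom E (Dom E f + Dom E g) (Cod E f + Cod E g)" if "f \<in> Arr E" "g \<in> Arr E" for f g
    using that by (cases f; cases g) (simp add: Hom_iff)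
  show "Ide E n \<odot>\<^bsub>E\<^esub> Ide E m = Ide E (n + m)" for n m
    using ten_unique [of n n "Ide S (P n)" m m "Ide S (P m)" "Ide S (P (n + m))"] by simp
  show "(f' \<cdot>\<^bsub>E\<^esub> f) \<odot>\<^bsub>E\<^esub> (g' \<cdot>\<^bsub>E\<^esub> g) = (f' \<odot>\<^bsub>E\<^esub> g') \<cdot>\<^bsub>E\<^esub> (f \<odot>\<^bsub>E\<^esub> g)"
    if a: "f \<in> Arr E" "f' \<in> Arr E" "g \<in> Arr E" "g' \<in> Arr E" "Cod E f = Dom E f'" "Cod E g = Dom E g'" for f f' g g'
  proof -
    obtain n m u where f: "f = (n, m, u)" by (cases f)
    obtain k v where f': "f' = (m, k, v)" using a(5) f by (cases f') auto
    obtain n1 m1 u1 where g: "g = (n1, m1, u1)" by (cases g)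
    obtain k1 v1 where g': "g' = (m1, k1, v1)" using a(6) g by (cases g') auto
    note A = a(1-4) [unfolded f f' g g']
    have "ten (n, k, v \<cdot> u) (n1, k1, v1 \<cdot> u1) = ten (m, k, v) (m1, k1, v1) \<cdot> ten (n, m, u) (n1, m1, u1)"
    proof (rule ten_unique)
      have "(ten (m, k, v) (m1, k1, v1) \<cdot> ten (n, m, u) (n1, m1, u1)) \<cdot> can n n1 = ten (m, k, v) (m1, k1, v1) \<cdot> (can m m1 \<cdot> (u \<odot> u1))"
        unfolding ten_can [OF A(1,3), symmetric] using A by (intro assoc_arr) simp_all
      also have "\<dots> = (ten (m, k, v) (m1, k1, v1) \<cdot> can m m1) \<cdot> (u \<odot> u1)"
        using A by (intro assoc_arr [symmetric]) simp_all
      also have "\<dots> = can k k1 \<cdot> ((v \<cdot> u) \<odot> (v1 \<cdot> u1))"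
        unfolding ten_can [OF A(2,4)] using A by (simp add: assoc_arr interchange)
      finally show "(ten (m, k, v) (m1, k1, v1) \<cdot> ten (n, m, u) (n1, m1, u1)) \<cdot> can n n1 = can k k1 \<cdot> ((v \<cdot> u) \<odot> (v1 \<cdot> u1))" .
    qed (use A in simp_all)
    then show ?thesis by (simp add: f f' g g')
  qed
  show "(f \<odot>\<^bsub>E\<^esub> g) \<odot>\<^bsub>E\<^esub> h = f \<odot>\<^bsub>E\<^esub> (g \<odot>\<^bsub>E\<^esub> h)" if a: "f \<in> Arr E" "g \<in> Arr E" "h \<in> Arr E" for f g h
  proof -
    obtain n m u n1 m1 u1 n2 m2 u2 where e: "f = (n, m, u)" "g = (n1, m1, u1)" "h = (n2, m2, u2)" by (cases f, cases g, cases h)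
    note A = a [unfolded e]
    have "ten (n + n1, m + m1, ten (n, m, u) (n1, m1, u1)) (n2, m2, u2) = ten (n, m, u) (n1 + n2, m1 + m2, ten (n1, m1, u1) (n2, m2, u2))"
      by (rule iso_epi [OF D3_iso [of n n1 n2]]) (use A D3_left [OF A] D3_right [OF A] in \<open>simp_all add: add.assoc\<close>)
    then show ?thesis by (simp add: e add.assoc)
  qed
  show "Ide E 0 \<odot>\<^bsub>E\<^esub> f = f" "f \<odot>\<^bsub>E\<^esub> Ide E 0 = f" if a: "f \<in> Arr E" for f
  proof -
    obtain n m u where e: "f = (n, m, u)" by (cases f)
    note A = a [unfolded e]
    have "ten (0, 0, Ide S (Unit S)) (n, m, u) = u"
      by (rule ten_unique) (use A lunit_nat_arr [of u] in \<open>simp_all add: can_0_left\<close>)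
    moreover have "ten (n, m, u) (0, 0, Ide S (Unit S)) = u"
      by (rule ten_unique) (use A runit_nat_arr [of u] in simp_all)
    ultimately show "Ide E 0 \<odot>\<^bsub>E\<^esub> f = f" "f \<odot>\<^bsub>E\<^esub> Ide E 0 = f" by (simp_all add: e)
  qed
  show "Sym E n m \<in> Hom E (n + m) (m + n)" for n m by (simp add: Hom_iff)
  show "Sym E (Cod E f) (Cod E g) \<cdot>\<^bsub>E\<^esub> (f \<odot>\<^bsub>E\<^esub> g) = (g \<odot>\<^bsub>E\<^esub> f) \<cdot>\<^bsub>E\<^esub> Sym E (Dom E f) (Dom E g)"
    if a: "f \<in> Arr E" "g \<in> Arr E" for f g
  proof -
    obtain n m u n1 m1 u1 where e: "f = (n, m, u)" "g = (n1, m1, u1)" by (cases f, cases g)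
    note A = a [unfolded e]
    have "sy m m1 \<cdot> ten (n, m, u) (n1, m1, u1) = ten (n1, m1, u1) (n, m, u) \<cdot> sy n n1"
    proof (rule iso_epi [OF can_iso [of n n1]])
      have "(sy m m1 \<cdot> ten (n, m, u) (n1, m1, u1)) \<cdot> can n n1 = sy m m1 \<cdot> (can m m1 \<cdot> (u \<odot> u1))"
        unfolding ten_can [OF A, symmetric] using A by (intro assoc_arr) simp_all
      also have "\<dots> = (sy m m1 \<cdot> can m m1) \<cdot> (u \<odot> u1)"
        using A by (intro assoc_arr [symmetric]) simp_all
      also have "\<dots> = can m1 m \<cdot> ((u1 \<odot> u) \<cdot> Sym S (P n) (P n1))"
        unfolding sy_can using A sym_nat_arr [of u u1] by (simp add: assoc_arr)
      also have "\<dots> = (ten (n1, m1, u1) (n, m, u) \<cdot> can n1 n) \<cdot> Sym S (P n) (P n1)"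
        unfolding ten_can [OF A(2,1)] using A by (simp add: assoc_arr)
      also have "\<dots> = ten (n1, m1, u1) (n, m, u) \<cdot> (sy n n1 \<cdot> can n n1)"
        unfolding sy_can using A by (intro assoc_arr) simp_all
      also have "\<dots> = (ten (n1, m1, u1) (n, m, u) \<cdot> sy n n1) \<cdot> can n n1"
        using A by (intro assoc_arr [symmetric]) (simp_all add: ac_simps)
      finally show "(sy m m1 \<cdot> ten (n, m, u) (n1, m1, u1)) \<cdot> can n n1 = (ten (n1, m1, u1) (n, m, u) \<cdot> sy n n1) \<cdot> can n n1" .
    qed (use A in \<open>simp_all add: ac_simps\<close>)
    then show ?thesis by (simp add: e)
  qed
  show "Sym E m n \<cdot>\<^bsub>E\<^esub> Sym E n m = Ide E (n + m)" for n m
  proof -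
    have "sy m n \<cdot> sy n m = Ide S (P (n + m))"
    proof (rule iso_epi [OF can_iso [of n m]])
      have "(sy m n \<cdot> sy n m) \<cdot> can n m = sy m n \<cdot> (can m n \<cdot> Sym S (P n) (P m))"
        unfolding sy_can [symmetric] by (rule assoc_arr) simp_all
      also have "\<dots> = (sy m n \<cdot> can m n) \<cdot> Sym S (P n) (P m)" by (rule assoc_arr [symmetric]) simp_all
      also have "\<dots> = can n m" unfolding sy_can by (simp add: assoc_arr sym_sym)
      finally show "(sy m n \<cdot> sy n m) \<cdot> can n m = Ide S (P (n + m)) \<cdot> can n m" by simp
    qed simp_all
    then show ?thesis by simp
  qed
  show "Sym E x (y + z) = (Ide E y \<odot>\<^bsub>E\<^esub> Sym E x z) \<cdot>\<^bsub>E\<^esub> (Sym E x y \<odot>\<^bsub>E\<^esub> Ide E z)" for x y z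
    by (simp add: E_hex)
qed (simp_all add: E_def)

end

section \<open>Morphisms of PROPs out of the composite\<close>

lemma G_monoid_cong:
  assumes "G_monoid E G mu eta act" "\<And>g. g \<in> carrier G \<Longrightarrow> act g = act' g"
  shows "G_monoid E G mu eta act'"
proof -
  interpret G_monoid E G mu eta act by (rule assms(1))
  note e = assms(2) [symmetric]
  show ?thesis
    by unfold_locales
      (simp_all add: e mu_assoc mu_eta act_mult act_mu act_eta del: One_nat_def)
qed

lemma PROP_morphism_eqI:
  assumes F: "PROP_morphism T E F" and F': "PROP_morphism T E F'"
    and B: "B \<subseteq> Arr T" "\<And>f. f \<in> B \<Longrightarrow> F f = F' f" and f: "gen_by T B f"
  shows "F f = F' f"
proof -
  interpret F: PROP_morphism T E F by (rule F)
  interpret F': PROP_morphism T E F' by (rule F')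
  have "f \<in> Arr T \<and> F f = F' f" using f
  proof (induction rule: gen_by.induct)
    case (base f)
    then show ?case using B by blast
  next
    case (comp f g)
    then show ?case using F.F_comp [of f g] F'.F_comp [of f g] by simp
  next
    case (tens f g)
    then show ?case using F.F_tens [of f g] F'.F_tens [of f g] by simp
  qed (use F.F_ide [of 0] F'.F_ide [of 0] F.F_ide [of 1] F'.F_ide [of 1] in simp_all)
  then show ?thesis by blast
qed

text \<open>The comonoid is a monoid in the opposite PROP. Composition is reversed there, so the
  action is read through \<open>inv\<close> to remain a left action. The four equations are those
  that the squares of \<open>mul 2\<close> and \<open>mul 0\<close> impose.\<close>

locale G_bialgebra = G_monoid E G mu eta act
  for E :: "(nat, 'e, 'z) smc_scheme" (structure) and G :: "('g, 'y) monoid_scheme"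
    and mu eta :: 'e and act :: "'g \<Rightarrow> 'e" +
  fixes delta eps :: 'e
  assumes comonoid: "G_monoid (opp E) G delta eps (\<lambda>g. act (inv\<^bsub>G\<^esub> g))"
    and delta_mu: "delta \<cdot> mu = (mu \<odot> mu) \<cdot> ((Ide E 1 \<odot> Sym E 1 1 \<odot> Ide E 1) \<cdot> (delta \<odot> delta))"
    and eps_mu: "eps \<cdot> mu = eps \<odot> eps"
    and delta_eta: "delta \<cdot> eta = eta \<odot> eta"
    and eps_eta: "eps \<cdot> eta = Ide E 0"
begin

interpretation C: G_monoid "opp E" G delta eps "\<lambda>g. act (inv\<^bsub>G\<^esub> g)" by (rule comonoid)

text \<open>Evaluation in \<open>opp E\<close>, hence contravariant when read in \<open>E\<close>;
  it interprets the left legs of spans.\<close>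

definition W :: "'g qarr \<Rightarrow> 'e" where "W = C.N"

lemma co_in [simp]: "delta \<in> Arr E" "Dom E delta = 1" "Cod E delta = 2" "eps \<in> Arr E" "Dom E eps = 1" "Cod E eps = 0"
  using C.mu_in C.eta_in by simp_all

lemma W_in [simp]: "f \<in> Arr (QPROP G) \<Longrightarrow> W f \<in> Arr E"
  "f \<in> Arr (QPROP G) \<Longrightarrow> Dom E (W f) = qcod f" "f \<in> Arr (QPROP G) \<Longrightarrow> Cod E (W f) = qdom f"
  using C.N_in [of f] by (simp_all add: W_def)

lemma W_ide [simp]: "W (qide G n) = Ide E n"
  using C.N_ide by (simp add: W_def)

lemma W_comp: "\<lbrakk>f \<in> Arr (QPROP G); g \<in> Arr (QPROP G); qcod f = qdom g\<rbrakk> \<Longrightarrow> W (qcomp G g f) = W f \<cdot> W g"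
  using C.N_comp [of f g] by (simp add: W_def)

lemma W_tens: "\<lbrakk>f \<in> Arr (QPROP G); g \<in> Arr (QPROP G)\<rbrakk> \<Longrightarrow> W (qtens f g) = W f \<odot> W g"
  using C.N_tens [of f g] by (simp add: W_def)

lemma W_gens: "W (G.mul 2) = delta" "W (G.mul 0) = eps" "W (Sym (QPROP G) 1 1) = Sym E 1 1"
  "g \<in> carrier G \<Longrightarrow> W (lab g) = act (inv\<^bsub>G\<^esub> g)"
  using C.N_gens by (simp_all add: W_def)

lemmas N_ide' [simp] = N_ide

text \<open>Isomorphisms are generated by the symmetry and the labels. On these the two evaluations
  are inverse: the symmetry is an involution, and a label acts by \<open>g\<close> in the one and by
  its inverse in the other.\<close>

lemma N_W_inverse:
  assumes h: "is_iso (QPROP G) h"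
  shows "inverse_arrows E (N h) (W h)"
proof -
  have "qdom h = qcod h" using bij_betw_same_card [OF G.Q_iso_facts(2) [OF h]] by simp
  then have "gen_by (QPROP G) G.Igens h" using G.gen_iso [OF h] by simp
  then have "h \<in> Arr (QPROP G) \<and> inverse_arrows E (N h) (W h)"
  proof (induction rule: gen_by.induct)
    case (base h)
    then consider "h = Sym (QPROP G) 1 1" | g where "g \<in> carrier G" "h = lab g" by (auto simp: G.Igens_def)
    then show ?case
    proof cases
      case 1
      then show ?thesis using inverse_sym [of 1 1] by (simp add: N_gens W_gens del: One_nat_def)
    next
      case (2 g)
      have "inverse_arrows E (act g) (act (inv\<^bsub>G\<^esub> g))"
        using 2(1) act_mult [of g "inv\<^bsub>G\<^esub> g"] act_mult [of "inv\<^bsub>G\<^esub> g" g] by (simp add: inverse_arrows_iff)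
      then show ?thesis using 2 by (simp add: N_gens W_gens del: One_nat_def)
    qed
  next
    case (comp f g)
    then show ?case using inverse_arrows_comp [of "N f" "W f" "N g" "W g"] by (simp add: N_comp W_comp)
  next
    case (tens f g)
    then show ?case using inverse_arrows_tens [of "N f" "W f" "N g" "W g"] by (simp add: N_tens W_tens)
  qed (use inverse_arrows_ide [of 0] inverse_arrows_ide [of 1] in simp_all)
  then show ?thesis by blast
qed

lemma N_W_cancel:
  assumes h: "is_iso (QPROP G) h"
  shows "N h \<cdot> W h = Ide E (qcod h)" "W h \<cdot> N h = Ide E (qdom h)"
  using N_W_inverse [OF h] G.Q_iso_facts(1) [OF h] by (simp_all add: inverse_arrows_iff)

text \<open>By uniqueness of inverses, the inverse of \<open>h\<close> evaluated forwards must be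
  \<open>h\<close> evaluated backwards.\<close>

lemma N_inverse:
  assumes h: "inverse_arrows (QPROP G) h h'"
  shows "N h' = W h" "W h' = N h"
proof -
  have a: "h \<in> Arr (QPROP G)" "h' \<in> Arr (QPROP G)" "qdom h' = qcod h" "qcod h' = qdom h"
      "qcomp G h' h = qide G (qdom h)" "qcomp G h h' = qide G (qcod h)"
    using h by (simp_all add: G.Q_inverse_iff)
  have "inverse_arrows E (N h) (N h')"
    using a N_comp [of h h'] N_comp [of h' h] by (simp add: inverse_arrows_iff)
  then show 1: "N h' = W h" using N_W_inverse [OF G.Q.is_isoI [OF h]] by (rule inverse_arrows_unique)
  have "inverse_arrows E (W h) (W h')"
    using a W_comp [of h h'] W_comp [of h' h] by (simp add: inverse_arrows_iff)
  then show "W h' = N h" using inverse_arrows_sym [OF N_W_inverse [OF G.Q.is_isoI [OF h]]] by (rule inverse_arrows_unique)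
qed

text \<open>The law for the two evaluations. Under \<open>PB_induct\<close> pasting of squares
  becomes chaining of equations, and the four generating squares become the bialgebra
  axioms.\<close>

lemma W_N: "G.PB b c x y \<Longrightarrow> W c \<cdot> N b = N y \<cdot> W x"
proof (induct rule: G.PB_induct)
  case (equiv b c x y x' y')
  note P = G.PB_facts(1-8) [OF equiv(1)] and P' = G.PB_facts(1-8) [OF equiv(3)]
  \<comment> \<open>Another square over the same cospan differs by an isomorphism of the apex, which
    cancels between \<open>N\<close> and \<open>W\<close>.\<close>
  obtain h where h: "is_iso (QPROP G) h" "qdom h = qdom x" "qcod h = qdom x'" "x = qcomp G x' h" "y = qcomp G y' h"
    using G.PB_unique [OF equiv(1,3)] by (auto simp: G.Q.span_rel_iff)
  have hA: "h \<in> Arr (QPROP G)" using G.Q_iso_facts(1) [OF h(1)] .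
  have "N y \<cdot> W x = (N y' \<cdot> N h) \<cdot> (W h \<cdot> W x')" using hA P' h(3) by (simp add: h(4,5) N_comp W_comp)
  also have "\<dots> = N y' \<cdot> ((N h \<cdot> W h) \<cdot> W x')" using hA P' h(3) by (simp add: assoc_arr)
  also have "\<dots> = N y' \<cdot> W x'" using P' h(3) by (simp add: N_W_cancel [OF h(1)])
  finally show ?case using equiv(2) by simp
next
  case (iso b c x y g g' h h')
  note P = G.PB_facts(1-8) [OF iso(1)]
  have a: "g \<in> Arr (QPROP G)" "g' \<in> Arr (QPROP G)" "qdom g' = qcod g" "qcod g' = qdom g"
    "h \<in> Arr (QPROP G)" "h' \<in> Arr (QPROP G)" "qdom h' = qcod h" "qcod h' = qdom h"
    using iso(3,4) by (simp_all add: G.Q_inverse_iff)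
  have "W (qcomp G c h) \<cdot> N (qcomp G b g) = W h \<cdot> ((W c \<cdot> N b) \<cdot> N g)"
    using P a iso(5,6) by (simp add: W_comp N_comp assoc_arr)
  also have "\<dots> = (W h \<cdot> N y) \<cdot> (W x \<cdot> N g)" using P a iso(5,6) by (simp add: iso(2) assoc_arr)
  also have "\<dots> = N (qcomp G h' y) \<cdot> W (qcomp G g' x)"
    using P a iso(5,6) by (simp add: W_comp N_comp N_inverse(1) [OF iso(4)] N_inverse(2) [OF iso(3)])
  finally show ?case .
next
  case (comp_left b c x y f z w)
  note P = G.PB_facts(1-8) [OF comp_left(1)] and P' = G.PB_facts(1-8) [OF comp_left(3)]
  have "W c \<cdot> N (qcomp G b f) = (W c \<cdot> N b) \<cdot> N f" using P P' by (simp add: N_comp assoc_arr)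
  also have "\<dots> = N y \<cdot> (W x \<cdot> N f)" using P P' by (simp add: comp_left(2) assoc_arr)
  also have "\<dots> = N (qcomp G y w) \<cdot> W z" using P P' by (simp add: comp_left(4) N_comp assoc_arr)
  finally show ?case .
next
  case (comp_right b c x y h z w)
  note P = G.PB_facts(1-8) [OF comp_right(1)] and P' = G.PB_facts(1-8) [OF comp_right(3)]
  have "W (qcomp G c h) \<cdot> N b = W h \<cdot> (W c \<cdot> N b)" using P P' by (simp add: W_comp assoc_arr)
  also have "\<dots> = (W h \<cdot> N y) \<cdot> W x" using P P' by (simp add: comp_right(2) assoc_arr)
  also have "\<dots> = N w \<cdot> W (qcomp G x z)" using P P' by (simp add: comp_right(4) W_comp assoc_arr)
  finally show ?case .
next
  case (tens b c x y b' c' x' y')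
  note P = G.PB_facts(1-8) [OF tens(1)] and P' = G.PB_facts(1-8) [OF tens(3)]
  show ?case using P P' by (simp add: N_tens W_tens interchange tens(2,4))
next
  case mm
  have s: "sigma23 G \<in> Arr (QPROP G)" "qdom (sigma23 G) = 4" "qcod (sigma23 G) = 4" by (simp_all add: sigma23_def)
  have "W (sigma23 G) = Ide E 1 \<odot> Sym E 1 1 \<odot> Ide E 1"
    unfolding sigma23_def by (simp add: W_tens W_gens [unfolded One_nat_def])
  \<comment> \<open>\<open>W\<close> reverses composition, so the middle exchange comes after both
    comultiplications, as in \<open>delta_mu\<close>.\<close>
  then have "W (qcomp G (qtens (G.mul 2) (G.mul 2)) (sigma23 G)) = (Ide E 1 \<odot> Sym E 1 1 \<odot> Ide E 1) \<cdot> (delta \<odot> delta)"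
    using s by (simp add: W_comp W_tens W_gens)
  then show ?case using delta_mu by (simp add: N_tens N_gens W_gens)
next
  case uu
  show ?case using eps_eta by (simp add: N_gens W_gens)
next
  case mu
  show ?case using eps_mu by (simp add: W_tens N_gens W_gens)
next
  case um
  show ?case using delta_eta by (simp add: N_tens N_gens W_gens)
qed simp_all

text \<open>A representative of the class is picked by \<open>SOME\<close>; \<open>FT_class\<close>
  shows that the value does not depend on it.\<close>

definition FT :: "('g qarr \<times> 'g qarr) set \<Rightarrow> 'e" where
  "FT X = (let s = SOME s. s \<in> X in N (snd s) \<cdot> W (fst s))"

lemma FT_class:
  assumes s: "(a, b) \<in> spans (QPROP G)"
  shows "FT (span_class (QPROP G) a b) = N b \<cdot> W a"
proof -
  obtain a' b' where e: "(SOME s. s \<in> span_class (QPROP G) a b) = (a', b')" by (meson surj_pair)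
  have "(SOME s. s \<in> span_class (QPROP G) a b) \<in> span_class (QPROP G) a b"
    by (rule someI [of _ "(a, b)"]) (rule G.Q.span_class_self [OF s])
  then obtain h where h: "is_iso (QPROP G) h" "qdom h = qdom a" "qcod h = qdom a'" "a = qcomp G a' h" "b = qcomp G b' h"
      "(a', b') \<in> spans (QPROP G)"
    unfolding e by (auto simp: G.Q.span_rel_iff)
  have A: "h \<in> Arr (QPROP G)" "a' \<in> Arr (QPROP G)" "b' \<in> Arr (QPROP G)" "qdom b' = qdom a'"
    using G.Q_iso_facts(1) [OF h(1)] h(6) by (simp_all add: G.Q.spans_iff)
  have "N b \<cdot> W a = (N b' \<cdot> N h) \<cdot> (W h \<cdot> W a')" using A h(3) by (simp add: h(4,5) N_comp W_comp)
  also have "\<dots> = N b' \<cdot> ((N h \<cdot> W h) \<cdot> W a')" using A h(3) by (simp add: assoc_arr)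
  also have "\<dots> = N b' \<cdot> W a'" using A h(3) by (simp add: N_W_cancel [OF h(1)])
  finally show ?thesis unfolding FT_def e Let_def by simp
qed

lemma FT_embed: "f \<in> Arr (QPROP G) \<Longrightarrow> FT (span_embed (QPROP G) f) = N f"
  and FT_coembed: "f \<in> Arr (QPROP G) \<Longrightarrow> FT (G.T.coembed f) = W f"
  unfolding span_embed_def G.T.coembed_def by (simp_all add: FT_class G.Q.spans_iff)

text \<open>Only the composition rule involves the law, through \<open>W_N\<close>; identities and
  tensor products are computed leg by leg.\<close>

lemma FT_morphism: "PROP_morphism (GBimon_PROP G) E FT"
proof -
  let ?T = "GBimon_PROP G"
  interpret T: is_PROP "GBimon_PROP G" by (rule G.GBimon_PROP_is_PROP)
  have ex: "\<exists>a b. X = span_class (QPROP G) a b \<and> (a, b) \<in> spans (QPROP G) \<and> a \<in> Arr (QPROP G) \<and> b \<in> Arr (QPROP G) \<and> qdom b = qdom a \<and>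
      Dom ?T X = qcod a \<and> Cod ?T X = qcod b" if "X \<in> Arr ?T" for X
  proof -
    have "X \<in> spans (QPROP G) // span_rel (QPROP G)" using that by (simp add: GBimon_PROP_def)
    then obtain a b where ab: "(a, b) \<in> spans (QPROP G)" "X = span_class (QPROP G) a b" by (rule G.Q.spans_quotientE)
    then show ?thesis using G.T.composite_dom [OF ab(1)] by (intro exI [of _ a] exI [of _ b]) (simp add: GBimon_PROP_def G.Q.spans_iff)
  qed
  show ?thesis
  proof unfold_locales
    fix X assume "X \<in> Arr ?T"
    from ex [OF this] show "FT X \<in> Arr E" "Dom E (FT X) = Dom ?T X" "Cod E (FT X) = Cod ?T X"
      by (auto simp: FT_class)
  next
    fix n show "FT (Ide ?T n) = Ide E n"
      by (simp add: GBimon_PROP_def FT_class G.Q.spans_iff)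
  next
    fix X Y assume X: "X \<in> Arr ?T" and Y: "Y \<in> Arr ?T" and e: "Cod ?T X = Dom ?T Y"
    obtain a b where a: "X = span_class (QPROP G) a b" "(a, b) \<in> spans (QPROP G)" "a \<in> Arr (QPROP G)" "b \<in> Arr (QPROP G)"
        "qdom b = qdom a" "Cod ?T X = qcod b" using ex [OF X] by blast
    obtain c d where c: "Y = span_class (QPROP G) c d" "(c, d) \<in> spans (QPROP G)" "c \<in> Arr (QPROP G)" "d \<in> Arr (QPROP G)"
        "qdom d = qdom c" "Dom ?T Y = qcod c" using ex [OF Y] by blast
    have bc: "qcod b = qcod c" using a(6) c(6) e by simp
    obtain x y where p: "G.PB b c x y" using G.PB_exists [OF a(4) c(3) bc] .
    note P = G.PB_facts(1-8) [OF p]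
    have "Comp ?T Y X = span_class (QPROP G) (qcomp G a x) (qcomp G d y)"
      using G.T.composite_comp [OF a(2) c(2)] p by (simp add: a(1) c(1) GBimon_PROP_def G.T_L_iff)
    then have "FT (Comp ?T Y X) = N (qcomp G d y) \<cdot> W (qcomp G a x)"
      using a c P by (simp add: FT_class G.Q.spans_iff)
    also have "\<dots> = (N d \<cdot> N y) \<cdot> (W x \<cdot> W a)" using a(3-5) c(3-5) P by (simp add: N_comp W_comp)
    also have "\<dots> = N d \<cdot> ((N y \<cdot> W x) \<cdot> W a)" using a(3-5) c(3-5) P by (simp add: assoc_arr)
    also have "\<dots> = N d \<cdot> ((W c \<cdot> N b) \<cdot> W a)" by (simp only: W_N [OF p])
    also have "\<dots> = (N d \<cdot> W c) \<cdot> (N b \<cdot> W a)" using a(3-5) c(3-5) bc by (simp add: assoc_arr)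
    finally show "FT (Comp ?T Y X) = FT Y \<cdot> FT X" using a(1,2) c(1,2) by (simp add: FT_class)
  next
    fix X Y assume X: "X \<in> Arr ?T" and Y: "Y \<in> Arr ?T"
    obtain a b where a: "X = span_class (QPROP G) a b" "(a, b) \<in> spans (QPROP G)" "a \<in> Arr (QPROP G)" "b \<in> Arr (QPROP G)"
        "qdom b = qdom a" using ex [OF X] by blast
    obtain c d where c: "Y = span_class (QPROP G) c d" "(c, d) \<in> spans (QPROP G)" "c \<in> Arr (QPROP G)" "d \<in> Arr (QPROP G)"
        "qdom d = qdom c" using ex [OF Y] by blast
    have "TensA ?T X Y = span_class (QPROP G) (qtens a c) (qtens b d)"
      using G.T.composite_tens [OF a(2) c(2)] by (simp add: a(1) c(1) GBimon_PROP_def)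
    then have "FT (TensA ?T X Y) = (N b \<odot> N d) \<cdot> (W a \<odot> W c)"
      using a(3-5) c(3-5) by (simp add: FT_class G.Q.spans_iff N_tens W_tens)
    also have "\<dots> = FT X \<odot> FT Y" using a c by (simp add: FT_class interchange)
    finally show "FT (TensA ?T X Y) = FT X \<odot> FT Y" .
  next
    have "Sym ?T 1 1 = span_embed (QPROP G) (Sym (QPROP G) 1 1)" by (simp add: GBimon_PROP_def composite_def)
    then show "FT (Sym ?T 1 1) = Sym E 1 1" using FT_embed [of "Sym (QPROP G) 1 1"] N_gens(3) by simp
  qed
qed

end

text \<open>The forward copy of \<open>Q\<close> yields the monoid and its action, the backward copy
  a monoid in \<open>opp E\<close>, and the mixed axioms are the equations
  \<open>coembed_embed\<close> for the four generating squares.\<close>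

lemma G_bialgebra_of_morphism:
  assumes G: "group G" and F: "PROP_morphism (GBimon_PROP G) E F"
  shows "G_bialgebra E G (F (span_embed (QPROP G) (group.mul G 2))) (F (span_embed (QPROP G) (group.mul G 0)))
    (\<lambda>g. F (span_embed (QPROP G) (lab g)))
    (F (distributive_law.coembed (QPROP G) (group.mul G 2))) (F (distributive_law.coembed (QPROP G) (group.mul G 0)))"
proof -
  let ?T = "GBimon_PROP G"
  interpret G: group G by (rule G)
  interpret F: PROP_morphism "GBimon_PROP G" E F by (rule F)
  let ?e = "span_embed (QPROP G)" and ?c = "G.T.coembed"
  note T = GBimon_PROP_def
  have arr: "?e f \<in> Arr ?T" "Dom ?T (?e f) = qdom f" "Cod ?T (?e f) = qcod f"
    "?c f \<in> Arr ?T" "Dom ?T (?c f) = qcod f" "Cod ?T (?c f) = qdom f"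
    if "f \<in> Arr (QPROP G)" for f
    using that G.T.composite_dom [of f "qide G (qdom f)"] by (simp_all add: T G.T.coembed_def G.Q.spans_iff)
  have ide: "?e (qide G n) = Ide ?T n" "?c (qide G n) = Ide ?T n" for n
    by (simp_all add: T span_embed_def G.T.coembed_def)
  have sym: "?e (Sym (QPROP G) 1 1) = Sym ?T 1 1" "?c (Sym (QPROP G) 1 1) = Sym ?T 1 1"
    using G.coembed_sym [of 1 1] by (simp_all add: T composite_def)
  have comp: "?e (qcomp G g f) = Comp ?T (?e g) (?e f)" "?c (qcomp G g f) = Comp ?T (?c f) (?c g)"
    if "f \<in> Arr (QPROP G)" "g \<in> Arr (QPROP G)" "qcod f = qdom g" for f g
    using that G.T.embed_comp [of f g] G.T.coembed_comp' [of f g] by (simp_all add: T)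
  have tens: "?e (qtens f g) = TensA ?T (?e f) (?e g)" "?c (qtens f g) = TensA ?T (?c f) (?c g)"
    if "f \<in> Arr (QPROP G)" "g \<in> Arr (QPROP G)" for f g
    using that G.T.embed_tens [of f g] G.T.coembed_tens [of f g] by (simp_all add: T)
  have swap: "F (?c c) \<cdot>\<^bsub>E\<^esub> F (?e b) = F (?e y) \<cdot>\<^bsub>E\<^esub> F (?c x)" if p: "G.PB b c x y" for b c x y
  proof -
    note P = G.PB_facts(1-8) [OF p]
    have "Comp ?T (?c c) (?e b) = Comp ?T (?e y) (?c x)"
      using G.T.coembed_embed [of b c x y] p by (simp add: T G.T_L_iff)
    then show ?thesis using P F.F_comp [of "?e b" "?c c"] F.F_comp [of "?c x" "?e y"] by (simp add: arr)
  qed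
  have Fc: "F (?c (qcomp G g f)) = F (?c f) \<cdot>\<^bsub>E\<^esub> F (?c g)" if "f \<in> Arr (QPROP G)" "g \<in> Arr (QPROP G)" "qcod f = qdom g" for f g
    using comp(2) [OF that] F.F_comp [of "?c g" "?c f"] that by (simp add: arr)
  have Ft: "F (?c (qtens f g)) = F (?c f) \<odot>\<^bsub>E\<^esub> F (?c g)" "F (?e (qtens f g)) = F (?e f) \<odot>\<^bsub>E\<^esub> F (?e g)"
    if "f \<in> Arr (QPROP G)" "g \<in> Arr (QPROP G)" for f g
    using tens [OF that] F.F_tens [of "?c f" "?c g"] F.F_tens [of "?e f" "?e g"] that by (simp_all add: arr)
  have e: "PROP_morphism (QPROP G) E (\<lambda>f. F (?e f))"
    by (intro PROP_morphism.intro PROP_morphism_axioms.intro G.Q.is_PROP_axioms F.E.is_PROP_axioms)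
      (use F.F_comp Ft(2) F.F_sym1 sym(1) in \<open>simp_all add: arr ide comp\<close>)
  have c: "PROP_morphism (QPROP G) (opp E) (\<lambda>f. F (?c f))"
    by (intro PROP_morphism.intro PROP_morphism_axioms.intro G.Q.is_PROP_axioms F.E.opp_is_PROP)
      (use Fc Ft(1) F.F_sym1 sym(2) in \<open>simp_all add: arr ide\<close>)
  have s: "sigma23 G \<in> Arr (QPROP G)" "qdom (sigma23 G) = 4" "qcod (sigma23 G) = 4" by (simp_all add: sigma23_def)
  have cs: "F (?c (sigma23 G)) = Ide E 1 \<odot>\<^bsub>E\<^esub> Sym E 1 1 \<odot>\<^bsub>E\<^esub> Ide E 1"
    using F.F_sym1 sym(2) unfolding sigma23_def by (simp add: Ft ide)
  show ?thesis
  proof (intro G_bialgebra.intro G_bialgebra_axioms.intro)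
    show "G_monoid E G (F (?e (G.mul 2))) (F (?e (G.mul 0))) (\<lambda>g. F (?e (lab g)))"
      by (rule G_monoid_of_morphism [OF G e])
    show "G_monoid (opp E) G (F (?c (G.mul 2))) (F (?c (G.mul 0))) (\<lambda>g. F (?e (lab (inv\<^bsub>G\<^esub> g))))"
      by (rule G_monoid_cong [OF G_monoid_of_morphism [OF G c]]) (simp add: G.coembed_lab)
    show "F (?c (G.mul 2)) \<cdot>\<^bsub>E\<^esub> F (?e (G.mul 2)) = (F (?e (G.mul 2)) \<odot>\<^bsub>E\<^esub> F (?e (G.mul 2))) \<cdot>\<^bsub>E\<^esub>
        ((Ide E 1 \<odot>\<^bsub>E\<^esub> Sym E 1 1 \<odot>\<^bsub>E\<^esub> Ide E 1) \<cdot>\<^bsub>E\<^esub> (F (?c (G.mul 2)) \<odot>\<^bsub>E\<^esub> F (?c (G.mul 2))))"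
      using swap [OF G.PB_mul_2_2] s cs by (simp add: Fc Ft)
    show "F (?c (G.mul 0)) \<cdot>\<^bsub>E\<^esub> F (?e (G.mul 2)) = F (?c (G.mul 0)) \<odot>\<^bsub>E\<^esub> F (?c (G.mul 0))"
      using swap [OF G.PB_mul_0(2)] by (simp add: Ft ide arr)
    show "F (?c (G.mul 2)) \<cdot>\<^bsub>E\<^esub> F (?e (G.mul 0)) = F (?e (G.mul 0)) \<odot>\<^bsub>E\<^esub> F (?e (G.mul 0))"
      using swap [OF G.PB_mul_0(3)] by (simp add: Ft ide arr)
    show "F (?c (G.mul 0)) \<cdot>\<^bsub>E\<^esub> F (?e (G.mul 0)) = Ide E 0"
      using swap [OF G.PB_mul_0(1)] by (simp add: ide)
  qed
qed

section \<open>Isomorphisms of categories, functor categories\<close>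

text \<open>A functor that is bijective on objects and arrows has a strict inverse, so identities
  serve as components of both natural isomorphisms.\<close>

lemma equivalent_categoriesI:
  assumes F: "cat_functor C D F" and o: "bij_betw (FO F) (Obj C) (Obj D)" and a: "bij_betw (FA F) (Arr C) (Arr D)"
  shows "equivalent_categories C D"
proof -
  interpret F: cat_functor C D F by (rule F)
  let ?o = "inv_into (Obj C) (FO F)" and ?a = "inv_into (Arr C) (FA F)"
  let ?H = "\<lparr>FO = ?o, FA = ?a\<rparr>"
  have oin: "?o Y \<in> Obj C" "FO F (?o Y) = Y" if "Y \<in> Obj D" for Y
    using that o by (simp_all add: bij_betw_def inv_into_into f_inv_into_f)
  have ain: "?a g \<in> Arr C" "FA F (?a g) = g" if "g \<in> Arr D" for g
    using that a by (simp_all add: bij_betw_def inv_into_into f_inv_into_f)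
  have oi: "?o (FO F X) = X" if "X \<in> Obj C" for X using that o by (simp add: bij_betw_def)
  have ai: "?a (FA F f) = f" if "f \<in> Arr C" for f using that a by (simp add: bij_betw_def)
  have Fin: "FA F f \<in> Arr D" "Dom D (FA F f) = FO F (Dom C f)" "Cod D (FA F f) = FO F (Cod C f)" if "f \<in> Arr C" for f
    using F.map_hom [of f "Dom C f" "Cod C f"] that by (simp_all add: Hom_iff)
  have Fc: "Comp D (FA F g) (FA F f) = FA F (Comp C g f)" if "f \<in> Arr C" "g \<in> Arr C" "Cod C f = Dom C g" for f g
    using F.map_comp [of f "Dom C f" "Cod C f" g "Cod C g"] that by (simp add: Hom_iff)
  have Hin: "?a g \<in> Arr C" "Dom C (?a g) = ?o (Dom D g)" "Cod C (?a g) = ?o (Cod D g)" if "g \<in> Arr D" for g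
  proof -
    show A: "?a g \<in> Arr C" using ain that by blast
    show "Dom C (?a g) = ?o (Dom D g)" "Cod C (?a g) = ?o (Cod D g)"
      using oi [OF F.source.dom_obj [OF A]] oi [OF F.source.cod_obj [OF A]] Fin [OF A] ain(2) [OF that] by simp_all
  qed
  have H: "cat_functor D C ?H"
  proof unfold_locales
    show "FA ?H (Ide D Y) = Ide C (FO ?H Y)" if Y: "Y \<in> Obj D" for Y
      using ai [of "Ide C (?o Y)"] F.map_ide [OF oin(1) [OF Y]] oin [OF Y] by simp
    show "FA ?H (Comp D g f) = Comp C (FA ?H g) (FA ?H f)" if f: "f \<in> Hom D X Y" and g: "g \<in> Hom D Y Z" for f g X Y Z
    proof -
      have fg: "f \<in> Arr D" "g \<in> Arr D" "Cod D f = Dom D g" using f g by (simp_all add: Hom_iff)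
      have "FA F (Comp C (?a g) (?a f)) = Comp D (FA F (?a g)) (FA F (?a f))"
        by (rule F.map_comp [of _ "?o X" "?o Y" _ "?o Z"]) (use f g Hin fg in \<open>simp_all add: Hom_iff\<close>)
      then have "FA F (Comp C (?a g) (?a f)) = Comp D g f" using ain fg by simp
      then show ?thesis using ai [of "Comp C (?a g) (?a f)"] Hin fg by simp
    qed
  qed (use oin Hin in \<open>simp_all add: Hom_iff\<close>)
  have 1: "nat_trans C C id_fun (comp_fun ?H F) (Ide C)"
  proof (intro nat_trans.intro nat_trans_axioms.intro)
    show i: "cat_functor C C id_fun" by unfold_locales (simp_all add: id_fun_def)
    show c: "cat_functor C C (comp_fun ?H F)"
      by unfold_locales (auto simp: comp_fun_def oi ai Fin Hom_iff Fc F.source.dom_obj F.source.cod_obj)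
    show "Ide C X \<in> Hom C (FO id_fun X) (FO (comp_fun ?H F) X)" if "X \<in> Obj C" for X
      using that by (simp add: id_fun_def comp_fun_def oi Hom_iff)
    show "Comp C (Ide C Y) (FA id_fun f) = Comp C (FA (comp_fun ?H F) f) (Ide C X)" if "f \<in> Hom C X Y" for f X Y
      using that by (simp add: id_fun_def comp_fun_def ai Hom_iff)
  qed
  have 2: "nat_trans D D (comp_fun F ?H) id_fun (Ide D)"
  proof (intro nat_trans.intro nat_trans_axioms.intro)
    interpret H: cat_functor D C ?H by (rule H)
    show i: "cat_functor D D id_fun" by unfold_locales (simp_all add: id_fun_def)
    show c: "cat_functor D D (comp_fun F ?H)"
      by unfold_locales (auto simp: comp_fun_def oin ain Hom_iff F.target.dom_obj F.target.cod_obj)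
    show "Ide D X \<in> Hom D (FO (comp_fun F ?H) X) (FO id_fun X)" if "X \<in> Obj D" for X
      using that by (simp add: id_fun_def comp_fun_def oin Hom_iff)
    show "Comp D (Ide D Y) (FA (comp_fun F ?H) f) = Comp D (FA id_fun f) (Ide D X)" if "f \<in> Hom D X Y" for f X Y
      using that by (simp add: id_fun_def comp_fun_def ain Hom_iff)
  qed
  show ?thesis unfolding equivalent_categories_def naturally_isomorphic_def
    using F H 1 2 F.source.is_iso_ide F.target.is_iso_ide by blast
qed

section \<open>Functor categories\<close>

lemma nat_trans_ide:
  assumes "cat_functor C D F"
  shows "nat_trans C D F F (restrict (\<lambda>X. Ide D (FO F X)) (Obj C))"
proof -
  interpret F: cat_functor C D F by (rule assms)
  show ?thesis
  proof unfold_locales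
    show "restrict (\<lambda>X. Ide D (FO F X)) (Obj C) X \<in> Hom D (FO F X) (FO F X)" if "X \<in> Obj C" for X
      using F.target.ide_hom [OF F.map_obj [OF that]] that by simp
    show "Comp D (restrict (\<lambda>X. Ide D (FO F X)) (Obj C) Y) (FA F f) = Comp D (FA F f) (restrict (\<lambda>X. Ide D (FO F X)) (Obj C) X)"
      if "f \<in> Hom C X Y" for f X Y
      using F.map_hom [OF that] that F.source.dom_obj [of f] F.source.cod_obj [of f] by (auto simp: Hom_iff)
  qed
qed

lemma nat_trans_comp:
  assumes s: "nat_trans C D F H s" and t: "nat_trans C D H K t"
  shows "nat_trans C D F K (restrict (\<lambda>X. Comp D (t X) (s X)) (Obj C))"
proof -
  interpret s: nat_trans C D F H s by (rule s)
  interpret t: nat_trans C D H K t by (rule t)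
  show ?thesis
  proof unfold_locales
    show "restrict (\<lambda>X. Comp D (t X) (s X)) (Obj C) X \<in> Hom D (FO F X) (FO K X)" if "X \<in> Obj C" for X
      using s.dom_functor.target.comp_hom [OF s.component_hom [OF that] t.component_hom [OF that]] that by simp
    show "Comp D (restrict (\<lambda>X. Comp D (t X) (s X)) (Obj C) Y) (FA F f) = Comp D (FA K f) (restrict (\<lambda>X. Comp D (t X) (s X)) (Obj C) X)"
      if f: "f \<in> Hom C X Y" for f X Y
    proof -
      have o: "X \<in> Obj C" "Y \<in> Obj C"
        using f s.dom_functor.source.dom_obj [of f] s.dom_functor.source.cod_obj [of f] by (auto simp: Hom_iff)
      note a = s.dom_functor.target.comp_assoc
      have "Comp D (Comp D (t Y) (s Y)) (FA F f) = Comp D (t Y) (Comp D (FA H f) (s X))"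
        by (subst a [OF s.dom_functor.map_hom [OF f] s.component_hom [OF o(2)] t.component_hom [OF o(2)]])
          (simp only: s.naturality [OF f])
      also have "\<dots> = Comp D (Comp D (FA K f) (t X)) (s X)"
        by (subst a [OF s.component_hom [OF o(1)] s.cod_functor.map_hom [OF f] t.component_hom [OF o(2)], symmetric])
          (simp only: t.naturality [OF f])
      also have "\<dots> = Comp D (FA K f) (Comp D (t X) (s X))"
        by (rule a [OF s.component_hom [OF o(1)] t.component_hom [OF o(1)] t.cod_functor.map_hom [OF f]])
      finally show ?thesis using o by simp
    qed
  qed
qed

lemma functor_cat_simps [simp]:
  "Obj (functor_cat C D) = functors C D" "Dom (functor_cat C D) = NDom" "Cod (functor_cat C D) = NCod"
  "t \<in> Arr (functor_cat C D) \<longleftrightarrow> NDom t \<in> functors C D \<and> NCod t \<in> functors C D \<and>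
     nat_trans C D (NDom t) (NCod t) (NMap t) \<and> NMap t \<in> extensional (Obj C)"
  "Ide (functor_cat C D) F = \<lparr>NDom = F, NCod = F, NMap = restrict (\<lambda>X. Ide D (FO F X)) (Obj C)\<rparr>"
  "Comp (functor_cat C D) t s = \<lparr>NDom = NDom s, NCod = NCod t, NMap = restrict (\<lambda>X. Comp D (NMap t X) (NMap s X)) (Obj C)\<rparr>"
  by (simp_all add: functor_cat_def)

text \<open>The laws hold pointwise in \<open>D\<close>; extensionality of the components turns them
  into equalities of transformations.\<close>

lemma functor_cat_category:
  assumes C: "category C" and D: "category D"
  shows "category (functor_cat C D)"
proof -
  let ?F = "functor_cat C D"
  interpret D: category D by (rule D)
  have c: "cat_functor C D F" if "F \<in> functors C D" for F using that by (simp add: functors_def)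
  have h: "NMap t X \<in> Hom D (FO (NDom t) X) (FO (NCod t) X)" if "t \<in> Arr ?F" "X \<in> Obj C" for t X
    using that nat_trans.component_hom by fastforce
  have ext: "restrict f A = g" if "g \<in> extensional A" "\<And>x. x \<in> A \<Longrightarrow> f x = g x" for f g :: "_ \<Rightarrow> 'd" and A
    by (rule extensionalityI [of _ A]) (use that in auto)
  show ?thesis
  proof
    show "Comp ?F g f \<in> Hom ?F F K" if "f \<in> Hom ?F F H" "g \<in> Hom ?F H K" for f g F H K
      using that nat_trans_comp [of C D F H "NMap f" K "NMap g"] by (auto simp: Hom_iff)
    show "Ide ?F F \<in> Hom ?F F F" if "F \<in> Obj ?F" for F
      using that nat_trans_ide [OF c [of F]] by (simp add: Hom_iff)
    show "Comp ?F (Comp ?F h g) f = Comp ?F h (Comp ?F g f)"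
      if a: "f \<in> Hom ?F F H" "g \<in> Hom ?F H K" "h \<in> Hom ?F K L" for f g h F H K L
    proof -
      have "Comp D (Comp D (NMap h X) (NMap g X)) (NMap f X) = Comp D (NMap h X) (Comp D (NMap g X) (NMap f X))" if X: "X \<in> Obj C" for X
        by (rule D.comp_assoc [of _ "FO F X" "FO H X" _ "FO K X" _ "FO L X"])
          (use a h [of f X] h [of g X] h [of h X] X in \<open>auto simp: Hom_iff\<close>)
      then show ?thesis by (auto intro!: restrict_ext)
    qed
    show "Comp ?F f (Ide ?F F) = f" if a: "f \<in> Hom ?F F H" for f F H
    proof -
      have "restrict (\<lambda>X. Comp D (NMap f X) (restrict (\<lambda>X. Ide D (FO F X)) (Obj C) X)) (Obj C) = NMap f"
        by (rule extensionalityI [of _ "Obj C"]) (use a h in \<open>auto simp: Hom_iff\<close>)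
      then show ?thesis using a by (cases f) (simp add: Hom_iff)
    qed
    show "Comp ?F (Ide ?F H) f = f" if a: "f \<in> Hom ?F F H" for f F H
    proof -
      have "restrict (\<lambda>X. Comp D (restrict (\<lambda>X. Ide D (FO H X)) (Obj C) X) (NMap f X)) (Obj C) = NMap f"
        by (rule extensionalityI [of _ "Obj C"]) (use a h in \<open>auto simp: Hom_iff\<close>)
      then show ?thesis using a by (cases f) (simp add: Hom_iff)
    qed
  qed simp_all
qed

lemma group_cat_simps [simp]:
  "Obj (group_cat G) = UNIV" "Arr (group_cat G) = carrier G" "Dom (group_cat G) g = ()" "Cod (group_cat G) g = ()"
  "Ide (group_cat G) x = \<one>\<^bsub>G\<^esub>" "Comp (group_cat G) g h = g \<otimes>\<^bsub>G\<^esub> h"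
  by (auto simp: group_cat_def)

lemma group_cat_category:
  assumes "group G"
  shows "category (group_cat G)"
proof -
  interpret group G by (rule assms)
  show ?thesis by unfold_locales (auto simp: Hom_iff m_assoc)
qed

section \<open>Bimonoids as bialgebras in the endomorphism PROP\<close>

lemma Bimon_simps [simp]:
  "Obj (Bimon S) = {B. bimonoid_in S B}"
  "t \<in> Arr (Bimon S) \<longleftrightarrow> bimonoid_in S (BDom t) \<and> bimonoid_in S (BCod t) \<and> is_bimonoid_map S (BDom t) (BCod t) (BMap t)"
  "Dom (Bimon S) = BDom" "Cod (Bimon S) = BCod" "Ide (Bimon S) B = \<lparr>BDom = B, BCod = B, BMap = Ide S (Carr B)\<rparr>"
  "Comp (Bimon S) t s = \<lparr>BDom = BDom s, BCod = BCod t, BMap = Comp S (BMap t) (BMap s)\<rparr>"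
  by (simp_all add: Bimon_def)

context symmetric_monoidal_category
begin

lemma bimonoid_map_ide:
  assumes "bimonoid_in S B"
  shows "is_bimonoid_map S B B (Ide S (Carr B))"
proof -
  interpret B: is_bimonoid S "Carr B" "Mult B" "Eta B" "Comult B" "Counit B" by (rule assms)
  show ?thesis
    using B.carr_obj B.mult_hom B.eta_hom B.comult_hom B.counit_hom by (simp add: is_bimonoid_map_def Hom_iff)
qed

lemma bimonoid_map_comp:
  assumes B: "bimonoid_in S B" "bimonoid_in S B'" "bimonoid_in S B''"
    and f: "is_bimonoid_map S B B' f" and g: "is_bimonoid_map S B' B'' g"
  shows "is_bimonoid_map S B B'' (g \<cdot> f)"
proof -
  interpret B: is_bimonoid S "Carr B" "Mult B" "Eta B" "Comult B" "Counit B" by (rule B)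
  interpret B': is_bimonoid S "Carr B'" "Mult B'" "Eta B'" "Comult B'" "Counit B'" by (rule B)
  interpret B'': is_bimonoid S "Carr B''" "Mult B''" "Eta B''" "Comult B''" "Counit B''" by (rule B)
  note t = B.mult_hom B.eta_hom B.comult_hom B.counit_hom B'.mult_hom B'.eta_hom B'.comult_hom B'.counit_hom
    B''.mult_hom B''.eta_hom B''.comult_hom B''.counit_hom
  have F: "f \<in> Arr S" "Dom S f = Carr B" "Cod S f = Carr B'" "f \<cdot> Mult B = Mult B' \<cdot> (f \<odot> f)" "f \<cdot> Eta B = Eta B'"
      "(f \<odot> f) \<cdot> Comult B = Comult B' \<cdot> f" "Counit B = Counit B' \<cdot> f"
    and K: "g \<in> Arr S" "Dom S g = Carr B'" "Cod S g = Carr B''" "g \<cdot> Mult B' = Mult B'' \<cdot> (g \<odot> g)" "g \<cdot> Eta B' = Eta B''"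
      "(g \<odot> g) \<cdot> Comult B' = Comult B'' \<cdot> g" "Counit B' = Counit B'' \<cdot> g"
    using f g by (simp_all add: is_bimonoid_map_def Hom_iff)
  note fg = F(1-3) K(1-3)
  have gf: "(g \<cdot> f) \<odot> (g \<cdot> f) = (g \<odot> g) \<cdot> (f \<odot> f)" using fg by (simp add: interchange)
  have "(g \<cdot> f) \<cdot> Mult B = g \<cdot> (Mult B' \<cdot> (f \<odot> f))" using fg t by (simp add: assoc_arr Hom_iff F(4))
  also have "\<dots> = (Mult B'' \<cdot> (g \<odot> g)) \<cdot> (f \<odot> f)" unfolding K(4) [symmetric] using fg t by (simp add: assoc_arr Hom_iff)
  also have "\<dots> = Mult B'' \<cdot> ((g \<cdot> f) \<odot> (g \<cdot> f))" unfolding gf using fg t by (simp add: assoc_arr Hom_iff)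
  finally have 1: "(g \<cdot> f) \<cdot> Mult B = Mult B'' \<cdot> ((g \<cdot> f) \<odot> (g \<cdot> f))" .
  have "((g \<cdot> f) \<odot> (g \<cdot> f)) \<cdot> Comult B = (g \<odot> g) \<cdot> (Comult B' \<cdot> f)"
    unfolding gf using fg t by (simp add: assoc_arr Hom_iff F(6))
  also have "\<dots> = (Comult B'' \<cdot> g) \<cdot> f" unfolding K(6) [symmetric] using fg t by (simp add: assoc_arr Hom_iff)
  also have "\<dots> = Comult B'' \<cdot> (g \<cdot> f)" using fg t by (simp add: assoc_arr Hom_iff)
  finally have 2: "((g \<cdot> f) \<odot> (g \<cdot> f)) \<cdot> Comult B = Comult B'' \<cdot> (g \<cdot> f)" .
  have 3: "(g \<cdot> f) \<cdot> Eta B = Eta B''" using fg t by (simp add: assoc_arr Hom_iff F(5) K(5))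
  have 4: "Counit B = Counit B'' \<cdot> (g \<cdot> f)" unfolding F(7) K(7) using fg t by (simp add: assoc_arr Hom_iff)
  show ?thesis unfolding is_bimonoid_map_def using 1 2 3 4 fg by (simp add: Hom_iff)
qed

lemma Bimon_category: "category (Bimon S)"
proof
  have h: "BMap t \<in> Arr S" "Dom S (BMap t) = Carr A" "Cod S (BMap t) = Carr B" if "t \<in> Hom (Bimon S) A B" for t A B
    using that by (auto simp: is_bimonoid_map_def Hom_iff)
  show "Ide (Bimon S) B \<in> Hom (Bimon S) B B" if "B \<in> Obj (Bimon S)" for B
    using that bimonoid_map_ide [of B] by (simp add: Hom_iff)
  show "Comp (Bimon S) g f \<in> Hom (Bimon S) X Z" if "f \<in> Hom (Bimon S) X Y" "g \<in> Hom (Bimon S) Y Z" for f g X Y Z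
    using that bimonoid_map_comp [of X Y Z "BMap f" "BMap g"] by (auto simp: Hom_iff)
  show "Comp (Bimon S) (Comp (Bimon S) h g) f = Comp (Bimon S) h (Comp (Bimon S) g f)"
    if "f \<in> Hom (Bimon S) W X" "g \<in> Hom (Bimon S) X Y" "h \<in> Hom (Bimon S) Y Z" for f g h W X Y Z
    using h [OF that(1)] h [OF that(2)] h [OF that(3)] by (simp add: assoc_arr)
  show "Comp (Bimon S) f (Ide (Bimon S) X) = f" if "f \<in> Hom (Bimon S) X Y" for f X Y
    using that h [OF that] by (cases f) (simp add: Hom_iff)
  show "Comp (Bimon S) (Ide (Bimon S) Y) f = f" if "f \<in> Hom (Bimon S) X Y" for f X Y
    using that h [OF that] by (cases f) (simp add: Hom_iff)
qed simp_all

lemma comp_inv_arr_iff: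
  assumes h: "is_iso S h" and f: "f \<in> Arr S" "g \<in> Arr S" "Dom S f = Dom S h" "Dom S g = Cod S h"
  shows "f \<cdot> inv_arr S h = g \<longleftrightarrow> f = g \<cdot> h"
  using inv_cancel(1,2) [OF inverse_arrows_inv_arr [OF h]] f by metis

lemma inv_arr_comp_iff:
  assumes h: "is_iso S h" and f: "f \<in> Arr S" "g \<in> Arr S" "Cod S f = Cod S h" "Cod S g = Dom S h"
  shows "g = inv_arr S h \<cdot> f \<longleftrightarrow> h \<cdot> g = f"
  using inv_cancel(3,4) [OF inverse_arrows_inv_arr [OF h]] f by metis

end

context tensor_powers
begin

lemma P_small [simp]: "P 2 = X \<boxtimes> X" "P 3 = (X \<boxtimes> X) \<boxtimes> X"
  by (simp_all add: numeral_2_eq_2 numeral_3_eq_3)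

lemma can_small [simp]:
  "can (Suc 0) (Suc 0) = Ide S (X \<boxtimes> X)" "can 2 (Suc 0) = Ide S ((X \<boxtimes> X) \<boxtimes> X)" "can 3 (Suc 0) = Ide S (((X \<boxtimes> X) \<boxtimes> X) \<boxtimes> X)"
  "can (Suc 0) 2 = ainv X X X" "can 2 2 = ainv (X \<boxtimes> X) X X"
  using can_1 [of 2] can_1 [of 3] can_Suc [of "Suc 0" "Suc 0"] can_Suc [of "Suc 0" 2]
  by (simp_all add: numeral_2_eq_2 [symmetric])

lemma inv_arr_simps [simp]:
  "A \<in> Obj S \<Longrightarrow> inv_arr S (Ide S A) = Ide S A"
  "\<lbrakk>A \<in> Obj S; B \<in> Obj S; C \<in> Obj S\<rbrakk> \<Longrightarrow> inv_arr S (ainv A B C) = Assoc S A B C"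
  using inv_arr_eq [OF inverse_arrows_ide] inv_arr_eq [OF inverse_arrows_sym [OF inverse_arrows_inv_arr [OF assoc_iso]]]
  by simp_all

lemma sy_1 [simp]: "sy (Suc 0) (Suc 0) = Sym S X X"
  by (simp add: sy_def)

text \<open>The endomorphism PROP exchanges the middle factors inside left-bracketed powers, whereas
  \<open>middle_swap\<close> passes through
  \<open>X \<boxtimes> (X \<boxtimes> (X \<boxtimes> X))\<close>. The pentagon, applied on both
  sides of the exchange, identifies the two.\<close>

lemma middle_swap_alt:
  "Assoc S (X \<boxtimes> X) X X \<cdot> (((ainv X X X \<cdot> ((Ide S X \<odot> Sym S X X) \<cdot> Assoc S X X X)) \<odot> Ide S X) \<cdot> ainv (X \<boxtimes> X) X X) = middle_swap S X"
proof -
  let ?A = "Assoc S X X (X \<boxtimes> X)" and ?B = "Assoc S (X \<boxtimes> X) X X" and ?a = "Assoc S X X X" and ?C = "Assoc S X (X \<boxtimes> X) X"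
  let ?i = "Ide S X" and ?s = "Sym S X X" and ?b = "ainv X X X"
  let ?l = "(?b \<cdot> ((?i \<odot> ?s) \<cdot> ?a)) \<odot> ?i" and ?r = "?i \<odot> (?a \<cdot> (?s \<odot> ?i) \<cdot> ?b)"
  have pent: "?A \<cdot> ?B = (?i \<odot> ?a) \<cdot> (?C \<cdot> (?a \<odot> ?i))" by (simp add: pentagon assoc_arr)
  have "(?A \<cdot> ?B) \<cdot> ?l = (?i \<odot> ?a) \<cdot> (?C \<cdot> ((?a \<odot> ?i) \<cdot> ?l))" unfolding pent by (simp add: assoc_arr)
  also have "(?a \<odot> ?i) \<cdot> ?l = ((?i \<odot> ?s) \<cdot> ?a) \<odot> ?i"
    using inv_cancel(4) [OF inverse_arrows_inv_arr [OF assoc_iso [of X X X]], of "(?i \<odot> ?s) \<cdot> ?a"] by (simp add: interchange)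
  also have "\<dots> = ((?i \<odot> ?s) \<odot> ?i) \<cdot> (?a \<odot> ?i)" by (simp add: interchange)
  also have "?C \<cdot> (((?i \<odot> ?s) \<odot> ?i) \<cdot> (?a \<odot> ?i)) = (?C \<cdot> ((?i \<odot> ?s) \<odot> ?i)) \<cdot> (?a \<odot> ?i)"
    by (rule assoc_arr [symmetric]) simp_all
  also have "?C \<cdot> ((?i \<odot> ?s) \<odot> ?i) = (?i \<odot> (?s \<odot> ?i)) \<cdot> ?C"
    using assoc_nat_arr [of ?i ?s ?i] by simp
  also have "(?i \<odot> ?a) \<cdot> (((?i \<odot> (?s \<odot> ?i)) \<cdot> ?C) \<cdot> (?a \<odot> ?i)) = ((?i \<odot> ?a) \<cdot> (?i \<odot> (?s \<odot> ?i))) \<cdot> (?C \<cdot> (?a \<odot> ?i))"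
    by (simp add: assoc_arr)
  also have "(?i \<odot> ?a) \<cdot> (?i \<odot> (?s \<odot> ?i)) = ?r \<cdot> (?i \<odot> ?a)"
    using inv_cancel(1) [OF inverse_arrows_inv_arr [OF assoc_iso [of X X X]], of "?a \<cdot> (?s \<odot> ?i)"] by (simp add: interchange assoc_arr)
  also have "(?r \<cdot> (?i \<odot> ?a)) \<cdot> (?C \<cdot> (?a \<odot> ?i)) = ?r \<cdot> (?A \<cdot> ?B)"
    unfolding pent by (rule assoc_arr) simp_all
  finally have e: "(?A \<cdot> ?B) \<cdot> ?l = ?r \<cdot> (?A \<cdot> ?B)" .
  have "?B \<cdot> ?l = (ainv X X (X \<boxtimes> X) \<cdot> ?r \<cdot> ?A) \<cdot> ?B"
  proof (rule iso_mono [OF assoc_iso [of X X "X \<boxtimes> X"]])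
    have "?A \<cdot> ((ainv X X (X \<boxtimes> X) \<cdot> ?r \<cdot> ?A) \<cdot> ?B) = (?A \<cdot> (ainv X X (X \<boxtimes> X) \<cdot> (?r \<cdot> (?A \<cdot> ?B))))"
      by (simp add: assoc_arr)
    also have "\<dots> = ?r \<cdot> (?A \<cdot> ?B)"
      by (rule inv_cancel(4) [OF inverse_arrows_inv_arr [OF assoc_iso]]) simp_all
    also have "\<dots> = ?A \<cdot> (?B \<cdot> ?l)" unfolding e [symmetric] by (rule assoc_arr) simp_all
    finally show "?A \<cdot> (?B \<cdot> ?l) = ?A \<cdot> ((ainv X X (X \<boxtimes> X) \<cdot> ?r \<cdot> ?A) \<cdot> ?B)" by (rule sym)
  qed simp_all
  then have "(?B \<cdot> ?l) \<cdot> ainv (X \<boxtimes> X) X X = ainv X X (X \<boxtimes> X) \<cdot> ?r \<cdot> ?A"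
    by (subst comp_inv_arr_iff [OF assoc_iso]) simp_all
  then show ?thesis unfolding middle_swap_def by (simp add: assoc_arr)
qed

text \<open>Translates each axiom over the endomorphism PROP into \<open>S\<close>. In these small
  arities conjugation by \<open>can\<close> leaves associators and unit maps, which are brought to
  the places where the definition of a bimonoid has them.\<close>

lemma bialgebra_iff:
  assumes G: "group G"
  shows "G_bialgebra E G (2, 1, \<mu>) (0, 1, e) (\<lambda>g. (1, 1, \<rho> g)) (1, 2, \<Delta>) (1, 0, \<epsilon>) \<longleftrightarrow>
    is_bimonoid S X \<mu> e \<Delta> \<epsilon> \<and> \<rho> \<one>\<^bsub>G\<^esub> = Ide S X \<and>
    (\<forall>g\<in>carrier G. \<forall>h\<in>carrier G. \<rho> (g \<otimes>\<^bsub>G\<^esub> h) = \<rho> g \<cdot> \<rho> h) \<and>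
    (\<forall>g\<in>carrier G. is_bimonoid_map S \<lparr>Carr = X, Mult = \<mu>, Eta = e, Comult = \<Delta>, Counit = \<epsilon>\<rparr>
      \<lparr>Carr = X, Mult = \<mu>, Eta = e, Comult = \<Delta>, Counit = \<epsilon>\<rparr> (\<rho> g))" (is "?L \<longleftrightarrow> ?R")
proof -
  interpret G: group G by (rule G)
  \<comment> \<open>Typing is common to both sides and is extracted beforehand, since the equations
    can only be simplified for arrows of known source and target.\<close>
  define ty where "ty \<longleftrightarrow> \<mu> \<in> Hom S (X \<boxtimes> X) X \<and> e \<in> Hom S (Unit S) X \<and> \<Delta> \<in> Hom S X (X \<boxtimes> X) \<and> \<epsilon> \<in> Hom S X (Unit S) \<and>
    (\<forall>g\<in>carrier G. \<rho> g \<in> Hom S X X)"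
  interpret O: is_PROP "opp E" by (rule is_PROP.opp_is_PROP [OF E_is_PROP])
  have L: ty if ?L
  proof -
    interpret G_bialgebra E G "(2, 1, \<mu>)" "(0, 1, e)" "\<lambda>g. (1, 1, \<rho> g)" "(1, 2, \<Delta>)" "(1, 0, \<epsilon>)" by (rule that)
    show ty using mu_in eta_in act_in co_in by (auto simp: ty_def Hom_iff)
  qed
  have R: ty if ?R
    using that by (auto simp: ty_def is_bimonoid_def is_bimonoid_axioms_def is_bimonoid_map_def)
  have "?L \<longleftrightarrow> ?R" if ty
  proof -
    have T: "\<mu> \<in> Arr S" "Dom S \<mu> = X \<boxtimes> X" "Cod S \<mu> = X" "e \<in> Arr S" "Dom S e = Unit S" "Cod S e = X"
      "\<Delta> \<in> Arr S" "Dom S \<Delta> = X" "Cod S \<Delta> = X \<boxtimes> X" "\<epsilon> \<in> Arr S" "Dom S \<epsilon> = X" "Cod S \<epsilon> = Unit S"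
      using that by (simp_all add: ty_def Hom_iff)
    have r: "\<rho> g \<in> Arr S" "Dom S (\<rho> g) = X" "Cod S (\<rho> g) = X" if "g \<in> carrier G" for g
      using \<open>ty\<close> that by (simp_all add: ty_def Hom_iff)
    note li = lunit_iso [OF X] and ri = runit_iso [OF X] and ui = lunit_iso [OF unit_obj]
    have inv1: "inv_arr S (LUnit S X) \<in> Arr S" "Dom S (inv_arr S (LUnit S X)) = X" "Cod S (inv_arr S (LUnit S X)) = Unit S \<boxtimes> X"
      "inv_arr S (RUnit S X) \<in> Arr S" "Dom S (inv_arr S (RUnit S X)) = X" "Cod S (inv_arr S (RUnit S X)) = X \<boxtimes> Unit S"
      "inv_arr S (LUnit S (Unit S)) \<in> Arr S" "Dom S (inv_arr S (LUnit S (Unit S))) = Unit S" "Cod S (inv_arr S (LUnit S (Unit S))) = Unit S \<boxtimes> Unit S"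
      using inverse_arrows_inv_arr [OF li] inverse_arrows_inv_arr [OF ri] inverse_arrows_inv_arr [OF ui] by (simp_all add: inverse_arrows_iff)
    have m: "G_monoid_axioms E G (2, 1, \<mu>) (0, 1, e) (\<lambda>g. (1, 1, \<rho> g)) \<longleftrightarrow>
        \<mu> \<cdot> (\<mu> \<odot> Ide S X) = \<mu> \<cdot> (Ide S X \<odot> \<mu>) \<cdot> Assoc S X X X \<and> \<mu> \<cdot> (e \<odot> Ide S X) = LUnit S X \<and> \<mu> \<cdot> (Ide S X \<odot> e) = RUnit S X \<and>
        \<rho> \<one>\<^bsub>G\<^esub> = Ide S X \<and> (\<forall>g\<in>carrier G. \<forall>h\<in>carrier G. \<rho> (g \<otimes>\<^bsub>G\<^esub> h) = \<rho> g \<cdot> \<rho> h) \<and>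
        (\<forall>g\<in>carrier G. \<rho> g \<cdot> \<mu> = \<mu> \<cdot> (\<rho> g \<odot> \<rho> g) \<and> \<rho> g \<cdot> e = e)"
    proof -
      have 1: "\<mu> \<cdot> ((e \<odot> Ide S X) \<cdot> inv_arr S (LUnit S X)) = Ide S X \<longleftrightarrow> \<mu> \<cdot> (e \<odot> Ide S X) = LUnit S X"
        using comp_inv_arr_iff [OF li, of "\<mu> \<cdot> (e \<odot> Ide S X)" "Ide S X"] T inv1 by (simp add: assoc_arr)
      have 2: "\<mu> \<cdot> ((Ide S X \<odot> e) \<cdot> inv_arr S (RUnit S X)) = Ide S X \<longleftrightarrow> \<mu> \<cdot> (Ide S X \<odot> e) = RUnit S X"
        using comp_inv_arr_iff [OF ri, of "\<mu> \<cdot> (Ide S X \<odot> e)" "Ide S X"] T inv1 by (simp add: assoc_arr)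
      show ?thesis unfolding G_monoid_axioms_def
        using T r inv1 1 2 by (auto simp: ten_def assoc_arr can_0_left)
    qed
    \<comment> \<open>That \<open>\<rho>\<close> is a homomorphism is taken from the monoid half, so
      only the coalgebra conditions remain on the right.\<close>
    have c: "G_monoid_axioms (opp E) G (1, 2, \<Delta>) (1, 0, \<epsilon>) (\<lambda>g. (1, 1, \<rho> (inv\<^bsub>G\<^esub> g))) \<longleftrightarrow>
        Assoc S X X X \<cdot> (\<Delta> \<odot> Ide S X) \<cdot> \<Delta> = (Ide S X \<odot> \<Delta>) \<cdot> \<Delta> \<and>
        LUnit S X \<cdot> (\<epsilon> \<odot> Ide S X) \<cdot> \<Delta> = Ide S X \<and> RUnit S X \<cdot> (Ide S X \<odot> \<epsilon>) \<cdot> \<Delta> = Ide S X \<and>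
        (\<forall>g\<in>carrier G. (\<rho> g \<odot> \<rho> g) \<cdot> \<Delta> = \<Delta> \<cdot> \<rho> g \<and> \<epsilon> = \<epsilon> \<cdot> \<rho> g)"
      if one: "\<rho> \<one>\<^bsub>G\<^esub> = Ide S X" and mult: "\<forall>g\<in>carrier G. \<forall>h\<in>carrier G. \<rho> (g \<otimes>\<^bsub>G\<^esub> h) = \<rho> g \<cdot> \<rho> h"
    proof -
      have 1: "(\<Delta> \<odot> Ide S X) \<cdot> \<Delta> = ainv X X X \<cdot> ((Ide S X \<odot> \<Delta>) \<cdot> \<Delta>) \<longleftrightarrow> Assoc S X X X \<cdot> ((\<Delta> \<odot> Ide S X) \<cdot> \<Delta>) = (Ide S X \<odot> \<Delta>) \<cdot> \<Delta>"
        using inv_arr_comp_iff [OF assoc_iso [OF X X X], of "(Ide S X \<odot> \<Delta>) \<cdot> \<Delta>" "(\<Delta> \<odot> Ide S X) \<cdot> \<Delta>"] T by simp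
      \<comment> \<open>Inversion permutes the carrier, so a condition on all inverses is a
        condition on all elements.\<close>
      have A: "(\<forall>g\<in>carrier G. Q (\<rho> (inv\<^bsub>G\<^esub> g))) \<longleftrightarrow> (\<forall>g\<in>carrier G. Q (\<rho> g))" for Q
        by (metis G.inv_closed G.inv_inv)
      have B: "\<rho> (inv\<^bsub>G\<^esub> (g \<otimes>\<^bsub>G\<^esub> h)) = \<rho> (inv\<^bsub>G\<^esub> h) \<cdot> \<rho> (inv\<^bsub>G\<^esub> g)" if "g \<in> carrier G" "h \<in> carrier G" for g h
        using that mult by (simp add: G.inv_mult_group)
      have i: "\<rho> (inv\<^bsub>G\<^esub> \<one>\<^bsub>G\<^esub>) = Ide S X" using one by simp
      have C: "(\<forall>g\<in>carrier G. (\<rho> (inv\<^bsub>G\<^esub> g) \<odot> \<rho> (inv\<^bsub>G\<^esub> g)) \<cdot> \<Delta> = \<Delta> \<cdot> \<rho> (inv\<^bsub>G\<^esub> g) \<and> \<epsilon> = \<epsilon> \<cdot> \<rho> (inv\<^bsub>G\<^esub> g)) \<longleftrightarrow>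
          (\<forall>g\<in>carrier G. (\<rho> g \<odot> \<rho> g) \<cdot> \<Delta> = \<Delta> \<cdot> \<rho> g \<and> \<epsilon> = \<epsilon> \<cdot> \<rho> g)"
        by (rule A [of "\<lambda>f. (f \<odot> f) \<cdot> \<Delta> = \<Delta> \<cdot> f \<and> \<epsilon> = \<epsilon> \<cdot> f"])
      have r': "\<rho> (inv\<^bsub>G\<^esub> g) \<in> Arr S" "Dom S (\<rho> (inv\<^bsub>G\<^esub> g)) = X" "Cod S (\<rho> (inv\<^bsub>G\<^esub> g)) = X" if "g \<in> carrier G" for g
        using r that by simp_all
      show ?thesis unfolding C [symmetric] G_monoid_axioms_def
        using T r' 1 B i by (auto simp: ten_def assoc_arr can_0_left)
    qed
    have d: "(1, 2, \<Delta>) \<cdot>\<^bsub>E\<^esub> (2, 1, \<mu>) = ((2, 1, \<mu>) \<odot>\<^bsub>E\<^esub> (2, 1, \<mu>)) \<cdot>\<^bsub>E\<^esub> ((Ide E 1 \<odot>\<^bsub>E\<^esub> Sym E 1 1 \<odot>\<^bsub>E\<^esub> Ide E 1) \<cdot>\<^bsub>E\<^esub> ((1, 2, \<Delta>) \<odot>\<^bsub>E\<^esub> (1, 2, \<Delta>))) \<longleftrightarrow>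
        \<Delta> \<cdot> \<mu> = (\<mu> \<odot> \<mu>) \<cdot> middle_swap S X \<cdot> (\<Delta> \<odot> \<Delta>)"
      unfolding middle_swap_alt [symmetric] using T by (simp add: ten_def assoc_arr)
    have ee: "(1, 0, \<epsilon>) \<cdot>\<^bsub>E\<^esub> (2, 1, \<mu>) = (1, 0, \<epsilon>) \<odot>\<^bsub>E\<^esub> (1, 0, \<epsilon>) \<longleftrightarrow> \<epsilon> \<cdot> \<mu> = LUnit S (Unit S) \<cdot> (\<epsilon> \<odot> \<epsilon>)"
      using T by (simp add: ten_def lunit_runit)
    have f: "(1, 2, \<Delta>) \<cdot>\<^bsub>E\<^esub> (0, 1, e) = (0, 1, e) \<odot>\<^bsub>E\<^esub> (0, 1, e) \<longleftrightarrow> \<Delta> \<cdot> e \<cdot> LUnit S (Unit S) = e \<odot> e"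
      using T comp_inv_arr_iff [OF ui, of "e \<odot> e" "\<Delta> \<cdot> e"] inv1 by (simp add: ten_def lunit_runit [symmetric]) metis
    have u: "(1, 0, \<epsilon>) \<cdot>\<^bsub>E\<^esub> (0, 1, e) = Ide E 0 \<longleftrightarrow> \<epsilon> \<cdot> e = Ide S (Unit S)" by simp
    have "?L \<longleftrightarrow> G_monoid_axioms E G (2, 1, \<mu>) (0, 1, e) (\<lambda>g. (1, 1, \<rho> g)) \<and>
        G_monoid_axioms (opp E) G (1, 2, \<Delta>) (1, 0, \<epsilon>) (\<lambda>g. (1, 1, \<rho> (inv\<^bsub>G\<^esub> g))) \<and>
        \<Delta> \<cdot> \<mu> = (\<mu> \<odot> \<mu>) \<cdot> middle_swap S X \<cdot> (\<Delta> \<odot> \<Delta>) \<and> \<epsilon> \<cdot> \<mu> = LUnit S (Unit S) \<cdot> (\<epsilon> \<odot> \<epsilon>) \<and>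
        \<Delta> \<cdot> e \<cdot> LUnit S (Unit S) = e \<odot> e \<and> \<epsilon> \<cdot> e = Ide S (Unit S)"
      unfolding G_bialgebra_def G_bialgebra_axioms_def G_monoid_def d ee f u
      using E_is_PROP O.is_PROP_axioms G by blast
    also have "\<dots> \<longleftrightarrow> ?R"
      unfolding m is_bimonoid_def is_bimonoid_axioms_def
      using c T r symmetric_monoidal_category_axioms by (auto simp: is_bimonoid_map_def Hom_iff)
    finally show ?thesis .
  qed
  then show ?thesis using L R by blast
qed

end

section \<open>Algebras\<close>

lemma restrict_UNIV [simp]: "restrict f UNIV = f"
  by (simp add: restrict_def)

text \<open>Bracketed like \<open>tpow\<close>. By \<open>transformation_power\<close> these are the
  only possible components of a monoidal transformation.\<close>

fun tpowA :: "('o, 'a, 'z) smc_scheme \<Rightarrow> 'a \<Rightarrow> nat \<Rightarrow> 'a" where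
  "tpowA S f 0 = Ide S (Unit S)"
| "tpowA S f (Suc 0) = f"
| "tpowA S f (Suc (Suc n)) = tpowA S f (Suc n) \<odot>\<^bsub>S\<^esub> f"

lemma tpowA_Suc: "0 < n \<Longrightarrow> tpowA S f (Suc n) = tpowA S f n \<odot>\<^bsub>S\<^esub> f"
  by (cases n) simp_all

context symmetric_monoidal_category
begin

lemma tpowA_in [simp]:
  assumes f: "f \<in> Arr S"
  shows "tpowA S f n \<in> Arr S" "Dom S (tpowA S f n) = tpow S (Dom S f) n" "Cod S (tpowA S f n) = tpow S (Cod S f) n"
proof -
  have "tpowA S f n \<in> Arr S \<and> Dom S (tpowA S f n) = tpow S (Dom S f) n \<and> Cod S (tpowA S f n) = tpow S (Cod S f) n"
  proof (induction n)
    case (Suc n)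
    then show ?case using f by (cases n) simp_all
  qed simp
  then show "tpowA S f n \<in> Arr S" "Dom S (tpowA S f n) = tpow S (Dom S f) n" "Cod S (tpowA S f n) = tpow S (Cod S f) n" by blast+
qed

text \<open>Naturality of the canonical isomorphisms, by the recursion of \<open>can\<close>; it is
  the monoidality condition for the powers of one arrow.\<close>

lemma tpowA_can:
  assumes f: "f \<in> Arr S" "Dom S f = X" "Cod S f = Y"
  shows "tpowA S f (p + q) \<cdot> can_tens S X p q = can_tens S Y p q \<cdot> (tpowA S f p \<odot> tpowA S f q)"
proof -
  have o: "X \<in> Obj S" "Y \<in> Obj S" using f dom_obj cod_obj by auto
  interpret X: tensor_powers S X by unfold_locales (rule o)
  interpret Y: tensor_powers S Y by unfold_locales (rule o)
  show ?thesis
  proof (cases "q = 0")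
    case True
    then show ?thesis using runit_nat_arr [of "tpowA S f p"] f by simp
  next
    case False
    then have "0 < q" by simp
    then show ?thesis
    proof (induction q)
      case (Suc q)
      show ?case
      proof (cases "q = 0")
        case True
        show ?thesis
        proof (cases "p = 0")
          case True
          then show ?thesis using \<open>q = 0\<close> lunit_nat_arr [of f] f by simp
        next
          case False
          then show ?thesis using \<open>q = 0\<close> f X.can_1 [of p] Y.can_1 [of p] X.P_Suc [of p] Y.P_Suc [of p] by (simp add: tpowA_Suc)
        qed
      next
        case False
        then have q: "0 < q" "0 < p + q" by simp_all
        let ?t = "tpowA S f"
        let ?aX = "inv_arr S (Assoc S (X.P p) (X.P q) X)" and ?aY = "inv_arr S (Assoc S (Y.P p) (Y.P q) Y)"
        have "?t (p + Suc q) \<cdot> X.can p (Suc q) = ((?t (p + q) \<odot> f) \<cdot> (X.can p q \<odot> Ide S X)) \<cdot> ?aX"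
          using q f X.can_Suc [of q p] by (simp add: tpowA_Suc assoc_arr)
        also have "(?t (p + q) \<odot> f) \<cdot> (X.can p q \<odot> Ide S X) = (Y.can p q \<odot> Ide S Y) \<cdot> ((?t p \<odot> ?t q) \<odot> f)"
          using f Suc.IH q by (simp add: interchange)
        also have "\<dots> \<cdot> ?aX = (Y.can p q \<odot> Ide S Y) \<cdot> (((?t p \<odot> ?t q) \<odot> f) \<cdot> ?aX)"
          by (rule assoc_arr) (use f in simp_all)
        also have "((?t p \<odot> ?t q) \<odot> f) \<cdot> ?aX = ?aY \<cdot> (?t p \<odot> (?t q \<odot> f))"
          using X.ainv_nat [of "?t p" "?t q" f] f by simp
        also have "(Y.can p q \<odot> Ide S Y) \<cdot> (?aY \<cdot> (?t p \<odot> (?t q \<odot> f))) = Y.can p (Suc q) \<cdot> (?t p \<odot> ?t (Suc q))"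
          using q f Y.can_Suc [of q p] by (simp add: tpowA_Suc assoc_arr)
        finally show ?thesis .
      qed
    qed simp
  qed
qed

end

lemma Alg_simps [simp]:
  "F \<in> Obj (Alg T S) \<longleftrightarrow> F \<in> functors T S \<and> prop_algebra T S F"
  "t \<in> Arr (Alg T S) \<longleftrightarrow> t \<in> Arr (functor_cat T S) \<and> prop_algebra T S (NDom t) \<and> prop_algebra T S (NCod t) \<and>
     monoidal_transformation S (NDom t) (NCod t) (NMap t)"
  "Dom (Alg T S) = NDom" "Cod (Alg T S) = NCod" "Ide (Alg T S) = Ide (functor_cat T S)"
  "Comp (Alg T S) = Comp (functor_cat T S)"
  unfolding Alg_def by (simp_all add: functor_cat_def)

lemma prop_algebra_power:
  assumes "prop_algebra T S F"
  shows "\<exists>x. x \<in> Obj S \<and> (\<forall>n. FO F n = tpow S x n) \<and> FO F 1 = x"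
proof -
  interpret prop_algebra T S F by (rule assms)
  have "FO F 1 \<in> Obj S" by (rule map_obj) (simp add: T.obj_UNIV)
  then show ?thesis using map_power by blast
qed

text \<open>The laws are inherited from the functor category; the point is that monoidality survives
  identities and composition.\<close>

lemma Alg_category:
  assumes T: "is_PROP T" and S: "symmetric_monoidal_category S"
  shows "category (Alg T S)"
proof -
  interpret T: is_PROP T by (rule T)
  interpret S: symmetric_monoidal_category S by (rule S)
  interpret FC: category "functor_cat T S" by (rule functor_cat_category) unfold_locales
  have i: "monoidal_transformation S F F (\<lambda>n. Ide S (FO F n))" if F: "prop_algebra T S F" for F
  proof -
    obtain x where x: "x \<in> Obj S" "\<And>n. FO F n = tpow S x n" "FO F 1 = x" using prop_algebra_power [OF F] by blast
    interpret X: tensor_powers S x by unfold_locales (rule x)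
    show ?thesis by (simp add: monoidal_transformation_def x(2))
  qed
  have c: "monoidal_transformation S F K (\<lambda>n. Comp S (NMap t n) (NMap s n))"
    if s: "s \<in> Hom (Alg T S) F H" and t: "t \<in> Hom (Alg T S) H K" for s t F H K
  proof -
    have s': "prop_algebra T S F" "nat_trans T S F H (NMap s)" "monoidal_transformation S F H (NMap s)"
      and t': "prop_algebra T S H" "prop_algebra T S K" "nat_trans T S H K (NMap t)" "monoidal_transformation S H K (NMap t)"
      using s t by (auto simp: Hom_iff)
    obtain x where x: "x \<in> Obj S" "\<And>n. FO F n = tpow S x n" "FO F 1 = x" using prop_algebra_power [OF s'(1)] by blast
    obtain y where y: "y \<in> Obj S" "\<And>n. FO H n = tpow S y n" "FO H 1 = y" using prop_algebra_power [OF t'(1)] by blast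
    obtain z where z: "z \<in> Obj S" "\<And>n. FO K n = tpow S z n" "FO K 1 = z" using prop_algebra_power [OF t'(2)] by blast
    interpret X: tensor_powers S x by unfold_locales (rule x)
    interpret Y: tensor_powers S y by unfold_locales (rule y)
    interpret Z: tensor_powers S z by unfold_locales (rule z)
    have a: "NMap s n \<in> Arr S" "Dom S (NMap s n) = X.P n" "Cod S (NMap s n) = Y.P n"
      "NMap t n \<in> Arr S" "Dom S (NMap t n) = Y.P n" "Cod S (NMap t n) = Z.P n" for n
      using nat_trans.component_hom [OF s'(2), of n] nat_trans.component_hom [OF t'(3), of n] by (simp_all add: Hom_iff x y z)
    have ms: "Comp S (NMap s (p + q)) (X.can p q) = Comp S (Y.can p q) (TensA S (NMap s p) (NMap s q))"
      and mt: "Comp S (NMap t (p + q)) (Y.can p q) = Comp S (Z.can p q) (TensA S (NMap t p) (NMap t q))" for p q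
      using s'(3) t'(4) by (simp_all add: monoidal_transformation_def x y z)
    have z0: "NMap s 0 = Ide S (Unit S)" "NMap t 0 = Ide S (Unit S)" using s'(3) t'(4) by (simp_all add: monoidal_transformation_def)
    have "Comp S (Comp S (NMap t (p + q)) (NMap s (p + q))) (X.can p q) =
        Comp S (Z.can p q) (TensA S (Comp S (NMap t p) (NMap s p)) (Comp S (NMap t q) (NMap s q)))" for p q
    proof -
      have "Comp S (Comp S (NMap t (p + q)) (NMap s (p + q))) (X.can p q) = Comp S (NMap t (p + q)) (Comp S (Y.can p q) (TensA S (NMap s p) (NMap s q)))"
        unfolding ms [symmetric] using a by (intro S.assoc_arr) simp_all
      also have "\<dots> = Comp S (Comp S (NMap t (p + q)) (Y.can p q)) (TensA S (NMap s p) (NMap s q))"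
        using a by (intro S.assoc_arr [symmetric]) simp_all
      also have "\<dots> = Comp S (Z.can p q) (Comp S (TensA S (NMap t p) (NMap t q)) (TensA S (NMap s p) (NMap s q)))"
        unfolding mt using a by (intro S.assoc_arr) simp_all
      finally show ?thesis using a by (simp add: S.interchange)
    qed
    then show ?thesis using z0 by (simp add: monoidal_transformation_def x z)
  qed
  have sub: "t \<in> Hom (functor_cat T S) F H" if "t \<in> Hom (Alg T S) F H" for t F H
    using that unfolding Hom_iff by auto
  show ?thesis
  proof
    show "Ide (Alg T S) F \<in> Hom (Alg T S) F F" if "F \<in> Obj (Alg T S)" for F
      using FC.ide_hom [of F] i [of F] that by (simp add: Hom_iff T.obj_UNIV)
    show "Comp (Alg T S) t s \<in> Hom (Alg T S) F K" if st: "s \<in> Hom (Alg T S) F H" "t \<in> Hom (Alg T S) H K" for s t F H K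
      using FC.comp_hom [OF sub sub, OF st] c [OF st] st by (auto simp: Hom_iff T.obj_UNIV)
    show "Comp (Alg T S) (Comp (Alg T S) h g) f = Comp (Alg T S) h (Comp (Alg T S) g f)"
      if "f \<in> Hom (Alg T S) F H" "g \<in> Hom (Alg T S) H K" "h \<in> Hom (Alg T S) K L" for f g h F H K L
      using FC.comp_assoc [OF that [THEN sub]] by simp
    show "Comp (Alg T S) f (Ide (Alg T S) F) = f" "Comp (Alg T S) (Ide (Alg T S) H) f = f" if "f \<in> Hom (Alg T S) F H" for f F H
      using FC.comp_ide [OF sub [OF that]] FC.ide_comp [OF sub [OF that]] by simp_all
  qed simp_all
qed

text \<open>Algebras on \<open>x\<close> are PROP morphisms into the endomorphism PROP of
  \<open>x\<close>: compatibility with \<open>can_tens\<close> is the equation that characterises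
  the conjugated tensor product, by \<open>ten_unique\<close>.\<close>

lemma algebra_morphism:
  assumes F: "prop_algebra T S F" and x: "FO F 1 = x"
  shows "PROP_morphism T (tensor_powers.E S x) (\<lambda>f. (Dom T f, Cod T f, FA F f))"
proof -
  interpret A: prop_algebra T S F by (rule F)
  have o: "x \<in> Obj S" using A.map_obj [of 1] x by (simp add: A.T.obj_UNIV)
  interpret X: tensor_powers S x by unfold_locales (rule o)
  have pw: "FO F n = X.P n" for n using A.map_power [of n] x by simp
  have a: "FA F f \<in> Arr S" "Dom S (FA F f) = X.P (Dom T f)" "Cod S (FA F f) = X.P (Cod T f)" if "f \<in> Arr T" for f
    using A.map_hom [of f "Dom T f" "Cod T f"] that by (simp_all add: Hom_iff pw)
  show ?thesis
  proof (intro PROP_morphism.intro PROP_morphism_axioms.intro)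
    show "is_PROP T" "is_PROP X.E" by (rule A.T.is_PROP_axioms X.E_is_PROP)+
    show "(Dom T (Ide T n), Cod T (Ide T n), FA F (Ide T n)) = Ide X.E n" for n
      using A.map_ide [of n] by (simp add: pw A.T.obj_UNIV)
    show "(Dom T (Comp T g f), Cod T (Comp T g f), FA F (Comp T g f)) = Comp X.E (Dom T g, Cod T g, FA F g) (Dom T f, Cod T f, FA F f)"
      if "f \<in> Arr T" "g \<in> Arr T" "Cod T f = Dom T g" for f g
      using A.map_comp [of f "Dom T f" "Cod T f" g "Cod T g"] that by (simp add: Hom_iff)
    show "(Dom T (TensA T f g), Cod T (TensA T f g), FA F (TensA T f g)) = TensA X.E (Dom T f, Cod T f, FA F f) (Dom T g, Cod T g, FA F g)"
      if fg: "f \<in> Arr T" "g \<in> Arr T" for f g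
      using X.ten_unique [of "Dom T f" "Cod T f" "FA F f" "Dom T g" "Cod T g" "FA F g" "FA F (TensA T f g)"]
        A.map_tens [of f "Dom T f" "Cod T f" g "Dom T g" "Cod T g"] fg a [of f] a [of g] a [of "TensA T f g"]
      by (simp add: Hom_iff x [unfolded One_nat_def])
    show "(Dom T (Sym T 1 1), Cod T (Sym T 1 1), FA F (Sym T 1 1)) = Sym X.E 1 1"
      using A.map_sym [of 1 1] a [of "Sym T 1 1"] by (simp add: x [unfolded One_nat_def])
  qed (simp_all add: a)
qed

text \<open>The converse passage. The arrow part is restricted to \<open>Arr T\<close> because
  members of a functor category are extensional; every number is an object, so the object part
  already is.\<close>

lemma algebra_of_morphism:
  assumes S: "symmetric_monoidal_category S" and x: "x \<in> Obj S" and K: "PROP_morphism T (tensor_powers.E S x) K"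
  shows "\<lparr>FO = tpow S x, FA = restrict (\<lambda>f. snd (snd (K f))) (Arr T)\<rparr> \<in> Obj (Alg T S)" (is "?F \<in> _")
proof -
  interpret S: symmetric_monoidal_category S by (rule S)
  interpret X: tensor_powers S x by unfold_locales (rule x)
  interpret K: PROP_morphism T X.E K by (rule K)
  have e: "K f = (Dom T f, Cod T f, snd (snd (K f)))" if "f \<in> Arr T" for f
    using K.F_dom [OF that] K.F_cod [OF that] by (cases "K f") simp
  have a: "snd (snd (K f)) \<in> Arr S" "Dom S (snd (snd (K f))) = X.P (Dom T f)" "Cod S (snd (snd (K f))) = X.P (Cod T f)"
    if "f \<in> Arr T" for f
    using K.F_in [OF that] e [OF that] by (metis X.E_simps(2))+
  have F: "cat_functor T S ?F"
  proof
    show "FO ?F n \<in> Obj S" for n by simp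
    show "FA ?F f \<in> Hom S (FO ?F n) (FO ?F m)" if "f \<in> Hom T n m" for f n m using that a [of f] by (auto simp: Hom_iff)
    show "FA ?F (Ide T n) = Ide S (FO ?F n)" for n using K.F_ide [of n] by simp
    show "FA ?F (Comp T g f) = Comp S (FA ?F g) (FA ?F f)" if "f \<in> Hom T n m" "g \<in> Hom T m k" for f g n m k
      using that K.F_comp [of f g] by (simp add: Hom_iff)
  qed
  moreover have "prop_algebra T S ?F"
  proof (intro prop_algebra.intro prop_algebra_axioms.intro F)
    show "is_PROP T" "symmetric_monoidal_category S" by (rule K.T.is_PROP_axioms S)+
    show "FO ?F n = tpow S (FO ?F 1) n" for n by simp
    show "Comp S (FA ?F (TensA T f g)) (can_tens S (FO ?F 1) p q) = Comp S (can_tens S (FO ?F 1) p' q') (TensA S (FA ?F f) (FA ?F g))"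
      if f: "f \<in> Hom T p p'" and g: "g \<in> Hom T q q'" for f g p p' q q'
    proof -
      have fg: "f \<in> Arr T" "g \<in> Arr T" "Dom T f = p" "Cod T f = p'" "Dom T g = q" "Cod T g = q'" using f g by (simp_all add: Hom_iff)
      have "K (TensA T f g) = (p + q, p' + q', X.ten (p, p', snd (snd (K f))) (q, q', snd (snd (K g))))"
        using K.F_tens [of f g] e [of f] e [of g] fg by (metis X.E_simps(8) fst_conv snd_conv)
      then show ?thesis
        using X.ten_can [of p p' "snd (snd (K f))" q q' "snd (snd (K g))"] a [of f] a [of g] fg by simp
    qed
    show "Comp S (FA ?F (Sym T p q)) (can_tens S (FO ?F 1) p q) = Comp S (can_tens S (FO ?F 1) q p) (Sym S (FO ?F p) (FO ?F q))" for p q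
      using X.sy_can [of p q] by (simp add: K.F_sym)
  qed
  ultimately show ?thesis by (simp add: functors_def K.T.obj_UNIV)
qed

text \<open>Monoidality at \<open>n\<close> and \<open>1\<close> expresses the component at
  \<open>n + 1\<close> by the one before it, and the component at \<open>0\<close> is prescribed, so
  the component at \<open>1\<close> determines all.\<close>

lemma transformation_power:
  assumes F: "prop_algebra T S F" and H: "prop_algebra T S H" and n: "nat_trans T S F H \<eta>"
    and m: "monoidal_transformation S F H \<eta>"
  shows "\<eta> n = tpowA S (\<eta> 1) n"
proof -
  interpret F: prop_algebra T S F by (rule F)
  obtain x where x: "x \<in> Obj S" "\<And>n. FO F n = tpow S x n" "FO F 1 = x" using prop_algebra_power [OF F] by blast
  obtain y where y: "y \<in> Obj S" "\<And>n. FO H n = tpow S y n" "FO H 1 = y" using prop_algebra_power [OF H] by blast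
  interpret X: tensor_powers S x by unfold_locales (rule x)
  interpret Y: tensor_powers S y by unfold_locales (rule y)
  have a: "\<eta> n \<in> Arr S" "Dom S (\<eta> n) = X.P n" "Cod S (\<eta> n) = Y.P n" for n
    using nat_trans.component_hom [OF n, of n] by (simp_all add: Hom_iff x y F.T.obj_UNIV)
  show ?thesis
  proof (induction n)
    case 0
    show ?case using m by (simp add: monoidal_transformation_def)
  next
    case (Suc n)
    show ?case
    proof (cases "n = 0")
      case False
      have "Comp S (\<eta> (p + q)) (X.can p q) = Comp S (Y.can p q) (TensA S (\<eta> p) (\<eta> q))" for p q
        using m by (simp add: monoidal_transformation_def x y)
      from this [of n "Suc 0"] have "\<eta> (Suc n) = TensA S (\<eta> n) (\<eta> 1)"
        using False X.can_1 [of n] Y.can_1 [of n] a [of n] a [of "Suc n"] a [of "Suc 0"] X.P_Suc [of n] Y.P_Suc [of n] by simp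
      then show ?thesis using Suc False by (simp add: tpowA_Suc)
    qed simp
  qed
qed

section \<open>From algebras to bimonoids with action, and back\<close>

locale bimonoid_algebras = symmetric_monoidal_category S + G: group G
  for S :: "('o, 'a, 'z) smc_scheme" (structure) and G :: "('g, 'y) monoid_scheme"
begin

abbreviation T where "T \<equiv> GBimon_PROP G"
abbreviation em where "em f \<equiv> span_embed (QPROP G) f"
abbreviation co where "co f \<equiv> G.T.coembed f"

lemma T_PROP: "is_PROP T" by (rule G.GBimon_PROP_is_PROP)

sublocale T: is_PROP T by (rule T_PROP)

lemma em_arr [simp]:
  assumes "f \<in> Arr (QPROP G)"
  shows "em f \<in> Arr T" "Dom T (em f) = qdom f" "Cod T (em f) = qcod f"
    "co f \<in> Arr T" "Dom T (co f) = qcod f" "Cod T (co f) = qdom f"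
  using assms G.T.composite_dom [of f "qide G (qdom f)"] by (simp_all add: GBimon_PROP_def G.T.coembed_def G.Q.spans_iff)

lemma em_sym: "em (Sym (QPROP G) 1 1) = Sym T 1 1"
  by (simp add: GBimon_PROP_def composite_def)

lemma Tgens_cases:
  assumes "k \<in> G.Tgens"
  obtains "k = em (G.mul 2)" | "k = em (G.mul 0)" | "k = Sym T 1 1" | g where "g \<in> carrier G" "k = em (lab g)"
    | "k = co (G.mul 2)" | "k = co (G.mul 0)"
  using assms em_sym unfolding G.Tgens_def G.Qgens_def G.Igens_def by auto

lemma Tgens_arr: "G.Tgens \<subseteq> Arr T"
  using G.Qgens_arr by (auto simp: G.Tgens_def)

definition bim :: "(nat, ('g qarr \<times> 'g qarr) set, 'o, 'a) cfun \<Rightarrow> ('o, 'a) bimonoid" where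
  "bim F = \<lparr>Carr = FO F 1, Mult = FA F (em (G.mul 2)), Eta = FA F (em (G.mul 0)),
     Comult = FA F (co (G.mul 2)), Counit = FA F (co (G.mul 0))\<rparr>"

text \<open>A functor on the one-object category of \<open>G\<close> is an object with an action;
  here the labels on one strand act on the bimonoid of \<open>F\<close>. Restriction to the carrier
  makes the arrow part extensional.\<close>

definition rep :: "(nat, ('g qarr \<times> 'g qarr) set, 'o, 'a) cfun \<Rightarrow> (unit, 'g, ('o, 'a) bimonoid, ('o, 'a) bimonoid_map) cfun" where
  "rep F = \<lparr>FO = (\<lambda>_. bim F), FA = restrict (\<lambda>g. \<lparr>BDom = bim F, BCod = bim F, BMap = FA F (em (lab g))\<rparr>) (carrier G)\<rparr>"

definition \<Phi> where
  "\<Phi> = \<lparr>FO = rep, FA = (\<lambda>t. \<lparr>NDom = rep (NDom t), NCod = rep (NCod t),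
     NMap = (\<lambda>_. \<lparr>BDom = bim (NDom t), BCod = bim (NCod t), BMap = NMap t 1\<rparr>)\<rparr>)\<rparr>"

lemma G_bialgebra_cong:
  assumes b: "G_bialgebra E G mu eta act delta eps" and c: "\<And>g. g \<in> carrier G \<Longrightarrow> act g = act' g"
  shows "G_bialgebra E G mu eta act' delta eps"
proof -
  interpret G_bialgebra E G mu eta act delta eps by (rule b)
  show ?thesis
    using G_monoid_cong [OF G_monoid_axioms c] G_monoid_cong [OF comonoid, of "\<lambda>g. act' (inv\<^bsub>G\<^esub> g)"] c
      delta_mu eps_mu delta_eta eps_eta
    by (intro G_bialgebra.intro G_bialgebra_axioms.intro) simp_all
qed

text \<open>Read as a morphism into the endomorphism PROP of its object, the algebra restricts to a
  bialgebra there, which \<open>bialgebra_iff\<close> unpacks.\<close>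

lemma bim_facts:
  assumes F: "prop_algebra T S F"
  shows "bimonoid_in S (bim F)" "FA F (em (lab \<one>\<^bsub>G\<^esub>)) = Ide S (FO F 1)"
    "\<lbrakk>g \<in> carrier G; h \<in> carrier G\<rbrakk> \<Longrightarrow> FA F (em (lab (g \<otimes>\<^bsub>G\<^esub> h))) = FA F (em (lab g)) \<cdot> FA F (em (lab h))"
    "g \<in> carrier G \<Longrightarrow> is_bimonoid_map S (bim F) (bim F) (FA F (em (lab g)))"
proof -
  obtain x where x: "x \<in> Obj S" "\<And>n. FO F n = tpow S x n" "FO F 1 = x" using prop_algebra_power [OF F] by blast
  interpret X: tensor_powers S x by unfold_locales (rule x)
  have "G_bialgebra X.E G (2, 1, FA F (em (G.mul 2))) (0, 1, FA F (em (G.mul 0)))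
      (\<lambda>g. (Dom T (em (lab g)), Cod T (em (lab g)), FA F (em (lab g)))) (1, 2, FA F (co (G.mul 2))) (1, 0, FA F (co (G.mul 0)))"
    using G_bialgebra_of_morphism [OF G.is_group algebra_morphism [OF F x(3)]] by simp
  then have "G_bialgebra X.E G (2, 1, FA F (em (G.mul 2))) (0, 1, FA F (em (G.mul 0))) (\<lambda>g. (1, 1, FA F (em (lab g))))
      (1, 2, FA F (co (G.mul 2))) (1, 0, FA F (co (G.mul 0)))"
    by (rule G_bialgebra_cong) simp
  then have b: "is_bimonoid S x (FA F (em (G.mul 2))) (FA F (em (G.mul 0))) (FA F (co (G.mul 2))) (FA F (co (G.mul 0)))"
      "FA F (em (lab \<one>\<^bsub>G\<^esub>)) = Ide S x"
      "\<forall>g\<in>carrier G. \<forall>h\<in>carrier G. FA F (em (lab (g \<otimes>\<^bsub>G\<^esub> h))) = FA F (em (lab g)) \<cdot> FA F (em (lab h))"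
      "\<forall>g\<in>carrier G. is_bimonoid_map S (bim F) (bim F) (FA F (em (lab g)))"
    unfolding X.bialgebra_iff [OF G.is_group] bim_def x(3) by blast+
  show "bimonoid_in S (bim F)" using b(1) by (simp add: bim_def x(3) del: One_nat_def)
  show "FA F (em (lab \<one>\<^bsub>G\<^esub>)) = Ide S (FO F 1)" using b(2) x(3) by simp
  show "\<lbrakk>g \<in> carrier G; h \<in> carrier G\<rbrakk> \<Longrightarrow> FA F (em (lab (g \<otimes>\<^bsub>G\<^esub> h))) = FA F (em (lab g)) \<cdot> FA F (em (lab h))"
    "g \<in> carrier G \<Longrightarrow> is_bimonoid_map S (bim F) (bim F) (FA F (em (lab g)))" using b(3,4) by blast+
qed

interpretation B: category "Bimon S" by (rule Bimon_category)
interpretation GC: category "group_cat G" by (rule group_cat_category [OF G.is_group])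
interpretation AC: category "Alg T S" by (rule Alg_category [OF T_PROP symmetric_monoidal_category_axioms])
interpretation GB: category "GBimon G S" unfolding GBimon_def by (rule functor_cat_category [OF GC.category_axioms B.category_axioms])

lemma rep_functor:
  assumes F: "prop_algebra T S F"
  shows "rep F \<in> functors (group_cat G) (Bimon S)"
proof -
  note b = bim_facts [OF F]
  have "cat_functor (group_cat G) (Bimon S) (rep F)"
    by unfold_locales (use b in \<open>auto simp: rep_def Hom_iff\<close>, simp add: bim_def)
  then show ?thesis by (simp add: functors_def rep_def extensional_def)
qed

text \<open>Naturality at \<open>mul 2\<close>, \<open>mul 0\<close> and their duals gives the four
  equations of a bimonoid map, naturality at a label is equivariance, and at the symmetry it is
  automatic.\<close>

lemma natural_on_generators:
  assumes F: "prop_algebra T S F" and H: "prop_algebra T S H" and f: "f \<in> Hom S (FO F 1) (FO H 1)"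
  shows "(\<forall>k\<in>G.Tgens. tpowA S f (Cod T k) \<cdot> FA F k = FA H k \<cdot> tpowA S f (Dom T k)) \<longleftrightarrow>
    is_bimonoid_map S (bim F) (bim H) f \<and> (\<forall>g\<in>carrier G. f \<cdot> FA F (em (lab g)) = FA H (em (lab g)) \<cdot> f)"
proof -
  obtain x where x: "x \<in> Obj S" "\<And>n. FO F n = tpow S x n" "FO F 1 = x" using prop_algebra_power [OF F] by blast
  obtain y where y: "y \<in> Obj S" "\<And>n. FO H n = tpow S y n" "FO H 1 = y" using prop_algebra_power [OF H] by blast
  interpret KF: PROP_morphism T "tensor_powers.E S x" "\<lambda>f. (Dom T f, Cod T f, FA F f)" by (rule algebra_morphism [OF F x(3)])
  interpret KH: PROP_morphism T "tensor_powers.E S y" "\<lambda>f. (Dom T f, Cod T f, FA H f)" by (rule algebra_morphism [OF H y(3)])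
  interpret X: tensor_powers S x by unfold_locales (rule x)
  interpret Y: tensor_powers S y by unfold_locales (rule y)
  have f': "f \<in> Arr S" "Dom S f = x" "Cod S f = y" using f by (simp_all add: Hom_iff x(3) y(3) del: One_nat_def)
  have t2: "tpowA S f 2 = f \<odot> f" by (simp add: numeral_2_eq_2)
  have aF: "FA F k \<in> Arr S" "Dom S (FA F k) = X.P (Dom T k)" "Cod S (FA F k) = X.P (Cod T k)" if "k \<in> Arr T" for k
    using KF.F_in [OF that] by simp_all
  have aH: "FA H k \<in> Arr S" "Dom S (FA H k) = Y.P (Dom T k)" "Cod S (FA H k) = Y.P (Cod T k)" if "k \<in> Arr T" for k
    using KH.F_in [OF that] by simp_all
  have s: "FA F (Sym T 1 1) = Sym S x x" "FA H (Sym T 1 1) = Sym S y y"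
    using KF.F_sym1 KH.F_sym1 by simp_all
  let ?N = "\<lambda>k. tpowA S f (Cod T k) \<cdot> FA F k = FA H k \<cdot> tpowA S f (Dom T k)"
  have S: "?N (Sym T 1 1)"
    using s sym_nat_arr [of f f] f' by (simp add: numeral_2_eq_2 [symmetric] t2)
  have L: "?N (em (lab g)) \<longleftrightarrow> f \<cdot> FA F (em (lab g)) = FA H (em (lab g)) \<cdot> f" if "g \<in> carrier G" for g
    using that by simp
  have M: "?N (em (G.mul 2)) \<longleftrightarrow> f \<cdot> Mult (bim F) = Mult (bim H) \<cdot> (f \<odot> f)"
    and U: "?N (em (G.mul 0)) \<longleftrightarrow> f \<cdot> Eta (bim F) = Eta (bim H)"
    and D: "?N (co (G.mul 2)) \<longleftrightarrow> (f \<odot> f) \<cdot> Comult (bim F) = Comult (bim H) \<cdot> f"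
    and E: "?N (co (G.mul 0)) \<longleftrightarrow> Counit (bim F) = Counit (bim H) \<cdot> f"
    using aF [of "co (G.mul 0)"] aH [of "em (G.mul 0)"] by (simp_all add: bim_def t2)
  have c: "f \<in> Hom S (Carr (bim F)) (Carr (bim H))" using f by (simp add: bim_def)
  have gens: "em (G.mul 2) \<in> G.Tgens" "em (G.mul 0) \<in> G.Tgens" "co (G.mul 2) \<in> G.Tgens" "co (G.mul 0) \<in> G.Tgens"
    "\<And>g. g \<in> carrier G \<Longrightarrow> em (lab g) \<in> G.Tgens"
    by (auto simp: G.Tgens_def G.Qgens_def G.Igens_def)
  show ?thesis (is "?A \<longleftrightarrow> ?B")
  proof
    assume A: ?A
    then have "?N (em (G.mul 2))" "?N (em (G.mul 0))" "?N (co (G.mul 2))" "?N (co (G.mul 0))" "\<And>g. g \<in> carrier G \<Longrightarrow> ?N (em (lab g))"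
      using gens by blast+
    then show ?B using c L unfolding is_bimonoid_map_def M U D E by blast
  next
    assume B: ?B
    show ?A
    proof
      fix k assume "k \<in> G.Tgens"
      then show "?N k"
        by (rule Tgens_cases) (use B L M U D E S in \<open>simp_all only: is_bimonoid_map_def\<close>)
    qed
  qed
qed

text \<open>Induction over the generation of arrows. For a tensor product both sides are compared
  after the isomorphism \<open>can\<close>, through which \<open>tpowA\<close> and both algebras can
  be moved.\<close>

lemma natural_everywhere:
  assumes F: "prop_algebra T S F" and H: "prop_algebra T S H" and f: "f \<in> Hom S (FO F 1) (FO H 1)"
    and g: "\<forall>k\<in>G.Tgens. tpowA S f (Cod T k) \<cdot> FA F k = FA H k \<cdot> tpowA S f (Dom T k)" and k: "k \<in> Arr T"
  shows "tpowA S f (Cod T k) \<cdot> FA F k = FA H k \<cdot> tpowA S f (Dom T k)"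
proof -
  obtain x where x: "x \<in> Obj S" "\<And>n. FO F n = tpow S x n" "FO F 1 = x" using prop_algebra_power [OF F] by blast
  obtain y where y: "y \<in> Obj S" "\<And>n. FO H n = tpow S y n" "FO H 1 = y" using prop_algebra_power [OF H] by blast
  interpret AF: prop_algebra T S F by (rule F)
  interpret AH: prop_algebra T S H by (rule H)
  interpret X: tensor_powers S x by unfold_locales (rule x)
  interpret Y: tensor_powers S y by unfold_locales (rule y)
  have f': "f \<in> Arr S" "Dom S f = x" "Cod S f = y" using f by (simp_all add: Hom_iff x(3) y(3) del: One_nat_def)
  let ?t = "tpowA S f"
  have aF: "FA F k \<in> Arr S" "Dom S (FA F k) = X.P (Dom T k)" "Cod S (FA F k) = X.P (Cod T k)" if "k \<in> Arr T" for k
    using AF.map_hom [of k "Dom T k" "Cod T k"] that by (simp_all add: Hom_iff x)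
  have aH: "FA H k \<in> Arr S" "Dom S (FA H k) = Y.P (Dom T k)" "Cod S (FA H k) = Y.P (Cod T k)" if "k \<in> Arr T" for k
    using AH.map_hom [of k "Dom T k" "Cod T k"] that by (simp_all add: Hom_iff y)
  have i: "?t n \<cdot> FA F (Ide T n) = FA H (Ide T n) \<cdot> ?t n" for n
    using AF.map_ide [of n] AH.map_ide [of n] f' by (simp add: x y)
  have "k \<in> Arr T \<and> ?t (Cod T k) \<cdot> FA F k = FA H k \<cdot> ?t (Dom T k)"
    using G.T_gen [OF k]
  proof (induction rule: gen_by.induct)
    case (base k)
    then show ?case using g Tgens_arr by blast
  next
    case ide0
    then show ?case using i [of 0] by simp
  next
    case ide1
    then show ?case using i [of 1] by simp
  next
    case (comp k l)
    then have kl: "k \<in> Arr T" "l \<in> Arr T" by blast+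
    have "?t (Cod T l) \<cdot> (FA F l \<cdot> FA F k) = (?t (Cod T l) \<cdot> FA F l) \<cdot> FA F k"
      using kl comp(3) aF f' by (intro assoc_arr [symmetric]) simp_all
    also have "\<dots> = FA H l \<cdot> (?t (Cod T k) \<cdot> FA F k)" using kl comp aF aH f' by (simp add: assoc_arr)
    also have "\<dots> = (FA H l \<cdot> FA H k) \<cdot> ?t (Dom T k)" using kl comp aF aH f' by (simp add: assoc_arr)
    finally show ?case
      using kl comp(3) AF.map_comp [of k "Dom T k" "Cod T k" l "Cod T l"] AH.map_comp [of k "Dom T k" "Cod T k" l "Cod T l"]
      by (simp add: Hom_iff)
  next
    case (tens k l)
    then have kl: "k \<in> Arr T" "l \<in> Arr T" and n: "?t (Cod T k) \<cdot> FA F k = FA H k \<cdot> ?t (Dom T k)" "?t (Cod T l) \<cdot> FA F l = FA H l \<cdot> ?t (Dom T l)"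
      by blast+
    define p p' q q' where d: "p = Dom T k" "p' = Cod T k" "q = Dom T l" "q' = Cod T l"
    define m where "m = TensA T k l"
    have m: "m \<in> Arr T" "Dom T m = p + q" "Cod T m = p' + q'" using kl by (simp_all add: m_def d)
    note a = aF [OF kl(1), folded d] aF [OF kl(2), folded d] aH [OF kl(1), folded d] aH [OF kl(2), folded d] aF [OF m(1), unfolded m] aH [OF m(1), unfolded m] f'
    have mF: "FA F m \<cdot> X.can p q = X.can p' q' \<cdot> (FA F k \<odot> FA F l)" and mH: "FA H m \<cdot> Y.can p q = Y.can p' q' \<cdot> (FA H k \<odot> FA H l)"
      using AF.map_tens [of k p p' l q q'] AH.map_tens [of k p p' l q q'] kl by (simp_all add: Hom_iff d m_def x(3) y(3) del: One_nat_def)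
    note cf = tpowA_can [OF f']
    have "?t (p' + q') \<cdot> FA F m = FA H m \<cdot> ?t (p + q)"
    proof (rule iso_epi [OF X.can_iso [of p q]])
      have "(?t (p' + q') \<cdot> FA F m) \<cdot> X.can p q = ?t (p' + q') \<cdot> (X.can p' q' \<cdot> (FA F k \<odot> FA F l))"
        unfolding mF [symmetric] using a by (intro assoc_arr) simp_all
      also have "\<dots> = (?t (p' + q') \<cdot> X.can p' q') \<cdot> (FA F k \<odot> FA F l)"
        using a by (intro assoc_arr [symmetric]) simp_all
      also have "\<dots> = Y.can p' q' \<cdot> ((?t p' \<cdot> FA F k) \<odot> (?t q' \<cdot> FA F l))"
        unfolding cf using a by (simp add: assoc_arr interchange)
      also have "\<dots> = Y.can p' q' \<cdot> ((FA H k \<odot> FA H l) \<cdot> (?t p \<odot> ?t q))"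
        using a n [folded d] by (simp add: interchange)
      also have "\<dots> = (Y.can p' q' \<cdot> (FA H k \<odot> FA H l)) \<cdot> (?t p \<odot> ?t q)"
        using a by (intro assoc_arr [symmetric]) simp_all
      also have "\<dots> = FA H m \<cdot> (Y.can p q \<cdot> (?t p \<odot> ?t q))"
        unfolding mH [symmetric] using a by (intro assoc_arr) simp_all
      also have "\<dots> = (FA H m \<cdot> ?t (p + q)) \<cdot> X.can p q"
        unfolding cf [symmetric] using a by (intro assoc_arr [symmetric]) simp_all
      finally show "(?t (p' + q') \<cdot> FA F m) \<cdot> X.can p q = (FA H m \<cdot> ?t (p + q)) \<cdot> X.can p q" .
    qed (use a in simp_all)
    then show ?case using kl m by (simp add: m_def)
  qed
  then show ?thesis by blast
qed

text \<open>\<open>rep F\<close> records the object and the values of \<open>F\<close> at all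
  generators other than the symmetry, where the value is forced; a PROP morphism is determined by
  these.\<close>

lemma rep_inj:
  assumes F: "F \<in> Obj (Alg T S)" and H: "H \<in> Obj (Alg T S)" and e: "rep F = rep H"
  shows "F = H"
proof -
  have aF: "prop_algebra T S F" and aH: "prop_algebra T S H" using F H by simp_all
  have b: "bim F = bim H" using e by (simp add: rep_def fun_eq_iff)
  have l: "FA F (em (lab g)) = FA H (em (lab g))" if "g \<in> carrier G" for g
    using arg_cong [OF e, of "\<lambda>r. BMap (FA r g)"] that by (simp add: rep_def)
  obtain x where x: "x \<in> Obj S" "\<And>n. FO F n = tpow S x n" "FO F 1 = x" using prop_algebra_power [OF aF] by blast
  obtain y where y: "y \<in> Obj S" "\<And>n. FO H n = tpow S y n" "FO H 1 = y" using prop_algebra_power [OF aH] by blast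
  have xy: "y = x" using arg_cong [OF b, of Carr] x(3) y(3) by (simp add: bim_def)
  note mF = algebra_morphism [OF aF x(3)] and mH = algebra_morphism [OF aH y(3), unfolded xy]
  interpret KF: PROP_morphism T "tensor_powers.E S x" "\<lambda>f. (Dom T f, Cod T f, FA F f)" by (rule mF)
  interpret KH: PROP_morphism T "tensor_powers.E S x" "\<lambda>f. (Dom T f, Cod T f, FA H f)" by (rule mH)
  interpret X: tensor_powers S x by unfold_locales (rule x)
  have "FA F k = FA H k" if "k \<in> Arr T" for k
  proof -
    have "FA F k = FA H k" if "k \<in> G.Tgens" for k
      using that
    proof (rule Tgens_cases)
      assume "k = Sym T 1 1"
      then show ?thesis using KF.F_sym1 KH.F_sym1 by simp
    next
      fix g assume "g \<in> carrier G" "k = em (lab g)"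
      then show ?thesis using l by simp
    qed (use b in \<open>simp_all add: bim_def\<close>)
    then have "(Dom T k, Cod T k, FA F k) = (Dom T k, Cod T k, FA H k)"
      using PROP_morphism_eqI [OF mF mH Tgens_arr _ G.T_gen [OF \<open>k \<in> Arr T\<close>]] by simp
    then show ?thesis by simp
  qed
  moreover have "FA F \<in> extensional (Arr T)" "FA H \<in> extensional (Arr T)" using F H by (simp_all add: functors_def)
  ultimately have "FA F = FA H" by (intro extensionalityI)
  moreover have "FO F = FO H" using x(2) y(2) xy by (intro ext) simp
  ultimately show ?thesis by (intro cfun.equality) simp_all
qed

text \<open>By \<open>bialgebra_iff\<close> the functor \<open>A\<close> is a bialgebra in the
  endomorphism PROP; its evaluation \<open>FT\<close> on the composite is then read as an
  algebra.\<close>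

lemma rep_surj:
  assumes A: "A \<in> functors (group_cat G) (Bimon S)"
  shows "\<exists>F\<in>Obj (Alg T S). rep F = A"
proof -
  interpret A: cat_functor "group_cat G" "Bimon S" A using A by (simp add: functors_def)
  define B where "B = FO A ()"
  define \<rho> where "\<rho> = (\<lambda>g. BMap (FA A g))"
  have B: "bimonoid_in S B" using A.map_obj [of "()"] by (simp add: B_def)
  interpret B: is_bimonoid S "Carr B" "Mult B" "Eta B" "Comult B" "Counit B" by (rule B)
  interpret X: tensor_powers S "Carr B" by unfold_locales (rule B.carr_obj)
  have h: "BDom (FA A g) = B" "BCod (FA A g) = B" "is_bimonoid_map S B B (\<rho> g)" if "g \<in> carrier G" for g
    using A.map_hom [of g "()" "()"] that by (auto simp: Hom_iff B_def \<rho>_def)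
  have one: "\<rho> \<one>\<^bsub>G\<^esub> = Ide S (Carr B)" using A.map_ide [of "()"] by (simp add: \<rho>_def B_def)
  have mult: "\<rho> (g \<otimes>\<^bsub>G\<^esub> h) = \<rho> g \<cdot> \<rho> h" if "g \<in> carrier G" "h \<in> carrier G" for g h
    using A.map_comp [of h "()" "()" g "()"] that by (simp add: \<rho>_def Hom_iff)
  have Bc: "\<lparr>Carr = Carr B, Mult = Mult B, Eta = Eta B, Comult = Comult B, Counit = Counit B\<rparr> = B" by (cases B) simp
  have "G_bialgebra X.E G (2, 1, Mult B) (0, 1, Eta B) (\<lambda>g. (1, 1, \<rho> g)) (1, 2, Comult B) (1, 0, Counit B)"
    unfolding X.bialgebra_iff [OF G.is_group] Bc using B one mult h(3) by blast
  then interpret b: G_bialgebra X.E G "(2, 1, Mult B)" "(0, 1, Eta B)" "\<lambda>g. (1, 1, \<rho> g)" "(1, 2, Comult B)" "(1, 0, Counit B)" .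
  define K where "K = b.FT"
  have K: "K (em (G.mul 2)) = (2, 1, Mult B)" "K (em (G.mul 0)) = (0, 1, Eta B)" "K (co (G.mul 2)) = (1, 2, Comult B)"
    "K (co (G.mul 0)) = (1, 0, Counit B)" "g \<in> carrier G \<Longrightarrow> K (em (lab g)) = (1, 1, \<rho> g)" for g
    by (simp_all add: K_def b.FT_embed b.FT_coembed b.N_gens b.W_gens del: One_nat_def)
  let ?F = "\<lparr>FO = tpow S (Carr B), FA = restrict (\<lambda>f. snd (snd (K f))) (Arr T)\<rparr>"
  have F: "?F \<in> Obj (Alg T S)"
    unfolding K_def by (rule algebra_of_morphism [OF symmetric_monoidal_category_axioms B.carr_obj b.FT_morphism])
  have "bim ?F = B" using Bc by (simp add: bim_def K)
  moreover have "FA ?F (em (lab g)) = \<rho> g" if "g \<in> carrier G" for g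
    using that by (simp add: K)
  moreover have "\<lparr>BDom = B, BCod = B, BMap = \<rho> g\<rparr> = FA A g" if "g \<in> carrier G" for g
    using h(1,2) [OF that] by (cases "FA A g") (simp add: \<rho>_def)
  moreover have "FA A \<in> extensional (carrier G)" using A by (simp add: functors_def)
  ultimately have "FA (rep ?F) = FA A"
    by (intro extensionalityI [of _ "carrier G"]) (simp_all add: rep_def)
  moreover have "FO (rep ?F) = FO A" using \<open>bim ?F = B\<close> by (intro ext) (simp add: rep_def B_def)
  ultimately have "rep ?F = A" by (intro cfun.equality) simp_all
  then show ?thesis using F by blast
qed

lemma GBimon_simps [simp]:
  "Obj (GBimon G S) = functors (group_cat G) (Bimon S)" "Dom (GBimon G S) = NDom" "Cod (GBimon G S) = NCod"
  "t \<in> Arr (GBimon G S) \<longleftrightarrow> t \<in> Arr (functor_cat (group_cat G) (Bimon S))"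
  "Ide (GBimon G S) = Ide (functor_cat (group_cat G) (Bimon S))" "Comp (GBimon G S) = Comp (functor_cat (group_cat G) (Bimon S))"
  by (simp_all add: GBimon_def)

text \<open>On a one-object category a transformation has a single component, and naturality at
  \<open>g\<close> is equivariance.\<close>

lemma rep_transformation:
  assumes F: "prop_algebra T S F" and H: "prop_algebra T S H"
    and u: "\<And>x. u x = \<lparr>BDom = bim F, BCod = bim H, BMap = f\<rparr>"
  shows "nat_trans (group_cat G) (Bimon S) (rep F) (rep H) u \<longleftrightarrow>
    is_bimonoid_map S (bim F) (bim H) f \<and> (\<forall>g\<in>carrier G. f \<cdot> FA F (em (lab g)) = FA H (em (lab g)) \<cdot> f)"
proof -
  have c: "cat_functor (group_cat G) (Bimon S) (rep F)" "cat_functor (group_cat G) (Bimon S) (rep H)"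
    using rep_functor [OF F] rep_functor [OF H] by (simp_all add: functors_def)
  show ?thesis
  proof
    assume "nat_trans (group_cat G) (Bimon S) (rep F) (rep H) u"
    then interpret n: nat_trans "group_cat G" "Bimon S" "rep F" "rep H" u .
    have "f \<cdot> FA F (em (lab g)) = FA H (em (lab g)) \<cdot> f" if "g \<in> carrier G" for g
      using n.naturality [of g "()" "()"] that by (simp add: u Hom_iff rep_def)
    then show "is_bimonoid_map S (bim F) (bim H) f \<and> (\<forall>g\<in>carrier G. f \<cdot> FA F (em (lab g)) = FA H (em (lab g)) \<cdot> f)"
      using n.component_hom [of "()"] by (simp add: u Hom_iff rep_def)
  next
    assume r: "is_bimonoid_map S (bim F) (bim H) f \<and> (\<forall>g\<in>carrier G. f \<cdot> FA F (em (lab g)) = FA H (em (lab g)) \<cdot> f)"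
    show "nat_trans (group_cat G) (Bimon S) (rep F) (rep H) u"
    proof (intro nat_trans.intro nat_trans_axioms.intro c)
      show "u x \<in> Hom (Bimon S) (FO (rep F) x) (FO (rep H) x)" for x
        using r bim_facts(1) [OF F] bim_facts(1) [OF H] by (simp add: u Hom_iff rep_def)
      show "Comp (Bimon S) (u y) (FA (rep F) g) = Comp (Bimon S) (FA (rep H) g) (u x)" if "g \<in> Hom (group_cat G) x y" for g x y
        using r that by (simp add: u Hom_iff rep_def)
    qed
  qed
qed

lemma \<Phi>_arr:
  assumes t: "t \<in> Arr (Alg T S)"
  shows "FA \<Phi> t \<in> Arr (GBimon G S)"
proof -
  have a: "prop_algebra T S (NDom t)" "prop_algebra T S (NCod t)" "nat_trans T S (NDom t) (NCod t) (NMap t)"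
    "monoidal_transformation S (NDom t) (NCod t) (NMap t)" using t by simp_all
  interpret t: nat_trans T S "NDom t" "NCod t" "NMap t" by (rule a)
  have f: "NMap t 1 \<in> Hom S (FO (NDom t) 1) (FO (NCod t) 1)" by (rule t.component_hom) simp
  have "tpowA S (NMap t 1) (Cod T k) \<cdot> FA (NDom t) k = FA (NCod t) k \<cdot> tpowA S (NMap t 1) (Dom T k)" if "k \<in> Arr T" for k
    using t.naturality [of k "Dom T k" "Cod T k"] that transformation_power [OF a, symmetric] by (simp add: Hom_iff)
  then have "is_bimonoid_map S (bim (NDom t)) (bim (NCod t)) (NMap t 1) \<and>
      (\<forall>g\<in>carrier G. NMap t 1 \<cdot> FA (NDom t) (em (lab g)) = FA (NCod t) (em (lab g)) \<cdot> NMap t 1)"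
    unfolding natural_on_generators [OF a(1,2) f, symmetric] using Tgens_arr by blast
  then show ?thesis
    using rep_functor [OF a(1)] rep_functor [OF a(2)] rep_transformation [OF a(1,2), of _ "NMap t 1"] by (simp add: \<Phi>_def)
qed

lemma \<Phi>_functor: "cat_functor (Alg T S) (GBimon G S) \<Phi>"
proof
  show "FO \<Phi> F \<in> Obj (GBimon G S)" if "F \<in> Obj (Alg T S)" for F using that rep_functor by (simp add: \<Phi>_def)
  show "FA \<Phi> t \<in> Hom (GBimon G S) (FO \<Phi> F) (FO \<Phi> H)" if "t \<in> Hom (Alg T S) F H" for t F H
    using that \<Phi>_arr [of t] unfolding Hom_iff by (auto simp: \<Phi>_def)
  show "FA \<Phi> (Ide (Alg T S) F) = Ide (GBimon G S) (FO \<Phi> F)" if "F \<in> Obj (Alg T S)" for F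
    by (auto simp: \<Phi>_def rep_def bim_def)
  show "FA \<Phi> (Comp (Alg T S) t s) = Comp (GBimon G S) (FA \<Phi> t) (FA \<Phi> s)" if "s \<in> Hom (Alg T S) F H" "t \<in> Hom (Alg T S) H K" for s t F H K
    by (auto simp: \<Phi>_def)
qed

text \<open>Source and target are recovered by \<open>rep_inj\<close>, and all components from the
  one at \<open>1\<close>.\<close>

lemma \<Phi>_inj: "inj_on (FA \<Phi>) (Arr (Alg T S))"
proof (rule inj_onI)
  fix s t assume s: "s \<in> Arr (Alg T S)" and t: "t \<in> Arr (Alg T S)" and e: "FA \<Phi> s = FA \<Phi> t"
  have d: "NDom s = NDom t" "NCod s = NCod t"
    using e s t by (auto intro!: rep_inj simp: \<Phi>_def)
  have 1: "NMap s 1 = NMap t 1" using e by (auto simp: \<Phi>_def fun_eq_iff)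
  have "NMap s n = NMap t n" for n
    using transformation_power [of T S "NDom s" "NCod s" "NMap s" n] transformation_power [of T S "NDom t" "NCod t" "NMap t" n] s t 1
    by simp
  then show "s = t" using d by (intro ntr.equality) auto
qed

text \<open>The only component of \<open>u\<close> extends by its tensor powers; these are natural
  on the generators, hence everywhere.\<close>

lemma \<Phi>_surj:
  assumes u: "u \<in> Arr (GBimon G S)"
  shows "u \<in> FA \<Phi> ` Arr (Alg T S)"
proof -
  have u': "NDom u \<in> functors (group_cat G) (Bimon S)" "NCod u \<in> functors (group_cat G) (Bimon S)"
    "nat_trans (group_cat G) (Bimon S) (NDom u) (NCod u) (NMap u)" using u by simp_all
  obtain F H where F: "F \<in> Obj (Alg T S)" "rep F = NDom u" and H: "H \<in> Obj (Alg T S)" "rep H = NCod u"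
    using rep_surj [OF u'(1)] rep_surj [OF u'(2)] by blast
  have a: "prop_algebra T S F" "prop_algebra T S H" using F H by simp_all
  define f where "f = BMap (NMap u ())"
  have n: "nat_trans (group_cat G) (Bimon S) (rep F) (rep H) (NMap u)" using u'(3) F(2) H(2) by simp
  have "NMap u () \<in> Hom (Bimon S) (bim F) (bim H)"
    using nat_trans.component_hom [OF n, of "()"] by (simp add: rep_def)
  then have uf: "NMap u x = \<lparr>BDom = bim F, BCod = bim H, BMap = f\<rparr>" and "is_bimonoid_map S (bim F) (bim H) f" for x
    by (auto simp: Hom_iff f_def)
  then have f: "f \<in> Hom S (FO F 1) (FO H 1)" by (simp add: is_bimonoid_map_def bim_def)
  have g: "\<forall>k\<in>G.Tgens. tpowA S f (Cod T k) \<cdot> FA F k = FA H k \<cdot> tpowA S f (Dom T k)"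
    using n unfolding natural_on_generators [OF a f] rep_transformation [OF a uf] .
  obtain x where x: "x \<in> Obj S" "\<And>n. FO F n = tpow S x n" "FO F 1 = x" using prop_algebra_power [OF a(1)] by blast
  obtain y where y: "y \<in> Obj S" "\<And>n. FO H n = tpow S y n" "FO H 1 = y" using prop_algebra_power [OF a(2)] by blast
  have f': "f \<in> Arr S" "Dom S f = x" "Cod S f = y" using f by (simp_all add: Hom_iff x(3) y(3) del: One_nat_def)
  let ?t = "\<lparr>NDom = F, NCod = H, NMap = tpowA S f\<rparr>"
  have "nat_trans T S F H (tpowA S f)"
  proof (intro nat_trans.intro nat_trans_axioms.intro)
    show "cat_functor T S F" "cat_functor T S H" using F(1) H(1) by (simp_all add: functors_def)
    show "tpowA S f n \<in> Hom S (FO F n) (FO H n)" for n using f' by (simp add: Hom_iff x(2) y(2))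
    show "tpowA S f m \<cdot> FA F k = FA H k \<cdot> tpowA S f n" if "k \<in> Hom T n m" for k n m
      using natural_everywhere [OF a f g, of k] that by (auto simp: Hom_iff)
  qed
  moreover have "monoidal_transformation S F H (tpowA S f)"
    using tpowA_can [OF f'] by (simp add: monoidal_transformation_def x(3) y(3) del: One_nat_def)
  ultimately have t: "?t \<in> Arr (Alg T S)" using F(1) H(1) a by (simp add: extensional_def)
  have "FA \<Phi> ?t = u" using F(2) H(2) uf by (intro ntr.equality) (auto simp: \<Phi>_def)
  then show ?thesis using t by blast
qed

lemma equivalence: "equivalent_categories (Alg T S) (GBimon G S)"
proof (rule equivalent_categoriesI [OF \<Phi>_functor])
  show "bij_betw (FO \<Phi>) (Obj (Alg T S)) (Obj (GBimon G S))"
    unfolding bij_betw_def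
  proof
    show "inj_on (FO \<Phi>) (Obj (Alg T S))" by (rule inj_onI) (simp add: \<Phi>_def rep_inj)
    show "FO \<Phi> ` Obj (Alg T S) = Obj (GBimon G S)"
      using rep_functor rep_surj by (auto simp: \<Phi>_def image_iff)
  qed
  show "bij_betw (FA \<Phi>) (Arr (Alg T S)) (Arr (GBimon G S))"
    unfolding bij_betw_def using \<Phi>_inj \<Phi>_arr \<Phi>_surj by blast
qed

end

theorem theorem6p1:
  fixes S :: "('o, 'a, 'y) smc_scheme"
    and G :: "('g, 'z) monoid_scheme"
  assumes "symmetric_monoidal_category S"
    and "group G"
  shows "equivalent_categories (Alg (GBimon_PROP G) S) (GBimon G S)"
  using bimonoid_algebras.equivalence [OF bimonoid_algebras.intro [OF assms]] .

end
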